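(* Let $d,\ell\in\mathbb{N}$ with $\ell\ge 1$ and let $\sigma>0$. There is a constant $C$ depending only on $d$, $\ell$ and $\sigma$ (in particular not on the mesh size and not on $\alpha=\min a/\max a$) such that the following holds. Let $\mathcal{T}$ be a conforming simplicial mesh of a polyhedral domain $\Omega\subset\mathbb{R}^d$ with shape parameter bounded by $\sigma$, and let $a$ be a uniformly positive function on $\Omega$ that is constant on every $K\in\mathcal{T}$, with value $a_K$ on $K$. Assume that $a$ satisfies the quasi-monotonicity property. Then, for every $u\in H^1(\Omega)$, $$\inf_{v\in S^{\ell,0}(\mathcal{T})}\|a^{1/2}\nabla(u-v)\|_{L^2(\Omega)}^2\le C\sum_{K\in\mathcal{T}}\ \inf_{P\in\mathbb{P}_\ell(K)}a_K\|\nabla(u-P)\|_{L^2(K)}^2 .$$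
   Context: Elements $K\in\mathcal{T}$ are (closed) $d$-simplices. The mesh has shape parameter bounded by $\sigma$ if $\sup_{K\in\mathcal{T}}h_K/\rho_K\le\sigma$, where $h_K=\mathrm{diam}(K)$ and $\rho_K$ is the maximum diameter of a ball inscribed in $K$. $\mathbb{P}_\ell(K)$ is the space of polynomials of total degree at most $\ell$ on $K$, and $S^{\ell,0}(\mathcal{T})$ is the space of functions $v\in C^0(\overline\Omega)$ with $v|_K\in\mathbb{P}_\ell(K)$ for all $K\in\mathcal{T}$. Nodes: for a simplex $K$ with vertices $a_0,\dots,a_d$, $\mathcal{N}_K=\{\sum_{i=0}^d\frac{\alpha_i}{\ell}a_i:\alpha\in\mathbb{N}_0^{d+1},\ \sum_i\alpha_i=\ell\}$, and $\mathcal{N}=\bigcup_{K\in\mathcal{T}}\mathcal{N}_K$. The nodal basis $\{\phi_z\}_{z\in\mathcal{N}}$ of $S^{\ell,0}(\mathcal{T})$ is given by $\phi_z(y)=\delta_{yz}$ for $y,z\in\mathcal{N}$, and $\omega_z=\mathrm{supp}(\phi_z)$. Quasi-monotonicity: for $z\in\mathcal{N}$ and elements $K,\widetilde K\subset\omega_z$, a monotone path from $K$ to $\widetilde K$ is a finite sequence of elements $K_0,\dots,K_m\subset\omega_z$ with $K_0=K$, $K_m=\widetilde K$, such that for $n=0,\dots,m-1$ the intersection $K_n\cap K_{n+1}$ is an interior $(d-1)$-dimensional face of $\mathcal{T}$ and $a_{K_n}\le a_{K_{n+1}}$. The function $a$ satisfies the quasi-monotonicity property if for every $z\in\mathcal{N}$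 and all elements $K,\widetilde K\subset\omega_z$ with $a_K\le a_{\widetilde K}$ there exists a monotone path from $K$ to $\widetilde K$. *)

theory Defs
  imports "HOL-Analysis.Analysis"
begin

section \<open>Sobolev space and weak gradient\<close>

text \<open>The function is \<open>k\<close> times continuously differentiable on the whole space, expressed through
  its iterated partial derivatives.\<close>

primrec Ck :: "nat \<Rightarrow> ('a::euclidean_space \<Rightarrow> real) \<Rightarrow> bool" where
  "Ck 0 f \<longleftrightarrow> continuous_on UNIV f"
| "Ck (Suc k) f \<longleftrightarrow> (\<forall>x. f differentiable (at x)) \<and>
     (\<forall>i\<in>Basis. Ck k (\<lambda>x. frechet_derivative f (at x) i))"

definition test_functions :: "'a::euclidean_space set \<Rightarrow> ('a \<Rightarrow> real) set" where
  "test_functions U = {\<phi>. (\<forall>k. Ck k \<phi>) \<and> compact (closure {x. \<phi> x \<noteq> 0}) \<and>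
     closure {x. \<phi> x \<noteq> 0} \<subseteq> U}"

definition locally_integrable_on ::
    "'a::euclidean_space set \<Rightarrow> ('a \<Rightarrow> 'b::euclidean_space) \<Rightarrow> bool" where
  "locally_integrable_on U f \<longleftrightarrow> (\<forall>B. compact B \<and> B \<subseteq> U \<longrightarrow> set_integrable lebesgue B f)"

definition is_weak_gradient ::
    "'a::euclidean_space set \<Rightarrow> ('a \<Rightarrow> real) \<Rightarrow> ('a \<Rightarrow> 'a) \<Rightarrow> bool" where
  "is_weak_gradient U w g \<longleftrightarrow> locally_integrable_on U w \<and> locally_integrable_on U g \<and>
     (\<forall>\<phi>\<in>test_functions U. \<forall>i\<in>Basis.
        (LINT x:U|lebesgue. w x * frechet_derivative \<phi> (at x) i) =
        - (LINT x:U|lebesgue. (g x \<bullet> i) * \<phi> x))"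

text \<open>Weak gradients are unique only up to null sets, so this picks a representative. It is used
  below only under integrals, whose values do not depend on the choice.\<close>

definition weak_gradient :: "'a::euclidean_space set \<Rightarrow> ('a \<Rightarrow> real) \<Rightarrow> 'a \<Rightarrow> 'a" where
  "weak_gradient U w = (SOME g. is_weak_gradient U w g)"

definition L2_on :: "'a::euclidean_space set \<Rightarrow> ('a \<Rightarrow> 'b::euclidean_space) \<Rightarrow> bool" where
  "L2_on U f \<longleftrightarrow> set_borel_measurable lebesgue U f \<and>
     set_integrable lebesgue U (\<lambda>x. (norm (f x))\<^sup>2)"

definition L2_norm :: "'a::euclidean_space set \<Rightarrow> ('a \<Rightarrow> 'b::euclidean_space) \<Rightarrow> real" where
  "L2_norm U f = sqrt (LINT x:U|lebesgue. (norm (f x))\<^sup>2)"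

definition H1 :: "'a::euclidean_space set \<Rightarrow> ('a \<Rightarrow> real) set" where
  "H1 U = {w. L2_on U w \<and> (\<exists>g. is_weak_gradient U w g \<and> L2_on U g)}"

section \<open>Meshes\<close>

text \<open>The condition \<open>interior (closure \<Omega>) = \<Omega>\<close> says that \<open>\<Omega>\<close> is the interior of a polyhedron, so
  that there are no cracks; the boundary is not required to be Lipschitz.\<close>

definition polyhedral_domain :: "'a::euclidean_space set \<Rightarrow> bool" where
  "polyhedral_domain \<Omega> \<longleftrightarrow> open \<Omega> \<and> connected \<Omega> \<and> \<Omega> \<noteq> {} \<and> interior (closure \<Omega>) = \<Omega> \<and>
     (\<exists>\<P>. finite \<P> \<and> (\<forall>Q\<in>\<P>. polytope Q) \<and> closure \<Omega> = \<Union>\<P>)"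

text \<open>The empty set counts as a face, so disjoint elements are allowed.\<close>

definition conforming_mesh :: "'a::euclidean_space set \<Rightarrow> 'a set set \<Rightarrow> bool" where
  "conforming_mesh \<Omega> \<T> \<longleftrightarrow> finite \<T> \<and> (\<forall>K\<in>\<T>. int DIM('a) simplex K) \<and> \<Union>\<T> = closure \<Omega> \<and>
     (\<forall>K\<in>\<T>. \<forall>L\<in>\<T>. (K \<inter> L) face_of K \<and> (K \<inter> L) face_of L)"

definition inball_diameter :: "'a::euclidean_space set \<Rightarrow> real" where
  "inball_diameter K = Sup {diameter (cball x r) | x r. 0 \<le> r \<and> cball x r \<subseteq> K}"

definition shape_bounded :: "'a::euclidean_space set set \<Rightarrow> real \<Rightarrow> bool" where
  "shape_bounded \<T> \<sigma> \<longleftrightarrow> (\<forall>K\<in>\<T>. diameter K / inball_diameter K \<le> \<sigma>)"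

section \<open>Finite element space\<close>

definition multi_indices :: "nat \<Rightarrow> ('a::euclidean_space \<Rightarrow> nat) set" where
  "multi_indices l = {\<alpha>. (\<forall>i. i \<notin> Basis \<longrightarrow> \<alpha> i = 0) \<and> (\<Sum>i\<in>Basis. \<alpha> i) \<le> l}"

lemma finite_multi_indices: "finite (multi_indices l :: ('a::euclidean_space \<Rightarrow> nat) set)"
proof (rule finite_subset)
  let ?S = "{\<alpha>. \<forall>i::'a. (i \<in> Basis \<longrightarrow> \<alpha> i \<in> {..l}) \<and> (i \<notin> Basis \<longrightarrow> \<alpha> i = 0)}"
  show "multi_indices l \<subseteq> ?S"
  proof
    fix \<alpha> :: "'a \<Rightarrow> nat" assume \<alpha>: "\<alpha> \<in> multi_indices l"
    have "\<alpha> i \<le> l" if "i \<in> Basis" for i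
    proof -
      have "\<alpha> i \<le> (\<Sum>i\<in>Basis. \<alpha> i)"
        by (rule member_le_sum) (use that in simp_all)
      also have "\<dots> \<le> l"
        using \<alpha> by (simp add: multi_indices_def)
      finally show ?thesis .
    qed
    then show "\<alpha> \<in> ?S"
      using \<alpha> by (simp add: multi_indices_def)
  qed
  show "finite ?S"
    by (rule finite_set_of_finite_funs) simp_all
qed

definition polys :: "nat \<Rightarrow> ('a::euclidean_space \<Rightarrow> real) set" where
  "polys l = {P. \<exists>c. \<forall>x. P x = (\<Sum>\<alpha>\<in>multi_indices l. c \<alpha> * (\<Prod>i\<in>Basis. (x \<bullet> i) ^ \<alpha> i))}"

text \<open>Functions on \<open>closure \<Omega>\<close> are represented by total functions whose values elsewhere are
  irrelevant.\<close>

definition fe_space ::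
    "nat \<Rightarrow> 'a::euclidean_space set \<Rightarrow> 'a set set \<Rightarrow> ('a \<Rightarrow> real) set" where
  "fe_space l \<Omega> \<T> = {v. continuous_on (closure \<Omega>) v \<and> (\<forall>K\<in>\<T>. \<exists>P\<in>polys l. \<forall>x\<in>K. v x = P x)}"

definition vertices :: "'a::euclidean_space set \<Rightarrow> 'a set" where
  "vertices K = {x. x extreme_point_of K}"

definition element_nodes :: "nat \<Rightarrow> 'a::euclidean_space set \<Rightarrow> 'a set" where
  "element_nodes l K =
     {\<Sum>p\<in>vertices K. (real (\<alpha> p) / real l) *\<^sub>R p | \<alpha>. (\<Sum>p\<in>vertices K. \<alpha> p) = l}"

definition nodes :: "nat \<Rightarrow> 'a::euclidean_space set set \<Rightarrow> 'a set" where
  "nodes l \<T> = (\<Union>K\<in>\<T>. element_nodes l K)"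

text \<open>The basis function is unique on \<open>closure \<Omega>\<close> only, hence the choice operator here and the
  restriction to \<open>closure \<Omega>\<close> in the support.\<close>

definition nodal_basis ::
    "nat \<Rightarrow> 'a::euclidean_space set \<Rightarrow> 'a set set \<Rightarrow> 'a \<Rightarrow> 'a \<Rightarrow> real" where
  "nodal_basis l \<Omega> \<T> z =
     (SOME \<phi>. \<phi> \<in> fe_space l \<Omega> \<T> \<and> (\<forall>y\<in>nodes l \<T>. \<phi> y = (if y = z then 1 else 0)))"

definition node_patch ::
    "nat \<Rightarrow> 'a::euclidean_space set \<Rightarrow> 'a set set \<Rightarrow> 'a \<Rightarrow> 'a set" where
  "node_patch l \<Omega> \<T> z = closure {x \<in> closure \<Omega>. nodal_basis l \<Omega> \<T> z x \<noteq> 0}"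

section \<open>Coefficient and quasi-monotonicity\<close>

text \<open>Neighbouring closed elements overlap in null sets, so the coefficient can only be required to
  be constant on them almost everywhere; \<open>aK K\<close> is its value on \<open>K\<close>.\<close>

definition piecewise_constant ::
    "'a::euclidean_space set set \<Rightarrow> ('a \<Rightarrow> real) \<Rightarrow> ('a set \<Rightarrow> real) \<Rightarrow> bool" where
  "piecewise_constant \<T> a aK \<longleftrightarrow> (\<forall>K\<in>\<T>. AE x in lebesgue. x \<in> K \<longrightarrow> a x = aK K)"

definition uniformly_positive :: "'a::euclidean_space set \<Rightarrow> ('a \<Rightarrow> real) \<Rightarrow> bool" where
  "uniformly_positive \<Omega> a \<longleftrightarrow> (\<exists>c>0. AE x in lebesgue. x \<in> \<Omega> \<longrightarrow> c \<le> a x)"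

definition interior_facet :: "'a::euclidean_space set \<Rightarrow> 'a set set \<Rightarrow> 'a set \<Rightarrow> bool" where
  "interior_facet \<Omega> \<T> F \<longleftrightarrow> (\<exists>K\<in>\<T>. F facet_of K) \<and> \<not> F \<subseteq> frontier \<Omega>"

definition monotone_path ::
    "nat \<Rightarrow> 'a::euclidean_space set \<Rightarrow> 'a set set \<Rightarrow> ('a set \<Rightarrow> real) \<Rightarrow> 'a \<Rightarrow>
      'a set \<Rightarrow> 'a set \<Rightarrow> nat \<Rightarrow> (nat \<Rightarrow> 'a set) \<Rightarrow> bool" where
  "monotone_path l \<Omega> \<T> aK z K K' m p \<longleftrightarrow>
     p 0 = K \<and> p m = K' \<and> (\<forall>n\<le>m. p n \<in> \<T> \<and> p n \<subseteq> node_patch l \<Omega> \<T> z) \<and>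
     (\<forall>n<m. interior_facet \<Omega> \<T> (p n \<inter> p (Suc n)) \<and> aK (p n) \<le> aK (p (Suc n)))"

definition quasi_monotone ::
    "nat \<Rightarrow> 'a::euclidean_space set \<Rightarrow> 'a set set \<Rightarrow> ('a set \<Rightarrow> real) \<Rightarrow> bool" where
  "quasi_monotone l \<Omega> \<T> aK \<longleftrightarrow>
     (\<forall>z\<in>nodes l \<T>. \<forall>K\<in>\<T>. \<forall>K'\<in>\<T>.
        K \<subseteq> node_patch l \<Omega> \<T> z \<and> K' \<subseteq> node_patch l \<Omega> \<T> z \<and> aK K \<le> aK K' \<longrightarrow>
        (\<exists>m p. monotone_path l \<Omega> \<T> aK z K K' m p))"

end

theory Submission
  imports Defs
begin

text \<open>After adding constants, each local polynomial \<open>P K\<close> matches \<open>u\<close> in average against a smooth bump in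
  the interior of \<open>K\<close>. In dimension at least two, the conforming approximation takes at every node \<open>z\<close>
  the value of \<open>P K\<close>, where \<open>K\<close> is an element of largest coefficient at \<open>z\<close>. The nodal error on
  another element at \<open>z\<close> telescopes along a monotone path into jumps \<open>P K z - P L z\<close> across facets,
  whose number is bounded by a volume argument and along which the coefficient only increases. A jump
  is estimated without traces or Poincare inequalities: the average of a weakly differentiable
  function against a bump that moves and dilates along a segment has as derivative an average of the
  weak gradient, so moving the bump from \<open>K\<close> through the facet to \<open>L\<close> controls averages of the jump
  over small perturbations of the points of a disc in the facet, and these control the polynomial
  jump on the whole facet. In dimension one, the pieces \<open>P K\<close> are glued by adding constants.\<close>

section \<open>Smooth functions\<close>

text \<open>The constant must not see the contrast of the coefficient. At a node the error on
  \<open>K\<close> is weighted with \<open>aK K\<close>, while the jumps to be summed live on other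
  elements \<open>L\<close>; they are absorbed by \<open>aK L\<close> times the energy on
  \<open>L\<close> only if \<open>aK K \<le> aK L\<close>, hence the value from the element of
  largest coefficient and the monotone paths. Energies fix each local polynomial only up to a
  constant, whereas jumps compare values, hence the normalization by averages. Across a facet the
  tangential derivatives of the jump are not controlled in advance. A bump that crosses exactly
  along the normal meets only the normal component of the gradient, so one polynomial may first be
  corrected by a function that is constant along the normal. Jump estimates also need neighbours of
  comparable diameter: elements sharing a facet with at least two vertices share an edge, but in
  dimension one they share only a point and their lengths are unrelated, so that case is glued
  exactly. All constants are functions of dimension, degree and \<sigma>.\<close>

lemma Ck_SucI:
  assumes "\<And>x. (f has_derivative f' x) (at x)"
    and "\<And>i. i \<in> Basis \<Longrightarrow> Ck k (\<lambda>x. f' x i)"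
  shows "Ck (Suc k) f"
proof -
  have "frechet_derivative f (at x) = f' x" for x
    using frechet_derivative_at[OF assms(1)] by simp
  moreover have "f differentiable (at x)" for x
    using assms(1) differentiable_def by blast
  ultimately show ?thesis
    using assms(2) by simp
qed

lemma Ck_has_derivative:
  assumes "Ck (Suc k) f"
  shows "(f has_derivative frechet_derivative f (at x)) (at x)"
  using assms by (simp add: frechet_derivative_works)

lemma Ck_continuous: "Ck k f \<Longrightarrow> continuous_on UNIV f"
  by (cases k) (auto simp: continuous_on_eq_continuous_at differentiable_imp_continuous_within)

lemma Ck_Suc_imp: "Ck (Suc k) f \<Longrightarrow> Ck k f"
proof (induction k arbitrary: f)
  case 0
  then show ?case using Ck_continuous[OF 0] by simp
next
  case (Suc k)
  then show ?case by auto
qed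

lemma Ck_const: "Ck k (\<lambda>x. c)"
proof (induction k arbitrary: c)
  case 0
  then show ?case by simp
next
  case (Suc k)
  show ?case
    by (rule Ck_SucI[where f' = "\<lambda>x h. 0"]) (use Suc in auto)
qed

lemma Ck_add: "Ck k f \<Longrightarrow> Ck k g \<Longrightarrow> Ck k (\<lambda>x. f x + g x)"
proof (induction k arbitrary: f g)
  case 0
  then show ?case by (simp add: continuous_on_add)
next
  case (Suc k)
  show ?case
    by (rule Ck_SucI[OF has_derivative_add[OF Ck_has_derivative[OF Suc.prems(1)] Ck_has_derivative[OF Suc.prems(2)]]])
       (use Suc in auto)
qed

lemma Ck_mult: "Ck k f \<Longrightarrow> Ck k g \<Longrightarrow> Ck k (\<lambda>x. f x * g x)"
proof (induction k arbitrary: f g)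
  case 0
  then show ?case by (simp add: continuous_on_mult)
next
  case (Suc k)
  note * = Suc.prems[THEN Ck_Suc_imp]
  show ?case
    by (rule Ck_SucI[OF has_derivative_mult[OF Ck_has_derivative[OF Suc.prems(1)] Ck_has_derivative[OF Suc.prems(2)]]])
       (use Suc * in \<open>auto intro!: Ck_add\<close>)
qed

lemma Ck_cmult: "Ck k f \<Longrightarrow> Ck k (\<lambda>x. c * f x)"
  by (rule Ck_mult[OF Ck_const])

lemma Ck_diff: "Ck k f \<Longrightarrow> Ck k g \<Longrightarrow> Ck k (\<lambda>x. f x - g x)"
  using Ck_add[OF _ Ck_cmult[where c = "-1"], of k f g] by simp

lemma Ck_prod: "(\<And>i. i \<in> I \<Longrightarrow> Ck k (f i)) \<Longrightarrow> Ck k (\<lambda>x. \<Prod>i\<in>I. f i x)"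
  by (induction I rule: infinite_finite_induct) (simp_all add: Ck_const Ck_mult)

lemma Ck_sum: "(\<And>i. i \<in> I \<Longrightarrow> Ck k (f i)) \<Longrightarrow> Ck k (\<lambda>x. \<Sum>i\<in>I. f i x)"
  by (induction I rule: infinite_finite_induct) (simp_all add: Ck_const Ck_add)

lemma Ck_inner: "Ck k (\<lambda>x. x \<bullet> n)"
proof (cases k)
  case 0
  then show ?thesis by (auto intro!: continuous_intros)
next
  case (Suc m)
  show ?thesis unfolding Suc
    by (rule Ck_SucI[where f' = "\<lambda>x h. h \<bullet> n"])
       (auto intro!: derivative_eq_intros Ck_const)
qed

lemma Ck_power: "Ck k f \<Longrightarrow> Ck k (\<lambda>x. f x ^ n)"
  by (induction n) (simp_all add: Ck_const Ck_mult)

text \<open>By the chain rule each partial derivative of the composition is a fixed linear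
  combination of partials of \<open>f\<close> composed with the same affine map, so the induction on
  \<open>k\<close> closes with \<open>f\<close> arbitrary.\<close>

lemma Ck_compose_affine:
  fixes L :: "'a::euclidean_space \<Rightarrow> 'b::euclidean_space"
  assumes "bounded_linear L" and "Ck k f"
  shows "Ck k (\<lambda>x. f (L x + b))"
  using assms(2)
proof (induction k arbitrary: f)
  case 0
  then show ?case
    using linear_continuous_on[OF assms(1)]
    by (auto intro!: continuous_on_compose2[of UNIV f] continuous_intros)
next
  case (Suc k)
  let ?f' = "\<lambda>x. frechet_derivative f (at x)"
  have D: "((\<lambda>x. f (L x + b)) has_derivative (\<lambda>h. ?f' (L x + b) (L h))) (at x)" for x
    by (rule has_derivative_compose[where f = "\<lambda>x. L x + b" and g = f])
       (auto intro!: derivative_eq_intros bounded_linear_imp_has_derivative assms Ck_has_derivative[OF Suc.prems])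
  have lin: "linear (?f' y)" for y
    using Ck_has_derivative[OF Suc.prems] has_derivative_linear by blast
  have rep: "?f' y h = (\<Sum>j\<in>Basis. (h \<bullet> j) * ?f' y j)" for y h
  proof -
    have "?f' y h = ?f' y (\<Sum>j\<in>Basis. (h \<bullet> j) *\<^sub>R j)"
      by (simp only: euclidean_representation)
    then show ?thesis
      by (simp only: linear_sum[OF lin] linear_scale[OF lin] real_scaleR_def)
  qed
  have "Ck k (\<lambda>x. \<Sum>j\<in>Basis. (L i \<bullet> j) * ?f' (L x + b) j)" for i
    by (intro Ck_sum Ck_cmult Suc.IH) (use Suc.prems in auto)
  then have "Ck k (\<lambda>x. ?f' (L x + b) (L i))" for i
    by (subst rep)
  then show ?case
    by (intro Ck_SucI[OF D])
qed

section \<open>Polynomials\<close>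

definition mono_fun :: "('a::euclidean_space \<Rightarrow> nat) \<Rightarrow> 'a \<Rightarrow> real" where
  "mono_fun \<alpha> x = (\<Prod>i\<in>Basis. (x \<bullet> i) ^ \<alpha> i)"

lemma polys_iff: "P \<in> polys m \<longleftrightarrow> (\<exists>c. P = (\<lambda>x. \<Sum>\<alpha>\<in>multi_indices m. c \<alpha> * mono_fun \<alpha> x))"
  by (auto simp: polys_def mono_fun_def)

lemma polys_induct [consumes 1, case_names zero mono add scale]:
  assumes "P \<in> polys m"
    and "Q (\<lambda>x. 0)"
    and mono: "\<And>\<alpha>. \<alpha> \<in> multi_indices m \<Longrightarrow> Q (mono_fun \<alpha>)"
    and add: "\<And>f g. Q f \<Longrightarrow> Q g \<Longrightarrow> Q (\<lambda>x. f x + g x)"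
    and scale: "\<And>c f. Q f \<Longrightarrow> Q (\<lambda>x. c * f x)"
  shows "Q P"
proof -
  obtain c where P: "P = (\<lambda>x. \<Sum>\<alpha>\<in>multi_indices m. c \<alpha> * mono_fun \<alpha> x)"
    using assms(1) polys_iff by blast
  have "Q (\<lambda>x. \<Sum>\<alpha>\<in>A. c \<alpha> * mono_fun \<alpha> x)" if "finite A" "A \<subseteq> multi_indices m" for A
    using that
  proof (induction A rule: finite_induct)
    case empty
    then show ?case using assms(2) by simp
  next
    case (insert a A)
    then show ?case
      by (simp, intro add scale mono) auto
  qed
  then show ?thesis
    using P finite_multi_indices by blast
qed

lemma polys_zero: "(\<lambda>x. 0) \<in> polys m"
  unfolding polys_iff by (rule exI[of _ "\<lambda>_. 0"]) simp

lemma polys_mono_fun: "\<alpha> \<in> multi_indices m \<Longrightarrow> mono_fun \<alpha> \<in> polys m"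
  unfolding polys_iff
  by (rule exI[of _ "\<lambda>\<beta>. if \<beta> = \<alpha> then 1 else 0"])
     (simp add: if_distrib[of "\<lambda>c. c * _"] sum.delta' finite_multi_indices cong: if_cong)

lemma polys_add: "P \<in> polys m \<Longrightarrow> Q \<in> polys m \<Longrightarrow> (\<lambda>x. P x + Q x) \<in> polys m"
  unfolding polys_iff
proof (elim exE)
  fix c e assume "P = (\<lambda>x. \<Sum>\<alpha>\<in>multi_indices m. c \<alpha> * mono_fun \<alpha> x)"
    "Q = (\<lambda>x. \<Sum>\<alpha>\<in>multi_indices m. e \<alpha> * mono_fun \<alpha> x)"
  then show "\<exists>f. (\<lambda>x. P x + Q x) = (\<lambda>x. \<Sum>\<alpha>\<in>multi_indices m. f \<alpha> * mono_fun \<alpha> x)"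
    by (intro exI[of _ "\<lambda>\<alpha>. c \<alpha> + e \<alpha>"]) (simp add: sum.distrib algebra_simps)
qed

lemma polys_cmult: "P \<in> polys m \<Longrightarrow> (\<lambda>x. c * P x) \<in> polys m"
  unfolding polys_iff
proof (elim exE)
  fix e assume "P = (\<lambda>x. \<Sum>\<alpha>\<in>multi_indices m. e \<alpha> * mono_fun \<alpha> x)"
  then show "\<exists>f. (\<lambda>x. c * P x) = (\<lambda>x. \<Sum>\<alpha>\<in>multi_indices m. f \<alpha> * mono_fun \<alpha> x)"
    by (intro exI[of _ "\<lambda>\<alpha>. c * e \<alpha>"]) (simp add: sum_distrib_left algebra_simps)
qed

lemma polys_diff: "P \<in> polys m \<Longrightarrow> Q \<in> polys m \<Longrightarrow> (\<lambda>x. P x - Q x) \<in> polys m"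
  using polys_add[OF _ polys_cmult[where c = "-1"], of P m Q] by simp

lemma polys_sum: "(\<And>i. i \<in> I \<Longrightarrow> f i \<in> polys m) \<Longrightarrow> (\<lambda>x. \<Sum>i\<in>I. f i x) \<in> polys m"
  by (induction I rule: infinite_finite_induct) (simp_all add: polys_zero polys_add)

lemma multi_indices_mono: "m \<le> m' \<Longrightarrow> multi_indices m \<subseteq> multi_indices m'"
  by (auto simp: multi_indices_def)

lemma polys_mono: "P \<in> polys m \<Longrightarrow> m \<le> m' \<Longrightarrow> P \<in> polys m'"
proof (induction rule: polys_induct)
  case zero
  show ?case by (rule polys_zero)
next
  case (mono \<alpha>)
  then show ?case using multi_indices_mono polys_mono_fun by blast
next
  case (add f g)
  then show ?case using polys_add by blast
next
  case (scale c f)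
  then show ?case using polys_cmult by blast
qed

lemma mono_fun_0: "mono_fun (\<lambda>_. 0) = (\<lambda>x. 1)"
  by (simp add: mono_fun_def fun_eq_iff)

lemma polys_const: "(\<lambda>x. c) \<in> polys m"
proof -
  have "(\<lambda>_. 0) \<in> multi_indices m" by (simp add: multi_indices_def)
  then have "(\<lambda>x. c * mono_fun (\<lambda>_. 0) x) \<in> polys m"
    by (intro polys_cmult polys_mono_fun)
  then show ?thesis by (simp add: mono_fun_0)
qed

lemma mono_fun_upd:
  assumes "i \<in> Basis"
  shows "mono_fun (\<alpha>(i := Suc (\<alpha> i))) x = (x \<bullet> i) * mono_fun \<alpha> x"
proof -
  have "(\<Prod>j\<in>Basis - {i}. (x \<bullet> j) ^ (\<alpha>(i := Suc (\<alpha> i))) j) = (\<Prod>j\<in>Basis - {i}. (x \<bullet> j) ^ \<alpha> j)"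
    by (rule prod.cong) auto
  then show ?thesis
    by (simp add: mono_fun_def prod.remove[OF finite_Basis assms])
qed

lemma sum_upd_Suc:
  assumes "i \<in> Basis"
  shows "(\<Sum>j\<in>Basis. (\<alpha>(i := Suc (\<alpha> i))) j) = Suc (\<Sum>j\<in>Basis. \<alpha> j)"
proof -
  have "(\<Sum>j\<in>Basis - {i}. (\<alpha>(i := Suc (\<alpha> i))) j) = (\<Sum>j\<in>Basis - {i}. \<alpha> j)"
    by (rule sum.cong) auto
  then show ?thesis
    by (simp add: sum.remove[OF finite_Basis assms])
qed

lemma multi_indices_upd:
  assumes "i \<in> Basis"
  shows "\<alpha>(i := Suc (\<alpha> i)) \<in> multi_indices (Suc m) \<longleftrightarrow> \<alpha> \<in> multi_indices m"
  using assms sum_upd_Suc[OF assms, of \<alpha>] by (auto simp: multi_indices_def)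

lemma polys_coord_mult:
  assumes "P \<in> polys m" and i: "i \<in> Basis"
  shows "(\<lambda>x. (x \<bullet> i) * P x) \<in> polys (Suc m)"
  using assms(1)
proof (induction rule: polys_induct)
  case zero
  then show ?case using polys_zero by simp
next
  case (mono \<alpha>)
  have "mono_fun (\<alpha>(i := Suc (\<alpha> i))) = (\<lambda>x. (x \<bullet> i) * mono_fun \<alpha> x)"
    using mono_fun_upd[OF i] by blast
  with mono show ?case
    using polys_mono_fun[of "\<alpha>(i := Suc (\<alpha> i))" "Suc m"] multi_indices_upd[OF i] by simp
next
  case (add f g)
  then show ?case using polys_add[OF add.IH] by (simp only: distrib_left)
next
  case (scale c f)
  then show ?case using polys_cmult[OF scale.IH, of c] by (simp only: mult.left_commute[of _ c])
qed

lemma polys_affine_mult: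
  assumes "P \<in> polys m"
  shows "(\<lambda>x. (n \<bullet> x + c) * P x) \<in> polys (Suc m)"
proof -
  have "(n \<bullet> x + c) * P x = (\<Sum>i\<in>Basis. (n \<bullet> i) * ((x \<bullet> i) * P x)) + c * P x" for x
    using euclidean_inner[of n x] by (simp add: algebra_simps sum_distrib_left)
  then show ?thesis
    by (simp only:) (intro polys_add polys_sum polys_cmult polys_coord_mult polys_mono[OF assms] assms le_SucI order.refl)
qed

text \<open>Builds a monomial by multiplying one coordinate at a time. The counter \<open>k\<close>
  and the bound \<open>k < m\<close> serve predicates that depend on the degree reached so far, such
  as membership in \<open>SP l k\<close>, where a step is possible only below the top
  degree.\<close>

lemma mono_fun_induct [consumes 1, case_names zero Suc]:
  assumes "\<alpha> \<in> multi_indices m"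
    and "Q 0 (\<lambda>x. 1)"
    and "\<And>i k \<beta>. i \<in> Basis \<Longrightarrow> k < m \<Longrightarrow> Q k (mono_fun \<beta>) \<Longrightarrow> Q (Suc k) (\<lambda>x. (x \<bullet> i) * mono_fun \<beta> x)"
  shows "\<exists>k\<le>m. Q k (mono_fun \<alpha>)"
proof -
  have "\<forall>\<alpha>. (\<forall>i. i \<notin> Basis \<longrightarrow> \<alpha> i = 0) \<longrightarrow> sum \<alpha> Basis = k \<longrightarrow> Q k (mono_fun \<alpha>)" if "k \<le> m" for k
    using that
  proof (induction k)
    case 0
    show ?case
    proof (intro allI impI)
      fix \<alpha> :: "'a \<Rightarrow> nat" assume "\<forall>i. i \<notin> Basis \<longrightarrow> \<alpha> i = 0" "sum \<alpha> Basis = 0"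
      then have "\<alpha> = (\<lambda>_. 0)" by (auto simp: fun_eq_iff)
      then show "Q 0 (mono_fun \<alpha>)" using assms(2) by (simp add: mono_fun_0)
    qed
  next
    case (Suc k)
    show ?case
    proof (intro allI impI)
      fix \<alpha> :: "'a \<Rightarrow> nat" assume \<alpha>: "\<forall>i. i \<notin> Basis \<longrightarrow> \<alpha> i = 0" "sum \<alpha> Basis = Suc k"
      then obtain i where i: "i \<in> Basis" "\<alpha> i \<noteq> 0"
        by (metis sum.neutral nat.distinct(1))
      define \<beta> where "\<beta> = \<alpha>(i := \<alpha> i - 1)"
      have \<alpha>\<beta>: "\<alpha> = \<beta>(i := Suc (\<beta> i))" using i by (auto simp: \<beta>_def)
      have "sum \<alpha> Basis = Suc (sum \<beta> Basis)"
        using sum_upd_Suc[OF i(1), of \<beta>] unfolding \<alpha>\<beta>[symmetric] .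
      then have "sum \<beta> Basis = k" using \<alpha> by simp
      then have "Q k (mono_fun \<beta>)"
        using Suc i \<alpha> by (auto simp: \<beta>_def)
      from assms(3)[OF i(1) _ this] Suc.prems
      have "Q (Suc k) (\<lambda>x. (x \<bullet> i) * mono_fun \<beta> x)" by simp
      also have "(\<lambda>x. (x \<bullet> i) * mono_fun \<beta> x) = mono_fun \<alpha>"
        using mono_fun_upd[OF i(1), of \<beta>] unfolding \<alpha>\<beta>[symmetric] by (rule ext[OF sym])
      finally show "Q (Suc k) (mono_fun \<alpha>)" .
    qed
  qed
  then show ?thesis using assms(1) by (auto simp: multi_indices_def)
qed

lemma polys_Ck: "P \<in> polys m \<Longrightarrow> Ck k P"
proof (induction rule: polys_induct)
  case (mono \<alpha>)
  then show ?case
    unfolding mono_fun_def[abs_def] by (intro Ck_prod Ck_power Ck_inner)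
next
  case zero
  show ?case by (rule Ck_const)
next
  case (add f g)
  then show ?case by (rule Ck_add)
next
  case (scale c f)
  then show ?case by (rule Ck_cmult)
qed

text \<open>Reduces estimates in several variables to one: each factor of a monomial is a power of
  an affine function of \<open>t\<close>, so the degree in \<open>t\<close> is at most the total
  degree.\<close>

lemma polys_line:
  assumes "P \<in> polys m"
  shows "\<exists>p. degree p \<le> m \<and> (\<forall>t. P (x + t *\<^sub>R y) = poly p t)"
  using assms
proof (induction rule: polys_induct)
  case zero
  then show ?case by (intro exI[of _ 0]) simp
next
  case (mono \<alpha>)
  let ?p = "\<Prod>i\<in>Basis. [:x \<bullet> i, y \<bullet> i:] ^ \<alpha> i"
  have "degree ?p \<le> (\<Sum>i\<in>Basis. degree ([:x \<bullet> i, y \<bullet> i:] ^ \<alpha> i))"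
    using degree_prod_sum_le[OF finite_Basis] by (simp add: o_def)
  also have "\<dots> \<le> (\<Sum>i\<in>Basis. \<alpha> i)"
  proof (rule sum_mono)
    fix i :: 'a
    have "degree ([:x \<bullet> i, y \<bullet> i:] ^ \<alpha> i) \<le> degree [:x \<bullet> i, y \<bullet> i:] * \<alpha> i"
      by (rule degree_power_le)
    also have "\<dots> \<le> 1 * \<alpha> i" by (intro mult_right_mono) auto
    finally show "degree ([:x \<bullet> i, y \<bullet> i:] ^ \<alpha> i) \<le> \<alpha> i" by simp
  qed
  also have "\<dots> \<le> m" using mono by (simp add: multi_indices_def)
  finally show ?case
    by (intro exI[of _ ?p]) (auto simp: poly_prod mono_fun_def algebra_simps poly_power)
next
  case (add f g)
  then obtain p q where "degree p \<le> m" "degree q \<le> m"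
    "\<forall>t. f (x + t *\<^sub>R y) = poly p t" "\<forall>t. g (x + t *\<^sub>R y) = poly q t" by blast
  then show ?case
    by (intro exI[of _ "p + q"]) (auto intro: degree_add_le)
next
  case (scale c f)
  then obtain p where "degree p \<le> m" "\<forall>t. f (x + t *\<^sub>R y) = poly p t" by blast
  then show ?case
    by (intro exI[of _ "smult c p"]) (auto intro: degree_smult_le order.trans)
qed

section \<open>Test functions and uniqueness of weak gradients\<close>

text \<open>The flat function exp(-1/t) with an extra power of t in the denominator: the family over
  \<open>k\<close> is closed under differentiation up to linear combinations, which makes smoothness
  an induction over all \<open>k\<close> at once.\<close>

definition sfun :: "nat \<Rightarrow> real \<Rightarrow> real" where
  "sfun k t = (if t > 0 then exp (- 1 / t) / t ^ k else 0)"

lemma sfun_tendsto_0: "(sfun k \<longlongrightarrow> 0) (at 0)"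
proof -
  have "((\<lambda>y::real. y ^ k / exp y) \<longlongrightarrow> 0) at_top"
    by (rule tendsto_power_div_exp_0)
  from filterlim_compose[OF this filterlim_inverse_at_top_right]
  have "((\<lambda>t::real. inverse t ^ k / exp (inverse t)) \<longlongrightarrow> 0) (at_right 0)" .
  moreover have "\<forall>\<^sub>F t in at_right 0. inverse t ^ k / exp (inverse t) = sfun k t"
    by (rule eventually_at_right_less[THEN eventually_mono])
       (simp add: sfun_def exp_minus field_simps)
  ultimately have "(sfun k \<longlongrightarrow> 0) (at_right 0)"
    by (rule Lim_transform_eventually)
  moreover have "\<forall>\<^sub>F t in at_left 0. 0 = sfun k t"
    unfolding eventually_at_left_field by (auto simp: sfun_def intro!: exI[of _ "-1"])
  then have "(sfun k \<longlongrightarrow> 0) (at_left 0)"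
    by (rule Lim_transform_eventually[OF tendsto_const])
  ultimately show ?thesis
    by (simp add: filterlim_split_at)
qed

lemma sfun_deriv: "(sfun k has_real_derivative (sfun (k + 2) t - real k * sfun (k + 1) t)) (at t)"
proof -
  consider "t > 0" | "t < 0" | "t = 0" by linarith
  then show ?thesis
  proof cases
    case 1
    have "((\<lambda>t. exp (- 1 / t) / t ^ k) has_real_derivative (sfun (k + 2) t - real k * sfun (k + 1) t)) (at t)"
    proof (rule DERIV_cong)
      show "((\<lambda>t. exp (- 1 / t) / t ^ k) has_real_derivative
        ((exp (- 1 / t) * (1 / t^2)) * t ^ k - exp (- 1 / t) * (real k * t ^ (k - 1))) / (t ^ k * t ^ k)) (at t)"
        using 1 by (auto intro!: derivative_eq_intros simp: field_simps power2_eq_square)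
      have "real k * t ^ (k - 1) = real k * t ^ k / t"
        using 1 by (cases k) auto
      then show "((exp (- 1 / t) * (1 / t^2)) * t ^ k - exp (- 1 / t) * (real k * t ^ (k - 1))) / (t ^ k * t ^ k)
        = sfun (k + 2) t - real k * sfun (k + 1) t"
        using 1 by (simp only:) (simp add: sfun_def field_simps power2_eq_square)
    qed
    then show ?thesis
      by (rule has_field_derivative_transform_within_open[of _ _ _ "{0<..}"]) (use 1 in \<open>auto simp: sfun_def\<close>)
  next
    case 2
    have "((\<lambda>t. 0) has_real_derivative (sfun (k + 2) t - real k * sfun (k + 1) t)) (at t)"
      using 2 by (simp add: sfun_def)
    then show ?thesis
      by (rule has_field_derivative_transform_within_open[of _ _ _ "{..<0}"]) (use 2 in \<open>auto simp: sfun_def\<close>)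
  next
    case 3
    \<comment> \<open>At the origin the difference quotient is again a member of the family, with
      index one higher, so the limit already computed gives the derivative.\<close>
    have eq: "(sfun k h - sfun k 0) / h = sfun (Suc k) h" for h
      by (simp add: sfun_def)
    show ?thesis
      unfolding 3 has_field_derivative_iff
      unfolding diff_0_right eq using sfun_tendsto_0[of "Suc k"] by (simp add: sfun_def[of _ 0])
  qed
qed

lemma sfun_nonneg: "0 \<le> sfun k t"
  by (simp add: sfun_def)

lemma sfun_0_le_1: "sfun 0 t \<le> 1"
  by (simp add: sfun_def)

lemma sfun_pos_iff: "0 < sfun k t \<longleftrightarrow> 0 < t"
  by (simp add: sfun_def)

lemma Ck_sfun: "Ck m (\<lambda>x. sfun k (x \<bullet> n + c))"
proof (induction m arbitrary: k)
  case 0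
  have "continuous_on UNIV (sfun k)"
    by (rule DERIV_continuous_on) (rule has_field_derivative_at_within[OF sfun_deriv])
  then have "continuous_on UNIV (\<lambda>x. sfun k (x \<bullet> n + c))"
    by (rule continuous_on_compose2) (auto intro!: continuous_intros)
  then show ?case by simp
next
  case (Suc m)
  show ?case
  proof (rule Ck_SucI)
    fix x
    show "((\<lambda>x. sfun k (x \<bullet> n + c)) has_derivative
      (\<lambda>h. (sfun (k + 2) (x \<bullet> n + c) - real k * sfun (k + 1) (x \<bullet> n + c)) * (h \<bullet> n))) (at x)"
      by (rule has_derivative_compose[where f = "\<lambda>x. x \<bullet> n + c" and f' = "\<lambda>h. h \<bullet> n"
            and g = "sfun k", OF _ sfun_deriv[unfolded has_field_derivative_def]])
         (auto intro!: derivative_eq_intros)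
  next
    fix i
    show "Ck m (\<lambda>x. (sfun (k + 2) (x \<bullet> n + c) - real k * sfun (k + 1) (x \<bullet> n + c)) * (i \<bullet> n))"
      by (intro Ck_mult Ck_diff Ck_const Suc)
  qed
qed

text \<open>The factor \<open>m\<close> sharpens the profile: for growing \<open>m\<close> the
  functions tend to the indicator of the open box while staying in [0, 1] and vanishing outside the
  box.\<close>

definition box_bump :: "real \<Rightarrow> 'a::euclidean_space \<Rightarrow> 'a \<Rightarrow> 'a \<Rightarrow> real" where
  "box_bump m a b x = (\<Prod>i\<in>Basis. sfun 0 (m * (x \<bullet> i - a \<bullet> i)) * sfun 0 (m * (b \<bullet> i - x \<bullet> i)))"

lemma Ck_box_bump: "Ck k (box_bump m a b)"
proof -
  have "Ck k (\<lambda>x. \<Prod>i\<in>Basis. sfun 0 (x \<bullet> (m *\<^sub>R i) + - m * (a \<bullet> i)) * sfun 0 (x \<bullet> (- m *\<^sub>R i) + m * (b \<bullet> i)))"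
    by (intro Ck_prod Ck_mult Ck_sfun)
  then show ?thesis
    by (simp add: box_bump_def[abs_def] algebra_simps)
qed

lemma box_bump_nonneg: "0 \<le> box_bump m a b x"
  by (simp add: box_bump_def prod_nonneg sfun_nonneg)

lemma box_bump_le_1: "box_bump m a b x \<le> 1"
  unfolding box_bump_def by (intro prod_le_1) (auto simp: sfun_nonneg sfun_0_le_1 mult_le_one)

lemma box_bump_pos: "m > 0 \<Longrightarrow> x \<in> box a b \<Longrightarrow> 0 < box_bump m a b x"
  unfolding box_bump_def by (intro prod_pos) (auto simp: sfun_pos_iff mem_box)

lemma box_bump_eq_0:
  assumes "m > 0" "x \<notin> box a b"
  shows "box_bump m a b x = 0"
proof -
  obtain i where i: "i \<in> Basis" "x \<bullet> i \<le> a \<bullet> i \<or> b \<bullet> i \<le> x \<bullet> i"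
    using assms by (auto simp: mem_box not_less)
  have "sfun 0 (m * (x \<bullet> i - a \<bullet> i)) = 0 \<or> sfun 0 (m * (b \<bullet> i - x \<bullet> i)) = 0"
    using i(2) assms(1) by (auto simp: sfun_def zero_less_mult_iff)
  then show ?thesis
    unfolding box_bump_def using i(1) by (intro prod_zero) auto
qed

lemma sfun_0_tendsto_1:
  assumes "t > 0"
  shows "(\<lambda>n. sfun 0 (real (Suc n) * t)) \<longlonglongrightarrow> 1"
proof -
  have "(\<lambda>n. exp (- (inverse (real (Suc n)) / t))) \<longlonglongrightarrow> exp (- (0 / t))"
    by (intro tendsto_intros LIMSEQ_inverse_real_of_nat) (use assms in auto)
  moreover have "sfun 0 (real (Suc n) * t) = exp (- (inverse (real (Suc n)) / t))" for n
  proof -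
    have "0 < real (Suc n) * t" using assms by (intro mult_pos_pos) auto
    then show ?thesis by (simp add: sfun_def divide_inverse)
  qed
  ultimately show ?thesis by simp
qed

lemma box_bump_tendsto: "(\<lambda>n. box_bump (real (Suc n)) a b x) \<longlonglongrightarrow> indicator (box a b) x"
proof (cases "x \<in> box a b")
  case True
  have "(\<lambda>n. box_bump (real (Suc n)) a b x) \<longlonglongrightarrow> (\<Prod>i\<in>(Basis::'a set). 1 * 1)"
    unfolding box_bump_def
    by (intro tendsto_prod tendsto_mult sfun_0_tendsto_1) (use True in \<open>auto simp: mem_box\<close>)
  then show ?thesis using True by simp
next
  case False
  then show ?thesis by (simp add: box_bump_eq_0)
qed

lemma test_functionsI:
  assumes "\<And>k. Ck k \<phi>" "compact S" "\<And>x. x \<notin> S \<Longrightarrow> \<phi> x = 0" "S \<subseteq> U"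
  shows "\<phi> \<in> test_functions U"
proof -
  have "closure {x. \<phi> x \<noteq> 0} \<subseteq> S"
    using assms(2,3) by (intro closure_minimal) (auto intro: compact_imp_closed)
  moreover from this have "compact (closure {x. \<phi> x \<noteq> 0})"
    using compact_Int_closed[OF assms(2) closed_closure, of "{x. \<phi> x \<noteq> 0}"]
    by (simp add: Int_absorb1)
  ultimately show ?thesis
    using assms(1,4) by (auto simp: test_functions_def)
qed

section \<open>Integration against test functions and the fundamental lemma\<close>

lemma sigma_finite_lebesgue: "sigma_finite_measure (lebesgue :: 'a::euclidean_space measure)"
proof -
  obtain A :: "'a set set" where A: "countable A" "A \<subseteq> sets lborel" "\<Union>A = space lborel" "\<forall>a\<in>A. emeasure lborel a \<noteq> \<infinity>"
    using lborel.sigma_finite_countable by blast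
  show ?thesis
    by standard (rule exI[of _ A], use A in \<open>auto simp: subset_eq\<close>)
qed

lemma test_functionsD:
  assumes "\<phi> \<in> test_functions U"
  obtains S where "\<And>k. Ck k \<phi>" "compact S" "\<And>x. x \<notin> S \<Longrightarrow> \<phi> x = 0" "S \<subseteq> U"
    "\<And>x i. x \<notin> S \<Longrightarrow> frechet_derivative \<phi> (at x) i = 0"
proof (rule that[of "closure {x. \<phi> x \<noteq> 0}"])
  show "Ck k \<phi>" "compact (closure {x. \<phi> x \<noteq> 0})" "closure {x. \<phi> x \<noteq> 0} \<subseteq> U" for k
    using assms by (auto simp: test_functions_def)
  show z: "\<phi> x = 0" if "x \<notin> closure {x. \<phi> x \<noteq> 0}" for x
    using that closure_subset[of "{x. \<phi> x \<noteq> 0}"] by auto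
  show "frechet_derivative \<phi> (at x) i = 0" if "x \<notin> closure {x. \<phi> x \<noteq> 0}" for x i
  proof -
    have "((\<lambda>x. 0) has_derivative (\<lambda>h. 0)) (at x)" by simp
    moreover have "open (- closure {x. \<phi> x \<noteq> 0})" by (intro open_Compl closed_closure)
    moreover have "x \<in> - closure {x. \<phi> x \<noteq> 0}" using that by blast
    moreover have "0 = \<phi> y" if "y \<in> - closure {x. \<phi> x \<noteq> 0}" for y
      using z[of y] that by simp
    ultimately have "(\<phi> has_derivative (\<lambda>h. 0)) (at x)"
      by (rule has_derivative_transform_within_open)
    from fun_cong[OF frechet_derivative_at[OF this], of i] show ?thesis by simp
  qed
qed

lemma test_functions_mono: "U \<subseteq> V \<Longrightarrow> test_functions U \<subseteq> test_functions V"
  by (auto simp: test_functions_def)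

lemma LINT_supp:
  fixes h :: "'a::euclidean_space \<Rightarrow> real"
  assumes "\<And>x. x \<notin> U \<Longrightarrow> h x = 0"
  shows "(LINT x:U|lebesgue. h x) = (LINT x|lebesgue. h x)"
  unfolding set_lebesgue_integral_def
  by (rule Bochner_Integration.integral_cong) (use assms in \<open>auto simp: indicator_def\<close>)

lemma lebesgue_measurable_continuous:
  "continuous_on UNIV (f :: 'a::euclidean_space \<Rightarrow> 'b::euclidean_space) \<Longrightarrow> f \<in> borel_measurable lebesgue"
  by (rule measurable_completion) (simp add: borel_measurable_continuous_onI)

lemma set_integrable_mult_bounded:
  fixes f \<phi> :: "'a::euclidean_space \<Rightarrow> real"
  assumes "set_integrable lebesgue S f" "\<phi> \<in> borel_measurable lebesgue"
    "\<And>x. \<bar>\<phi> x\<bar> \<le> B" "\<And>x. x \<notin> S \<Longrightarrow> \<phi> x = 0"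
  shows "integrable lebesgue (\<lambda>x. f x * \<phi> x)"
proof -
  have *: "integrable lebesgue (\<lambda>x. indicator S x * f x)"
    using assms(1) by (simp add: set_integrable_def)
  have "integrable lebesgue (\<lambda>x. (indicator S x * f x) * \<phi> x)"
  proof (rule Bochner_Integration.integrable_bound[of _ "\<lambda>x. B * (indicator S x * f x)"])
    show "integrable lebesgue (\<lambda>x. B * (indicator S x * f x))"
      using * by simp
    show "(\<lambda>x. indicator S x * f x * \<phi> x) \<in> borel_measurable lebesgue"
      using borel_measurable_integrable[OF *] assms(2) by (rule borel_measurable_times)
    show "AE x in lebesgue. norm (indicator S x * f x * \<phi> x) \<le> norm (B * (indicator S x * f x))"
    proof (rule AE_I2)
      fix x
      have "\<bar>\<phi> x\<bar> \<le> \<bar>B\<bar>" using assms(3)[of x] by linarith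
      then show "norm (indicator S x * f x * \<phi> x) \<le> norm (B * (indicator S x * f x))"
        by (simp add: abs_mult mult.commute mult_right_mono)
    qed
  qed
  moreover have "(indicator S x * f x) * \<phi> x = f x * \<phi> x" for x
    using assms(4)[of x] by (cases "x \<in> S") auto
  ultimately show ?thesis by simp
qed

lemma set_integrable_mult_test:
  fixes f \<phi> :: "'a::euclidean_space \<Rightarrow> real"
  assumes "locally_integrable_on U f" "compact S" "S \<subseteq> U" "continuous_on UNIV \<phi>" "\<And>x. x \<notin> S \<Longrightarrow> \<phi> x = 0"
  shows "integrable lebesgue (\<lambda>x. f x * \<phi> x)"
proof -
  have "bounded (\<phi> ` S)"
    by (intro compact_imp_bounded compact_continuous_image continuous_on_subset[OF assms(4)] assms(2) subset_UNIV)
  then obtain B where B: "\<And>x. x \<in> S \<Longrightarrow> \<bar>\<phi> x\<bar> \<le> B"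
    by (auto simp: bounded_iff)
  have "\<bar>\<phi> x\<bar> \<le> max B 0" for x
    using B[of x] assms(5)[of x] by (cases "x \<in> S") auto
  then show ?thesis
    using assms by (intro set_integrable_mult_bounded[of S f])
      (auto simp: locally_integrable_on_def lebesgue_measurable_continuous)
qed

text \<open>The bumps on the box are admissible because the closed box is compact in
  \<open>U\<close>; dominated convergence with the majorant |f| on that box passes to the
  indicator.\<close>

lemma integral_box_eq_0:
  fixes f :: "'a::euclidean_space \<Rightarrow> real"
  assumes "locally_integrable_on U f" "cbox a b \<subseteq> U"
    and "\<And>\<phi>. \<phi> \<in> test_functions U \<Longrightarrow> (LINT x|lebesgue. f x * \<phi> x) = 0"
  shows "(LINT x|lebesgue. indicator (box a b) x * f x) = 0"
proof -
  have int: "integrable lebesgue (\<lambda>x. indicator (cbox a b) x * f x)"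
    using assms(1,2) by (auto simp: locally_integrable_on_def set_integrable_def)
  have test: "box_bump (real (Suc n)) a b \<in> test_functions U" for n
    using assms(2) by (intro test_functionsI[of _ "cbox a b"] Ck_box_bump box_bump_eq_0)
      (use box_subset_cbox in auto)
  have eq: "f x * box_bump (real (Suc n)) a b x = indicator (cbox a b) x * f x * box_bump (real (Suc n)) a b x" for n x
    using box_bump_eq_0[of "real (Suc n)" x a b] box_subset_cbox[of a b] by (auto simp: indicator_def)
  have "(\<lambda>n. LINT x|lebesgue. (indicator (cbox a b) x * f x) * box_bump (real (Suc n)) a b x)
      \<longlonglongrightarrow> (LINT x|lebesgue. (indicator (cbox a b) x * f x) * indicator (box a b) x)"
  proof (rule integral_dominated_convergence[where w = "\<lambda>x. \<bar>indicator (cbox a b) x * f x\<bar>"])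
    show "(\<lambda>x. indicator (cbox a b) x * f x * indicator (box a b) x) \<in> borel_measurable lebesgue"
      using borel_measurable_integrable[OF int] by (rule borel_measurable_times) (intro borel_measurable_indicator, simp)
    show "(\<lambda>x. indicator (cbox a b) x * f x * box_bump (real (Suc n)) a b x) \<in> borel_measurable lebesgue" for n
      using borel_measurable_integrable[OF int]
      by (rule borel_measurable_times) (intro lebesgue_measurable_continuous Ck_continuous[OF Ck_box_bump])
    show "integrable lebesgue (\<lambda>x. \<bar>indicator (cbox a b) x * f x\<bar>)" using int by simp
    show "AE x in lebesgue. (\<lambda>n. indicator (cbox a b) x * f x * box_bump (real (Suc n)) a b x)
         \<longlonglongrightarrow> indicator (cbox a b) x * f x * indicator (box a b) x"
      by (intro AE_I2 tendsto_mult tendsto_const box_bump_tendsto)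
    show "AE x in lebesgue. norm (indicator (cbox a b) x * f x * box_bump (real (Suc n)) a b x)
         \<le> \<bar>indicator (cbox a b) x * f x\<bar>" for n
      using box_bump_nonneg[of "real (Suc n)" a b] box_bump_le_1[of "real (Suc n)" a b]
      by (intro AE_I2) (auto simp: abs_mult mult_left_le simp del: of_nat_Suc)
  qed
  moreover have "(LINT x|lebesgue. (indicator (cbox a b) x * f x) * box_bump (real (Suc n)) a b x) = 0" for n
    using assms(3)[OF test] by (simp only: eq)
  ultimately have "(LINT x|lebesgue. (indicator (cbox a b) x * f x) * indicator (box a b) x) = 0"
    using LIMSEQ_unique[OF tendsto_const] by force
  moreover have "(indicator (cbox a b) x * f x) * indicator (box a b) x = indicator (box a b) x * f x" for x
    using box_subset_cbox[of a b] by (auto simp: indicator_def)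
  ultimately show ?thesis by simp
qed

text \<open>Boxes are stable under intersection and generate the Borel sets, so by Dynkin's argument
  \<open>F\<close> has integral zero on every Borel set; \<open>tot\<close> is what the passage to
  complements uses. A Lebesgue set differs from a Borel set by part of a null set.\<close>

lemma AE_zero_if_box_integrals_zero:
  fixes F :: "'a::euclidean_space \<Rightarrow> real"
  assumes int: "integrable lebesgue F"
    and tot: "(LINT x|lebesgue. F x) = 0"
    and box: "\<And>a b. (LINT x|lebesgue. indicator (box a b) x * F x) = 0"
  shows "AE x in lebesgue. F x = 0"
proof (rule sigma_finite_measure.density_zero[OF sigma_finite_lebesgue int])
  have borel0: "set_lebesgue_integral lebesgue A F = 0" if "A \<in> sets borel" for A
  proof -
    let ?G = "range (\<lambda>(a, b). box a b :: 'a set)"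
    have mem: "A \<in> sigma_sets UNIV ?G"
      using that by (simp add: borel_eq_box)
    have G: "Int_stable ?G"
      by (auto simp: Int_stable_def box_Int_box)
    have sub: "?G \<subseteq> Pow UNIV" by simp
    show ?thesis using mem
    proof (induction rule: sigma_sets_induct_disjoint[OF G sub, consumes 1, case_names basic empty compl union])
      case (basic A)
      then show ?case using box by (auto simp: set_lebesgue_integral_def)
    next
      case empty
      then show ?case by (simp add: set_lebesgue_integral_def)
    next
      case 6: (compl A)
      have "A \<in> sets borel" using 6(1) unfolding borel_eq_box by simp
      then have A: "A \<in> sets lebesgue" by simp
      have i: "integrable lebesgue (\<lambda>x. indicator A x *\<^sub>R F x)"
        using int A by (rule integrable_mult_indicator[rotated])
      have "(LINT x|lebesgue. indicator (UNIV - A) x *\<^sub>R F x) = (LINT x|lebesgue. F x - indicator A x *\<^sub>R F x)"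
        by (rule Bochner_Integration.integral_cong) (auto simp: indicator_def)
      also have "\<dots> = 0"
        using int i tot 6(2) by (simp add: set_lebesgue_integral_def)
      finally show ?case by (simp add: set_lebesgue_integral_def)
    next
      case 7: (union A)
      have A: "A i \<in> sets lebesgue" for i
      proof -
        have "A i \<in> sets borel" using 7(2) unfolding borel_eq_box by auto
        then show ?thesis by simp
      qed
      have "set_integrable lebesgue (\<Union>i. A i) F"
        unfolding set_integrable_def using int A by (intro integrable_mult_indicator) auto
      then have "set_lebesgue_integral lebesgue (\<Union>i. A i) F = (\<Sum>i. set_lebesgue_integral lebesgue (A i) F)"
        using 7(1) A by (intro lebesgue_integral_countable_add) (auto simp: disjoint_family_on_def)
      then show ?case using 7(3) by simp
    qed
  qed
  show "set_lebesgue_integral lebesgue A F = 0" if Am: "A \<in> sets lebesgue" for A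
  proof -
    obtain S N N' where *: "A = S \<union> N" "N \<subseteq> N'" "N' \<in> null_sets lborel" "S \<in> sets lborel"
      using sets_completionE[OF Am] by metis
    have S: "S \<in> sets lebesgue" using *(4) by auto
    have "AE x in lborel. x \<notin> N'" using *(3) by (rule AE_not_in)
    then have "AE x in lebesgue. x \<notin> N'" by (rule AE_completion)
    then have "AE x in lebesgue. indicator A x *\<^sub>R F x = indicator S x *\<^sub>R F x"
      by eventually_elim (use * in \<open>auto simp: indicator_def\<close>)
    moreover have "(\<lambda>x. indicator A x *\<^sub>R F x) \<in> borel_measurable lebesgue"
      "(\<lambda>x. indicator S x *\<^sub>R F x) \<in> borel_measurable lebesgue"
      by (intro borel_measurable_scaleR borel_measurable_indicator Am S borel_measurable_integrable[OF int])+
    ultimately have "set_lebesgue_integral lebesgue A F = set_lebesgue_integral lebesgue S F"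
      unfolding set_lebesgue_integral_def by (intro integral_cong_AE)
    then show ?thesis using borel0[of S] *(4) by simp
  qed
qed

text \<open>Since \<open>f\<close> is only locally integrable, the argument is run on closed boxes
  inside \<open>U\<close>, where truncation makes it integrable; countably many such boxes cover
  \<open>U\<close>.\<close>

lemma fundamental_lemma:
  fixes f :: "'a::euclidean_space \<Rightarrow> real"
  assumes "open U" "locally_integrable_on U f"
    and "\<And>\<phi>. \<phi> \<in> test_functions U \<Longrightarrow> (LINT x|lebesgue. f x * \<phi> x) = 0"
  shows "AE x in lebesgue. x \<in> U \<longrightarrow> f x = 0"
proof -
  have cb: "AE x in lebesgue. x \<in> cbox a b \<longrightarrow> f x = 0" if ab: "cbox a b \<subseteq> U" for a b
  proof -
    have i: "integrable lebesgue (\<lambda>x. indicator (cbox a b) x * f x)"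
      using assms(2) ab by (auto simp: locally_integrable_on_def set_integrable_def)
    have "integrable lebesgue (\<lambda>x. indicator (box a b) x *\<^sub>R (indicator (cbox a b) x * f x))"
      using i by (intro integrable_mult_indicator) auto
    moreover have "(\<lambda>x. indicator (box a b) x *\<^sub>R (indicator (cbox a b) x * f x)) = (\<lambda>x. indicator (box a b) x * f x)"
      using box_subset_cbox[of a b] by (auto simp: indicator_def fun_eq_iff)
    ultimately have int: "integrable lebesgue (\<lambda>x. indicator (box a b) x * f x)" by metis
    have "AE x in lebesgue. indicator (box a b) x * f x = 0"
    proof (rule AE_zero_if_box_integrals_zero[OF int])
      show "(LINT x|lebesgue. indicator (box a b) x * f x) = 0"
        by (rule integral_box_eq_0[OF assms(2) ab assms(3)])
      \<comment> \<open>Intersections of boxes are boxes, so box integrals of the truncated function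
        are box integrals of \<open>f\<close> over smaller boxes in \<open>U\<close>.\<close>
      fix c d
      obtain p q where pq: "box a b \<inter> box c d = box p q" "cbox a b \<inter> cbox c d = cbox p q"
        by (simp add: box_Int_box Int_interval)
      have "(LINT x|lebesgue. indicator (box p q) x * f x) = 0"
        by (rule integral_box_eq_0[OF assms(2) _ assms(3)]) (use ab pq in auto)
      moreover have "(\<lambda>x. indicator (box c d) x * (indicator (box a b) x * f x)) = (\<lambda>x. indicator (box p q) x * f x)"
        using pq(1) by (auto simp: indicator_def fun_eq_iff)
      ultimately show "(LINT x|lebesgue. indicator (box c d) x * (indicator (box a b) x * f x)) = 0"
        by metis
    qed
    moreover have "AE x in lebesgue. x \<notin> cbox a b - box a b"
      using negligible_frontier_interval[of a b] by (intro AE_not_in) (simp add: negligible_iff_null_sets)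
    ultimately show ?thesis
      by eventually_elim (auto simp: indicator_def)
  qed
  obtain D where D: "countable D" "D \<subseteq> Pow U" "\<And>X. X \<in> D \<Longrightarrow> \<exists>a b. X = cbox a b" "\<Union>D = U"
    using open_countable_Union_open_cbox[OF assms(1)] by metis
  have "AE x in lebesgue. \<forall>X\<in>D. x \<in> X \<longrightarrow> f x = 0"
    unfolding AE_ball_countable[OF D(1)]
  proof
    fix X assume "X \<in> D"
    then obtain a b where "X = cbox a b" "cbox a b \<subseteq> U" using D by blast
    then show "AE x in lebesgue. x \<in> X \<longrightarrow> f x = 0" using cb by simp
  qed
  then show ?thesis
    by eventually_elim (use D(4) in blast)
qed

lemma locally_integrable_on_subset:
  "locally_integrable_on U f \<Longrightarrow> V \<subseteq> U \<Longrightarrow> locally_integrable_on V f"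
  by (auto simp: locally_integrable_on_def)

lemma locally_integrable_on_diff:
  "locally_integrable_on U f \<Longrightarrow> locally_integrable_on U g \<Longrightarrow> locally_integrable_on U (\<lambda>x. f x - g x)"
  by (auto simp: locally_integrable_on_def)

lemma locally_integrable_on_inner:
  assumes "locally_integrable_on U g"
  shows "locally_integrable_on U (\<lambda>x. g x \<bullet> i)"
  unfolding locally_integrable_on_def set_integrable_def
proof (intro allI impI)
  fix B assume "compact B \<and> B \<subseteq> U"
  then have "integrable lebesgue (\<lambda>x. indicator B x *\<^sub>R g x)"
    using assms by (auto simp: locally_integrable_on_def set_integrable_def)
  then have "integrable lebesgue (\<lambda>x. (indicator B x *\<^sub>R g x) \<bullet> i)"
    by (rule integrable_inner_left)
  then show "integrable lebesgue (\<lambda>x. indicator B x *\<^sub>R (g x \<bullet> i))" by simp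
qed

text \<open>Test functions and their derivatives vanish outside \<open>U\<close>, so integrals over
  \<open>U\<close> may be taken over the whole space. The integral identity then no longer mentions
  \<open>U\<close>, and restricting to a smaller set only means having fewer test functions.\<close>

lemma is_weak_gradient_alt:
  fixes g :: "'a::euclidean_space \<Rightarrow> 'a"
  shows "is_weak_gradient U w g \<longleftrightarrow> locally_integrable_on U w \<and> locally_integrable_on U g \<and>
     (\<forall>\<phi>\<in>test_functions U. \<forall>i\<in>Basis.
        (LINT x|lebesgue. w x * frechet_derivative \<phi> (at x) i) = - (LINT x|lebesgue. (g x \<bullet> i) * \<phi> x))"
proof -
  have "(LINT x:U|lebesgue. w x * frechet_derivative \<phi> (at x) i) = (LINT x|lebesgue. w x * frechet_derivative \<phi> (at x) i)
    \<and> (LINT x:U|lebesgue. (g x \<bullet> i) * \<phi> x) = (LINT x|lebesgue. (g x \<bullet> i) * \<phi> x)"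
    if t: "\<phi> \<in> test_functions U" for \<phi> and i :: 'a
  proof -
    obtain S where S: "\<And>x. x \<notin> S \<Longrightarrow> \<phi> x = 0" "S \<subseteq> U" "\<And>x i. x \<notin> S \<Longrightarrow> frechet_derivative \<phi> (at x) i = 0"
      using test_functionsD[OF t] by metis
    show ?thesis
      by (intro conjI LINT_supp) (use S in auto)
  qed
  then show ?thesis
    unfolding is_weak_gradient_def by auto
qed

lemma weak_gradient_integrable:
  fixes g :: "'a::euclidean_space \<Rightarrow> 'a"
  assumes "is_weak_gradient U w g" "\<phi> \<in> test_functions U" "i \<in> Basis"
  shows "integrable lebesgue (\<lambda>x. w x * frechet_derivative \<phi> (at x) i)"
    "integrable lebesgue (\<lambda>x. (g x \<bullet> i) * \<phi> x)"
proof -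
  obtain S where S: "\<And>k. Ck k \<phi>" "compact S" "\<And>x. x \<notin> S \<Longrightarrow> \<phi> x = 0" "S \<subseteq> U"
    "\<And>x i. x \<notin> S \<Longrightarrow> frechet_derivative \<phi> (at x) i = 0"
    using test_functionsD[OF assms(2)] by metis
  have "continuous_on UNIV (\<lambda>x. frechet_derivative \<phi> (at x) i)"
    using S(1)[of 1] assms(3) by simp
  then show "integrable lebesgue (\<lambda>x. w x * frechet_derivative \<phi> (at x) i)"
    using assms(1) S by (intro set_integrable_mult_test[of U w S]) (auto simp: is_weak_gradient_def)
  show "integrable lebesgue (\<lambda>x. (g x \<bullet> i) * \<phi> x)"
    using assms(1) S by (intro set_integrable_mult_test[of U _ S] locally_integrable_on_inner)
      (auto simp: is_weak_gradient_def intro: Ck_continuous)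
qed

lemma is_weak_gradient_subset:
  assumes "is_weak_gradient U w g" "V \<subseteq> U"
  shows "is_weak_gradient V w g"
  using assms test_functions_mono[OF assms(2)]
  by (auto simp: is_weak_gradient_alt intro: locally_integrable_on_subset)

lemma is_weak_gradient_diff:
  fixes g g' :: "'a::euclidean_space \<Rightarrow> 'a"
  assumes "is_weak_gradient U w g" "is_weak_gradient U w' g'"
  shows "is_weak_gradient U (\<lambda>x. w x - w' x) (\<lambda>x. g x - g' x)"
  using assms weak_gradient_integrable[OF assms(1)] weak_gradient_integrable[OF assms(2)]
  by (auto simp: is_weak_gradient_alt locally_integrable_on_diff left_diff_distrib inner_diff_left)

text \<open>The difference is a weak gradient of the zero function, so each component integrates to
  zero against all test functions.\<close>

lemma weak_gradient_unique:
  fixes g g' :: "'a::euclidean_space \<Rightarrow> 'a"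
  assumes "open U" "is_weak_gradient U w g" "is_weak_gradient U w g'"
  shows "AE x in lebesgue. x \<in> U \<longrightarrow> g x = g' x"
proof -
  have "AE x in lebesgue. x \<in> U \<longrightarrow> (g x - g' x) \<bullet> i = 0" if i: "i \<in> Basis" for i
  proof (rule fundamental_lemma[OF assms(1)])
    have *: "is_weak_gradient U (\<lambda>x. 0) (\<lambda>x. g x - g' x)"
      using is_weak_gradient_diff[OF assms(2,3)] by simp
    then show "locally_integrable_on U (\<lambda>x. (g x - g' x) \<bullet> i)"
      by (auto simp: is_weak_gradient_def intro: locally_integrable_on_inner)
    show "(LINT x|lebesgue. (g x - g' x) \<bullet> i * \<phi> x) = 0" if "\<phi> \<in> test_functions U" for \<phi>
      using * that i by (auto simp: is_weak_gradient_alt)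
  qed
  then have "AE x in lebesgue. \<forall>i\<in>Basis. x \<in> U \<longrightarrow> (g x - g' x) \<bullet> i = 0"
    by (subst AE_ball_countable) (auto intro: countable_finite)
  then show ?thesis
  proof eventually_elim
    case (elim x)
    show ?case
    proof
      assume "x \<in> U"
      then show "g x = g' x"
        using elim by (intro euclidean_eqI[of "g x" "g' x"]) (auto simp: inner_diff_left)
    qed
  qed
qed

text \<open>Makes the choice operator harmless: under integrals over \<open>U\<close> the chosen
  gradient may be replaced by any known one.\<close>

lemma weak_gradient_AE:
  fixes g :: "'a::euclidean_space \<Rightarrow> 'a"
  assumes "open U" "is_weak_gradient U w g"
  shows "AE x in lebesgue. x \<in> U \<longrightarrow> weak_gradient U w x = g x"
proof -
  have "is_weak_gradient U w (weak_gradient U w)"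
    unfolding weak_gradient_def using someI[of "is_weak_gradient U w", OF assms(2)] by simp
  then show ?thesis
    using weak_gradient_unique assms by blast
qed

section \<open>Weak gradients of piecewise smooth functions\<close>

declare Ck.simps [simp del]

lemma Ck1_partial:
  assumes "Ck 1 f" "i \<in> Basis"
  shows "continuous_on UNIV (\<lambda>x. frechet_derivative f (at x) i)"
  using assms by (simp add: Ck.simps)

definition grad :: "('a::euclidean_space \<Rightarrow> real) \<Rightarrow> 'a \<Rightarrow> 'a" where
  "grad f x = (\<Sum>i\<in>Basis. frechet_derivative f (at x) i *\<^sub>R i)"

lemma has_derivative_grad:
  assumes "(f has_derivative f') (at x)"
  shows "f' h = grad f x \<bullet> h"
proof -
  have f': "f' = frechet_derivative f (at x)"
    using assms by (rule frechet_derivative_at)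
  have lin: "linear f'" using assms by (rule has_derivative_linear)
  have "f' h = f' (\<Sum>i\<in>Basis. (h \<bullet> i) *\<^sub>R i)"
    by (simp only: euclidean_representation)
  also have "\<dots> = (\<Sum>i\<in>Basis. (h \<bullet> i) * f' i)"
    by (simp only: linear_sum[OF lin] linear_scale[OF lin] real_scaleR_def)
  also have "\<dots> = grad f x \<bullet> h"
    by (simp add: grad_def f' inner_sum_left inner_sum_right mult.commute inner_commute[of _ h])
  finally show ?thesis .
qed

lemma grad_eqI:
  assumes "(f has_derivative (\<lambda>h. G \<bullet> h)) (at x)"
  shows "grad f x = G"
  by (rule euclidean_eqI) (simp add: has_derivative_grad[OF assms, symmetric])

lemma Ck1_grad:
  assumes "Ck 1 f"
  shows "(f has_derivative (\<lambda>h. grad f x \<bullet> h)) (at x)"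
proof -
  have D: "(f has_derivative frechet_derivative f (at x)) (at x)"
    using assms Ck_has_derivative[of 0 f x] by simp
  have "frechet_derivative f (at x) = (\<lambda>h. grad f x \<bullet> h)"
    using has_derivative_grad[OF D] by blast
  with D show ?thesis by simp
qed

lemma continuous_grad:
  assumes "Ck 1 f"
  shows "continuous_on UNIV (grad f)"
  unfolding grad_def[abs_def] using assms by (intro continuous_intros Ck1_partial)

lemma Ck1_compact_support_grad_bounded:
  assumes "Ck 1 f" "compact S" "\<And>x. x \<notin> S \<Longrightarrow> grad f x = 0"
  obtains B where "B \<ge> 0" "\<And>x. norm (grad f x) \<le> B"
proof -
  have "bounded (grad f ` S)"
    by (intro compact_imp_bounded compact_continuous_image continuous_on_subset[OF continuous_grad[OF assms(1)]] assms(2) subset_UNIV)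
  then obtain B where B: "\<And>x. x \<in> S \<Longrightarrow> norm (grad f x) \<le> B"
    by (auto simp: bounded_iff)
  have "norm (grad f x) \<le> max B 0" for x
    using B[of x] assms(3)[of x] by (cases "x \<in> S") auto
  then show ?thesis using that[of "max B 0"] by simp
qed

lemma Ck1_lipschitz:
  assumes "Ck 1 f" "\<And>x. norm (grad f x) \<le> B"
  shows "\<bar>f x - f y\<bar> \<le> B * norm (x - y)"
proof -
  have "norm (f x - f y) \<le> B * norm (x - y)"
  proof (rule differentiable_bound[of UNIV])
    show "onorm (\<lambda>h. grad f z \<bullet> h) \<le> B" for z
    proof (rule onorm_le)
      show "norm (grad f z \<bullet> h) \<le> B * norm h" for h
        using Cauchy_Schwarz_ineq2[of "grad f z" h] mult_right_mono[OF assms(2)[of z] norm_ge_zero[of h]]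
        by simp
    qed
  qed (use Ck1_grad[OF assms(1)] in auto)
  then show ?thesis by simp
qed

lemma integral_translation:
  fixes w :: "'a::euclidean_space \<Rightarrow> real"
  assumes "continuous_on UNIV w"
  shows "(LINT x|lebesgue. w (x + c)) = (LINT x|lebesgue. w x)"
proof -
  have m: "w \<in> borel_measurable lborel" "(\<lambda>x. w (x + c)) \<in> borel_measurable lborel"
    using assms by (auto intro!: borel_measurable_continuous_onI continuous_on_compose2[OF assms] continuous_intros)
  have "(LINT x|lborel. w x) = (LINT x|distr lborel borel ((+) c). w x)"
    by (simp add: lborel_distr_plus)
  also have "\<dots> = (LINT x|lborel. w (c + x))"
    using m by (subst integral_distr) auto
  finally show ?thesis
    using m by (simp add: integral_completion add.commute)
qed

text \<open>The difference quotients of a compactly supported Lipschitz function have integral zero by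
  translation invariance; this replaces the divergence theorem.\<close>

lemma integral_derivative_lipschitz_eq_0:
  fixes w D :: "'a::euclidean_space \<Rightarrow> real"
  assumes lip: "\<And>x y. \<bar>w x - w y\<bar> \<le> L * norm (x - y)"
    and supp: "\<And>x. norm x > R \<Longrightarrow> w x = 0"
    and D: "AE x in lebesgue. ((\<lambda>t. w (x + t *\<^sub>R v)) has_real_derivative D x) (at 0)"
    and Dm: "D \<in> borel_measurable lebesgue"
  shows "(LINT x|lebesgue. D x) = 0"
proof -
  define h where "h n = inverse (real (Suc n))" for n
  have h: "h n > 0" "h n \<le> 1" for n by (auto simp: h_def field_simps)
  have hlim: "h \<longlonglongrightarrow> 0" unfolding h_def by (rule LIMSEQ_inverse_real_of_nat)
  have "continuous_on UNIV w"
  proof (rule continuous_on_iff[THEN iffD2], intro ballI allI impI)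
    fix x and e :: real assume "e > 0"
    have L0: "0 \<le> \<bar>L\<bar> + 1" by simp
    show "\<exists>d>0. \<forall>x'\<in>UNIV. dist x' x < d \<longrightarrow> dist (w x') (w x) < e"
    proof (intro exI[of _ "e / (\<bar>L\<bar> + 1)"] conjI ballI impI)
      show "0 < e / (\<bar>L\<bar> + 1)" using \<open>e > 0\<close> by simp
      fix x' assume "dist x' x < e / (\<bar>L\<bar> + 1)"
      then have "(\<bar>L\<bar> + 1) * norm (x' - x) < e"
        by (simp add: dist_norm field_simps)
      moreover have "L * norm (x' - x) \<le> (\<bar>L\<bar> + 1) * norm (x' - x)"
        by (intro mult_right_mono) auto
      ultimately show "dist (w x') (w x) < e"
        using lip[of x' x] by (simp add: dist_norm)
    qed
  qed
  note cont = this
  have cont': "continuous_on UNIV (\<lambda>x. w (x + c))" for c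
    by (rule continuous_on_compose2[OF cont]) (auto intro!: continuous_intros)
  have wint: "integrable lebesgue (\<lambda>x. w (x + c))" for c
  proof -
    have "integrable lebesgue (\<lambda>x. indicator (cball 0 (R + norm c)) x *\<^sub>R w (x + c))"
      using borel_integrable_compact[OF compact_cball, of 0 "R + norm c" "\<lambda>x. w (x + c)"] continuous_on_subset[OF cont' subset_UNIV]
      by (simp add: integrable_completion borel_measurable_integrable indicator_def if_distrib cong: if_cong)
    moreover have "indicator (cball 0 (R + norm c)) x *\<^sub>R w (x + c) = w (x + c)" for x
    proof (cases "norm (x + c) > R")
      case False
      then have "norm x \<le> R + norm c" using norm_diff_ineq[of x c] by linarith
      then show ?thesis by simp
    qed (simp add: supp)
    ultimately show ?thesis by (simp only:)
  qed
  \<comment> \<open>The quotients vanish outside one fixed ball since the steps \<open>h n\<close>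
    are at most 1, and there the Lipschitz bound is an integrable majorant.\<close>
  have "(\<lambda>n. LINT x|lebesgue. (w (x + h n *\<^sub>R v) - w x) / h n) \<longlonglongrightarrow> (LINT x|lebesgue. D x)"
  proof (rule integral_dominated_convergence[where w = "\<lambda>x. \<bar>L\<bar> * norm v * indicator (cball 0 (R + norm v)) x"])
    show "D \<in> borel_measurable lebesgue" by (rule Dm)
    show "(\<lambda>x. (w (x + h n *\<^sub>R v) - w x) / h n) \<in> borel_measurable lebesgue" for n
      using wint[of "h n *\<^sub>R v"] wint[of 0] by (intro borel_measurable_integrable) simp
    show "integrable lebesgue (\<lambda>x. \<bar>L\<bar> * norm v * indicator (cball 0 (R + norm v)) x)"
      by (intro integrable_mult_right integrable_real_indicator)
         (use emeasure_bounded_finite[OF bounded_cball, of 0 "R + norm v"] in auto)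
    show "AE x in lebesgue. (\<lambda>n. (w (x + h n *\<^sub>R v) - w x) / h n) \<longlonglongrightarrow> D x"
      using D
    proof eventually_elim
      case (elim x)
      then have "((\<lambda>t. (w (x + t *\<^sub>R v) - w x) / t) \<longlongrightarrow> D x) (at 0)"
        by (simp add: has_field_derivative_iff)
      moreover have "filterlim h (at 0) sequentially"
        by (rule filterlim_atI[OF hlim]) (use h in \<open>auto intro!: always_eventually simp: less_imp_neq[symmetric]\<close>)
      ultimately show ?case
        by (rule filterlim_compose)
    qed
    show "AE x in lebesgue. norm ((w (x + h n *\<^sub>R v) - w x) / h n) \<le> \<bar>L\<bar> * norm v * indicator (cball 0 (R + norm v)) x" for n
    proof (rule AE_I2)
      fix x
      show "norm ((w (x + h n *\<^sub>R v) - w x) / h n) \<le> \<bar>L\<bar> * norm v * indicator (cball 0 (R + norm v)) x"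
      proof (cases "norm x \<le> R + norm v")
        case True
        have "\<bar>w (x + h n *\<^sub>R v) - w x\<bar> \<le> L * norm (h n *\<^sub>R v)"
          using lip[of "x + h n *\<^sub>R v" x] by simp
        also have "\<dots> = L * (norm v * h n)"
          using h[of n] by (simp add: mult.commute)
        also have "\<dots> \<le> \<bar>L\<bar> * (norm v * h n)"
          using h[of n] by (intro mult_right_mono) auto
        finally show ?thesis
          using True h[of n] by (simp add: field_simps)
      next
        case False
        have n: "norm (h n *\<^sub>R v) \<le> norm v"
          using h[of n] by (simp add: mult_left_le_one_le)
        have "norm (x + h n *\<^sub>R v) \<ge> norm x - norm (h n *\<^sub>R v)"
          by (rule norm_diff_ineq)
        with n False have "norm (x + h n *\<^sub>R v) > R" by linarith
        moreover have "norm x > R" using False norm_ge_zero[of v] by linarith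
        ultimately show ?thesis using supp by simp
      qed
    qed
  qed
  moreover have "(LINT x|lebesgue. (w (x + h n *\<^sub>R v) - w x) / h n) = 0" for n
    using wint[of "h n *\<^sub>R v"] wint[of 0] integral_translation[OF cont, of "h n *\<^sub>R v"] by simp
  ultimately have "(\<lambda>n::nat. 0) \<longlonglongrightarrow> (LINT x|lebesgue. D x)"
    by (simp only:)
  then show ?thesis
    by (rule LIMSEQ_unique) (rule tendsto_const)
qed

text \<open>Along the segment from \<open>x\<close> to \<open>y\<close> the closed pieces cut out
  finitely many closed subsets of the parameter line that cover [0, 1], and on an interval Lipschitz
  bounds on such pieces with one constant combine to a bound on the whole. The pieces need not be
  convex.\<close>

lemma lipschitz_closed_cover:
  fixes w :: "'a::euclidean_space \<Rightarrow> real"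
  assumes "finite I" "\<And>j. j \<in> I \<Longrightarrow> closed (C j)" "(\<Union>j\<in>I. C j) = UNIV" "0 \<le> L"
    and "\<And>j x y. j \<in> I \<Longrightarrow> x \<in> C j \<Longrightarrow> y \<in> C j \<Longrightarrow> \<bar>w x - w y\<bar> \<le> L * norm (x - y)"
  shows "\<bar>w x - w y\<bar> \<le> L * norm (x - y)"
proof -
  let ?p = "\<lambda>t. x + t *\<^sub>R (y - x)"
  have "(L * norm (y - x))-lipschitz_on {0..1} (\<lambda>t. w (?p t))"
  proof (rule lipschitz_on_closed_Union[where I = I and U = "\<lambda>j. ?p -` C j"])
    show "(L * norm (y - x))-lipschitz_on (?p -` C j) (\<lambda>t. w (?p t))" if "j \<in> I" for j
    proof (rule lipschitz_onI)
      fix s t assume "s \<in> ?p -` C j" "t \<in> ?p -` C j"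
      then have "\<bar>w (?p s) - w (?p t)\<bar> \<le> L * norm (?p s - ?p t)"
        using assms(5)[OF that, of "?p s" "?p t"] by (simp only: vimage_eq)
      also have "?p s - ?p t = (s - t) *\<^sub>R (y - x)"
        by (simp add: algebra_simps)
      finally show "dist (w (?p s)) (w (?p t)) \<le> L * norm (y - x) * dist s t"
        by (simp add: dist_norm mult_ac)
    qed (use assms(4) in auto)
    show "closed (?p -` C j)" if "j \<in> I" for j
      using assms(2)[OF that] by (intro closed_vimage continuous_intros) auto
    show "{0..1} \<subseteq> (\<Union>j\<in>I. ?p -` C j)"
    proof
      fix t :: real
      have "?p t \<in> (\<Union>j\<in>I. C j)" using assms(3) by (simp only: UNIV_I)
      then show "t \<in> (\<Union>j\<in>I. ?p -` C j)" by auto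
    qed
  qed (use assms in auto)
  from lipschitz_onD[OF this, of 0 1] show ?thesis
    by (simp add: dist_norm norm_minus_commute abs_minus_commute)
qed

text \<open>Where interiors of pieces overlap, the pieces coincide near the point, so the choice
  does not matter in the setting below; the points of the domain outside all interiors form a null
  set there.\<close>

definition pw_grad :: "'i set \<Rightarrow> ('i \<Rightarrow> 'a::euclidean_space set) \<Rightarrow> ('i \<Rightarrow> 'a \<Rightarrow> real) \<Rightarrow> 'a \<Rightarrow> 'a" where
  "pw_grad I C p x = (if \<exists>j\<in>I. x \<in> interior (C j)
     then grad (p (SOME j. j \<in> I \<and> x \<in> interior (C j))) x else 0)"

lemma measurable_indicator_UN:
  fixes f :: "'a \<Rightarrow> 'b::euclidean_space"
  assumes "finite I" "\<And>j. j \<in> I \<Longrightarrow> A j \<in> sets M"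
    and "\<And>j. j \<in> I \<Longrightarrow> (\<lambda>x. indicator (A j) x *\<^sub>R f x) \<in> borel_measurable M"
  shows "(\<lambda>x. indicator (\<Union>j\<in>I. A j) x *\<^sub>R f x) \<in> borel_measurable M"
  using assms
proof (induction I rule: finite_induct)
  case (insert j I)
  have "indicat_real (- A j) = (\<lambda>x. 1 - indicator (A j) x)" by (auto simp: indicator_def fun_eq_iff)
  moreover have "indicat_real (A j) \<in> borel_measurable M"
    using insert.prems(1)[of j] by (intro borel_measurable_indicator) simp
  ultimately have m: "indicat_real (- A j) \<in> borel_measurable M" by simp
  have "(\<lambda>x. indicator (A j) x *\<^sub>R f x + indicator (- A j) x *\<^sub>R (indicator (\<Union>j\<in>I. A j) x *\<^sub>R f x)) \<in> borel_measurable M"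
  proof (rule borel_measurable_add)
    show "(\<lambda>x. indicator (A j) x *\<^sub>R f x) \<in> borel_measurable M"
      using insert.prems by simp
    show "(\<lambda>x. indicator (- A j) x *\<^sub>R (indicator (\<Union>j\<in>I. A j) x *\<^sub>R f x)) \<in> borel_measurable M"
      by (rule borel_measurable_scaleR[OF m]) (use insert in simp)
  qed
  also have "(\<lambda>x. indicator (A j) x *\<^sub>R f x + indicator (- A j) x *\<^sub>R (indicator (\<Union>j\<in>I. A j) x *\<^sub>R f x))
     = (\<lambda>x. indicator (\<Union>j\<in>insert j I. A j) x *\<^sub>R f x)"
    by (auto simp: indicator_def fun_eq_iff)
  finally show ?case .
qed simp

lemma set_integrable_bounded_measurable:
  fixes f :: "'a::euclidean_space \<Rightarrow> 'b::euclidean_space"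
  assumes "compact K" "K \<subseteq> U" "(\<lambda>x. indicator U x *\<^sub>R f x) \<in> borel_measurable lebesgue"
    and "\<And>x. x \<in> K \<Longrightarrow> norm (f x) \<le> B"
  shows "set_integrable lebesgue K f"
  unfolding set_integrable_def
proof (rule Bochner_Integration.integrable_bound[of _ "\<lambda>x. B * indicator K x"])
  have Ks: "K \<in> sets lebesgue" using assms(1) by (simp add: borel_compact)
  show "integrable lebesgue (\<lambda>x. B * indicator K x)"
    by (intro integrable_mult_right integrable_real_indicator Ks)
       (use emeasure_bounded_finite[OF compact_imp_bounded[OF assms(1)]] assms(1) in \<open>auto simp: borel_compact\<close>)
  have "(\<lambda>x. indicator K x *\<^sub>R (indicator U x *\<^sub>R f x)) \<in> borel_measurable lebesgue"
    by (intro borel_measurable_scaleR borel_measurable_indicator Ks assms(3))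
  also have "(\<lambda>x. indicator K x *\<^sub>R (indicator U x *\<^sub>R f x)) = (\<lambda>x. indicator K x *\<^sub>R f x)"
    using assms(2) by (auto simp: indicator_def fun_eq_iff)
  finally show "(\<lambda>x. indicator K x *\<^sub>R f x) \<in> borel_measurable lebesgue" .
  show "AE x in lebesgue. norm (indicator K x *\<^sub>R f x) \<le> norm (B * indicator K x)"
    using assms(4) by (intro AE_I2) (force simp: indicator_def)
qed

text \<open>One setting for three uses: a single C1 function, a polynomial broken along a
  hyperplane, and a finite element function on the mesh. That every \<open>p j\<close> agrees with
  \<open>v\<close> on a closed piece is what encodes continuity across the interfaces.\<close>

locale piecewise_C1 =
  fixes U :: "'a::euclidean_space set" and I :: "'i set" and C and p :: "'i \<Rightarrow> 'a \<Rightarrow> real" and v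
  assumes opU: "open U" and fin: "finite I" and clC: "\<And>j. j \<in> I \<Longrightarrow> closed (C j)"
    and C1: "\<And>j. j \<in> I \<Longrightarrow> Ck 1 (p j)" and cover: "U \<subseteq> (\<Union>j\<in>I. C j)"
    and v: "\<And>j x. j \<in> I \<Longrightarrow> x \<in> C j \<Longrightarrow> x \<in> U \<Longrightarrow> v x = p j x"
    and negl: "\<And>j. j \<in> I \<Longrightarrow> negligible (frontier (C j))"
begin

abbreviation "G \<equiv> pw_grad I C p"

lemma AE_interior: "AE x in lebesgue. x \<in> U \<longrightarrow> (\<exists>j\<in>I. x \<in> interior (C j))"
proof -
  have "negligible (\<Union>j\<in>I. frontier (C j))"
    using fin negl by (intro negligible_Union) auto
  then have "AE x in lebesgue. x \<notin> (\<Union>j\<in>I. frontier (C j))"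
    by (intro AE_not_in) (simp add: negligible_iff_null_sets)
  then show ?thesis
  proof eventually_elim
    case (elim x)
    show ?case
    proof
      assume "x \<in> U"
      then obtain j where j: "j \<in> I" "x \<in> C j" using cover by blast
      then have "x \<in> interior (C j)"
        using elim clC[OF j(1)] by (auto simp: frontier_def)
      then show "\<exists>j\<in>I. x \<in> interior (C j)" using j by blast
    qed
  qed
qed

lemma pw_grad_eq:
  assumes "j \<in> I" "x \<in> interior (C j)" "x \<in> U"
  shows "G x = grad (p j) x"
proof -
  define k where "k = (SOME j. j \<in> I \<and> x \<in> interior (C j))"
  have k: "k \<in> I" "x \<in> interior (C k)"
    using someI[of "\<lambda>j. j \<in> I \<and> x \<in> interior (C j)" j] assms by (auto simp: k_def)
  have op: "open (interior (C j) \<inter> interior (C k) \<inter> U)" using opU by auto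
  have "(p j has_derivative (\<lambda>h. grad (p k) x \<bullet> h)) (at x)"
  proof (rule has_derivative_transform_within_open[OF Ck1_grad[OF C1[OF k(1)]] op])
    fix y assume "y \<in> interior (C j) \<inter> interior (C k) \<inter> U"
    then have "y \<in> C j" "y \<in> C k" "y \<in> U"
      using interior_subset[of "C j"] interior_subset[of "C k"] by auto
    then show "p k y = p j y"
      using v[OF assms(1), of y] v[OF k(1), of y] by simp
  qed (use assms k in auto)
  from grad_eqI[OF this] show ?thesis
    using assms by (auto simp: pw_grad_def k_def)
qed

lemma v_measurable: "(\<lambda>x. indicator U x *\<^sub>R v x) \<in> borel_measurable lebesgue"
proof -
  have "(\<lambda>x. indicator (\<Union>j\<in>I. U \<inter> C j) x *\<^sub>R v x) \<in> borel_measurable lebesgue"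
  proof (rule measurable_indicator_UN[OF fin])
    fix j assume j: "j \<in> I"
    show s: "U \<inter> C j \<in> sets lebesgue" using opU clC[OF j] by auto
    have "(\<lambda>x. indicator (U \<inter> C j) x *\<^sub>R p j x) \<in> borel_measurable lebesgue"
      by (intro borel_measurable_scaleR borel_measurable_indicator s lebesgue_measurable_continuous
          Ck_continuous[OF C1[OF j]])
    also have "(\<lambda>x. indicator (U \<inter> C j) x *\<^sub>R p j x) = (\<lambda>x. indicator (U \<inter> C j) x *\<^sub>R v x)"
      using v[OF j] by (auto simp: indicator_def fun_eq_iff)
    finally show "(\<lambda>x. indicator (U \<inter> C j) x *\<^sub>R v x) \<in> borel_measurable lebesgue" .
  qed
  moreover have "(\<Union>j\<in>I. U \<inter> C j) = U" using cover by blast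
  ultimately show ?thesis by simp
qed

lemma G_measurable: "(\<lambda>x. indicator U x *\<^sub>R G x) \<in> borel_measurable lebesgue"
proof -
  have "(\<lambda>x. indicator (\<Union>j\<in>I. U \<inter> interior (C j)) x *\<^sub>R G x) \<in> borel_measurable lebesgue"
  proof (rule measurable_indicator_UN[OF fin])
    fix j assume j: "j \<in> I"
    show s: "U \<inter> interior (C j) \<in> sets lebesgue" using opU by auto
    have "(\<lambda>x. indicator (U \<inter> interior (C j)) x *\<^sub>R grad (p j) x) \<in> borel_measurable lebesgue"
      by (intro borel_measurable_scaleR borel_measurable_indicator s lebesgue_measurable_continuous
          continuous_grad[OF C1[OF j]])
    also have "(\<lambda>x. indicator (U \<inter> interior (C j)) x *\<^sub>R grad (p j) x) = (\<lambda>x. indicator (U \<inter> interior (C j)) x *\<^sub>R G x)"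
      using pw_grad_eq[OF j] by (auto simp: indicator_def fun_eq_iff)
    finally show "(\<lambda>x. indicator (U \<inter> interior (C j)) x *\<^sub>R G x) \<in> borel_measurable lebesgue" .
  qed
  also have "(\<lambda>x. indicator (\<Union>j\<in>I. U \<inter> interior (C j)) x *\<^sub>R G x) = (\<lambda>x. indicator U x *\<^sub>R G x)"
    by (auto simp: indicator_def fun_eq_iff pw_grad_def)
  finally show ?thesis .
qed

lemma compact_bounds:
  assumes "compact K" "K \<subseteq> U"
  obtains B where "\<And>x. x \<in> K \<Longrightarrow> \<bar>v x\<bar> \<le> B" "\<And>x. x \<in> K \<Longrightarrow> norm (G x) \<le> B"
proof -
  have "bounded (p j ` K)" "bounded (grad (p j) ` K)" if "j \<in> I" for j
    by (intro compact_imp_bounded compact_continuous_image assms(1)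
        continuous_on_subset[OF Ck_continuous[OF C1[OF that]]]
        continuous_on_subset[OF continuous_grad[OF C1[OF that]]] subset_UNIV)+
  then have "bounded (\<Union>j\<in>I. p j ` K)" "bounded (\<Union>j\<in>I. grad (p j) ` K)"
    by (auto intro!: bounded_UN fin)
  then obtain B1 B2 where B': "\<forall>y\<in>(\<Union>j\<in>I. p j ` K). norm y \<le> B1"
    "\<forall>y\<in>(\<Union>j\<in>I. grad (p j) ` K). norm y \<le> B2"
    unfolding bounded_iff by metis
  have B: "\<bar>p j x\<bar> \<le> B1" "norm (grad (p j) x) \<le> B2" if "j \<in> I" "x \<in> K" for j x
    using B'(1)[rule_format, of "p j x"] B'(2)[rule_format, of "grad (p j) x"] that by auto
  show ?thesis
  proof (rule that[of "max (max B1 B2) 0"])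
    fix x assume x: "x \<in> K"
    then obtain j where j: "j \<in> I" "x \<in> C j" using assms(2) cover by blast
    then show "\<bar>v x\<bar> \<le> max (max B1 B2) 0"
      using B(1)[OF j(1) x] v[OF j(1), of x] x assms(2) by auto
    show "norm (G x) \<le> max (max B1 B2) 0"
    proof (cases "\<exists>j\<in>I. x \<in> interior (C j)")
      case True
      then obtain j where "j \<in> I" "x \<in> interior (C j)" by blast
      then show ?thesis using pw_grad_eq[of j x] B(2)[of j x] x assms(2) by auto
    next
      case False
      then have "G x = 0" by (simp add: pw_grad_def)
      then show ?thesis by simp
    qed
  qed
qed

lemma loc_int: "locally_integrable_on U v" "locally_integrable_on U G"
proof -
  have "set_integrable lebesgue K v \<and> set_integrable lebesgue K G" if K: "compact K" "K \<subseteq> U" for K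
  proof -
    obtain B where "\<And>x. x \<in> K \<Longrightarrow> \<bar>v x\<bar> \<le> B" "\<And>x. x \<in> K \<Longrightarrow> norm (G x) \<le> B"
      using compact_bounds[OF K] by metis
    then show ?thesis
      using set_integrable_bounded_measurable[OF K v_measurable, of B]
        set_integrable_bounded_measurable[OF K G_measurable, of B] by simp
  qed
  then show "locally_integrable_on U v" "locally_integrable_on U G"
    unfolding locally_integrable_on_def by auto
qed

text \<open>The product of \<open>v\<close> with a test function is Lipschitz with compact support,
  and almost everywhere its derivative is given by the product rule on one piece. The integral of
  this derivative vanishes, which is integration by parts without any boundary terms on the
  interfaces.\<close>

lemma is_weak_gradient: "is_weak_gradient U v G"
  unfolding is_weak_gradient_alt
proof (intro conjI loc_int ballI)
  fix \<phi> and i :: 'a assume "\<phi> \<in> test_functions U" and i: "i \<in> Basis"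
  then obtain S where S: "\<And>k. Ck k \<phi>" "compact S" "\<And>x. x \<notin> S \<Longrightarrow> \<phi> x = 0" "S \<subseteq> U"
    "\<And>x i. x \<notin> S \<Longrightarrow> frechet_derivative \<phi> (at x) i = 0"
    using test_functionsD[of \<phi> U] by metis
  define w where "w x = v x * \<phi> x" for x
  define D where "D x = v x * frechet_derivative \<phi> (at x) i + (G x \<bullet> i) * \<phi> x" for x
  have w_C: "w x = p j x * \<phi> x" if "j \<in> I" "x \<in> C j" for j x
    using v[OF that] S(3,4) by (cases "x \<in> U") (auto simp: w_def)
  have int1: "integrable lebesgue (\<lambda>x. v x * frechet_derivative \<phi> (at x) i)"
    using S(5) by (intro set_integrable_mult_test[OF loc_int(1) S(2,4)] Ck1_partial[OF S(1) i]) auto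
  have int2: "integrable lebesgue (\<lambda>x. (G x \<bullet> i) * \<phi> x)"
    using S by (intro set_integrable_mult_test[OF locally_integrable_on_inner[OF loc_int(2)] S(2,4)] Ck_continuous[OF S(1)]) auto
  have "\<exists>L\<ge>0. \<forall>x y. \<bar>p j x * \<phi> x - p j y * \<phi> y\<bar> \<le> L * norm (x - y)" if "j \<in> I" for j
  proof -
    have c: "Ck 1 (\<lambda>x. p j x * \<phi> x)" by (intro Ck_mult C1[OF that] S(1))
    have "grad (\<lambda>x. p j x * \<phi> x) x = 0" if "x \<notin> S" for x
    proof (rule grad_eqI)
      have "((\<lambda>x. 0) has_derivative (\<lambda>h. 0)) (at x)" by simp
      moreover have "open (- S)" using S(2) by (intro open_Compl compact_imp_closed)
      moreover have "x \<in> - S" using that by blast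
      moreover have "0 = p j y * \<phi> y" if "y \<in> - S" for y using S(3)[of y] that by simp
      ultimately have "((\<lambda>x. p j x * \<phi> x) has_derivative (\<lambda>h. 0)) (at x)"
        by (rule has_derivative_transform_within_open)
      then show "((\<lambda>x. p j x * \<phi> x) has_derivative (\<lambda>h. 0 \<bullet> h)) (at x)" by simp
    qed
    from Ck1_compact_support_grad_bounded[OF c S(2) this] obtain L where
      "L \<ge> 0" "\<And>x. norm (grad (\<lambda>x. p j x * \<phi> x) x) \<le> L" by metis
    then show ?thesis using Ck1_lipschitz[OF c] by metis
  qed
  then obtain L where L: "\<And>j. j \<in> I \<Longrightarrow> L j \<ge> 0"
    "\<And>j x y. j \<in> I \<Longrightarrow> \<bar>p j x * \<phi> x - p j y * \<phi> y\<bar> \<le> L j * norm (x - y)"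
    by metis
  define M where "M = (\<Sum>j\<in>I. L j)"
  have M: "M \<ge> 0" "\<And>j. j \<in> I \<Longrightarrow> L j \<le> M"
    using L(1) fin by (auto simp: M_def intro!: sum_nonneg member_le_sum)
  have lip: "\<bar>w x - w y\<bar> \<le> M * norm (x - y)" for x y
  \<comment> \<open>The complement of \<open>U\<close> joins as one more closed piece, on which the
    product is zero, so that the pieces cover the whole space.\<close>
  proof (rule lipschitz_closed_cover[where I = "insert None (Some ` I)"
        and C = "\<lambda>k. case k of None \<Rightarrow> - U | Some j \<Rightarrow> C j"])
    show "(\<Union>j\<in>insert None (Some ` I). case j of None \<Rightarrow> - U | Some x \<Rightarrow> C x) = UNIV"
      using cover by auto
    show "\<bar>w x - w y\<bar> \<le> M * norm (x - y)"
      if "k \<in> insert None (Some ` I)" "x \<in> (case k of None \<Rightarrow> - U | Some j \<Rightarrow> C j)"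
        "y \<in> (case k of None \<Rightarrow> - U | Some j \<Rightarrow> C j)" for k x y
    proof (cases k)
      case None
      then have "\<phi> x = 0" "\<phi> y = 0" using that S(3,4) by auto
      then show ?thesis using M(1) by (simp add: w_def)
    next
      case (Some j)
      then have j: "j \<in> I" "x \<in> C j" "y \<in> C j" using that by auto
      have "\<bar>w x - w y\<bar> \<le> L j * norm (x - y)"
        using L(2)[OF j(1), of x y] w_C[OF j(1)] j by simp
      also have "\<dots> \<le> M * norm (x - y)"
        using M(2)[OF j(1)] by (intro mult_right_mono) auto
      finally show ?thesis .
    qed
  qed (use fin clC opU M in auto)
  obtain R where R: "\<And>x. x \<in> S \<Longrightarrow> norm x \<le> R"
    using compact_imp_bounded[OF S(2)] by (auto simp: bounded_iff)
  have "(LINT x|lebesgue. D x) = 0"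
  proof (rule integral_derivative_lipschitz_eq_0[OF lip, where R = R and v = i])
    show "w x = 0" if "norm x > R" for x
      using that R[of x] S(3)[of x] by (auto simp: w_def)
    show "D \<in> borel_measurable lebesgue"
      unfolding D_def[abs_def] by (intro borel_measurable_add borel_measurable_integrable int1 int2)
    show "AE x in lebesgue. ((\<lambda>t. w (x + t *\<^sub>R i)) has_real_derivative D x) (at 0)"
      using AE_interior
    proof eventually_elim
      case (elim x)
      have "(w has_derivative (\<lambda>h. v x * frechet_derivative \<phi> (at x) h + (G x \<bullet> h) * \<phi> x)) (at x)"
      proof (cases "x \<in> U")
        case True
        then obtain j where j: "j \<in> I" "x \<in> interior (C j)" using elim by blast
        have xC: "x \<in> C j" using j(2) interior_subset by blast
        have "((\<lambda>x. p j x * \<phi> x) has_derivative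
            (\<lambda>h. p j x * frechet_derivative \<phi> (at x) h + (grad (p j) x \<bullet> h) * \<phi> x)) (at x)"
          by (rule has_derivative_mult[OF Ck1_grad[OF C1[OF j(1)]] Ck_has_derivative[OF S(1)]])
        then have "((\<lambda>x. p j x * \<phi> x) has_derivative
            (\<lambda>h. v x * frechet_derivative \<phi> (at x) h + (G x \<bullet> h) * \<phi> x)) (at x)"
          by (simp add: pw_grad_eq[OF j True] v[OF j(1) xC True])
        then show ?thesis
        proof (rule has_derivative_transform_within_open[OF _ open_interior j(2)])
          fix y assume "y \<in> interior (C j)"
          then show "p j y * \<phi> y = w y" using w_C[OF j(1), of y] interior_subset[of "C j"] by auto
        qed
      next
        case False
        then have x: "x \<notin> S" using S(4) by blast
        have "((\<lambda>x. 0) has_derivative (\<lambda>h. 0)) (at x)" by simp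
        moreover have "open (- S)" using S(2) by (intro open_Compl compact_imp_closed)
        moreover have "x \<in> - S" using x by blast
        moreover have "0 = w y" if "y \<in> - S" for y using S(3)[of y] that by (simp add: w_def)
        ultimately have "(w has_derivative (\<lambda>h. 0)) (at x)"
          by (rule has_derivative_transform_within_open)
        then show ?thesis using S(3,5)[OF x] by simp
      qed
      moreover have "((\<lambda>t. x + t *\<^sub>R i) has_derivative (\<lambda>t. t *\<^sub>R i)) (at 0)"
        by (auto intro!: derivative_eq_intros)
      ultimately have "((\<lambda>t. w (x + t *\<^sub>R i)) has_derivative
          (\<lambda>t. v x * frechet_derivative \<phi> (at x) (t *\<^sub>R i) + (G x \<bullet> (t *\<^sub>R i)) * \<phi> x)) (at 0)"
        by (intro has_derivative_compose[where f = "\<lambda>t. x + t *\<^sub>R i" and g = w]) simp_all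
      moreover have "frechet_derivative \<phi> (at x) (t *\<^sub>R i) = t * frechet_derivative \<phi> (at x) i" for t
        using linear_scale[OF has_derivative_linear[OF Ck_has_derivative[OF S(1)]]] by simp
      moreover have "(*) (D x) = (\<lambda>t. v x * (t * frechet_derivative \<phi> (at x) i) + (G x \<bullet> (t *\<^sub>R i)) * \<phi> x)"
        by (simp add: D_def algebra_simps fun_eq_iff)
      ultimately show ?case
        unfolding has_field_derivative_def by (simp only:)
    qed
  qed
  then show "(LINT x|lebesgue. v x * frechet_derivative \<phi> (at x) i) = - (LINT x|lebesgue. (G x \<bullet> i) * \<phi> x)"
    unfolding D_def using int1 int2 by simp
qed

end

section \<open>Averages against a moving bump\<close>

text \<open>A bump on the cube with half-side 1/d, which lies in the unit ball because the Euclidean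
  norm is at most the l1 norm; it is positive on a nonempty open set, so its integral can be
  normalized.\<close>

lemma kernel_exists:
  "\<exists>b::'a::euclidean_space \<Rightarrow> real. (\<forall>k. Ck k b) \<and> (\<forall>x. 0 \<le> b x) \<and> (\<forall>x. norm x > 1 \<longrightarrow> b x = 0)
     \<and> (LINT x|lebesgue. b x) = 1"
proof -
  let ?c = "(1 / real DIM('a)) *\<^sub>R (One::'a)"
  define b where "b = box_bump 1 (- ?c) ?c"
  have z: "b x = 0" if "norm x > 1" for x
  proof -
    have "\<exists>i\<in>Basis. 1 / real DIM('a) \<le> \<bar>x \<bullet> i\<bar>"
    proof (rule ccontr)
      assume "\<not> ?thesis"
      then have "(\<Sum>i\<in>Basis. \<bar>x \<bullet> i\<bar>) \<le> (\<Sum>i\<in>(Basis::'a set). 1 / real DIM('a))"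
        by (intro sum_mono) auto
      then show False using norm_le_l1[of x] that by simp
    qed
    then obtain i where i: "i \<in> Basis" "1 / real DIM('a) \<le> \<bar>x \<bullet> i\<bar>" by blast
    then have "x \<bullet> i \<le> - (1 / real DIM('a)) \<or> 1 / real DIM('a) \<le> x \<bullet> i" by linarith
    then have "x \<notin> box (- ?c) ?c"
      using i(1) by (auto simp: mem_box not_less intro!: bexI[of _ i])
    then show ?thesis unfolding b_def by (intro box_bump_eq_0) auto
  qed
  have nn: "b x \<ge> 0" for x by (simp add: b_def box_bump_nonneg)
  have ck: "Ck k b" for k by (simp add: b_def Ck_box_bump)
  have int: "integrable lebesgue (\<lambda>x. 1 * b x)"
  proof (rule set_integrable_mult_test[of UNIV _ "cball 0 1"])
    show "locally_integrable_on UNIV (\<lambda>x::'a. 1::real)"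
      unfolding locally_integrable_on_def
      by (intro allI impI set_integrable_bounded_measurable[where B = 1 and U = UNIV]) auto
  qed (use z ck Ck_continuous in auto)
  have "(LINT x|lebesgue. b x) \<noteq> 0"
  proof
    assume "(LINT x|lebesgue. b x) = 0"
    then have "AE x in lebesgue. b x = 0"
      using integral_nonneg_eq_0_iff_AE[of lebesgue b] int nn by simp
    then have "AE x in lebesgue. x \<notin> box (- ?c) ?c"
    proof eventually_elim
      case (elim x)
      then show ?case using box_bump_pos[of 1 x "- ?c" ?c] by (auto simp: b_def)
    qed
    then have "negligible (box (- ?c) ?c)"
      using AE_iff_null_sets[of "box (- ?c) ?c" lebesgue] by (simp add: negligible_iff_null_sets)
    moreover have "box (- ?c) ?c \<noteq> {}"
      by (rule box_ne_empty(2)[THEN iffD2]) (auto simp: field_simps)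
    ultimately show False
      using open_not_negligible[of "box (- ?c) ?c"] by auto
  qed
  moreover have "(LINT x|lebesgue. b x) \<ge> 0" using nn by simp
  ultimately have I: "(LINT x|lebesgue. b x) > 0" by simp
  define c where "c = inverse (LINT x|lebesgue. b x)"
  have "c > 0" using I by (simp add: c_def)
  then show ?thesis
    using I by (intro exI[of _ "\<lambda>x. c * b x"])
      (auto simp: nn z Ck_cmult ck c_def intro!: Ck_cmult ck)
qed

definition mollifier :: "'a::euclidean_space \<Rightarrow> real" where
  "mollifier = (SOME b. (\<forall>k. Ck k b) \<and> (\<forall>x. 0 \<le> b x) \<and> (\<forall>x. norm x > 1 \<longrightarrow> b x = 0)
     \<and> (LINT x|lebesgue. b x) = 1)"

lemma mollifier:
  fixes x :: "'a::euclidean_space"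
  shows Ck_mollifier: "Ck k (mollifier :: 'a \<Rightarrow> real)"
    and mollifier_nonneg: "0 \<le> mollifier x"
    and mollifier_0: "norm x > 1 \<Longrightarrow> mollifier x = 0"
    and integral_mollifier: "(LINT x|lebesgue. mollifier (x::'a)) = 1"
  using someI_ex[OF kernel_exists[where 'a = 'a]] unfolding mollifier_def[symmetric] by auto

lemma mollifier_grad_0: "norm x > 1 \<Longrightarrow> grad mollifier x = 0"
proof (rule grad_eqI)
  assume x: "norm x > 1"
  have "((\<lambda>x. 0) has_derivative (\<lambda>h. 0)) (at x)" by simp
  moreover have "open (- cball 0 1 :: 'a set)" by (intro open_Compl closed_cball)
  moreover have "x \<in> - cball 0 1" using x by simp
  moreover have "0 = mollifier y" if "y \<in> - cball 0 1" for y :: 'a using mollifier_0[of y] that by simp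
  ultimately have "(mollifier has_derivative (\<lambda>h. 0)) (at x)"
    by (rule has_derivative_transform_within_open)
  then show "(mollifier has_derivative (\<lambda>h. 0 \<bullet> h)) (at x)" by simp
qed

lemma mollifier_bound_ex:
  "\<exists>B>0. \<forall>x::'a::euclidean_space. mollifier x \<le> B \<and> norm (grad mollifier x) \<le> B"
proof -
  have "bounded (mollifier ` cball (0::'a) 1)"
    by (intro compact_imp_bounded compact_continuous_image continuous_on_subset[OF Ck_continuous[OF Ck_mollifier[of 0]]]) auto
  then obtain B1 where "\<forall>y\<in>mollifier ` cball (0::'a) 1. norm y \<le> B1" unfolding bounded_iff by metis
  then have B1: "mollifier x \<le> max B1 0" for x :: 'a
    using mollifier_0[of x] by (cases "norm x \<le> 1") force+
  obtain B2 where B2: "\<And>x::'a. norm (grad mollifier x) \<le> B2"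
    using Ck1_compact_support_grad_bounded[OF Ck_mollifier compact_cball[of 0 1], where 'a = 'a] mollifier_grad_0
    by (metis dist_0_norm mem_cball not_le)
  have "0 \<le> B2" using B2[of 0] norm_ge_zero order_trans by blast
  then show ?thesis
    using B1 B2 by (intro exI[of _ "max B1 0 + B2 + 1"]) (auto intro: order_trans[OF B1] order_trans[OF B2])
qed

text \<open>Takes the type as argument so that the constant depends on the space alone.\<close>

definition moll_bound :: "'a::euclidean_space itself \<Rightarrow> real" where
  "moll_bound _ = (SOME B. B > 0 \<and> (\<forall>x::'a. mollifier x \<le> B \<and> norm (grad mollifier x) \<le> B))"

lemma moll_bound: "moll_bound TYPE('a) > 0"
    "mollifier (x::'a::euclidean_space) \<le> moll_bound TYPE('a)"
    "norm (grad mollifier x) \<le> moll_bound TYPE('a)"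
  using someI_ex[OF mollifier_bound_ex[where 'a = 'a]] unfolding moll_bound_def by auto

text \<open>The mollifier rescaled to the ball of radius \<open>r\<close> about \<open>x\<close>;
  the power of \<open>r\<close> keeps the mass equal to 1.\<close>

definition rho :: "'a::euclidean_space \<Rightarrow> real \<Rightarrow> 'a \<Rightarrow> real" where
  "rho x r z = mollifier ((1 / r) *\<^sub>R (z - x)) / r ^ DIM('a)"

lemma rho_nonneg: "r > 0 \<Longrightarrow> 0 \<le> rho x r z"
  by (simp add: rho_def mollifier_nonneg)

lemma norm_rescale_gt_1: "r > 0 \<Longrightarrow> norm y > r \<Longrightarrow> norm ((1 / r) *\<^sub>R y) > 1"
  by (simp add: field_simps)

lemma rho_0: "r > 0 \<Longrightarrow> norm (z - x) > r \<Longrightarrow> rho x r z = 0"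
  unfolding rho_def by (simp only: mollifier_0[OF norm_rescale_gt_1])

lemma rho_outside: "r > 0 \<Longrightarrow> z \<notin> cball x r \<Longrightarrow> rho x r z = 0"
  by (rule rho_0) (simp_all add: dist_norm norm_minus_commute)

lemma rho_le: "r > 0 \<Longrightarrow> rho x r (z::'a::euclidean_space) \<le> moll_bound TYPE('a) / r ^ DIM('a)"
  by (simp add: rho_def moll_bound divide_right_mono)

lemma Ck_rho: "Ck k (rho x r)"
proof -
  have "Ck k (\<lambda>z. (1 / r ^ DIM('a)) * mollifier ((1 / r) *\<^sub>R z + - (1 / r) *\<^sub>R x :: 'a))"
    by (intro Ck_cmult Ck_compose_affine[OF bounded_linear_scaleR_right Ck_mollifier])
  then show ?thesis by (simp add: rho_def[abs_def] algebra_simps)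
qed

lemma integrable_rho: "r > 0 \<Longrightarrow> integrable lebesgue (rho x r)"
proof -
  assume r: "r > 0"
  have "integrable lebesgue (\<lambda>z. 1 * rho x r z)"
  proof (rule set_integrable_mult_test[of UNIV _ "cball x r"])
    show "locally_integrable_on UNIV (\<lambda>x::'a. 1::real)"
      unfolding locally_integrable_on_def
      by (intro allI impI set_integrable_bounded_measurable[where B = 1 and U = UNIV]) auto
  qed (use r in \<open>auto intro: Ck_continuous[OF Ck_rho] simp: rho_0 dist_norm norm_minus_commute\<close>)
  then show ?thesis by simp
qed

lemma rho_has_derivative:
  assumes r: "r > 0"
  shows "(rho x r has_derivative (\<lambda>h. (grad mollifier ((1 / r) *\<^sub>R (z - x)) \<bullet> h) / (r * r ^ DIM('a)))) (at (z::'a::euclidean_space))"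
proof -
  have "((\<lambda>z. (1 / r) *\<^sub>R (z - x)) has_derivative (\<lambda>h. (1 / r) *\<^sub>R h)) (at z)"
    by (auto intro!: derivative_eq_intros)
  from has_derivative_compose[OF this Ck1_grad[OF Ck_mollifier]]
  have "((\<lambda>z. mollifier ((1 / r) *\<^sub>R (z - x))) has_derivative
     (\<lambda>h. grad mollifier ((1 / r) *\<^sub>R (z - x)) \<bullet> ((1 / r) *\<^sub>R h))) (at z)" .
  from has_derivative_mult_right[OF this, of "1 / r ^ DIM('a)"] show ?thesis
    by (simp add: rho_def[abs_def] mult.commute)
qed

text \<open>The derivative of \<open>rho\<close> in time when the centre moves with velocity
  \<open>x'\<close> and the radius grows at rate \<open>r'\<close>; the first summand comes from
  differentiating the power of the radius.\<close>

definition drho :: "'a::euclidean_space \<Rightarrow> real \<Rightarrow> 'a \<Rightarrow> real \<Rightarrow> 'a \<Rightarrow> real" where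
  "drho x r x' r' z = - (real DIM('a) * r' * mollifier ((1 / r) *\<^sub>R (z - x))
      + grad mollifier ((1 / r) *\<^sub>R (z - x)) \<bullet> (x' + (r' / r) *\<^sub>R (z - x))) / (r * r ^ DIM('a))"

lemma rho_path_derivative:
  fixes x0 x' z :: "'a::euclidean_space"
  assumes r: "r0 + t * r' > 0"
  shows "((\<lambda>s. rho (x0 + s *\<^sub>R x') (r0 + s * r') z) has_real_derivative
     drho (x0 + t *\<^sub>R x') (r0 + t * r') x' r' z) (at t)"
proof -
  define r where "r = r0 + t * r'"
  define x where "x = x0 + t *\<^sub>R x'"
  define d where "d = DIM('a)"
  have d: "d > 0" by (simp add: d_def)
  have r0: "r > 0" using r by (simp add: r_def)
  have D1: "((\<lambda>s. (1 / (r0 + s * r')) *\<^sub>R (z - (x0 + s *\<^sub>R x'))) has_derivative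
      (\<lambda>h. h *\<^sub>R (- (1 / r) *\<^sub>R x' - (r' / r\<^sup>2) *\<^sub>R (z - x)))) (at t)"
  proof -
    have "((\<lambda>s. 1 / (r0 + s * r')) has_real_derivative (- r' / r\<^sup>2)) (at t)"
      using r0 unfolding r_def by (auto intro!: derivative_eq_intros simp: power2_eq_square)
    then have f: "((\<lambda>s. 1 / (r0 + s * r')) has_derivative (\<lambda>h. (- r' / r\<^sup>2) * h)) (at t)"
      by (simp only: has_field_derivative_def)
    have g: "((\<lambda>s. z - (x0 + s *\<^sub>R x')) has_derivative (\<lambda>h. - (h *\<^sub>R x'))) (at t)"
      by (auto intro!: derivative_eq_intros)
    have "(\<lambda>h. (1 / (r0 + t * r')) *\<^sub>R (- (h *\<^sub>R x')) + ((- r' / r\<^sup>2) * h) *\<^sub>R (z - (x0 + t *\<^sub>R x')))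
      = (\<lambda>h. h *\<^sub>R (- (1 / r) *\<^sub>R x' - (r' / r\<^sup>2) *\<^sub>R (z - x)))"
      unfolding r_def[symmetric] x_def[symmetric]
      by (rule ext) (simp add: scaleR_diff_right mult.commute)
    with has_derivative_scaleR[OF f g] show ?thesis by (simp only:)
  qed
  have D2: "((\<lambda>s. mollifier ((1 / (r0 + s * r')) *\<^sub>R (z - (x0 + s *\<^sub>R x')))) has_derivative
      (\<lambda>h. grad mollifier ((1 / r) *\<^sub>R (z - x)) \<bullet> (h *\<^sub>R (- (1 / r) *\<^sub>R x' - (r' / r\<^sup>2) *\<^sub>R (z - x))))) (at t)"
    using has_derivative_compose[OF D1 Ck1_grad[OF Ck_mollifier]] unfolding r_def x_def .
  have e: "grad mollifier ((1 / r) *\<^sub>R (z - x)) \<bullet> (h *\<^sub>R (- (1 / r) *\<^sub>R x' - (r' / r\<^sup>2) *\<^sub>R (z - x)))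
     = (- (grad mollifier ((1 / r) *\<^sub>R (z - x)) \<bullet> (x' + (r' / r) *\<^sub>R (z - x))) / r) * h" for h
    using r0 by (simp add: inner_diff_right inner_add_right power2_eq_square field_simps)
  have D3: "((\<lambda>s. mollifier ((1 / (r0 + s * r')) *\<^sub>R (z - (x0 + s *\<^sub>R x')))) has_real_derivative
      - (grad mollifier ((1 / r) *\<^sub>R (z - x)) \<bullet> (x' + (r' / r) *\<^sub>R (z - x))) / r) (at t)"
    using D2 unfolding has_field_derivative_def e .
  have D4: "((\<lambda>s. (r0 + s * r') ^ d) has_real_derivative (real d * r' * r ^ (d - 1))) (at t)"
    unfolding r_def by (auto intro!: derivative_eq_intros)
  have rd: "r ^ d = r * r ^ (d - 1)" using d by (cases d) auto
  show ?thesis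
    unfolding rho_def[abs_def] d_def[symmetric]
  proof (rule DERIV_cong[OF DERIV_divide[OF D3 D4]])
    show "(r0 + t * r') ^ d \<noteq> 0" using r0 by (simp add: r_def)
    show "(- (grad mollifier ((1 / r) *\<^sub>R (z - x)) \<bullet> (x' + (r' / r) *\<^sub>R (z - x))) / r * (r0 + t * r') ^ d -
      mollifier ((1 / (r0 + t * r')) *\<^sub>R (z - (x0 + t *\<^sub>R x'))) * (real d * r' * r ^ (d - 1))) /
      ((r0 + t * r') ^ d * (r0 + t * r') ^ d) = drho (x0 + t *\<^sub>R x') (r0 + t * r') x' r' z"
      unfolding r_def[symmetric] x_def[symmetric] drho_def d_def[symmetric] rd
      using r0 by (simp add: field_simps)
  qed
qed

lemma drho_0: "r > 0 \<Longrightarrow> norm (z - x) > r \<Longrightarrow> drho x r x' r' z = 0"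
  unfolding drho_def
  by (simp only: mollifier_0[OF norm_rescale_gt_1] mollifier_grad_0[OF norm_rescale_gt_1]) simp

text \<open>A lower bound \<open>q\<close> for the radius makes the estimate uniform over a time
  interval, as domination under the integral requires.\<close>

lemma drho_bound:
  fixes x x' z :: "'a::euclidean_space"
  assumes "0 < q" "q \<le> r"
  shows "\<bar>drho x r x' r' z\<bar> \<le> (real DIM('a) * \<bar>r'\<bar> + norm x' + \<bar>r'\<bar>) * moll_bound TYPE('a) / (q * q ^ DIM('a))"
proof (cases "norm (z - x) \<le> r")
  case False
  then show ?thesis using drho_0[of r z x x' r'] assms moll_bound(1)[where 'a = 'a] by simp
next
  case True
  let ?B = "moll_bound TYPE('a)" and ?y = "(1 / r) *\<^sub>R (z - x)"
  have r: "r > 0" using assms by simp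
  have n: "norm (x' + (r' / r) *\<^sub>R (z - x)) \<le> norm x' + \<bar>r'\<bar>"
  proof -
    have "norm ((r' / r) *\<^sub>R (z - x)) \<le> \<bar>r'\<bar>"
    proof -
      have "norm ((r' / r) *\<^sub>R (z - x)) = \<bar>r'\<bar> * (norm (z - x) / r)" using r by simp
      also have "\<dots> \<le> \<bar>r'\<bar> * 1" using True r by (intro mult_left_mono) auto
      finally show ?thesis by simp
    qed
    then show ?thesis using norm_triangle_ineq[of x' "(r' / r) *\<^sub>R (z - x)"] by linarith
  qed
  have "\<bar>grad mollifier ?y \<bullet> (x' + (r' / r) *\<^sub>R (z - x))\<bar> \<le> norm (grad mollifier ?y) * norm (x' + (r' / r) *\<^sub>R (z - x))"
    by (rule Cauchy_Schwarz_ineq2)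
  also have "\<dots> \<le> ?B * (norm x' + \<bar>r'\<bar>)"
    using moll_bound(1)[where 'a = 'a] by (intro mult_mono moll_bound n) auto
  finally have 1: "\<bar>grad mollifier ?y \<bullet> (x' + (r' / r) *\<^sub>R (z - x))\<bar> \<le> ?B * (norm x' + \<bar>r'\<bar>)" .
  have "\<bar>real DIM('a) * r' * mollifier ?y\<bar> = real DIM('a) * \<bar>r'\<bar> * mollifier ?y"
    by (simp add: abs_mult mollifier_nonneg)
  also have "\<dots> \<le> real DIM('a) * \<bar>r'\<bar> * ?B"
    by (intro mult_left_mono moll_bound) auto
  finally have 2: "\<bar>real DIM('a) * r' * mollifier ?y\<bar> \<le> real DIM('a) * \<bar>r'\<bar> * ?B" .
  have "\<bar>drho x r x' r' z\<bar> = \<bar>real DIM('a) * r' * mollifier ?y + grad mollifier ?y \<bullet> (x' + (r' / r) *\<^sub>R (z - x))\<bar> / (r * r ^ DIM('a))"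
    unfolding drho_def abs_divide abs_minus using r by (simp add: abs_mult)
  also have "\<dots> \<le> ((real DIM('a) * \<bar>r'\<bar> + norm x' + \<bar>r'\<bar>) * ?B) / (q * q ^ DIM('a))"
  proof (rule frac_le)
    show "\<bar>real DIM('a) * r' * mollifier ?y + grad mollifier ?y \<bullet> (x' + (r' / r) *\<^sub>R (z - x))\<bar> \<le> (real DIM('a) * \<bar>r'\<bar> + norm x' + \<bar>r'\<bar>) * ?B"
      using 1 2 abs_triangle_ineq[of "real DIM('a) * r' * mollifier ?y" "grad mollifier ?y \<bullet> (x' + (r' / r) *\<^sub>R (z - x))"]
      by (simp add: algebra_simps)
    show "0 < q * q ^ DIM('a)" using assms by simp
    show "q * q ^ DIM('a) \<le> r * r ^ DIM('a)"
      using assms by (intro mult_mono power_mono) auto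
    show "0 \<le> (real DIM('a) * \<bar>r'\<bar> + norm x' + \<bar>r'\<bar>) * ?B"
      using moll_bound(1)[where 'a = 'a] by (intro mult_nonneg_nonneg) auto
  qed
  finally show ?thesis .
qed

section \<open>Differentiation of averages along a moving and dilating ball\<close>

lemma DERIV_integral:
  fixes F F' :: "real \<Rightarrow> 'a::euclidean_space \<Rightarrow> real"
  assumes "\<delta> > 0"
    and D: "\<And>s z. \<bar>s - t\<bar> < \<delta> \<Longrightarrow> ((\<lambda>s. F s z) has_real_derivative F' s z) (at s)"
    and F: "\<And>s. \<bar>s - t\<bar> < \<delta> \<Longrightarrow> integrable lebesgue (F s)"
    and F': "F' t \<in> borel_measurable lebesgue"
    and W: "integrable lebesgue W" "\<And>s z. \<bar>s - t\<bar> < \<delta> \<Longrightarrow> \<bar>F' s z\<bar> \<le> W z"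
  shows "((\<lambda>s. LINT z|lebesgue. F s z) has_real_derivative (LINT z|lebesgue. F' t z)) (at t)"
  unfolding DERIV_def tendsto_at_iff_sequentially
proof (intro allI impI)
  fix X :: "nat \<Rightarrow> real" assume "\<forall>i. X i \<in> UNIV - {0}" and X: "X \<longlonglongrightarrow> 0"
  then have X0: "X n \<noteq> 0" for n by auto
  \<comment> \<open>Cut off to zero for the finitely many large steps, so that the majorant holds
    for every \<open>n\<close> and not only eventually.\<close>
  define q where "q n z = (if \<bar>X n\<bar> < \<delta> then (F (t + X n) z - F t z) / X n else 0)" for n z
  have ev: "\<forall>\<^sub>F n in sequentially. \<bar>X n\<bar> < \<delta>"
    using tendstoD[OF X \<open>\<delta> > 0\<close>] by simp
  have "(\<lambda>n. LINT z|lebesgue. q n z) \<longlonglongrightarrow> (LINT z|lebesgue. F' t z)"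
  proof (rule integral_dominated_convergence[where w = W])
    show "q n \<in> borel_measurable lebesgue" for n
    proof (cases "\<bar>X n\<bar> < \<delta>")
      case True
      have "integrable lebesgue (\<lambda>z. (F (t + X n) z - F t z) / X n)"
        using True F[of "t + X n"] F[of t] \<open>\<delta> > 0\<close> by simp
      from borel_measurable_integrable[OF this] True show ?thesis by (simp add: q_def[abs_def])
    qed (simp add: q_def[abs_def])
    show "AE z in lebesgue. (\<lambda>n. q n z) \<longlonglongrightarrow> F' t z"
    proof (rule AE_I2)
      fix z
      have "((\<lambda>h. (F (t + h) z - F t z) / h) \<longlongrightarrow> F' t z) (at 0)"
        using D[of t z] \<open>\<delta> > 0\<close> by (simp add: DERIV_def)
      moreover have "filterlim X (at 0) sequentially"
        by (rule filterlim_atI[OF X]) (use X0 in auto)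
      ultimately have "(\<lambda>n. (F (t + X n) z - F t z) / X n) \<longlonglongrightarrow> F' t z"
        by (rule filterlim_compose)
      then show "(\<lambda>n. q n z) \<longlonglongrightarrow> F' t z"
        by (rule Lim_transform_eventually) (use ev in \<open>eventually_elim, simp add: q_def\<close>)
    qed
    show "AE z in lebesgue. norm (q n z) \<le> W z" for n
    proof (rule AE_I2)
      fix z
      show "norm (q n z) \<le> W z"
      proof (cases "\<bar>X n\<bar> < \<delta>")
        case True
        have "norm (F (t + X n) z - F t z) \<le> W z * norm ((t + X n) - t)"
        proof (rule field_differentiable_bound[where S = "{t - \<bar>X n\<bar>..t + \<bar>X n\<bar>}"])
          fix s assume "s \<in> {t - \<bar>X n\<bar>..t + \<bar>X n\<bar>}"
          then have s: "\<bar>s - t\<bar> < \<delta>" using True by auto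
          show "((\<lambda>s. F s z) has_field_derivative F' s z) (at s within {t - \<bar>X n\<bar>..t + \<bar>X n\<bar>})"
            using D[OF s] by (rule has_field_derivative_at_within)
          show "norm (F' s z) \<le> W z" using W(2)[OF s] by simp
        qed auto
        then show ?thesis using X0[of n] True by (simp add: q_def field_simps)
      next
        case False
        then show ?thesis using W(2)[of t z] \<open>\<delta> > 0\<close> by (simp add: q_def)
      qed
    qed
  qed (use F' W in auto)
  moreover have "\<forall>\<^sub>F n in sequentially. (LINT z|lebesgue. q n z) = ((LINT z|lebesgue. F (t + X n) z) - (LINT z|lebesgue. F t z)) / X n"
    using ev
  proof eventually_elim
    case (elim n)
    then show ?case using F[of "t + X n"] F[of t] \<open>\<delta> > 0\<close> by (simp add: q_def)
  qed
  ultimately have "(\<lambda>n. ((LINT z|lebesgue. F (t + X n) z) - (LINT z|lebesgue. F t z)) / X n) \<longlonglongrightarrow> (LINT z|lebesgue. F' t z)"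
    by (rule Lim_transform_eventually)
  then show "((\<lambda>h. ((LINT z|lebesgue. F (t + h) z) - (LINT z|lebesgue. F t z)) / h) \<circ> X) \<longlonglongrightarrow> (LINT z|lebesgue. F' t z)"
    by (simp add: o_def)
qed

definition avg :: "('a::euclidean_space \<Rightarrow> real) \<Rightarrow> 'a \<Rightarrow> real \<Rightarrow> real" where
  "avg u x r = (LINT z|lebesgue. u z * rho x r z)"

text \<open>Room around a closed ball by compactness. It lets a slightly displaced or dilated bump
  stay in one fixed compact set on which \<open>u\<close> is integrable.\<close>

lemma cball_subset_open_enlarge:
  fixes x :: "'a::euclidean_space"
  assumes "open U" "cball x r \<subseteq> U" "r > 0"
  obtains e where "e > 0" "cball x (r + e) \<subseteq> U"
proof -
  obtain e where e: "e > 0" "(\<Union>y\<in>cball x r. cball y e) \<subseteq> U"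
    using compact_subset_open_imp_cball_epsilon_subset[OF compact_cball assms(1,2)] by metis
  have "cball x (r + e) \<subseteq> (\<Union>y\<in>cball x r. cball y e)"
  proof
    fix w assume w: "w \<in> cball x (r + e)"
    show "w \<in> (\<Union>y\<in>cball x r. cball y e)"
    proof (cases "dist x w \<le> r")
      case True
      then show ?thesis using e(1) by (intro UN_I[of w]) auto
    next
      case False
      define y where "y = x + (r / norm (w - x)) *\<^sub>R (w - x)"
      have n: "norm (w - x) > r" using False by (simp add: dist_norm norm_minus_commute)
      then have n0: "norm (w - x) > 0" using assms(3) by linarith
      have ny: "norm (y - x) = r" using n0 assms(3) by (simp add: y_def)
      have "w - y = (1 - r / norm (w - x)) *\<^sub>R (w - x)" by (simp add: y_def algebra_simps)
      then have "norm (w - y) = \<bar>1 - r / norm (w - x)\<bar> * norm (w - x)" by (simp only: norm_scaleR)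
      also have "\<dots> = norm (w - x) - r" using n n0 by (simp add: field_simps)
      finally have nw: "norm (w - y) = norm (w - x) - r" .
      then have "norm (w - y) \<le> e" using w by (simp add: dist_norm norm_minus_commute)
      with ny show ?thesis
        by (intro UN_I[of y]) (auto simp: dist_norm norm_minus_commute)
    qed
  qed
  then show ?thesis using that e by blast
qed

lemma continuous_drho: "continuous_on UNIV (drho x r x' r')"
  unfolding drho_def[abs_def] divide_inverse
  by (intro continuous_intros continuous_on_compose2[OF Ck_continuous[OF Ck_mollifier]]
      continuous_on_compose2[OF continuous_grad[OF Ck_mollifier]]) auto

text \<open>The continuity equation: the bump is carried by the velocity field V(z) = x' + (r'/r)(z
  - x), so its time derivative is minus the divergence of V times \<open>rho\<close>. The components
  of this product are test functions when the ball lies in the domain, which is what lets the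
  derivative be moved onto the weak gradient.\<close>

lemma drho_eq_divergence:
  fixes x x' z :: "'a::euclidean_space"
  assumes r: "r > 0"
  shows "drho x r x' r' z = - (\<Sum>i\<in>Basis. frechet_derivative (\<lambda>z. ((x' + (r' / r) *\<^sub>R (z - x)) \<bullet> i) * rho x r z) (at z) i)"
proof -
  let ?V = "\<lambda>z. x' + (r' / r) *\<^sub>R (z - x)" and ?y = "(1 / r) *\<^sub>R (z - x)"
  have D: "frechet_derivative (\<lambda>z. (?V z \<bullet> i) * rho x r z) (at z) =
     (\<lambda>h. (?V z \<bullet> i) * ((grad mollifier ?y \<bullet> h) / (r * r ^ DIM('a))) + (((r' / r) *\<^sub>R h) \<bullet> i) * rho x r z)" for i
  proof (rule sym, rule frechet_derivative_at, rule has_derivative_mult[OF _ rho_has_derivative[OF r]])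
    show "((\<lambda>z. ?V z \<bullet> i) has_derivative (\<lambda>h. ((r' / r) *\<^sub>R h) \<bullet> i)) (at z)"
      by (auto intro!: derivative_eq_intros)
  qed
  have "(\<Sum>i\<in>Basis. frechet_derivative (\<lambda>z. (?V z \<bullet> i) * rho x r z) (at z) i)
     = (\<Sum>i\<in>Basis. ((?V z \<bullet> i) * (grad mollifier ?y \<bullet> i)) / (r * r ^ DIM('a)) + (r' / r) * rho x r z)"
    unfolding D by (intro sum.cong) auto
  also have "\<dots> = (\<Sum>i\<in>Basis. (?V z \<bullet> i) * (grad mollifier ?y \<bullet> i)) / (r * r ^ DIM('a)) + real DIM('a) * ((r' / r) * rho x r z)"
    by (simp add: sum.distrib sum_divide_distrib)
  also have "(\<Sum>i\<in>Basis. (?V z \<bullet> i) * (grad mollifier ?y \<bullet> i)) = grad mollifier ?y \<bullet> ?V z"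
    by (subst inner_commute, subst euclidean_inner) (rule refl)
  finally show ?thesis
    using r by (simp add: drho_def rho_def field_simps)
qed

lemma rho_field_test:
  fixes x x' :: "'a::euclidean_space"
  assumes "r > 0" "cball x r \<subseteq> U"
  shows "(\<lambda>z. ((x' + (r' / r) *\<^sub>R (z - x)) \<bullet> i) * rho x r z) \<in> test_functions U"
proof (rule test_functionsI[OF _ compact_cball _ assms(2)])
  have "Ck k (\<lambda>z. (z \<bullet> ((r' / r) *\<^sub>R i) + (x' \<bullet> i - (r' / r) * (x \<bullet> i))) * rho x r z)" for k
    by (intro Ck_mult Ck_add Ck_inner Ck_const Ck_rho)
  then show "Ck k (\<lambda>z. ((x' + (r' / r) *\<^sub>R (z - x)) \<bullet> i) * rho x r z)" for k
    by (simp add: inner_add_left inner_diff_left algebra_simps)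
  show "((x' + (r' / r) *\<^sub>R (z - x)) \<bullet> i) * rho x r z = 0" if "z \<notin> cball x r" for z
    using that rho_0[OF assms(1), of z x] by (simp add: dist_norm norm_minus_commute)
qed

lemma avg_path_derivative:
  fixes u :: "'a::euclidean_space \<Rightarrow> real" and g :: "'a \<Rightarrow> 'a"
  assumes "open U" and wg: "is_weak_gradient U u g"
    and r: "r0 + t * r' > 0" and sub: "cball (x0 + t *\<^sub>R x') (r0 + t * r') \<subseteq> U"
  shows "((\<lambda>s. avg u (x0 + s *\<^sub>R x') (r0 + s * r')) has_real_derivative
    (LINT z|lebesgue. (g z \<bullet> (x' + (r' / (r0 + t * r')) *\<^sub>R (z - (x0 + t *\<^sub>R x'))))
        * rho (x0 + t *\<^sub>R x') (r0 + t * r') z)) (at t)"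
proof -
  define r where "r = r0 + t * r'"
  define x where "x = x0 + t *\<^sub>R x'"
  have rpos: "r > 0" and subx: "cball x r \<subseteq> U" using r sub by (simp_all add: r_def x_def)
  obtain e where e: "e > 0" "cball x (r + e) \<subseteq> U"
    using cball_subset_open_enlarge[OF assms(1) subx rpos] .
  define K where "K = cball x (r + e)"
  define n where "n = norm x' + \<bar>r'\<bar>"
  \<comment> \<open>With speed at most \<open>n\<close>, during this time the radius stays above r/2
    and the ball stays inside the slightly larger compact ball \<open>K\<close>.\<close>
  define \<delta> where "\<delta> = min e (r / 2) / (n + 1)"
  have n: "n \<ge> 0" by (simp add: n_def)
  have \<delta>: "\<delta> > 0" using e(1) rpos n by (simp add: \<delta>_def)
  have loc: "locally_integrable_on U u" "locally_integrable_on U g"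
    using wg by (auto simp: is_weak_gradient_def)
  have uK: "set_integrable lebesgue K u"
    using loc(1) e(2) by (auto simp: locally_integrable_on_def K_def)
  define M where "M = (real DIM('a) * \<bar>r'\<bar> + norm x' + \<bar>r'\<bar>) * moll_bound TYPE('a) / (r / 2 * (r / 2) ^ DIM('a))"
  have near: "r0 + s * r' \<ge> r / 2 \<and> cball (x0 + s *\<^sub>R x') (r0 + s * r') \<subseteq> K" if s: "\<bar>s - t\<bar> < \<delta>" for s
  proof -
    have "\<bar>s - t\<bar> * n \<le> \<delta> * (n + 1)" using s n by (intro mult_mono) auto
    also have "\<dots> = min e (r / 2)" using n by (simp add: \<delta>_def)
    finally have b: "\<bar>s - t\<bar> * norm x' + \<bar>s - t\<bar> * \<bar>r'\<bar> \<le> min e (r / 2)" by (simp add: n_def algebra_simps)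
    have c: "\<bar>(s - t) * r'\<bar> = \<bar>s - t\<bar> * \<bar>r'\<bar>" by (simp add: abs_mult)
    have c0: "0 \<le> \<bar>s - t\<bar> * norm x'" "0 \<le> \<bar>s - t\<bar> * \<bar>r'\<bar>" by auto
    have rs: "r0 + s * r' = r + (s - t) * r'" by (simp add: r_def algebra_simps)
    have "r0 + s * r' \<ge> r / 2" using b c c0 rs by linarith
    moreover have "cball (x0 + s *\<^sub>R x') (r0 + s * r') \<subseteq> K"
    proof
      fix w assume "w \<in> cball (x0 + s *\<^sub>R x') (r0 + s * r')"
      then have w: "norm (w - (x0 + s *\<^sub>R x')) \<le> r + (s - t) * r'" by (simp add: rs dist_norm norm_minus_commute)
      have "w - x = (w - (x0 + s *\<^sub>R x')) + (s - t) *\<^sub>R x'" by (simp add: x_def algebra_simps)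
      then have "norm (w - x) \<le> norm (w - (x0 + s *\<^sub>R x')) + norm ((s - t) *\<^sub>R x')"
        by (simp only: norm_triangle_ineq)
      also have "\<dots> \<le> r + e" using w b c c0 by simp linarith
      finally show "w \<in> K" by (simp add: K_def dist_norm norm_minus_commute)
    qed
    ultimately show ?thesis by blast
  qed
  have D: "((\<lambda>s. LINT z|lebesgue. u z * rho (x0 + s *\<^sub>R x') (r0 + s * r') z) has_real_derivative
      (LINT z|lebesgue. u z * drho (x0 + t *\<^sub>R x') (r0 + t * r') x' r' z)) (at t)"
  proof (rule DERIV_integral[OF \<delta>, where W = "\<lambda>z. M * \<bar>indicator K z * u z\<bar>"])
    fix s assume s: "\<bar>s - t\<bar> < \<delta>"
    have pos: "r0 + s * r' > 0" using near[OF s] rpos by linarith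
    show "((\<lambda>s. u z * rho (x0 + s *\<^sub>R x') (r0 + s * r') z) has_real_derivative
         u z * drho (x0 + s *\<^sub>R x') (r0 + s * r') x' r' z) (at s)" for z
      by (rule DERIV_cmult[OF rho_path_derivative[OF pos]])
    show "integrable lebesgue (\<lambda>z. u z * rho (x0 + s *\<^sub>R x') (r0 + s * r') z)"
    proof (rule set_integrable_mult_test[OF loc(1) compact_cball _ Ck_continuous[OF Ck_rho]])
      show "cball (x0 + s *\<^sub>R x') (r0 + s * r') \<subseteq> U"
        using near[OF s] e(2) by (auto simp: K_def)
      show "rho (x0 + s *\<^sub>R x') (r0 + s * r') z = 0" if "z \<notin> cball (x0 + s *\<^sub>R x') (r0 + s * r')" for z
        by (rule rho_0[OF pos]) (use that in \<open>simp add: dist_norm norm_minus_commute\<close>)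
    qed
    show "\<bar>u z * drho (x0 + s *\<^sub>R x') (r0 + s * r') x' r' z\<bar> \<le> M * \<bar>indicator K z * u z\<bar>" for z
    proof (cases "z \<in> K")
      case True
      have "\<bar>drho (x0 + s *\<^sub>R x') (r0 + s * r') x' r' z\<bar> \<le> M"
        unfolding M_def using near[OF s] rpos by (intro drho_bound) auto
      then show ?thesis
        using True mult_right_mono[of "\<bar>drho (x0 + s *\<^sub>R x') (r0 + s * r') x' r' z\<bar>" M "\<bar>u z\<bar>"]
        by (simp add: abs_mult mult.commute[of "\<bar>u z\<bar>"])
    next
      case False
      then have "z \<notin> cball (x0 + s *\<^sub>R x') (r0 + s * r')" using near[OF s] by blast
      then have "drho (x0 + s *\<^sub>R x') (r0 + s * r') x' r' z = 0"
        by (intro drho_0[OF pos]) (simp add: dist_norm norm_minus_commute)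
      then show ?thesis using False by simp
    qed
  next
    have *: "drho (x0 + t *\<^sub>R x') (r0 + t * r') x' r' z = 0" if "z \<notin> K" for z
    proof -
      have "z \<notin> cball (x0 + t *\<^sub>R x') (r0 + t * r')" using near[of t] \<delta> that by auto
      then show ?thesis
        by (intro drho_0[OF r]) (simp add: dist_norm norm_minus_commute)
    qed
    show "(\<lambda>z. u z * drho (x0 + t *\<^sub>R x') (r0 + t * r') x' r' z) \<in> borel_measurable lebesgue"
      by (intro borel_measurable_integrable set_integrable_mult_test[OF loc(1) _ e(2)] compact_cball continuous_drho)
         (use * in \<open>auto simp: K_def\<close>)
    show "integrable lebesgue (\<lambda>z. M * \<bar>indicator K z * u z\<bar>)"
      using uK by (simp add: set_integrable_def)
  qed
  let ?V = "\<lambda>z. x' + (r' / r) *\<^sub>R (z - x)"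
  let ?\<phi> = "\<lambda>i z. (?V z \<bullet> i) * rho x r z"
  have test: "?\<phi> i \<in> test_functions U" for i
    by (rule rho_field_test[OF rpos subx])
  note int = weak_gradient_integrable[OF wg test]
  \<comment> \<open>Two signs cancel: \<open>drho\<close> is minus a divergence, and the weak
    gradient contributes another minus when the derivatives leave the test functions.\<close>
  have "(LINT z|lebesgue. u z * drho x r x' r' z)
     = (LINT z|lebesgue. - (\<Sum>i\<in>Basis. u z * frechet_derivative (?\<phi> i) (at z) i))"
    unfolding drho_eq_divergence[OF rpos] by (simp add: sum_distrib_left)
  also have "\<dots> = - (\<Sum>i\<in>Basis. LINT z|lebesgue. u z * frechet_derivative (?\<phi> i) (at z) i)"
    using int(1) by simp
  also have "\<dots> = (\<Sum>i\<in>Basis. LINT z|lebesgue. (g z \<bullet> i) * ?\<phi> i z)"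
    using wg test unfolding is_weak_gradient_alt sum_negf[symmetric] by (intro sum.cong) auto
  also have "\<dots> = (LINT z|lebesgue. (\<Sum>i\<in>Basis. (g z \<bullet> i) * ?\<phi> i z))"
    using int(2) by simp
  also have "\<dots> = (LINT z|lebesgue. (g z \<bullet> ?V z) * rho x r z)"
  proof (rule Bochner_Integration.integral_cong[OF refl])
    fix z
    show "(\<Sum>i\<in>Basis. (g z \<bullet> i) * ?\<phi> i z) = (g z \<bullet> ?V z) * rho x r z"
      using euclidean_inner[of "g z" "?V z"] by (simp only: sum_distrib_right mult.assoc)
  qed
  finally show ?thesis
    using D unfolding avg_def[abs_def] r_def x_def by (simp only:)
qed

lemma is_weak_gradient_C1:
  assumes "open U" "Ck 1 f"
  shows "is_weak_gradient U f (grad f)"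
proof -
  interpret piecewise_C1 U "{()}" "\<lambda>_. UNIV" "\<lambda>_. f" f
    by standard (use assms in auto)
  have "G = grad f" by (simp add: pw_grad_def fun_eq_iff)
  with is_weak_gradient show ?thesis by simp
qed

lemma grad_const: "grad (\<lambda>x. c) x = 0"
  by (rule grad_eqI) simp

text \<open>No change of variables: the average of the constant 1 along the straight path from the
  unit bump at 0 to the given one has derivative zero, because the gradient of a constant
  vanishes.\<close>

lemma integral_rho:
  fixes x :: "'a::euclidean_space"
  assumes "r > 0"
  shows "(LINT z|lebesgue. rho x r z) = 1"
proof -
  let ?A = "\<lambda>s. avg (\<lambda>_. 1) (0 + s *\<^sub>R x) (1 + s * (r - 1))"
  have wg: "is_weak_gradient UNIV (\<lambda>_. 1) (grad (\<lambda>_::'a. 1::real))"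
    by (intro is_weak_gradient_C1 Ck_const) auto
  have D: "(?A has_real_derivative 0) (at s)" if "0 \<le> s" "s \<le> 1" for s
  proof -
    have "1 + s * (r - 1) = (1 - s) + s * r" by (simp add: algebra_simps)
    moreover have "(1 - s) + s * r > 0"
      using that assms by (cases "s = 1") (auto intro: add_pos_nonneg)
    ultimately have "1 + s * (r - 1) > 0" by simp
    from avg_path_derivative[OF open_UNIV wg this subset_UNIV, of 0 x] show ?thesis
      by (simp add: grad_const)
  qed
  have "?A 1 - ?A 0 = (1 - 0) * 0"
    using MVT2[of 0 1 ?A "\<lambda>_. 0"] D by auto
  then have "avg (\<lambda>_. 1) x r = avg (\<lambda>_. 1) (0::'a) 1" by simp
  moreover have "avg (\<lambda>_. 1) (0::'a) 1 = 1"
    by (simp add: avg_def rho_def integral_mollifier)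
  ultimately show ?thesis by (simp add: avg_def)
qed

text \<open>Jensen's inequality for the probability density \<open>rho x r\<close>, obtained from
  the nonnegative variance of \<open>p\<close>, followed by the pointwise bound for the
  density.\<close>

lemma square_integral_le:
  fixes f :: "'a::euclidean_space \<Rightarrow> real"
  assumes r: "r > 0" and S: "cball x r \<subseteq> S" "S \<in> sets lebesgue"
    and q: "set_integrable lebesgue S (\<lambda>z. (q z)\<^sup>2)" "\<And>z. z \<in> S \<Longrightarrow> 0 \<le> q z"
    and f: "\<And>z. z \<in> cball x r \<Longrightarrow> \<bar>f z\<bar> \<le> V * q z" "V \<ge> 0"
  shows "(LINT z|lebesgue. f z * rho x r z)\<^sup>2
     \<le> V\<^sup>2 * (moll_bound TYPE('a) / r ^ DIM('a) * (LINT z:S|lebesgue. (q z)\<^sup>2))"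
proof -
  let ?B = "moll_bound TYPE('a) / r ^ DIM('a)"
  define p where "p z = indicator S z * q z" for z
  have p0: "p z \<ge> 0" for z using q(2) by (auto simp: p_def indicator_def)
  have p2: "(p z)\<^sup>2 = indicator S z * (q z)\<^sup>2" for z by (auto simp: p_def indicator_def power2_eq_square)
  have ip2: "integrable lebesgue (\<lambda>z. (p z)\<^sup>2)"
    using q(1) by (simp add: set_integrable_def p2)
  have "(\<lambda>z. sqrt ((p z)\<^sup>2)) \<in> borel_measurable lebesgue"
    using borel_measurable_integrable[OF ip2] by measurable
  then have pm: "p \<in> borel_measurable lebesgue" using p0 by simp
  have rm: "rho x r \<in> borel_measurable lebesgue"
    by (intro lebesgue_measurable_continuous Ck_continuous[OF Ck_rho])
  have rho0: "rho x r z \<ge> 0" for z by (rule rho_nonneg[OF r])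
  have i2: "integrable lebesgue (\<lambda>z. (p z)\<^sup>2 * rho x r z)"
  proof (rule Bochner_Integration.integrable_bound[of _ "\<lambda>z. ?B * (p z)\<^sup>2"])
    show "AE z in lebesgue. norm ((p z)\<^sup>2 * rho x r z) \<le> norm (?B * (p z)\<^sup>2)"
    proof (rule AE_I2)
      fix z
      have "?B \<ge> 0" using moll_bound(1)[where 'a = 'a] r by simp
      then have "norm (?B * (p z)\<^sup>2) = ?B * (p z)\<^sup>2" by (simp only: real_norm_def abs_mult abs_power2 abs_of_nonneg)
      moreover have "norm ((p z)\<^sup>2 * rho x r z) = rho x r z * (p z)\<^sup>2" using rho0[of z] by (simp add: mult.commute)
      ultimately show "norm ((p z)\<^sup>2 * rho x r z) \<le> norm (?B * (p z)\<^sup>2)"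
        using mult_right_mono[OF rho_le[OF r, of x z], of "(p z)\<^sup>2"] by simp
    qed
  qed (use ip2 pm rm in auto)
  have i1: "integrable lebesgue (\<lambda>z. p z * rho x r z)"
  proof (rule Bochner_Integration.integrable_bound[of _ "\<lambda>z. rho x r z + (p z)\<^sup>2 * rho x r z"])
    show "AE z in lebesgue. norm (p z * rho x r z) \<le> norm (rho x r z + (p z)\<^sup>2 * rho x r z)"
    proof (rule AE_I2)
      fix z
      have "0 \<le> (p z - 1 / 2)\<^sup>2" by simp
      then have "p z \<le> 1 + (p z)\<^sup>2" by (simp add: power2_eq_square algebra_simps)
      then have "p z * rho x r z \<le> (1 + (p z)\<^sup>2) * rho x r z" using rho0 by (intro mult_right_mono)
      then show "norm (p z * rho x r z) \<le> norm (rho x r z + (p z)\<^sup>2 * rho x r z)"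
        using p0[of z] rho0[of z] by (simp add: algebra_simps)
    qed
    show "integrable lebesgue (\<lambda>z. rho x r z + (p z)\<^sup>2 * rho x r z)"
      by (rule Bochner_Integration.integrable_add[OF integrable_rho[OF r] i2])
  qed (use pm rm in auto)
  define m where "m = (LINT z|lebesgue. p z * rho x r z)"
  have m0: "m \<ge> 0" unfolding m_def using p0 rho0 by (intro Bochner_Integration.integral_nonneg) auto
  have "0 \<le> (LINT z|lebesgue. (p z - m)\<^sup>2 * rho x r z)"
    using rho0 by (intro Bochner_Integration.integral_nonneg) auto
  also have "\<dots> = (LINT z|lebesgue. (p z)\<^sup>2 * rho x r z - 2 * m * (p z * rho x r z) + m\<^sup>2 * rho x r z)"
    by (intro Bochner_Integration.integral_cong) (auto simp: power2_eq_square algebra_simps)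
  also have "\<dots> = (LINT z|lebesgue. (p z)\<^sup>2 * rho x r z) - m\<^sup>2"
    using i1 i2 integrable_rho[OF r, of x]
    by (simp add: integral_rho[OF r] m_def[symmetric] power2_eq_square)
  finally have "m\<^sup>2 \<le> (LINT z|lebesgue. (p z)\<^sup>2 * rho x r z)" by simp
  also have "\<dots> \<le> (LINT z|lebesgue. ?B * (p z)\<^sup>2)"
  proof (rule integral_mono[OF i2])
    show "integrable lebesgue (\<lambda>z. ?B * (p z)\<^sup>2)" using ip2 by simp
    show "(p z)\<^sup>2 * rho x r z \<le> ?B * (p z)\<^sup>2" for z
      using mult_right_mono[OF rho_le[OF r, of x z] zero_le_power2[of "p z"]] by (simp only: mult.commute)
  qed
  also have "\<dots> = ?B * (LINT z:S|lebesgue. (q z)\<^sup>2)"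
    by (simp add: set_lebesgue_integral_def p2)
  finally have m2: "m\<^sup>2 \<le> ?B * (LINT z:S|lebesgue. (q z)\<^sup>2)" .
  have "\<bar>LINT z|lebesgue. f z * rho x r z\<bar> \<le> V * m"
  proof (cases "integrable lebesgue (\<lambda>z. f z * rho x r z)")
    \<comment> \<open>A function that is not integrable has integral 0 by convention.\<close>
    case False
    then show ?thesis using m0 f(2) by (simp add: not_integrable_integral_eq)
  next
    case True
    have "\<bar>LINT z|lebesgue. f z * rho x r z\<bar> \<le> (LINT z|lebesgue. \<bar>f z * rho x r z\<bar>)"
      by (rule integral_abs_bound)
    also have "\<dots> \<le> (LINT z|lebesgue. V * (p z * rho x r z))"
    proof (rule integral_mono)
      fix z
      show "\<bar>f z * rho x r z\<bar> \<le> V * (p z * rho x r z)"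
      proof (cases "z \<in> cball x r")
        case True
        then have "\<bar>f z\<bar> \<le> V * p z" using f(1)[OF True] S(1) by (auto simp: p_def)
        then show ?thesis using rho0[of z] by (simp add: abs_mult mult_right_mono flip: mult.assoc)
      next
        case False
        then have "rho x r z = 0" by (intro rho_0[OF r]) (simp add: dist_norm norm_minus_commute)
        then show ?thesis by simp
      qed
    qed (use True i1 in auto)
    also have "\<dots> = V * m" by (simp add: m_def)
    finally show ?thesis .
  qed
  then have "(LINT z|lebesgue. f z * rho x r z)\<^sup>2 \<le> (V * m)\<^sup>2"
    using m0 f(2) by (intro abs_le_square_iff[THEN iffD1]) (simp add: abs_mult)
  also have "\<dots> \<le> V\<^sup>2 * (?B * (LINT z:S|lebesgue. (q z)\<^sup>2))"
    unfolding power_mult_distrib by (rule mult_left_mono[OF m2]) simp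
  finally show ?thesis .
qed

text \<open>Mean value theorem in time. The condition on \<open>v\<close> covers all velocities
  occurring in the moving ball, which differ from \<open>x'\<close> by at most |r'|. For r' = 0 it
  involves only the component of the gradient along \<open>x'\<close>, so the weight
  \<open>q\<close> may measure that component alone.\<close>

lemma avg_path_bound:
  fixes u q :: "'a::euclidean_space \<Rightarrow> real" and g :: "'a \<Rightarrow> 'a"
  assumes "open U" and wg: "is_weak_gradient U u g"
    and \<rho>: "\<rho> > 0" "\<And>t. t \<in> {0..1} \<Longrightarrow> \<rho> \<le> r0 + t * r'"
    and sub: "\<And>t. t \<in> {0..1} \<Longrightarrow> cball (x0 + t *\<^sub>R x') (r0 + t * r') \<subseteq> U"
      "\<And>t. t \<in> {0..1} \<Longrightarrow> cball (x0 + t *\<^sub>R x') (r0 + t * r') \<subseteq> S" and S: "S \<in> sets lebesgue"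
    and q: "set_integrable lebesgue S (\<lambda>z. (q z)\<^sup>2)" "\<And>z. z \<in> S \<Longrightarrow> 0 \<le> q z"
    and g: "\<And>z v. z \<in> S \<Longrightarrow> norm (v - x') \<le> \<bar>r'\<bar> \<Longrightarrow> \<bar>g z \<bullet> v\<bar> \<le> V * q z" "V \<ge> 0"
  shows "(avg u (x0 + x') (r0 + r') - avg u x0 r0)\<^sup>2
     \<le> V\<^sup>2 * (moll_bound TYPE('a) / \<rho> ^ DIM('a) * (LINT z:S|lebesgue. (q z)\<^sup>2))"
proof -
  let ?A = "\<lambda>s. avg u (x0 + s *\<^sub>R x') (r0 + s * r')"
  let ?A' = "\<lambda>t. (LINT z|lebesgue. (g z \<bullet> (x' + (r' / (r0 + t * r')) *\<^sub>R (z - (x0 + t *\<^sub>R x'))))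
        * rho (x0 + t *\<^sub>R x') (r0 + t * r') z)"
  have pos: "r0 + t * r' > 0" if "t \<in> {0..1}" for t
    using \<rho>(1) \<rho>(2)[OF that] by linarith
  have D: "(?A has_real_derivative ?A' t) (at t)" if "t \<in> {0..1}" for t
    by (rule avg_path_derivative[OF assms(1) wg pos[OF that] sub(1)[OF that]])
  have I0: "(LINT z:S|lebesgue. (q z)\<^sup>2) \<ge> 0"
    unfolding set_lebesgue_integral_def by (intro Bochner_Integration.integral_nonneg) auto
  obtain t where t: "t > 0" "t < 1" "?A 1 - ?A 0 = (1 - 0) * ?A' t"
    using MVT2[of 0 1 ?A ?A'] D by auto
  have t': "t \<in> {0..1}" using t by auto
  have "(?A' t)\<^sup>2 \<le> V\<^sup>2 * (moll_bound TYPE('a) / (r0 + t * r') ^ DIM('a) * (LINT z:S|lebesgue. (q z)\<^sup>2))"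
  proof (rule square_integral_le[OF pos[OF t'] sub(2)[OF t'] S q])
    fix z assume z: "z \<in> cball (x0 + t *\<^sub>R x') (r0 + t * r')"
    show "\<bar>g z \<bullet> (x' + (r' / (r0 + t * r')) *\<^sub>R (z - (x0 + t *\<^sub>R x')))\<bar> \<le> V * q z"
    proof (rule g(1))
      show "z \<in> S" using sub(2)[OF t'] z by blast
      have n: "norm (z - (x0 + t *\<^sub>R x')) \<le> r0 + t * r'" using z by (simp add: dist_norm norm_minus_commute)
      have "norm ((r' / (r0 + t * r')) *\<^sub>R (z - (x0 + t *\<^sub>R x'))) = \<bar>r'\<bar> * (norm (z - (x0 + t *\<^sub>R x')) / (r0 + t * r'))"
        using pos[OF t'] by simp
      also have "\<dots> \<le> \<bar>r'\<bar> * 1"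
        using n pos[OF t'] by (intro mult_left_mono) auto
      finally show "norm (x' + (r' / (r0 + t * r')) *\<^sub>R (z - (x0 + t *\<^sub>R x')) - x') \<le> \<bar>r'\<bar>" by simp
    qed
  qed (use q g in auto)
  also have "\<dots> \<le> V\<^sup>2 * (moll_bound TYPE('a) / \<rho> ^ DIM('a) * (LINT z:S|lebesgue. (q z)\<^sup>2))"
    using \<rho>(1) \<rho>(2)[OF t'] moll_bound(1)[where 'a = 'a] I0
    by (intro mult_left_mono mult_right_mono divide_left_mono power_mono mult_pos_pos zero_less_power) auto
  finally show ?thesis using t(3) by simp
qed

lemma avg_diff:
  assumes "locally_integrable_on U u" "locally_integrable_on U v" "r > 0" "cball x r \<subseteq> U"
  shows "avg (\<lambda>z. u z - v z) x r = avg u x r - avg v x r"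
proof -
  have "integrable lebesgue (\<lambda>z. w z * rho x r z)" if "locally_integrable_on U w" for w
    by (intro set_integrable_mult_test[OF that compact_cball assms(4)] Ck_continuous[OF Ck_rho] rho_outside[OF assms(3)])
  then show ?thesis using assms(1,2) by (simp add: avg_def left_diff_distrib)
qed

lemma avg_const: "r > 0 \<Longrightarrow> avg (\<lambda>_. c) x r = c"
  by (simp add: avg_def integral_rho)

lemma avg_cong: "r > 0 \<Longrightarrow> (\<And>z. z \<in> cball x r \<Longrightarrow> u z = v z) \<Longrightarrow> avg u x r = avg v x r"
  unfolding avg_def
proof (rule Bochner_Integration.integral_cong[OF refl])
  fix z assume "r > 0" "\<And>z. z \<in> cball x r \<Longrightarrow> u z = v z"
  then show "u z * rho x r z = v z * rho x r z"
    using rho_0[of r z x] by (cases "z \<in> cball x r") (auto simp: dist_norm norm_minus_commute)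
qed

lemma avg_abs_le:
  assumes "continuous_on UNIV f" "r > 0" "\<And>z. z \<in> cball x r \<Longrightarrow> \<bar>f z\<bar> \<le> M"
  shows "\<bar>avg f x r\<bar> \<le> M"
proof -
  have l: "locally_integrable_on UNIV f"
    using assms(1) unfolding locally_integrable_on_def
  proof (intro allI impI)
    fix K :: "'a set" assume K: "compact K \<and> K \<subseteq> UNIV"
    then have "bounded (f ` K)"
      by (intro compact_imp_bounded compact_continuous_image continuous_on_subset[OF assms(1)]) auto
    then obtain B where "\<forall>y\<in>f ` K. norm y \<le> B" unfolding bounded_iff by metis
    then show "set_integrable lebesgue K f"
      using K assms(1) by (intro set_integrable_bounded_measurable[of K UNIV f B])
        (auto simp: lebesgue_measurable_continuous)
  qed
  have i: "integrable lebesgue (\<lambda>z. f z * rho x r z)"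
    by (intro set_integrable_mult_test[OF l compact_cball[of x r]] Ck_continuous[OF Ck_rho] rho_outside[OF assms(2)]) simp
  have "\<bar>avg f x r\<bar> \<le> (LINT z|lebesgue. \<bar>f z * rho x r z\<bar>)"
    unfolding avg_def by (rule integral_abs_bound)
  also have "\<dots> \<le> (LINT z|lebesgue. M * rho x r z)"
  proof (rule integral_mono)
    fix z
    show "\<bar>f z * rho x r z\<bar> \<le> M * rho x r z"
    proof (cases "z \<in> cball x r")
      case True
      then show ?thesis using assms(3)[OF True] rho_nonneg[OF assms(2), of x z]
        by (simp add: abs_mult mult_right_mono)
    next
      case False
      then have "rho x r z = 0" by (intro rho_0[OF assms(2)]) (simp add: dist_norm norm_minus_commute)
      then show ?thesis by simp
    qed
  qed (use i integrable_rho[OF assms(2)] in auto)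
  also have "\<dots> = M" by (simp add: integral_rho[OF assms(2)])
  finally show ?thesis .
qed

section \<open>Growth of polynomials along rays\<close>

text \<open>Lagrange interpolation at n + 1 points of [0, 1] writes \<open>p\<close> with
  coefficients of size at most \<open>M\<close> on fixed basis polynomials. The factor |t|, which
  makes small displacements harmless, comes from subtracting the value at 0.\<close>

lemma poly_growth:
  assumes "lam \<ge> (0::real)"
  shows "\<exists>C\<ge>0. \<forall>p M t. degree p \<le> n \<longrightarrow> (\<forall>s\<in>{0..1}. \<bar>poly p s\<bar> \<le> M) \<longrightarrow> \<bar>t\<bar> \<le> lam
    \<longrightarrow> \<bar>poly p t - poly p 0\<bar> \<le> C * \<bar>t\<bar> * M"
proof -
  define N where "N = {..n}"
  define x where "x j = real j / real (Suc n)" for j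
  have inj: "x j = x k \<longleftrightarrow> j = k" for j k by (simp add: x_def)
  have x01: "x j \<in> {0..1}" if "j \<in> N" for j using that by (auto simp: N_def x_def)
  define L where "L j = (\<Prod>k\<in>N - {j}. smult (1 / (x j - x k)) [:- x k, 1:])" for j
  have degL: "degree (L j) \<le> n" if "j \<in> N" for j
  proof -
    have "degree (L j) \<le> (\<Sum>k\<in>N - {j}. degree (smult (1 / (x j - x k)) [:- x k, 1:]))"
      unfolding L_def
      using degree_prod_sum_le[of "N - {j}" "\<lambda>k. smult (1 / (x j - x k)) [:- x k, 1:]"]
      by (simp only: o_def) (simp add: N_def)
    also have "\<dots> \<le> (\<Sum>k\<in>N - {j}. 1)"
      by (rule sum_mono) (auto intro: order.trans[OF degree_smult_le])
    also have "\<dots> = n" using that by (simp add: N_def)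
    finally show ?thesis .
  qed
  have Lx: "poly (L j) (x i) = (if i = j then 1 else 0)" if "i \<in> N" "j \<in> N" for i j
  proof (cases "i = j")
    case True
    have "poly (L j) (x j) = (\<Prod>k\<in>N - {j}. 1)"
      unfolding L_def poly_prod by (rule prod.cong) (auto simp: inj divide_simps)
    then show ?thesis using True by simp
  next
    case False
    then have "i \<in> N - {j}" using that by simp
    then have "poly (L j) (x i) = 0"
      unfolding L_def poly_prod by (intro prod_zero) (auto simp: N_def)
    then show ?thesis using False by simp
  qed
  have rep: "p = (\<Sum>j\<in>N. smult (poly p (x j)) (L j))" if "degree p \<le> n" for p
  proof (rule poly_eqI_degree[where A = "x ` N"])
    have c: "card (x ` N) = Suc n" by (subst card_image) (auto simp: inj_on_def inj N_def)
    show "card (x ` N) > degree p" using that c by simp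
    have "degree (\<Sum>j\<in>N. smult (poly p (x j)) (L j)) \<le> n"
      by (rule degree_sum_le) (auto simp: N_def intro: order.trans[OF degree_smult_le] degL[unfolded N_def])
    then show "card (x ` N) > degree (\<Sum>j\<in>N. smult (poly p (x j)) (L j))" using c by simp
    fix y assume "y \<in> x ` N"
    then obtain i where i: "i \<in> N" "y = x i" by blast
    have "poly (\<Sum>j\<in>N. smult (poly p (x j)) (L j)) (x i) = (\<Sum>j\<in>N. poly p (x j) * (if i = j then 1 else 0))"
      unfolding poly_sum poly_smult by (rule sum.cong) (use Lx i in auto)
    also have "\<dots> = poly p (x i)" using i(1) by (simp add: N_def if_distrib cong: if_cong)
    finally show "poly p y = poly (\<Sum>j\<in>N. smult (poly p (x j)) (L j)) y" using i by simp
  qed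
  have "\<exists>c\<ge>0. \<forall>t. \<bar>t\<bar> \<le> lam \<longrightarrow> \<bar>poly (L j) t - poly (L j) 0\<bar> \<le> c * \<bar>t\<bar>" for j
  proof -
    \<comment> \<open>Splits off the constant term: the increment is t times \<open>q\<close>, and
      \<open>q\<close> is bounded on the compact interval.\<close>
    obtain a q where L: "L j = pCons a q" by (cases "L j")
    have "bounded (poly q ` {-lam..lam})"
      by (intro compact_imp_bounded compact_continuous_image continuous_intros) auto
    then obtain c where c: "\<forall>y\<in>poly q ` {-lam..lam}. norm y \<le> c" unfolding bounded_iff by metis
    have "\<bar>poly (L j) t - poly (L j) 0\<bar> \<le> \<bar>c\<bar> * \<bar>t\<bar>" if "\<bar>t\<bar> \<le> lam" for t
    proof -
      have "t \<in> {-lam..lam}" using that by auto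
      then have "\<bar>poly q t\<bar> \<le> \<bar>c\<bar>" using bspec[OF c imageI[of t "{-lam..lam}" "poly q"]] by simp
      then show ?thesis
        unfolding L using mult_right_mono[of "\<bar>poly q t\<bar>" "\<bar>c\<bar>" "\<bar>t\<bar>"] by (simp add: abs_mult mult.commute)
    qed
    then show ?thesis by (intro exI[of _ "\<bar>c\<bar>"]) auto
  qed
  then obtain c where c: "\<And>j. c j \<ge> 0" "\<And>j t. \<bar>t\<bar> \<le> lam \<Longrightarrow> \<bar>poly (L j) t - poly (L j) 0\<bar> \<le> c j * \<bar>t\<bar>"
    by metis
  show ?thesis
  proof (intro exI[of _ "\<Sum>j\<in>N. c j"] conjI allI impI)
    show "0 \<le> sum c N" by (intro sum_nonneg c)
    fix p :: "real poly" and M t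
    assume p: "degree p \<le> n" and M: "\<forall>s\<in>{0..1}. \<bar>poly p s\<bar> \<le> M" and t: "\<bar>t\<bar> \<le> lam"
    have "poly p t - poly p 0 = (\<Sum>j\<in>N. poly p (x j) * (poly (L j) t - poly (L j) 0))"
      using arg_cong[OF rep[OF p], of "\<lambda>p. poly p t"] arg_cong[OF rep[OF p], of "\<lambda>p. poly p 0"]
      by (simp add: poly_sum sum_subtractf right_diff_distrib)
    also have "\<bar>\<dots>\<bar> \<le> (\<Sum>j\<in>N. \<bar>poly p (x j) * (poly (L j) t - poly (L j) 0)\<bar>)" by (rule sum_abs)
    also have "\<dots> \<le> (\<Sum>j\<in>N. M * (c j * \<bar>t\<bar>))"
      unfolding abs_mult
    proof (rule sum_mono, rule mult_mono)
      fix j assume j: "j \<in> N"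
      show "\<bar>poly p (x j)\<bar> \<le> M" using M x01[OF j] by blast
      then show "0 \<le> M" by linarith
    qed (use c t in auto)
    also have "\<dots> = sum c N * \<bar>t\<bar> * M" by (simp add: sum_distrib_left sum_distrib_right mult_ac)
    finally show "\<bar>poly p t - poly p 0\<bar> \<le> sum c N * \<bar>t\<bar> * M" .
  qed
qed

definition poly_const :: "nat \<Rightarrow> real \<Rightarrow> real" where
  "poly_const n lam = (SOME C. C \<ge> 0 \<and> (\<forall>p M t. degree p \<le> n \<longrightarrow> (\<forall>s\<in>{0..1}. \<bar>poly p s\<bar> \<le> M) \<longrightarrow> \<bar>t\<bar> \<le> lam
    \<longrightarrow> \<bar>poly p t - poly p 0\<bar> \<le> C * \<bar>t\<bar> * M))"

lemma poly_const:
  assumes "lam \<ge> 0"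
  shows "poly_const n lam \<ge> 0"
    and "degree p \<le> n \<Longrightarrow> (\<And>s. s \<in> {0..1} \<Longrightarrow> \<bar>poly p s\<bar> \<le> M) \<Longrightarrow> \<bar>t\<bar> \<le> lam
    \<Longrightarrow> \<bar>poly p t - poly p 0\<bar> \<le> poly_const n lam * \<bar>t\<bar> * M"
  using someI_ex[OF poly_growth[OF assms, of n, folded Ball_def]] unfolding poly_const_def[symmetric] by auto

lemma polys_ray_growth:
  fixes x y :: "'a::euclidean_space"
  assumes P: "P \<in> polys n" and M: "\<And>s. s \<in> {0..1} \<Longrightarrow> \<bar>P (x + s *\<^sub>R y)\<bar> \<le> M" and t: "\<bar>t\<bar> \<le> lam"
  shows "\<bar>P (x + t *\<^sub>R y) - P x\<bar> \<le> poly_const n lam * \<bar>t\<bar> * M"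
proof -
  obtain p where p: "degree p \<le> n" "\<And>t. P (x + t *\<^sub>R y) = poly p t"
    using polys_line[OF P, of x y] by blast
  have "\<bar>poly p t - poly p 0\<bar> \<le> poly_const n lam * \<bar>t\<bar> * M"
    using t M by (intro poly_const(2) p(1)) (auto simp: p(2))
  then show ?thesis using p(2)[of t] p(2)[of 0] by simp
qed

text \<open>The subspace \<open>T\<close> is the direction of a facet. The growth bounds limit the oscillation of the polynomial at the scale of the
  perturbations, so that its maximum over the disc is at most twice the corresponding average.\<close>

lemma polys_disc_bound:
  fixes c :: "'a::euclidean_space"
  assumes D: "D \<in> polys n" and T: "subspace T" and R: "R > 0"
    and k: "k > 0" "poly_const n 1 * k * (1 + 2 * poly_const n 2) \<le> 1 / 2" "k \<le> 1"
    and A: "\<And>s. s \<in> T \<Longrightarrow> norm s \<le> R \<Longrightarrow>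
      \<exists>a. \<bar>a\<bar> \<le> M \<and> (\<forall>B. (\<forall>y\<in>T. norm y \<le> k * R \<longrightarrow> \<bar>D (c + s + y) - D (c + s)\<bar> \<le> B) \<longrightarrow> \<bar>a - D (c + s)\<bar> \<le> B)"
    and z: "z \<in> T" "norm z \<le> lam * R"
  shows "\<bar>D (c + z)\<bar> \<le> (1 + poly_const n lam * lam) * (2 * M)"
proof -
  have Rk: "k * R > 0" using R k by simp
  have lam: "lam \<ge> 0"
  proof (rule ccontr)
    assume "\<not> lam \<ge> 0"
    then have "lam * R < 0" using R by (simp add: mult_neg_pos)
    then show False using z(2) norm_ge_zero[of z] by linarith
  qed
  have D_cont: "continuous_on UNIV D" by (rule Ck_continuous[OF polys_Ck[OF D, of 0]])
  have "compact (T \<inter> cball 0 R)"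
    by (intro closed_Int_compact closed_subspace T compact_cball)
  moreover have "T \<inter> cball 0 R \<noteq> {}" using subspace_0[OF T] R by auto
  moreover have "continuous_on (T \<inter> cball 0 R) (\<lambda>s. \<bar>D (c + s)\<bar>)"
    by (intro continuous_intros continuous_on_compose2[OF D_cont]) auto
  ultimately obtain s0 where s0: "s0 \<in> T" "norm s0 \<le> R"
    and s0max: "\<And>s. s \<in> T \<Longrightarrow> norm s \<le> R \<Longrightarrow> \<bar>D (c + s)\<bar> \<le> \<bar>D (c + s0)\<bar>"
    using continuous_attains_sup[of "T \<inter> cball 0 R" "\<lambda>s. \<bar>D (c + s)\<bar>"]
    by (metis Int_iff mem_cball_0)
  define S where "S = \<bar>D (c + s0)\<bar>"
  \<comment> \<open>On a ray from the centre the first stretch lies in the disc, where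
    \<open>S\<close> is the maximum, so the growth bound extends the estimate to discs of larger
    radius.\<close>
  have ext: "\<bar>D (c + s)\<bar> \<le> (1 + poly_const n mu * mu) * S" if "s \<in> T" "norm s \<le> mu * R" "mu \<ge> 0" for s mu
  proof (cases "s = 0")
    case True
    have "0 \<le> poly_const n mu * mu * S" using that(3) poly_const(1)[OF that(3), of n] by (simp add: S_def)
    then show ?thesis using True s0max[of 0] subspace_0[OF T] R
      by (simp add: S_def distrib_right)
  next
    case False
    let ?y = "(R / norm s) *\<^sub>R s"
    have yn: "norm ?y = R" using False R by simp
    have "\<bar>D (c + (norm s / R) *\<^sub>R ?y) - D c\<bar> \<le> poly_const n mu * \<bar>norm s / R\<bar> * S"
    proof (rule polys_ray_growth[OF D])
      show "\<bar>norm s / R\<bar> \<le> mu" using that(2) R by (simp add: field_simps)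
      fix u :: real assume u: "u \<in> {0..1}"
      have "u *\<^sub>R ?y \<in> T" using that(1) T by (intro subspace_scale)
      moreover have "norm (u *\<^sub>R ?y) \<le> R" using u yn R by (simp add: mult_left_le_one_le del: scaleR_scaleR)
      ultimately show "\<bar>D (c + u *\<^sub>R ?y)\<bar> \<le> S" unfolding S_def by (rule s0max)
    qed
    moreover have "(norm s / R) *\<^sub>R ?y = s" using False R by simp
    moreover have "poly_const n mu * \<bar>norm s / R\<bar> * S \<le> poly_const n mu * mu * S"
      using that(2) R poly_const(1)[OF that(3), of n]
      by (intro mult_right_mono mult_left_mono) (auto simp: S_def field_simps)
    moreover have "\<bar>D c\<bar> \<le> S" using s0max[of 0] subspace_0[OF T] R by (simp add: S_def)
    ultimately show ?thesis by (simp add: distrib_right)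
  qed
  obtain a where a: "\<bar>a\<bar> \<le> M"
    and aB: "\<And>B. (\<And>y. y \<in> T \<Longrightarrow> norm y \<le> k * R \<Longrightarrow> \<bar>D (c + s0 + y) - D (c + s0)\<bar> \<le> B) \<Longrightarrow> \<bar>a - D (c + s0)\<bar> \<le> B"
    using A[OF s0] by blast
  have "\<bar>a - D (c + s0)\<bar> \<le> S / 2"
  proof (rule aB)
    fix y assume y: "y \<in> T" "norm y \<le> k * R"
    show "\<bar>D (c + s0 + y) - D (c + s0)\<bar> \<le> S / 2"
    proof (cases "y = 0")
      case True
      then show ?thesis by (simp add: S_def)
    next
      case False
      let ?v = "(R / norm y) *\<^sub>R y"
      \<comment> \<open>The ray starts at the maximum point and has length \<open>R\<close>, so it
        stays in the disc of radius 2R, where \<open>ext\<close> bounds \<open>D\<close>. The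
        displacement \<open>y\<close> is at most the fraction \<open>k\<close> of that ray, and the
        choice of \<open>k\<close> leaves S / 2.\<close>
      have "\<bar>D (c + s0 + (norm y / R) *\<^sub>R ?v) - D (c + s0)\<bar> \<le> poly_const n 1 * \<bar>norm y / R\<bar> * ((1 + poly_const n 2 * 2) * S)"
      proof (rule polys_ray_growth[OF D])
        have "norm y / R \<le> k" using y(2) R by (simp add: field_simps)
        then have "norm y / R \<le> 1" using k(3) by linarith
        moreover have "\<bar>norm y / R\<bar> = norm y / R" using R by simp
        ultimately show "\<bar>norm y / R\<bar> \<le> 1" by (simp only:)
        fix u :: real assume u: "u \<in> {0..1}"
        have "s0 + u *\<^sub>R ?v \<in> T" using y(1) s0(1) T by (intro subspace_add subspace_scale)
        moreover have "norm (s0 + u *\<^sub>R ?v) \<le> 2 * R"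
        proof -
          have "norm (u *\<^sub>R ?v) = u * R" using False R u by simp
          also have "\<dots> \<le> R" using u R by (simp add: mult_left_le_one_le)
          finally show ?thesis using norm_triangle_ineq[of s0 "u *\<^sub>R ?v"] s0(2) by linarith
        qed
        ultimately have "\<bar>D (c + (s0 + u *\<^sub>R ?v))\<bar> \<le> (1 + poly_const n 2 * 2) * S"
          by (rule ext) simp
        then show "\<bar>D (c + s0 + u *\<^sub>R ?v)\<bar> \<le> (1 + poly_const n 2 * 2) * S" by (simp only: add.assoc)
      qed
      also have "(norm y / R) *\<^sub>R ?v = y" using False R by simp
      also have "poly_const n 1 * \<bar>norm y / R\<bar> * ((1 + poly_const n 2 * 2) * S)
          \<le> poly_const n 1 * k * ((1 + poly_const n 2 * 2) * S)"
        using y(2) R poly_const(1)[of 1 n] poly_const(1)[of 2 n]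
        by (intro mult_right_mono mult_left_mono) (auto simp: S_def field_simps)
      also have "\<dots> = (poly_const n 1 * k * (1 + 2 * poly_const n 2)) * S" by (simp add: mult_ac)
      also have "\<dots> \<le> 1 / 2 * S" by (intro mult_right_mono k(2)) (simp add: S_def)
      finally show ?thesis by simp
    qed
  qed
  \<comment> \<open>The average differs from the value at the maximum point by at most half of the
    maximum, so the maximum is at most twice the size of the average.\<close>
  then have "S \<le> 2 * M" using a unfolding S_def by linarith
  then have "(1 + poly_const n lam * lam) * S \<le> (1 + poly_const n lam * lam) * (2 * M)"
    using poly_const(1)[OF lam, of n] lam by (intro mult_left_mono) auto
  then show ?thesis using ext[OF z lam] by linarith
qed

section \<open>Jumps across a facet\<close>

text \<open>The intermediate ball is the convex combination of the end balls: a point with relative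
  position w / r in it is combined from the two points with the same relative position.\<close>

lemma cball_convex_combination:
  fixes x0 x1 :: "'a::euclidean_space"
  assumes "convex U" "cball x0 r0 \<subseteq> U" "cball x1 r1 \<subseteq> U" "r0 > 0" "r1 > 0" "t \<in> {0..1}"
  shows "cball (x0 + t *\<^sub>R (x1 - x0)) (r0 + t * (r1 - r0)) \<subseteq> U"
proof
  fix z assume z: "z \<in> cball (x0 + t *\<^sub>R (x1 - x0)) (r0 + t * (r1 - r0))"
  define r where "r = (1 - t) * r0 + t * r1"
  define w where "w = z - ((1 - t) *\<^sub>R x0 + t *\<^sub>R x1)"
  have r: "r > 0"
    using assms by (cases "t = 1") (auto simp: r_def intro!: add_pos_nonneg)
  have "norm w \<le> r"
    using z by (simp add: w_def r_def dist_norm algebra_simps norm_minus_commute)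
  then have w1: "norm ((1 / r) *\<^sub>R w) \<le> 1" using r by simp
  have "x0 + r0 *\<^sub>R ((1 / r) *\<^sub>R w) \<in> U" "x1 + r1 *\<^sub>R ((1 / r) *\<^sub>R w) \<in> U"
    using assms(2-5) mult_left_mono[OF w1, of r0] mult_left_mono[OF w1, of r1]
    by (auto simp: dist_norm subset_iff)
  then have "(1 - t) *\<^sub>R (x0 + r0 *\<^sub>R ((1 / r) *\<^sub>R w)) + t *\<^sub>R (x1 + r1 *\<^sub>R ((1 / r) *\<^sub>R w)) \<in> U"
    using assms(6) by (intro convexD[OF assms(1)]) auto
  also have "(1 - t) *\<^sub>R (x0 + r0 *\<^sub>R ((1 / r) *\<^sub>R w)) + t *\<^sub>R (x1 + r1 *\<^sub>R ((1 / r) *\<^sub>R w))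
     = ((1 - t) *\<^sub>R x0 + t *\<^sub>R x1) + (r * (1 / r)) *\<^sub>R w"
  proof -
    have "r * (1 / r) = (1 - t) * r0 * (1 / r) + t * r1 * (1 / r)" by (simp only: r_def distrib_right)
    then show ?thesis by (simp only: scaleR_add_left scaleR_add_right scaleR_scaleR add_ac mult.assoc)
  qed
  also have "\<dots> = z" using r by (simp add: w_def)
  finally show "z \<in> U" .
qed

text \<open>Comparison of two averages within one convex element; the bump travels along the segment
  of centres while its radius interpolates.\<close>

lemma avg_convex_bound:
  fixes u :: "'a::euclidean_space \<Rightarrow> real" and g :: "'a \<Rightarrow> 'a"
  assumes "open U" "convex U" "is_weak_gradient U u g" "Ck 1 P"
    and int: "set_integrable lebesgue U (\<lambda>z. (norm (g z - grad P z))\<^sup>2)"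
    and b: "cball x0 r0 \<subseteq> U" "cball x1 r1 \<subseteq> U" and \<rho>: "\<rho> > 0" "\<rho> \<le> r0" "\<rho> \<le> r1"
    and V: "norm (x1 - x0) + \<bar>r1 - r0\<bar> \<le> V"
  shows "(avg (\<lambda>z. u z - P z) x1 r1 - avg (\<lambda>z. u z - P z) x0 r0)\<^sup>2
     \<le> V\<^sup>2 * (moll_bound TYPE('a) / \<rho> ^ DIM('a) * (LINT z:U|lebesgue. (norm (g z - grad P z))\<^sup>2))"
proof -
  have wg: "is_weak_gradient U (\<lambda>z. u z - P z) (\<lambda>z. g z - grad P z)"
    by (intro is_weak_gradient_diff assms is_weak_gradient_C1)
  have sub: "cball (x0 + t *\<^sub>R (x1 - x0)) (r0 + t * (r1 - r0)) \<subseteq> U" if "t \<in> {0..1}" for t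
    using that \<rho> by (intro cball_convex_combination assms b) auto
  have r: "\<rho> \<le> r0 + t * (r1 - r0)" if "t \<in> {0..1}" for t
  proof -
    have "(1 - t) * \<rho> + t * \<rho> \<le> (1 - t) * r0 + t * r1"
      using that \<rho> by (intro add_mono mult_left_mono) auto
    then show ?thesis by (simp add: algebra_simps)
  qed
  have "(avg (\<lambda>z. u z - P z) (x0 + (x1 - x0)) (r0 + (r1 - r0)) - avg (\<lambda>z. u z - P z) x0 r0)\<^sup>2
     \<le> V\<^sup>2 * (moll_bound TYPE('a) / \<rho> ^ DIM('a) * (LINT z:U|lebesgue. (norm (g z - grad P z))\<^sup>2))"
  proof (rule avg_path_bound[OF assms(1) wg \<rho>(1) r sub sub _ int])
    show "U \<in> sets lebesgue" using assms(1) by auto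
    show "0 \<le> V" using V norm_ge_zero[of "x1 - x0"] abs_ge_zero[of "r1 - r0"] by linarith
    fix z v assume v: "norm (v - (x1 - x0)) \<le> \<bar>r1 - r0\<bar>"
    have "norm v \<le> V" using v V norm_triangle_ineq[of "v - (x1 - x0)" "x1 - x0"] by simp
    then have "norm (g z - grad P z) * norm v \<le> norm (g z - grad P z) * V"
      by (intro mult_left_mono) auto
    then show "\<bar>(g z - grad P z) \<bullet> v\<bar> \<le> V * norm (g z - grad P z)"
      using Cauchy_Schwarz_ineq2[of "g z - grad P z" v] by (simp add: mult.commute)
  qed auto
  then show ?thesis by simp
qed

lemma inner_diff_rearrange: "(z - c) \<bullet> n = n \<bullet> z - n \<bullet> c"
  by (simp add: inner_diff_left inner_commute[of n])

lemma negligible_frontier_halfspaces: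
  fixes n :: "'a::euclidean_space"
  assumes "n \<noteq> 0"
  shows "negligible (frontier {z. 0 \<le> (z - c) \<bullet> n})" "negligible (frontier {z. (z - c) \<bullet> n \<le> 0})"
    and "interior {z. 0 \<le> (z - c) \<bullet> n} = {z. 0 < (z - c) \<bullet> n}"
    and "interior {z. (z - c) \<bullet> n \<le> 0} = {z. (z - c) \<bullet> n < 0}"
    and "closed {z. 0 \<le> (z - c) \<bullet> n}" "closed {z. (z - c) \<bullet> n \<le> 0}"
proof -
  have 1: "{z. 0 \<le> (z - c) \<bullet> n} = {z. n \<bullet> z \<ge> n \<bullet> c}" "{z. (z - c) \<bullet> n \<le> 0} = {z. n \<bullet> z \<le> n \<bullet> c}"
    by (auto simp: inner_diff_rearrange)
  show "negligible (frontier {z. 0 \<le> (z - c) \<bullet> n})" "negligible (frontier {z. (z - c) \<bullet> n \<le> 0})"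
    unfolding 1 using assms by (simp_all add: frontier_halfspace_ge frontier_halfspace_le negligible_hyperplane)
  show "interior {z. 0 \<le> (z - c) \<bullet> n} = {z. 0 < (z - c) \<bullet> n}"
    "interior {z. (z - c) \<bullet> n \<le> 0} = {z. (z - c) \<bullet> n < 0}"
    unfolding 1 using assms by (auto simp: interior_halfspace_ge interior_halfspace_le inner_diff_rearrange)
  show "closed {z. 0 \<le> (z - c) \<bullet> n}" "closed {z. (z - c) \<bullet> n \<le> 0}"
    unfolding 1 by (auto simp: closed_halfspace_ge closed_halfspace_le)
qed

lemma sum_three_squares: "(a + b + c)\<^sup>2 \<le> 3 * (a\<^sup>2 + b\<^sup>2 + (c::real)\<^sup>2)"
proof -
  have "0 \<le> (a - b)\<^sup>2 + (b - c)\<^sup>2 + (a - c)\<^sup>2" by simp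
  then show ?thesis by (simp add: power2_eq_square algebra_simps)
qed

text \<open>The hyperplane through \<open>c\<close> with normal \<open>\<nu>\<close> carries the
  facet, and the half balls of radius \<open>\<delta>\<close> lie in the two elements,
  \<open>U1\<close> being the side of \<open>\<nu>\<close>. The bumps at \<open>x1\<close> and
  \<open>x2\<close> are those of the normalization, \<open>\<rho>\<close> is the radius of the bump
  that crosses, and \<open>h\<close> bounds all lengths.\<close>

locale crossing =
  fixes U1 U2 :: "'a::euclidean_space set" and u :: "'a \<Rightarrow> real" and g :: "'a \<Rightarrow> 'a"
    and c \<nu> :: 'a and \<delta> :: real and P1 P2 :: "'a \<Rightarrow> real" and n :: nat and \<rho> h :: real and x1 x2 :: 'a and r1 r2 :: real
  assumes op: "open U1" "open U2" and cv: "convex U1" "convex U2"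
    and wg: "is_weak_gradient (ball c \<delta>) u g" "is_weak_gradient U1 u g" "is_weak_gradient U2 u g"
    and \<nu>: "norm \<nu> = 1" and \<delta>: "\<delta> > 0"
    and sub1: "\<And>z. z \<in> ball c \<delta> \<Longrightarrow> (z - c) \<bullet> \<nu> > 0 \<Longrightarrow> z \<in> U1"
    and sub2: "\<And>z. z \<in> ball c \<delta> \<Longrightarrow> (z - c) \<bullet> \<nu> < 0 \<Longrightarrow> z \<in> U2"
    and P: "P1 \<in> polys n" "P2 \<in> polys n"
    and int1: "set_integrable lebesgue U1 (\<lambda>z. (norm (g z - grad P1 z))\<^sup>2)"
    and int2: "set_integrable lebesgue U2 (\<lambda>z. (norm (g z - grad P2 z))\<^sup>2)"
    and b: "cball x1 r1 \<subseteq> U1" "cball x2 r2 \<subseteq> U2"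
    and \<rho>: "\<rho> > 0" "\<rho> \<le> r1" "\<rho> \<le> r2" "\<rho> \<le> \<delta> / 8"
    and h: "norm (x1 - c) \<le> h" "norm (x2 - c) \<le> h" "\<delta> \<le> h" "r1 \<le> h" "r2 \<le> h"
    and z: "avg (\<lambda>z. u z - P1 z) x1 r1 = 0" "avg (\<lambda>z. u z - P2 z) x2 r2 = 0"
begin

abbreviation "E1 \<equiv> (LINT z:U1|lebesgue. (norm (g z - grad P1 z))\<^sup>2)"
abbreviation "E2 \<equiv> (LINT z:U2|lebesgue. (norm (g z - grad P2 z))\<^sup>2)"

definition "D z = P1 z - P2 z"
definition "proj z = z - ((z - c) \<bullet> \<nu>) *\<^sub>R \<nu>"
definition "T = {y. y \<bullet> \<nu> = 0}"
definition "Q = moll_bound TYPE('a) / \<rho> ^ DIM('a)"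

lemma nu: "\<nu> \<bullet> \<nu> = 1" "\<nu> \<noteq> 0"
  using \<nu> by (auto simp: norm_eq_1)

lemma Q: "Q > 0" using \<rho> moll_bound(1)[where 'a = 'a] by (simp add: Q_def)

lemma D_polys: "D \<in> polys n"
  unfolding D_def[abs_def] by (intro polys_diff P)

lemma proj_eq: "(z - c) \<bullet> \<nu> = 0 \<Longrightarrow> proj z = z"
  by (simp add: proj_def)

lemma bl_proj: "bounded_linear (\<lambda>z. z - (z \<bullet> \<nu>) *\<^sub>R \<nu>)"
  by (intro bounded_linear_sub bounded_linear_ident bounded_linear_scaleR_const bounded_linear_inner_left)

lemma proj_affine: "proj z = (z - (z \<bullet> \<nu>) *\<^sub>R \<nu>) + (c \<bullet> \<nu>) *\<^sub>R \<nu>"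
  by (simp add: proj_def algebra_simps inner_diff_left)

lemma D_proj_C1: "Ck 1 (\<lambda>z. D (proj z))"
  unfolding proj_affine by (rule Ck_compose_affine[OF bl_proj polys_Ck[OF D_polys]])

lemma grad_D_proj: "grad (\<lambda>z. D (proj z)) z \<bullet> \<nu> = 0"
proof -
  have p: "(proj has_derivative (\<lambda>h. h - (h \<bullet> \<nu>) *\<^sub>R \<nu>)) (at z)"
    unfolding proj_def[abs_def] by (auto intro!: derivative_eq_intros)
  have "((\<lambda>z. D (proj z)) has_derivative (\<lambda>h. grad D (proj z) \<bullet> (h - (h \<bullet> \<nu>) *\<^sub>R \<nu>))) (at z)"
    by (rule has_derivative_compose[OF p Ck1_grad[OF polys_Ck[OF D_polys]]])
  from has_derivative_grad[OF this, of \<nu>] show ?thesis using nu by simp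
qed

text \<open>Adding \<open>D (proj z)\<close> makes the broken polynomial continuous across the facet without changing its
  derivative in the normal direction \<open>\<nu>\<close>, the only one that matters for a bump moving along \<open>\<nu>\<close>.\<close>

definition "w z = (if (z - c) \<bullet> \<nu> \<ge> 0 then P1 z else P2 z + D (proj z))"
definition "C i = (if i then {z. 0 \<le> (z - c) \<bullet> \<nu>} else {z. (z - c) \<bullet> \<nu> \<le> 0})"
definition "p i = (if i then P1 else (\<lambda>z. P2 z + D (proj z)))"

text \<open>On the hyperplane \<open>proj\<close> is the identity, so there P2 + D equals P1 and the
  two closed half-spaces carry agreeing pieces.\<close>

sublocale pw: piecewise_C1 "ball c \<delta>" UNIV C p w
proof
  fix i :: bool
  show "closed (C i)" "negligible (frontier (C i))"
    using negligible_frontier_halfspaces[OF nu(2), of c] by (auto simp: C_def)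
  show "Ck 1 (p i)"
    using polys_Ck[OF P(1), of 1] Ck_add[OF polys_Ck[OF P(2)] D_proj_C1] by (cases i) (simp_all add: p_def)
  show "w x = p i x" if "x \<in> C i" for x
    using that proj_eq[of x] by (cases i) (auto simp: w_def p_def C_def D_def)
qed (auto simp: C_def UNIV_bool)

lemma pw_grad_nu:
  assumes "x \<in> ball c \<delta>"
  shows "(x - c) \<bullet> \<nu> > 0 \<Longrightarrow> pw.G x \<bullet> \<nu> = grad P1 x \<bullet> \<nu>"
    and "(x - c) \<bullet> \<nu> < 0 \<Longrightarrow> pw.G x \<bullet> \<nu> = grad P2 x \<bullet> \<nu>"
proof -
  assume "(x - c) \<bullet> \<nu> > 0"
  then have "x \<in> interior (C True)" using negligible_frontier_halfspaces[OF nu(2), of c] by (simp add: C_def)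
  from pw.pw_grad_eq[OF _ this assms] show "pw.G x \<bullet> \<nu> = grad P1 x \<bullet> \<nu>" by (simp add: p_def)
next
  assume "(x - c) \<bullet> \<nu> < 0"
  then have "x \<in> interior (C False)" using negligible_frontier_halfspaces[OF nu(2), of c] by (simp add: C_def)
  from pw.pw_grad_eq[OF _ this assms] have "pw.G x = grad (\<lambda>z. P2 z + D (proj z)) x" by (simp add: p_def)
  also have "\<dots> = grad P2 x + grad (\<lambda>z. D (proj z)) x"
    by (rule grad_eqI)
       (use has_derivative_add[OF Ck1_grad[OF polys_Ck[OF P(2)]] Ck1_grad[OF D_proj_C1]] in \<open>simp add: inner_add_left\<close>)
  finally show "pw.G x \<bullet> \<nu> = grad P2 x \<bullet> \<nu>" by (simp add: inner_add_left grad_D_proj)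
qed

text \<open>Only the normal component of the error, so that the gradient of
  \<open>D (proj z)\<close>, which is tangential, does not enter.\<close>

definition "q z = \<bar>(g z - pw.G z) \<bullet> \<nu>\<bar>"

lemma AE_q: "AE z in lebesgue. z \<in> ball c \<delta> \<longrightarrow>
    (q z)\<^sup>2 \<le> indicator U1 z * (norm (g z - grad P1 z))\<^sup>2 + indicator U2 z * (norm (g z - grad P2 z))\<^sup>2"
proof -
  have "negligible {z. \<nu> \<bullet> z = \<nu> \<bullet> c}" using nu(2) by (simp add: negligible_hyperplane)
  then have "AE z in lebesgue. z \<notin> {z. \<nu> \<bullet> z = \<nu> \<bullet> c}"
    by (intro AE_not_in) (simp add: negligible_iff_null_sets)
  then show ?thesis
  proof eventually_elim
    case (elim z)
    have cs: "\<bar>a \<bullet> \<nu>\<bar>\<^sup>2 \<le> (norm a)\<^sup>2" for a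
      using Cauchy_Schwarz_ineq2[of a \<nu>] \<nu> by (intro power_mono) auto
    show ?case
    proof
      assume z: "z \<in> ball c \<delta>"
      have "(z - c) \<bullet> \<nu> \<noteq> 0" using elim by (simp add: inner_diff_rearrange)
      then consider "(z - c) \<bullet> \<nu> > 0" | "(z - c) \<bullet> \<nu> < 0" by linarith
      then show "(q z)\<^sup>2 \<le> indicator U1 z * (norm (g z - grad P1 z))\<^sup>2 + indicator U2 z * (norm (g z - grad P2 z))\<^sup>2"
      proof cases
        case 1
        then have "q z = \<bar>(g z - grad P1 z) \<bullet> \<nu>\<bar>" using pw_grad_nu(1)[OF z] by (simp add: q_def inner_diff_left)
        then have "(q z)\<^sup>2 \<le> (norm (g z - grad P1 z))\<^sup>2" using cs[of "g z - grad P1 z"] by simp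
        moreover have "indicat_real U1 z = 1" using sub1[OF z 1] by simp
        moreover have "0 \<le> indicat_real U2 z * (norm (g z - grad P2 z))\<^sup>2" by (simp add: indicator_def)
        ultimately show ?thesis by (simp only: mult_1)
      next
        case 2
        then have "q z = \<bar>(g z - grad P2 z) \<bullet> \<nu>\<bar>" using pw_grad_nu(2)[OF z] by (simp add: q_def inner_diff_left)
        then have "(q z)\<^sup>2 \<le> (norm (g z - grad P2 z))\<^sup>2" using cs[of "g z - grad P2 z"] by simp
        moreover have "indicat_real U2 z = 1" using sub2[OF z 2] by simp
        moreover have "0 \<le> indicat_real U1 z * (norm (g z - grad P1 z))\<^sup>2" by (simp add: indicator_def)
        ultimately show ?thesis by (simp only: mult_1)
      qed
    qed
  qed
qed

text \<open>Contains all positions of the crossing bump, which reach distance \<delta>/4 +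
  \<delta>/2 + \<delta>/8 from \<open>c\<close>; the extra \<delta>/16 still keeps the closure
  inside the open ball, where the gradients are integrable on compact sets.\<close>

definition "S = ball c (\<delta> * (7 / 8) + \<delta> / 16)"

lemma S: "S \<subseteq> ball c \<delta>" "closure S \<subseteq> ball c \<delta>" "S \<in> sets lebesgue"
  using \<delta> by (auto simp: S_def closure_ball)

lemma q_int: "set_integrable lebesgue S (\<lambda>z. (q z)\<^sup>2)" "(LINT z:S|lebesgue. (q z)\<^sup>2) \<le> E1 + E2"
proof -
  have "locally_integrable_on (ball c \<delta>) (\<lambda>z. g z - pw.G z)"
    using wg(1) pw.loc_int(2) by (intro locally_integrable_on_diff) (auto simp: is_weak_gradient_def)
  then have "set_integrable lebesgue (closure S) (\<lambda>z. (g z - pw.G z) \<bullet> \<nu>)"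
  proof -
    assume l: "locally_integrable_on (ball c \<delta>) (\<lambda>z. g z - pw.G z)"
    have "compact (closure S)" using \<delta> by (simp add: S_def)
    then show ?thesis
      using locally_integrable_on_inner[OF l, of \<nu>] S(2) unfolding locally_integrable_on_def by blast
  qed
  then have "set_integrable lebesgue S (\<lambda>z. (g z - pw.G z) \<bullet> \<nu>)"
    by (rule set_integrable_subset) (use S closure_subset in auto)
  then have m: "(\<lambda>z. indicator S z *\<^sub>R ((g z - pw.G z) \<bullet> \<nu>)) \<in> borel_measurable lebesgue"
    by (auto simp: set_integrable_def)
  have "(\<lambda>z. (indicator S z *\<^sub>R ((g z - pw.G z) \<bullet> \<nu>))\<^sup>2) \<in> borel_measurable lebesgue"
    using m by (rule borel_measurable_power)
  also have "(\<lambda>z. (indicator S z *\<^sub>R ((g z - pw.G z) \<bullet> \<nu>))\<^sup>2) = (\<lambda>z. indicator S z *\<^sub>R (q z)\<^sup>2)"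
    by (auto simp: q_def indicator_def fun_eq_iff)
  finally have m2: "(\<lambda>z. indicator S z *\<^sub>R (q z)\<^sup>2) \<in> borel_measurable lebesgue" .
  have i: "integrable lebesgue (\<lambda>z. indicator U1 z * (norm (g z - grad P1 z))\<^sup>2 + indicator U2 z * (norm (g z - grad P2 z))\<^sup>2)"
    using int1 int2 by (simp add: set_integrable_def)
  have le: "AE z in lebesgue. indicator S z *\<^sub>R (q z)\<^sup>2
     \<le> indicator U1 z * (norm (g z - grad P1 z))\<^sup>2 + indicator U2 z * (norm (g z - grad P2 z))\<^sup>2"
    using AE_q
  proof eventually_elim
    case (elim z)
    show ?case
    proof (cases "z \<in> S")
      case True
      then show ?thesis using elim S(1) by auto
    qed simp
  qed
  show 1: "set_integrable lebesgue S (\<lambda>z. (q z)\<^sup>2)"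
    unfolding set_integrable_def
  proof (rule Bochner_Integration.integrable_bound[OF i m2])
    show "AE z in lebesgue. norm (indicator S z *\<^sub>R (q z)\<^sup>2)
       \<le> norm (indicator U1 z * (norm (g z - grad P1 z))\<^sup>2 + indicator U2 z * (norm (g z - grad P2 z))\<^sup>2)"
      using le by eventually_elim simp
  qed
  have "(LINT z:S|lebesgue. (q z)\<^sup>2) \<le> (LINT z|lebesgue. indicator U1 z * (norm (g z - grad P1 z))\<^sup>2 + indicator U2 z * (norm (g z - grad P2 z))\<^sup>2)"
    unfolding set_lebesgue_integral_def
    by (rule integral_mono_AE[OF _ i le]) (use 1 in \<open>simp add: set_integrable_def\<close>)
  also have "\<dots> = E1 + E2"
    using int1 int2 by (simp add: set_lebesgue_integral_def set_integrable_def)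
  finally show "(LINT z:S|lebesgue. (q z)\<^sup>2) \<le> E1 + E2" .
qed

lemma E_nonneg: "E1 \<ge> 0" "E2 \<ge> 0"
  unfolding set_lebesgue_integral_def by (auto intro!: Bochner_Integration.integral_nonneg)

text \<open>The orthogonal projection does not increase distances, so averaging
  \<open>D (proj z)\<close> over the bump means averaging \<open>D\<close> over displacements within
  the hyperplane of size at most \<rho>.\<close>

lemma proj_ball:
  assumes "s \<in> T" "z \<in> cball (c + s - (\<delta> / 2) *\<^sub>R \<nu>) \<rho>"
  obtains y where "y \<in> T" "norm y \<le> \<rho>" "proj z = c + s + y"
proof -
  define v where "v = z - (c + s - (\<delta> / 2) *\<^sub>R \<nu>)"
  have v: "norm v \<le> \<rho>" using assms(2) by (simp add: v_def dist_norm norm_minus_commute)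
  define y where "y = v - (v \<bullet> \<nu>) *\<^sub>R \<nu>"
  have "y \<in> T" using nu by (simp add: y_def T_def inner_diff_left)
  moreover have "norm y \<le> \<rho>"
  proof -
    have "v = y + (v \<bullet> \<nu>) *\<^sub>R \<nu>" by (simp add: y_def)
    moreover have "orthogonal y ((v \<bullet> \<nu>) *\<^sub>R \<nu>)" using \<open>y \<in> T\<close> by (simp add: orthogonal_def T_def)
    ultimately have "(norm v)\<^sup>2 = (norm y)\<^sup>2 + (norm ((v \<bullet> \<nu>) *\<^sub>R \<nu>))\<^sup>2"
      using norm_add_Pythagorean[of y "(v \<bullet> \<nu>) *\<^sub>R \<nu>"] by simp
    then have "(norm y)\<^sup>2 \<le> (norm v)\<^sup>2" by simp
    then have "norm y \<le> norm v" by (rule power2_le_imp_le) simp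
    with v show ?thesis by linarith
  qed
  moreover have "proj z = c + s + y"
  proof -
    have "z - c = s - (\<delta> / 2) *\<^sub>R \<nu> + v" by (simp add: v_def)
    then have "(z - c) \<bullet> \<nu> = - (\<delta> / 2) + v \<bullet> \<nu>"
      using assms(1) nu by (simp add: T_def inner_diff_left inner_add_left)
    then have "proj z = z - (- (\<delta> / 2) + v \<bullet> \<nu>) *\<^sub>R \<nu>" by (simp only: proj_def)
    moreover have "z = c + s - (\<delta> / 2) *\<^sub>R \<nu> + v" by (simp add: v_def)
    then have "z - (- (\<delta> / 2) + v \<bullet> \<nu>) *\<^sub>R \<nu> = c + s + y"
      by (simp only: y_def) (simp add: algebra_simps)
    ultimately show ?thesis by simp
  qed
  ultimately show ?thesis using that by blast
qed

text \<open>Three moves starting and ending with a normalized average: from \<open>x1\<close> to a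
  ball on the side of \<open>U1\<close>, straight through the facet, and on to \<open>x2\<close>. On
  the far side u - w = (u - P2) - D(proj z), so what remains after the three differences is the
  average of the jump.\<close>

lemma avg_D_bound:
  assumes s: "s \<in> T" "norm s \<le> \<delta> / 4"
  shows "(avg (\<lambda>z. D (proj z)) (c + s - (\<delta> / 2) *\<^sub>R \<nu>) \<rho>)\<^sup>2 \<le> 96 * h\<^sup>2 * Q * (E1 + E2)"
proof -
  let ?y1 = "c + s + (\<delta> / 2) *\<^sub>R \<nu>" and ?y2 = "c + s - (\<delta> / 2) *\<^sub>R \<nu>"
  have s\<nu>: "s \<bullet> \<nu> = 0" using s by (simp add: T_def)
  have dist: "norm (z - c) \<le> \<delta> / 4 + \<bar>t\<bar> + \<rho>" if "z \<in> cball (c + s + t *\<^sub>R \<nu>) \<rho>" for z t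
  proof -
    have "z - c = (z - (c + s + t *\<^sub>R \<nu>)) + (s + t *\<^sub>R \<nu>)" by simp
    then have "norm (z - c) \<le> norm (z - (c + s + t *\<^sub>R \<nu>)) + norm (s + t *\<^sub>R \<nu>)"
      by (simp only: norm_triangle_ineq)
    moreover have "norm (s + t *\<^sub>R \<nu>) \<le> norm s + \<bar>t\<bar>"
      using norm_triangle_ineq[of s "t *\<^sub>R \<nu>"] \<nu> by simp
    moreover have "norm (z - (c + s + t *\<^sub>R \<nu>)) \<le> \<rho>" using that by (simp add: dist_norm norm_minus_commute)
    ultimately show ?thesis using s(2) by linarith
  qed
  have side: "\<bar>(z - c) \<bullet> \<nu> - t\<bar> \<le> \<rho>" if "z \<in> cball (c + s + t *\<^sub>R \<nu>) \<rho>" for z t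
  proof -
    have "(z - c) \<bullet> \<nu> - t = (z - (c + s + t *\<^sub>R \<nu>)) \<bullet> \<nu>"
      using nu s\<nu> by (simp add: inner_diff_left inner_add_left)
    then show ?thesis
      using Cauchy_Schwarz_ineq2[of "z - (c + s + t *\<^sub>R \<nu>)" \<nu>] \<nu> that
      by (simp add: dist_norm norm_minus_commute)
  qed
  have inS: "cball (c + s + t *\<^sub>R \<nu>) \<rho> \<subseteq> S" if "\<bar>t\<bar> \<le> \<delta> / 2" for t
  proof
    fix z assume "z \<in> cball (c + s + t *\<^sub>R \<nu>) \<rho>"
    from dist[OF this] that \<rho>(4) \<delta> show "z \<in> S" by (simp add: S_def dist_norm norm_minus_commute)
  qed
  have y1: "cball ?y1 \<rho> \<subseteq> U1"
  proof
    fix z assume z: "z \<in> cball ?y1 \<rho>"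
    have "z \<in> S" by (rule subsetD[OF inS z]) (use \<delta> in simp)
    then have "z \<in> ball c \<delta>" by (rule subsetD[OF S(1)])
    moreover have "(z - c) \<bullet> \<nu> > 0" using side[OF z] \<rho>(4) \<delta> by linarith
    ultimately show "z \<in> U1" by (rule sub1)
  qed
  have y2_eq: "?y2 = c + s + (- (\<delta> / 2)) *\<^sub>R \<nu>" by simp
  have y2: "cball ?y2 \<rho> \<subseteq> U2"
  proof
    fix z assume z: "z \<in> cball ?y2 \<rho>"
    have z': "z \<in> cball (c + s + (- (\<delta> / 2)) *\<^sub>R \<nu>) \<rho>" using z unfolding y2_eq .
    have "z \<in> S" by (rule subsetD[OF inS z']) (use \<delta> in simp)
    then have "z \<in> ball c \<delta>" by (rule subsetD[OF S(1)])
    moreover have "(z - c) \<bullet> \<nu> < 0" using side[OF z'] \<rho>(4) \<delta> by linarith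
    ultimately show "z \<in> U2" by (rule sub2)
  qed
  have n: "norm (s + t *\<^sub>R \<nu>) \<le> \<delta> / 4 + \<bar>t\<bar>" for t
    using norm_triangle_ineq[of s "t *\<^sub>R \<nu>"] \<nu> s(2) by simp
  have \<rho>h: "\<rho> \<le> h" using \<rho> h by linarith
  have h0: "h \<ge> 0" using h(3) \<delta> by linarith
  \<comment> \<open>The displacement is at most 3\<delta>/4 + h and the radius changes by at most h,
    so 4h is a comfortable common bound.\<close>
  have V1: "norm (?y1 - x1) + \<bar>\<rho> - r1\<bar> \<le> 4 * h"
  proof -
    have "norm (?y1 - x1) = norm ((s + (\<delta> / 2) *\<^sub>R \<nu>) - (x1 - c))" by (simp add: algebra_simps)
    also have "\<dots> \<le> norm (s + (\<delta> / 2) *\<^sub>R \<nu>) + norm (x1 - c)" by (rule norm_triangle_ineq4)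
    finally show ?thesis using n[of "\<delta> / 2"] h \<rho> \<delta> by (simp add: abs_if split: if_splits)
  qed
  have V2: "norm (?y2 - x2) + \<bar>\<rho> - r2\<bar> \<le> 4 * h"
  proof -
    have "norm (?y2 - x2) = norm ((s + (- (\<delta> / 2)) *\<^sub>R \<nu>) - (x2 - c))" by (simp add: algebra_simps)
    also have "\<dots> \<le> norm (s + (- (\<delta> / 2)) *\<^sub>R \<nu>) + norm (x2 - c)" by (rule norm_triangle_ineq4)
    finally show ?thesis using n[of "- (\<delta> / 2)"] h \<rho> \<delta> by (simp add: abs_if split: if_splits)
  qed
  let ?e1 = "avg (\<lambda>z. u z - P1 z) ?y1 \<rho>" and ?e2 = "avg (\<lambda>z. u z - P2 z) ?y2 \<rho>"
  have b1: "?e1\<^sup>2 \<le> (4 * h)\<^sup>2 * (Q * E1)"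
    using avg_convex_bound[OF op(1) cv(1) wg(2) polys_Ck[OF P(1)] int1 b(1) y1 \<rho>(1,2) order.refl V1]
    by (simp add: z Q_def)
  have b2: "?e2\<^sup>2 \<le> (4 * h)\<^sup>2 * (Q * E2)"
    using avg_convex_bound[OF op(2) cv(2) wg(3) polys_Ck[OF P(2)] int2 b(2) y2 \<rho>(1,3) order.refl V2]
    by (simp add: z Q_def)
  let ?f = "\<lambda>z. u z - w z"
  have wf: "is_weak_gradient (ball c \<delta>) ?f (\<lambda>z. g z - pw.G z)"
    by (intro is_weak_gradient_diff wg(1) pw.is_weak_gradient)
  have path: "cball (?y1 + t *\<^sub>R (- \<delta> *\<^sub>R \<nu>)) (\<rho> + t * 0) \<subseteq> S" if "t \<in> {0..1}" for t
  proof -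
    have "\<bar>\<delta> / 2 - t * \<delta>\<bar> \<le> \<delta> / 2"
    proof -
      have "\<bar>1 / 2 - t\<bar> \<le> 1 / 2" using that by (auto simp: abs_if)
      then have "\<bar>1 / 2 - t\<bar> * \<delta> \<le> 1 / 2 * \<delta>" using \<delta> by (intro mult_right_mono) auto
      moreover have "\<bar>\<delta> / 2 - t * \<delta>\<bar> = \<bar>1 / 2 - t\<bar> * \<delta>"
        using \<delta> abs_mult[of "1 / 2 - t" \<delta>] by (simp add: algebra_simps)
      ultimately show ?thesis by simp
    qed
    from inS[OF this] show ?thesis by (simp add: algebra_simps)
  qed
  \<comment> \<open>The bump keeps its radius and moves by -\<delta> times \<nu>, so
    \<open>avg_path_bound\<close> asks for the normal component alone, with speed \<delta>.\<close>
  have "(avg ?f (?y1 + (- \<delta> *\<^sub>R \<nu>)) (\<rho> + 0) - avg ?f ?y1 \<rho>)\<^sup>2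
     \<le> \<delta>\<^sup>2 * (moll_bound TYPE('a) / \<rho> ^ DIM('a) * (LINT z:S|lebesgue. (q z)\<^sup>2))"
  proof (rule avg_path_bound[OF open_ball wf \<rho>(1) _ _ path S(3) q_int(1)])
    show "cball (?y1 + t *\<^sub>R (- \<delta> *\<^sub>R \<nu>)) (\<rho> + t * 0) \<subseteq> ball c \<delta>" if "t \<in> {0..1}" for t
      using path[OF that] S(1) by blast
    fix z v assume "norm (v - - \<delta> *\<^sub>R \<nu>) \<le> \<bar>0\<bar>"
    then have "v - - \<delta> *\<^sub>R \<nu> = 0" by simp
    then have "v = - \<delta> *\<^sub>R \<nu>" by (simp only: right_minus_eq)
    then show "\<bar>(g z - pw.G z) \<bullet> v\<bar> \<le> \<delta> * q z"
      using \<delta> by (simp add: q_def abs_mult)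
  qed (use \<delta> in \<open>auto simp: q_def\<close>)
  moreover have "?y1 + (- \<delta> *\<^sub>R \<nu>) = ?y2"
  proof -
    have "\<delta> *\<^sub>R \<nu> = (\<delta> / 2) *\<^sub>R \<nu> + (\<delta> / 2) *\<^sub>R \<nu>" by (simp flip: scaleR_add_left)
    then show ?thesis by simp
  qed
  ultimately have b3: "(avg ?f ?y2 \<rho> - avg ?f ?y1 \<rho>)\<^sup>2 \<le> \<delta>\<^sup>2 * (Q * (LINT z:S|lebesgue. (q z)\<^sup>2))"
    by (simp only: Q_def add_0_right)
  have "\<delta>\<^sup>2 \<le> (4 * h)\<^sup>2" using h(3) \<delta> by (intro power_mono) auto
  moreover have "0 \<le> (LINT z:S|lebesgue. (q z)\<^sup>2)"
    unfolding set_lebesgue_integral_def by (auto intro!: Bochner_Integration.integral_nonneg)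
  ultimately have "\<delta>\<^sup>2 * (Q * (LINT z:S|lebesgue. (q z)\<^sup>2)) \<le> (4 * h)\<^sup>2 * (Q * (E1 + E2))"
    using q_int(2) Q by (intro mult_mono mult_nonneg_nonneg) auto
  with b3 have b3': "(avg ?f ?y2 \<rho> - avg ?f ?y1 \<rho>)\<^sup>2 \<le> (4 * h)\<^sup>2 * (Q * (E1 + E2))" by linarith
  have f1: "avg ?f ?y1 \<rho> = ?e1"
  proof (rule avg_cong[OF \<rho>(1)])
    fix z assume "z \<in> cball ?y1 \<rho>"
    from side[OF this] \<rho>(4) \<delta> have "(z - c) \<bullet> \<nu> \<ge> 0" by linarith
    then show "u z - w z = u z - P1 z" by (simp add: w_def)
  qed
  have "avg ?f ?y2 \<rho> = avg (\<lambda>z. (u z - P2 z) - D (proj z)) ?y2 \<rho>"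
  proof (rule avg_cong[OF \<rho>(1)])
    fix z assume "z \<in> cball ?y2 \<rho>"
    with side[of z "- (\<delta> / 2)"] \<rho>(4) \<delta> have "(z - c) \<bullet> \<nu> < 0" unfolding y2_eq by linarith
    then show "u z - w z = (u z - P2 z) - D (proj z)" by (simp add: w_def)
  qed
  also have "\<dots> = ?e2 - avg (\<lambda>z. D (proj z)) ?y2 \<rho>"
  proof (rule avg_diff[OF _ _ \<rho>(1) y2])
    show "locally_integrable_on U2 (\<lambda>z. u z - P2 z)"
      using wg(3) is_weak_gradient_C1[OF op(2) polys_Ck[OF P(2)]]
      by (intro locally_integrable_on_diff) (auto simp: is_weak_gradient_def)
    show "locally_integrable_on U2 (\<lambda>z. D (proj z))"
      using is_weak_gradient_C1[OF op(2) D_proj_C1] by (auto simp: is_weak_gradient_def)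
  qed
  finally have "avg (\<lambda>z. D (proj z)) ?y2 \<rho> = ?e2 + (- ?e1) + (- (avg ?f ?y2 \<rho> - avg ?f ?y1 \<rho>))"
    using f1 by simp
  then have "(avg (\<lambda>z. D (proj z)) ?y2 \<rho>)\<^sup>2 \<le> 3 * (?e2\<^sup>2 + ?e1\<^sup>2 + (avg ?f ?y2 \<rho> - avg ?f ?y1 \<rho>)\<^sup>2)"
    using sum_three_squares[of ?e2 "- ?e1" "- (avg ?f ?y2 \<rho> - avg ?f ?y1 \<rho>)"] by (simp only: power2_minus)
  also have "\<dots> \<le> 3 * ((4 * h)\<^sup>2 * (Q * E2) + (4 * h)\<^sup>2 * (Q * E1) + (4 * h)\<^sup>2 * (Q * (E1 + E2)))"
    by (intro mult_left_mono add_mono b1 b2 b3') simp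
  \<comment> \<open>The factor 3 for three squares, 16 from the square of 4h, and every energy
    occurring twice.\<close>
  also have "\<dots> = 96 * h\<^sup>2 * Q * (E1 + E2)" by (simp add: power2_eq_square algebra_simps)
  finally show ?thesis .
qed

text \<open>\<open>polys_disc_bound\<close> on the disc of radius \<delta>/4 with the averages from
  \<open>avg_D_bound\<close>; the bump radius is the fraction \<open>k\<close> of the disc radius,
  so that the perturbations are of the admissible size.\<close>

lemma jump_bound:
  assumes k: "k > 0" "poly_const n 1 * k * (1 + 2 * poly_const n 2) \<le> 1 / 2" "k \<le> 1" "\<rho> = k * (\<delta> / 4)"
    and x: "(x - c) \<bullet> \<nu> = 0" "norm (x - c) \<le> lam * (\<delta> / 4)"
  shows "(P1 x - P2 x)\<^sup>2 \<le> (1 + poly_const n lam * lam)\<^sup>2 * 4 * (96 * h\<^sup>2 * Q * (E1 + E2))"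
proof -
  define M where "M = sqrt (96 * h\<^sup>2 * Q * (E1 + E2))"
  have nn: "0 \<le> 96 * h\<^sup>2 * Q * (E1 + E2)" using Q E_nonneg by simp
  have T: "subspace T" unfolding T_def by (simp add: subspace_def inner_add_left)
  have "\<bar>D (c + (x - c))\<bar> \<le> (1 + poly_const n lam * lam) * (2 * M)"
  proof (rule polys_disc_bound[OF D_polys T _ k(1,2,3) _ _ x(2)])
    show "\<delta> / 4 > 0" using \<delta> by simp
    show "x - c \<in> T" using x(1) by (simp add: T_def)
    fix s assume s: "s \<in> T" "norm s \<le> \<delta> / 4"
    let ?y2 = "c + s - (\<delta> / 2) *\<^sub>R \<nu>"
    let ?a = "avg (\<lambda>z. D (proj z)) ?y2 \<rho>"
    show "\<exists>a. \<bar>a\<bar> \<le> M \<and> (\<forall>B. (\<forall>y\<in>T. norm y \<le> k * (\<delta> / 4) \<longrightarrow> \<bar>D (c + s + y) - D (c + s)\<bar> \<le> B) \<longrightarrow> \<bar>a - D (c + s)\<bar> \<le> B)"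
    proof (intro exI[of _ ?a] conjI allI impI)
      show "\<bar>?a\<bar> \<le> M" unfolding M_def
        using avg_D_bound[OF s] by (intro real_le_rsqrt) simp
      fix B assume B: "\<forall>y\<in>T. norm y \<le> k * (\<delta> / 4) \<longrightarrow> \<bar>D (c + s + y) - D (c + s)\<bar> \<le> B"
      have "?a - D (c + s) = avg (\<lambda>z. D (proj z) - D (c + s)) ?y2 \<rho>"
      proof -
        have "avg (\<lambda>z. D (proj z) - D (c + s)) ?y2 \<rho> = ?a - avg (\<lambda>z. D (c + s)) ?y2 \<rho>"
        proof (rule avg_diff[OF _ _ \<rho>(1) subset_UNIV])
          show "locally_integrable_on UNIV (\<lambda>z. D (proj z))"
            using is_weak_gradient_C1[OF open_UNIV D_proj_C1] by (auto simp: is_weak_gradient_def)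
          show "locally_integrable_on UNIV (\<lambda>z::'a. D (c + s))"
            using is_weak_gradient_C1[OF open_UNIV Ck_const] by (auto simp: is_weak_gradient_def)
        qed
        then show ?thesis by (simp add: avg_const[OF \<rho>(1)])
      qed
      also have "\<bar>\<dots>\<bar> \<le> B"
      proof (rule avg_abs_le[OF _ \<rho>(1)])
        show "continuous_on UNIV (\<lambda>z. D (proj z) - D (c + s))"
          by (intro continuous_intros Ck_continuous[OF D_proj_C1])
        fix z assume "z \<in> cball ?y2 \<rho>"
        from proj_ball[OF s(1) this] obtain y where "y \<in> T" "norm y \<le> \<rho>" "proj z = c + s + y" .
        then show "\<bar>D (proj z) - D (c + s)\<bar> \<le> B" using B k(4) by simp
      qed
      finally show "\<bar>?a - D (c + s)\<bar> \<le> B" .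
    qed
  qed
  then have "(D x)\<^sup>2 \<le> ((1 + poly_const n lam * lam) * (2 * M))\<^sup>2"
    using power_mono[of "\<bar>D (c + (x - c))\<bar>" _ 2] by simp
  also have "\<dots> = (1 + poly_const n lam * lam)\<^sup>2 * 4 * M\<^sup>2"
    by (simp add: power_mult_distrib)
  also have "M\<^sup>2 = 96 * h\<^sup>2 * Q * (E1 + E2)" using nn by (simp add: M_def)
  finally show ?thesis by (simp add: D_def)
qed

end

section \<open>Barycentric coordinates\<close>

text \<open>The part \<open>z\<close> of p - q0 orthogonal to the directions of the opposite facet
  is nonzero by affine independence; divided by its squared length it is the gradient of the
  coordinate.\<close>

lemma bary_exists:
  fixes V :: "'a::euclidean_space set"
  assumes "\<not> affine_dependent V" "p \<in> V" "q0 \<in> V" "q0 \<noteq> p"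
  shows "\<exists>nc. fst nc \<bullet> p + snd nc = (1::real) \<and> (\<forall>q\<in>V - {p}. fst nc \<bullet> q + snd nc = 0)"
proof -
  define S where "S = affine hull (V - {p})"
  have p: "p \<notin> S" using assms(1,2) by (auto simp: affine_dependent_def S_def)
  have VS: "V - {p} \<subseteq> S" unfolding S_def by (rule hull_subset)
  have q0: "q0 \<in> S" using VS assms(3,4) by blast
  define W where "W = (\<lambda>x. - q0 + x) ` S"
  have W: "subspace W" unfolding W_def S_def
    by (rule affine_diffs_subspace) (use q0 in \<open>auto simp: S_def\<close>)
  then have spanW: "span W = W" by (simp add: span_eq_iff)
  obtain y z where yz: "y \<in> W" "\<And>w. w \<in> W \<Longrightarrow> orthogonal z w" "p - q0 = y + z"
    using orthogonal_subspace_decomp_exists[of W "p - q0"] spanW by metis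
  have "z \<noteq> 0"
  proof
    assume "z = 0"
    then have "p - q0 \<in> W" using yz by simp
    then show False using p by (auto simp: W_def)
  qed
  then have zz: "z \<bullet> z \<noteq> 0" by simp
  define n where "n = (1 / (z \<bullet> z)) *\<^sub>R z"
  have "z \<bullet> (p - q0) = z \<bullet> z"
    using yz(2)[OF yz(1)] by (simp add: yz(3) inner_add_right orthogonal_def)
  then have "n \<bullet> p + - (n \<bullet> q0) = 1"
    using zz by (simp add: n_def inner_diff_right flip: diff_divide_distrib)
  moreover have "n \<bullet> q + - (n \<bullet> q0) = 0" if "q \<in> V - {p}" for q
  proof -
    have "- q0 + q \<in> W" using that VS by (auto simp: W_def)
    from yz(2)[OF this] have "z \<bullet> q - z \<bullet> q0 = 0" by (simp add: orthogonal_def inner_diff_right)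
    then show ?thesis by (simp add: n_def flip: diff_divide_distrib)
  qed
  ultimately show ?thesis by (intro exI[of _ "(n, - (n \<bullet> q0))"]) auto
qed

definition bary_pair :: "'a::euclidean_space set \<Rightarrow> 'a \<Rightarrow> 'a \<times> real" where
  "bary_pair V p = (SOME nc. fst nc \<bullet> p + snd nc = 1 \<and> (\<forall>q\<in>V - {p}. fst nc \<bullet> q + snd nc = 0))"

definition lamgrad :: "'a::euclidean_space set \<Rightarrow> 'a \<Rightarrow> 'a" where
  "lamgrad V p = fst (bary_pair V p)"

text \<open>An affine function on the whole space rather than coefficients of a convex combination:
  it is a polynomial, and its constant gradient carries the geometry of the simplex.\<close>

definition lam :: "'a::euclidean_space set \<Rightarrow> 'a \<Rightarrow> 'a \<Rightarrow> real" where
  "lam V p x = lamgrad V p \<bullet> x + snd (bary_pair V p)"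

lemma lam_diff: "lam V p x - lam V p y = lamgrad V p \<bullet> (x - y)"
  by (simp add: lam_def inner_diff_right)

lemma lam_affine_sum:
  assumes "sum u A = 1"
  shows "lam V p (\<Sum>q\<in>A. u q *\<^sub>R q) = (\<Sum>q\<in>A. u q * lam V p q)"
proof -
  have "(\<Sum>q\<in>A. u q * lam V p q) = (\<Sum>q\<in>A. u q * (lamgrad V p \<bullet> q)) + (\<Sum>q\<in>A. u q) * snd (bary_pair V p)"
    by (simp only: lam_def distrib_left sum.distrib sum_distrib_right)
  also have "\<dots> = lam V p (\<Sum>q\<in>A. u q *\<^sub>R q)"
    by (simp only: assms lam_def inner_sum_right inner_scaleR_right mult_1)
  finally show ?thesis by (rule sym)
qed

locale full_simplex =
  fixes V :: "'a::euclidean_space set"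
  assumes indep: "\<not> affine_dependent V" and cardV: "card V = Suc DIM('a)"
begin

lemma fin: "finite V" by (rule aff_independent_finite[OF indep])

lemma lam_vertex:
  assumes "p \<in> V" "q \<in> V"
  shows "lam V p q = (if p = q then 1 else 0)"
proof -
  have "card (V - {p}) > 0" using cardV assms(1) fin by simp
  then have "V - {p} \<noteq> {}" by (metis card.empty less_irrefl)
  then obtain q0 where q0: "q0 \<in> V" "q0 \<noteq> p" by blast
  have "fst (bary_pair V p) \<bullet> p + snd (bary_pair V p) = 1
     \<and> (\<forall>q\<in>V - {p}. fst (bary_pair V p) \<bullet> q + snd (bary_pair V p) = 0)"
    unfolding bary_pair_def by (rule someI_ex[OF bary_exists[OF indep assms(1) q0]])
  then show ?thesis using assms by (auto simp: lam_def lamgrad_def)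
qed

lemma lam_unique:
  assumes "sum u V = 1" "p \<in> V"
  shows "lam V p (\<Sum>q\<in>V. u q *\<^sub>R q) = u p"
proof -
  have "(\<Sum>q\<in>V. u q * lam V p q) = (\<Sum>q\<in>V. if q = p then u q else 0)"
    by (rule sum.cong) (auto simp: lam_vertex assms(2))
  then show ?thesis using fin assms by (simp add: lam_affine_sum)
qed

lemma affine_hull_UNIV: "affine hull V = UNIV"
proof -
  have "aff_dim V = int DIM('a)"
    using aff_dim_affine_independent[OF indep] cardV by simp
  then show ?thesis by (simp add: aff_dim_eq_full)
qed

lemma lam_rep: "sum (\<lambda>p. lam V p x) V = 1" "(\<Sum>p\<in>V. lam V p x *\<^sub>R p) = x"
proof -
  have "x \<in> affine hull V" using affine_hull_UNIV by simp
  then obtain u where u: "sum u V = 1" "(\<Sum>v\<in>V. u v *\<^sub>R v) = x"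
    by (auto simp: affine_hull_finite[OF fin])
  have "lam V p x = u p" if "p \<in> V" for p using lam_unique[OF u(1) that] u(2) by simp
  then show "sum (\<lambda>p. lam V p x) V = 1" "(\<Sum>p\<in>V. lam V p x *\<^sub>R p) = x"
    using u by simp_all
qed

lemma mem_hull: "x \<in> convex hull V \<longleftrightarrow> (\<forall>p\<in>V. 0 \<le> lam V p x)"
proof
  assume "x \<in> convex hull V"
  then obtain u where "\<forall>p\<in>V. 0 \<le> u p" "sum u V = 1" "(\<Sum>v\<in>V. u v *\<^sub>R v) = x"
    by (auto simp: convex_hull_finite[OF fin])
  then show "\<forall>p\<in>V. 0 \<le> lam V p x" using lam_unique by metis
next
  assume "\<forall>p\<in>V. 0 \<le> lam V p x"
  then show "x \<in> convex hull V"
    unfolding convex_hull_finite[OF fin] using lam_rep[of x] by (intro CollectI exI[of _ "\<lambda>p. lam V p x"]) auto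
qed

lemma lam_le_1: "x \<in> convex hull V \<Longrightarrow> p \<in> V \<Longrightarrow> lam V p x \<le> 1"
  using member_le_sum[of p V "\<lambda>p. lam V p x"] lam_rep(1)[of x] fin mem_hull by auto

text \<open>From the centre of an inscribed ball one may go the distance \<open>r\<close> both ways
  along the gradient without leaving the simplex, where the coordinate stays between 0 and
  1.\<close>

lemma inradius_bound:
  assumes "cball x r \<subseteq> convex hull V" "r > 0" "p \<in> V"
  shows "norm (lamgrad V p) * (2 * r) \<le> 1" and "norm (lamgrad V p) * r \<le> lam V p x"
proof -
  define n where "n = lamgrad V p"
  have q: "\<exists>q. norm (n) * r = n \<bullet> q \<and> norm q \<le> r"
  proof (cases "n = 0")
    case True
    then show ?thesis using assms(2) by (intro exI[of _ 0]) auto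
  next
    case False
    then show ?thesis using assms(2)
      by (intro exI[of _ "(r / norm n) *\<^sub>R n"]) (auto simp: power2_norm_eq_inner[symmetric] power2_eq_square)
  qed
  then obtain q where q: "norm n * r = n \<bullet> q" "norm q \<le> r" by blast
  have "x + q \<in> cball x r" "x - q \<in> cball x r" using q by (auto simp: dist_norm)
  then have *: "x + q \<in> convex hull V" "x - q \<in> convex hull V" using assms(1) by auto
  have "lam V p (x + q) - lam V p (x - q) = n \<bullet> ((x + q) - (x - q))" unfolding n_def by (rule lam_diff)
  also have "\<dots> = 2 * (norm n * r)" by (simp add: q(1) inner_diff_right inner_add_right)
  finally show "norm (lamgrad V p) * (2 * r) \<le> 1"
  proof -
    assume e: "lam V p (x + q) - lam V p (x - q) = 2 * (norm n * r)"
    have "0 \<le> lam V p (x - q)" using *(2) assms(3) mem_hull by blast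
    then have "2 * (norm n * r) \<le> 1" using e lam_le_1[OF *(1) assms(3)] by linarith
    then show ?thesis by (simp add: n_def mult_ac)
  qed
  have "lam V p x - lam V p (x - q) = norm n * r" using lam_diff[of V p x "x - q"] q by (simp add: n_def)
  moreover have "0 \<le> lam V p (x - q)" using * assms(3) mem_hull by blast
  ultimately show "norm (lamgrad V p) * r \<le> lam V p x" by (simp add: n_def)
qed

text \<open>Between the two vertices the coordinate falls from 1 to 0. Together with
  \<open>inradius_bound\<close> this compares edges with inscribed balls.\<close>

lemma vertex_distance:
  assumes "p \<in> V" "q \<in> V" "p \<noteq> q"
  shows "1 \<le> norm (lamgrad V p) * norm (p - q)"
proof -
  have "lam V p p - lam V p q = 1" using lam_vertex assms by simp
  then have "lamgrad V p \<bullet> (p - q) = 1" by (simp add: lam_diff)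
  then show ?thesis using Cauchy_Schwarz_ineq2[of "lamgrad V p" "p - q"] by simp
qed

end

section \<open>Lagrange interpolation on a simplex\<close>

text \<open>The Lagrange basis function of the node \<open>\<alpha>\<close>: at the node
  \<open>\<beta>\<close> the factors become the ordinary binomials of \<open>\<beta> p\<close> over
  \<open>\<alpha> p\<close>.\<close>

definition lag :: "nat \<Rightarrow> 'a::euclidean_space set \<Rightarrow> ('a \<Rightarrow> nat) \<Rightarrow> 'a \<Rightarrow> real" where
  "lag l V \<alpha> x = (\<Prod>p\<in>V. (real l * lam V p x) gchoose (\<alpha> p))"

text \<open>The total \<open>m\<close> is kept apart from the order \<open>l\<close> of the nodes
  because products of lower degree occur in the proof that the basis spans. Values off
  \<open>V\<close> are fixed to make the set finite.\<close>

definition lag_idx :: "nat \<Rightarrow> 'a set \<Rightarrow> ('a \<Rightarrow> nat) set" where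
  "lag_idx m V = {\<alpha>. (\<forall>p. p \<notin> V \<longrightarrow> \<alpha> p = 0) \<and> sum \<alpha> V = m}"

definition lag_node :: "nat \<Rightarrow> 'a::euclidean_space set \<Rightarrow> ('a \<Rightarrow> nat) \<Rightarrow> 'a" where
  "lag_node l V \<alpha> = (\<Sum>p\<in>V. (real (\<alpha> p) / real l) *\<^sub>R p)"

lemma gchoose_Suc_mult: "(a::real) gchoose (Suc k) = (a - real k) * (a gchoose k) / real (Suc k)"
  using gbinomial_mult_1[of a k] by (simp add: field_simps)

lemma finite_lag_idx: "finite V \<Longrightarrow> finite (lag_idx m V)" and card_lag_idx: "finite V \<Longrightarrow> card (lag_idx m V) \<le> (m + 1) ^ card V"
proof -
  assume f: "finite V"
  have inj: "inj_on (\<lambda>\<alpha>. restrict \<alpha> V) (lag_idx m V)"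
  proof (rule inj_onI)
    fix \<alpha> \<beta> assume *: "\<alpha> \<in> lag_idx m V" "\<beta> \<in> lag_idx m V" "restrict \<alpha> V = restrict \<beta> V"
    show "\<alpha> = \<beta>"
    proof
      fix p
      have "restrict \<alpha> V p = restrict \<beta> V p" using *(3) by (rule fun_cong)
      with *(1,2) show "\<alpha> p = \<beta> p" by (cases "p \<in> V") (auto simp: lag_idx_def)
    qed
  qed
  have sub: "(\<lambda>\<alpha>. restrict \<alpha> V) ` lag_idx m V \<subseteq> (\<Pi>\<^sub>E p\<in>V. {..m})"
  proof (intro subsetI, elim imageE, hypsubst)
    fix \<alpha> assume a: "\<alpha> \<in> lag_idx m V"
    have "\<alpha> p \<le> m" if "p \<in> V" for p
      using member_le_sum[of p V \<alpha>] that f a by (auto simp: lag_idx_def)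
    then show "restrict \<alpha> V \<in> (\<Pi>\<^sub>E p\<in>V. {..m})" by auto
  qed
  have fP: "finite (\<Pi>\<^sub>E p\<in>V. {..m})" using f by (intro finite_PiE) auto
  show "finite (lag_idx m V)" using inj finite_subset[OF sub fP] by (rule finite_imageD[rotated])
  show "card (lag_idx m V) \<le> (m + 1) ^ card V"
    using card_mono[OF fP sub] by (simp add: card_image[OF inj] card_PiE[OF f])
qed

lemma polys_gchoose_mult:
  assumes "P \<in> polys m"
  shows "(\<lambda>x. P x * ((real l * lam V p x) gchoose k)) \<in> polys (m + k)"
proof (induction k)
  case 0
  then show ?case using assms by simp
next
  case (Suc k)
  let ?n = "(real l / real (Suc k)) *\<^sub>R lamgrad V p"
  let ?c = "(real l * snd (bary_pair V p) - real k) / real (Suc k)"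
  have "(\<lambda>x. (?n \<bullet> x + ?c) * (P x * ((real l * lam V p x) gchoose k))) \<in> polys (Suc (m + k))"
    by (rule polys_affine_mult[OF Suc])
  also have "(\<lambda>x. (?n \<bullet> x + ?c) * (P x * ((real l * lam V p x) gchoose k))) = (\<lambda>x. P x * ((real l * lam V p x) gchoose (Suc k)))"
  proof
    fix x
    have "?n \<bullet> x + ?c = (real l * lam V p x - real k) / real (Suc k)"
      by (simp add: lam_def add_divide_distrib diff_divide_distrib distrib_left del: of_nat_Suc)
    then show "(?n \<bullet> x + ?c) * (P x * ((real l * lam V p x) gchoose k)) = P x * ((real l * lam V p x) gchoose (Suc k))"
      by (simp only: gchoose_Suc_mult) simp
  qed
  finally show ?case by simp
qed

lemma polys_lag_partial:
  "finite A \<Longrightarrow> (\<lambda>x. \<Prod>p\<in>A. (real l * lam V p x) gchoose (\<alpha> p)) \<in> polys (sum \<alpha> A)"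
proof (induction A rule: finite_induct)
  case empty
  show ?case using polys_const[of 1 0] by simp
next
  case (insert q A)
  from polys_gchoose_mult[OF insert.IH, of l V q "\<alpha> q"] insert show ?case
    by (simp add: mult.commute add.commute)
qed

lemma lag_polys: "finite V \<Longrightarrow> \<alpha> \<in> lag_idx l V \<Longrightarrow> lag l V \<alpha> \<in> polys l"
  using polys_lag_partial[of V l V \<alpha>] by (simp add: lag_def[abs_def] lag_idx_def)

context full_simplex
begin

definition "SP l m = {f. \<exists>c. f = (\<lambda>x. \<Sum>\<alpha>\<in>lag_idx m V. c \<alpha> * lag l V \<alpha> x)}"

lemma SP_cmult: "f \<in> SP l m \<Longrightarrow> (\<lambda>x. c * f x) \<in> SP l m"
proof -
  assume "f \<in> SP l m"
  then obtain e where f: "f = (\<lambda>x. \<Sum>\<alpha>\<in>lag_idx m V. e \<alpha> * lag l V \<alpha> x)" by (auto simp: SP_def)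
  show ?thesis unfolding SP_def f
    by (intro CollectI exI[of _ "\<lambda>\<alpha>. c * e \<alpha>"]) (simp add: sum_distrib_left mult.assoc)
qed

lemma SP_add: "f \<in> SP l m \<Longrightarrow> g \<in> SP l m \<Longrightarrow> (\<lambda>x. f x + g x) \<in> SP l m"
proof -
  assume "f \<in> SP l m" "g \<in> SP l m"
  then obtain c e where f: "f = (\<lambda>x. \<Sum>\<alpha>\<in>lag_idx m V. c \<alpha> * lag l V \<alpha> x)"
    and g: "g = (\<lambda>x. \<Sum>\<alpha>\<in>lag_idx m V. e \<alpha> * lag l V \<alpha> x)" by (auto simp: SP_def)
  show ?thesis unfolding SP_def f g
    by (intro CollectI exI[of _ "\<lambda>\<alpha>. c \<alpha> + e \<alpha>"]) (simp add: sum.distrib distrib_right)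
qed

lemma SP_zero: "(\<lambda>x. 0) \<in> SP l m"
  unfolding SP_def by (intro CollectI exI[of _ "\<lambda>_. 0"]) simp

lemma SP_sum: "(\<And>i. i \<in> I \<Longrightarrow> f i \<in> SP l m) \<Longrightarrow> (\<lambda>x. \<Sum>i\<in>I. f i x) \<in> SP l m"
  by (induction I rule: infinite_finite_induct) (simp_all add: SP_zero SP_add)

lemma SP_lag: "\<alpha> \<in> lag_idx m V \<Longrightarrow> lag l V \<alpha> \<in> SP l m"
  unfolding SP_def
  by (intro CollectI exI[of _ "\<lambda>\<beta>. if \<beta> = \<alpha> then 1 else 0"])
     (simp add: if_distrib[of "\<lambda>c. c * _"] sum.delta' finite_lag_idx[OF fin] cong: if_cong)

lemma lag_idx_upd:
  assumes "q \<in> V" "\<alpha> \<in> lag_idx m V"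
  shows "\<alpha>(q := Suc (\<alpha> q)) \<in> lag_idx (Suc m) V"
proof -
  have "sum (\<alpha>(q := Suc (\<alpha> q))) (V - {q}) = sum \<alpha> (V - {q})" by (rule sum.cong) auto
  then have "sum (\<alpha>(q := Suc (\<alpha> q))) V = Suc (sum \<alpha> V)"
    by (simp add: sum.remove[OF fin assms(1)])
  then show ?thesis using assms by (auto simp: lag_idx_def)
qed

text \<open>The identity a (a choose k) = (k+1)(a choose k+1) + k (a choose k) in the factor of
  \<open>q\<close>: multiplication by a coordinate raises one index, up to a multiple of the
  function itself.\<close>

lemma lag_coord_mult:
  assumes "q \<in> V"
  shows "(real l * lam V q x) * lag l V \<alpha> x = real (Suc (\<alpha> q)) * lag l V (\<alpha>(q := Suc (\<alpha> q))) x + real (\<alpha> q) * lag l V \<alpha> x"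
proof -
  let ?R = "\<lambda>\<alpha>. \<Prod>p\<in>V - {q}. (real l * lam V p x) gchoose (\<alpha> p)"
  have R: "?R (\<alpha>(q := Suc (\<alpha> q))) = ?R \<alpha>" by (rule prod.cong) auto
  have e: "lag l V \<beta> x = ((real l * lam V q x) gchoose (\<beta> q)) * ?R \<beta>" for \<beta>
    unfolding lag_def by (rule prod.remove[OF fin assms])
  show ?thesis
    unfolding e R using gbinomial_mult_1[of "real l * lam V q x" "\<alpha> q"]
    by (simp only: fun_upd_same mult.assoc[symmetric] distrib_right[symmetric]) (simp add: algebra_simps)
qed

text \<open>Since \<open>\<Sum>p. l * lam p = l\<close>, a product of degree \<open>m < l\<close> is a combination of products of degree
  \<open>m + 1\<close>, so the products of degree exactly \<open>l\<close> span all polynomials of degree at most \<open>l\<close>.\<close>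

lemma SP_raise:
  assumes "f \<in> SP l m" "m < l"
  shows "f \<in> SP l (Suc m)"
proof -
  have "lag l V \<alpha> \<in> SP l (Suc m)" if a: "\<alpha> \<in> lag_idx m V" for \<alpha>
  proof -
    have "lag l V \<alpha> x = (1 / (real l - real m)) * (\<Sum>q\<in>V. real (Suc (\<alpha> q)) * lag l V (\<alpha>(q := Suc (\<alpha> q))) x)" for x
    proof -
      have "(\<Sum>q\<in>V. real (Suc (\<alpha> q)) * lag l V (\<alpha>(q := Suc (\<alpha> q))) x)
         = (\<Sum>q\<in>V. (real l * lam V q x) * lag l V \<alpha> x - real (\<alpha> q) * lag l V \<alpha> x)"
        by (rule sum.cong) (auto simp: lag_coord_mult)
      also have "\<dots> = (real l * (\<Sum>q\<in>V. lam V q x) - real (\<Sum>q\<in>V. \<alpha> q)) * lag l V \<alpha> x"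
        by (simp add: sum_subtractf sum_distrib_left sum_distrib_right left_diff_distrib)
      also have "\<dots> = (real l - real m) * lag l V \<alpha> x"
        using a lam_rep(1)[of x] by (simp add: lag_idx_def)
      finally show ?thesis using assms(2) by simp
    qed
    then have "lag l V \<alpha> = (\<lambda>x. (1 / (real l - real m)) * (\<Sum>q\<in>V. real (Suc (\<alpha> q)) * lag l V (\<alpha>(q := Suc (\<alpha> q))) x))"
      by (rule ext)
    also have "\<dots> \<in> SP l (Suc m)"
      by (intro SP_cmult SP_sum SP_lag lag_idx_upd a)
    finally show ?thesis .
  qed
  moreover obtain c where "f = (\<lambda>x. \<Sum>\<alpha>\<in>lag_idx m V. c \<alpha> * lag l V \<alpha> x)" using assms(1) by (auto simp: SP_def)
  ultimately show ?thesis by (simp only:) (intro SP_sum SP_cmult)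
qed

text \<open>A Cartesian coordinate is the combination of the barycentric ones weighted with that
  coordinate of the vertices; each product with a basis function lands in degree m + 1, with
  \<open>SP_raise\<close> for the term that keeps its degree.\<close>

lemma SP_coord:
  assumes "f \<in> SP l m" "m < l"
  shows "(\<lambda>x. (x \<bullet> i) * f x) \<in> SP l (Suc m)"
proof -
  have l: "real l \<noteq> 0" using assms(2) by simp
  have lagq: "(\<lambda>x. lam V q x * lag l V \<alpha> x) \<in> SP l (Suc m)" if "q \<in> V" "\<alpha> \<in> lag_idx m V" for q \<alpha>
  proof -
    have "(\<lambda>x. lam V q x * lag l V \<alpha> x) = (\<lambda>x. (1 / real l) * (real (Suc (\<alpha> q)) * lag l V (\<alpha>(q := Suc (\<alpha> q))) x + real (\<alpha> q) * lag l V \<alpha> x))"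
      using l by (simp only: lag_coord_mult[OF that(1), symmetric]) simp
    also have "\<dots> \<in> SP l (Suc m)"
      by (intro SP_cmult SP_add SP_lag[OF lag_idx_upd[OF that]] SP_raise[OF SP_lag[OF that(2)] assms(2)])
    finally show ?thesis .
  qed
  obtain c where f: "f = (\<lambda>x. \<Sum>\<alpha>\<in>lag_idx m V. c \<alpha> * lag l V \<alpha> x)" using assms(1) by (auto simp: SP_def)
  have "(\<lambda>x. (x \<bullet> i) * f x) = (\<lambda>x. \<Sum>q\<in>V. \<Sum>\<alpha>\<in>lag_idx m V. ((q \<bullet> i) * c \<alpha>) * (lam V q x * lag l V \<alpha> x))"
  proof
    fix x
    have "x \<bullet> i = (\<Sum>q\<in>V. lam V q x * (q \<bullet> i))"
    proof -
      have "x \<bullet> i = (\<Sum>q\<in>V. lam V q x *\<^sub>R q) \<bullet> i" by (simp only: lam_rep(2))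
      then show ?thesis by (simp only: inner_sum_left inner_scaleR_left)
    qed
    then show "(x \<bullet> i) * f x = (\<Sum>q\<in>V. \<Sum>\<alpha>\<in>lag_idx m V. ((q \<bullet> i) * c \<alpha>) * (lam V q x * lag l V \<alpha> x))"
      unfolding f by (simp add: sum_product mult_ac)
  qed
  also have "\<dots> \<in> SP l (Suc m)"
    by (intro SP_sum SP_cmult lagq)
  finally show ?thesis .
qed

lemma SP_up: "f \<in> SP l k \<Longrightarrow> k \<le> m \<Longrightarrow> m \<le> l \<Longrightarrow> f \<in> SP l m"
proof (induction m)
  case (Suc m)
  show ?case
  proof (cases "k = Suc m")
    case False
    then have "f \<in> SP l m" using Suc by simp
    then show ?thesis using Suc.prems by (intro SP_raise) simp_all
  qed (use Suc.prems in simp)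
qed simp

lemma polys_SP:
  assumes "P \<in> polys l"
  shows "P \<in> SP l l"
  using assms
proof (induction rule: polys_induct)
  case (mono \<alpha>)
  have "\<exists>k\<le>l. mono_fun \<alpha> \<in> SP l k"
    using mono
  proof (rule mono_fun_induct[where Q = "\<lambda>k f. f \<in> SP l k"])
    have "(\<lambda>_. 0) \<in> lag_idx 0 V" by (simp add: lag_idx_def)
    from SP_lag[OF this, of l] show "(\<lambda>x. 1) \<in> SP l 0" by (simp add: lag_def[abs_def])
  qed (rule SP_coord)
  then show ?case using SP_up by blast
next
  case zero
  show ?case by (rule SP_zero)
next
  case (add f g)
  then show ?case by (rule SP_add)
next
  case (scale c f)
  then show ?case by (rule SP_cmult)
qed

lemma lam_node:
  assumes "\<alpha> \<in> lag_idx l V" "l > 0" "p \<in> V"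
  shows "lam V p (lag_node l V \<alpha>) = real (\<alpha> p) / real l"
  unfolding lag_node_def
proof (rule lam_unique[OF _ assms(3)])
  have "(\<Sum>p\<in>V. real (\<alpha> p) / real l) = real (sum \<alpha> V) / real l" by (simp add: sum_divide_distrib)
  also have "sum \<alpha> V = l" using assms by (simp add: lag_idx_def)
  finally show "(\<Sum>p\<in>V. real (\<alpha> p) / real l) = 1" using assms by simp
qed

text \<open>For different multi-indices of equal sum some entry of \<open>\<alpha>\<close> exceeds
  that of \<open>\<beta>\<close>, and that binomial vanishes.\<close>

lemma lag_at_node:
  assumes "\<alpha> \<in> lag_idx l V" "\<beta> \<in> lag_idx l V" "l > 0"
  shows "lag l V \<alpha> (lag_node l V \<beta>) = (if \<alpha> = \<beta> then 1 else 0)"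
proof -
  have "lag l V \<alpha> (lag_node l V \<beta>) = (\<Prod>p\<in>V. real (\<beta> p choose \<alpha> p))"
    unfolding lag_def by (rule prod.cong) (use lam_node[OF assms(2,3)] assms(3) in \<open>auto simp: binomial_gbinomial\<close>)
  also have "\<dots> = (if \<alpha> = \<beta> then 1 else 0)"
  proof (cases "\<alpha> = \<beta>")
    case False
    have "\<exists>p\<in>V. \<beta> p < \<alpha> p"
    proof (rule ccontr)
      assume "\<not> ?thesis"
      then have le: "\<And>p. p \<in> V \<Longrightarrow> \<alpha> p \<le> \<beta> p" by force
      have "\<alpha> p = \<beta> p" for p
      proof (cases "p \<in> V")
        case True
        show ?thesis
        proof (rule ccontr)
          assume "\<alpha> p \<noteq> \<beta> p"
          then have "\<alpha> p < \<beta> p" using le[OF True] by simp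
          then have "sum \<alpha> V < sum \<beta> V" using le True fin by (intro sum_strict_mono_ex1) auto
          then show False using assms by (simp add: lag_idx_def)
        qed
      qed (use assms in \<open>simp add: lag_idx_def\<close>)
      then show False using False by auto
    qed
    then obtain p where "p \<in> V" "\<beta> p < \<alpha> p" by blast
    then have "(\<Prod>p\<in>V. real (\<beta> p choose \<alpha> p)) = 0" using fin by (intro prod_zero) (auto intro!: bexI[of _ p])
    then show ?thesis using False by simp
  qed simp
  finally show ?thesis .
qed

text \<open>Spanning gives some coefficients, and evaluation at the nodes identifies them; this
  replaces a dimension count.\<close>

lemma lag_interpolation:
  assumes "P \<in> polys l" "l > 0"
  shows "P x = (\<Sum>\<alpha>\<in>lag_idx l V. P (lag_node l V \<alpha>) * lag l V \<alpha> x)"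
proof -
  obtain c where P: "P = (\<lambda>x. \<Sum>\<alpha>\<in>lag_idx l V. c \<alpha> * lag l V \<alpha> x)" using polys_SP[OF assms(1)] by (auto simp: SP_def)
  have "P (lag_node l V \<beta>) = c \<beta>" if b: "\<beta> \<in> lag_idx l V" for \<beta>
  proof -
    have "P (lag_node l V \<beta>) = (\<Sum>\<alpha>\<in>lag_idx l V. if \<alpha> = \<beta> then c \<alpha> else 0)"
      unfolding P by (rule sum.cong) (auto simp: lag_at_node[OF _ b assms(2)])
    then show ?thesis using b finite_lag_idx[OF fin] by simp
  qed
  then show ?thesis by (subst P) simp
qed

lemma lag_node_hull:
  assumes "\<alpha> \<in> lag_idx l V" "l > 0"
  shows "lag_node l V \<alpha> \<in> convex hull V"
  unfolding mem_hull using lam_node[OF assms] by auto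

end

section \<open>Finite element functions on a mesh\<close>

text \<open>On a face the coordinates of the other vertices vanish, hence so do the basis functions
  whose index charges them. What is left refers to the vertices of the face only, which makes the
  local functions of two elements agree on their intersection.\<close>

lemma lag_sum_restrict:
  assumes "finite V" "W \<subseteq> V" "\<And>p. p \<in> V - W \<Longrightarrow> lam V p x = 0"
  shows "(\<Sum>\<alpha>\<in>lag_idx l V. val (lag_node l V \<alpha>) * lag l V \<alpha> x)
    = (\<Sum>\<alpha>\<in>lag_idx l W. val (\<Sum>p\<in>W. (real (\<alpha> p) / real l) *\<^sub>R p) * (\<Prod>p\<in>W. (real l * lam V p x) gchoose (\<alpha> p)))"
proof (rule sum.mono_neutral_cong_right[OF finite_lag_idx[OF assms(1)]])
  have sum_eq: "sum \<alpha> V = sum \<alpha> W" if "\<forall>p. p \<notin> W \<longrightarrow> \<alpha> p = 0" for \<alpha> :: "'a \<Rightarrow> nat"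
    using assms(1,2) that by (intro sum.mono_neutral_right) auto
  show "lag_idx l W \<subseteq> lag_idx l V"
    using assms(2) sum_eq by (auto simp: lag_idx_def)
  show "\<forall>\<alpha>\<in>lag_idx l V - lag_idx l W. val (lag_node l V \<alpha>) * lag l V \<alpha> x = 0"
  proof
    fix \<alpha> assume a: "\<alpha> \<in> lag_idx l V - lag_idx l W"
    have "\<exists>p\<in>V - W. \<alpha> p \<noteq> 0"
    proof (rule ccontr)
      assume "\<not> ?thesis"
      then have "\<forall>p. p \<notin> W \<longrightarrow> \<alpha> p = 0" using a by (auto simp: lag_idx_def)
      then show False using a sum_eq[of \<alpha>] by (auto simp: lag_idx_def)
    qed
    then obtain p where p: "p \<in> V - W" "\<alpha> p \<noteq> 0" by blast
    then have "(real l * lam V p x) gchoose (\<alpha> p) = 0" using assms(3)[OF p(1)] by (cases "\<alpha> p") auto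
    then have "lag l V \<alpha> x = 0" unfolding lag_def using p(1) assms(1) by (intro prod_zero) auto
    then show "val (lag_node l V \<alpha>) * lag l V \<alpha> x = 0" by simp
  qed
  fix \<alpha> assume a: "\<alpha> \<in> lag_idx l W"
  then have z: "\<alpha> p = 0" if "p \<notin> W" for p using that by (simp add: lag_idx_def)
  have "lag_node l V \<alpha> = (\<Sum>p\<in>W. (real (\<alpha> p) / real l) *\<^sub>R p)"
    unfolding lag_node_def using assms(1,2) z by (intro sum.mono_neutral_right) auto
  moreover have "lag l V \<alpha> x = (\<Prod>p\<in>W. (real l * lam V p x) gchoose (\<alpha> p))"
    unfolding lag_def using assms(1,2) z by (intro prod.mono_neutral_right) auto
  ultimately show "val (lag_node l V \<alpha>) * lag l V \<alpha> x
     = val (\<Sum>p\<in>W. (real (\<alpha> p) / real l) *\<^sub>R p) * (\<Prod>p\<in>W. (real l * lam V p x) gchoose (\<alpha> p))" by simp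
qed

lemma element_nodes_eq: "finite (vertices K) \<Longrightarrow> element_nodes l K = lag_node l (vertices K) ` lag_idx l (vertices K)"
proof (intro equalityI subsetI)
  fix z assume "z \<in> element_nodes l K"
  then obtain \<alpha> where a: "z = (\<Sum>p\<in>vertices K. (real (\<alpha> p) / real l) *\<^sub>R p)" "sum \<alpha> (vertices K) = l"
    by (auto simp: element_nodes_def)
  let ?\<beta> = "\<lambda>p. if p \<in> vertices K then \<alpha> p else 0"
  have "?\<beta> \<in> lag_idx l (vertices K)" using a(2) by (simp add: lag_idx_def)
  moreover have "z = lag_node l (vertices K) ?\<beta>" unfolding a(1) lag_node_def by (rule sum.cong) auto
  ultimately show "z \<in> lag_node l (vertices K) ` lag_idx l (vertices K)" by blast
next
  fix z assume "z \<in> lag_node l (vertices K) ` lag_idx l (vertices K)"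
  then show "z \<in> element_nodes l K" by (auto simp: element_nodes_def lag_idx_def lag_node_def)
qed

locale mesh =
  fixes \<Omega> :: "'a::euclidean_space set" and \<T> :: "'a set set" and l :: nat
  assumes dom: "polyhedral_domain \<Omega>" and conf: "conforming_mesh \<Omega> \<T>" and l: "l > 0"
begin

lemma finT: "finite \<T>" and UnT: "\<Union>\<T> = closure \<Omega>" and open_dom: "open \<Omega>"
  using dom conf by (auto simp: polyhedral_domain_def conforming_mesh_def)

lemma simplex:
  assumes "K \<in> \<T>"
  shows simplex_vertices: "full_simplex (vertices K)" and K_hull: "K = convex hull (vertices K)"
proof -
  have "int DIM('a) simplex K" using conf assms by (simp add: conforming_mesh_def)
  then obtain C where C: "\<not> affine_dependent C" "int (card C) = int DIM('a) + 1" "K = convex hull C"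
    by (auto simp: simplex_def)
  have "vertices K = C"
    using C extreme_point_of_convex_hull_affine_independent[OF C(1)] by (auto simp: vertices_def)
  then show "full_simplex (vertices K)" "K = convex hull (vertices K)"
    using C by (auto simp: full_simplex_def)
qed

lemma finV: "K \<in> \<T> \<Longrightarrow> finite (vertices K)"
  using full_simplex.fin simplex_vertices by blast

lemma compactK: "K \<in> \<T> \<Longrightarrow> compact K"
  using K_hull finV by (metis finite_imp_compact_convex_hull)

lemma convexK: "K \<in> \<T> \<Longrightarrow> convex K"
  using K_hull by (metis convex_convex_hull)

lemma interior_ne: "K \<in> \<T> \<Longrightarrow> interior K \<noteq> {}"
proof -
  assume K: "K \<in> \<T>"
  have "affine hull K = UNIV"
    using full_simplex.affine_hull_UNIV[OF simplex_vertices[OF K]] K_hull[OF K] by (metis affine_hull_convex_hull)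
  then have "rel_interior K = interior K" by (rule rel_interior_interior)
  moreover have "K \<noteq> {}"
  proof
    assume "K = {}"
    then have "convex hull (vertices K) = {}" using K_hull[OF K] by simp
    then have "card (vertices K) = 0" by (simp only: convex_hull_eq_empty card.empty)
    then show False using full_simplex.cardV[OF simplex_vertices[OF K]] by simp
  qed
  ultimately show ?thesis using rel_interior_eq_empty[OF convexK[OF K]] by simp
qed

lemma K_sub: "K \<in> \<T> \<Longrightarrow> K \<subseteq> closure \<Omega>"
  using UnT by blast

lemma interior_sub: "K \<in> \<T> \<Longrightarrow> interior K \<subseteq> \<Omega>"
  using interior_mono[OF K_sub] dom by (auto simp: polyhedral_domain_def)

lemma negl_frontier: "K \<in> \<T> \<Longrightarrow> negligible (frontier K)"
  by (rule negligible_convex_frontier[OF convexK])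

text \<open>The intersection is a face of both elements and a proper face of at least one of them; a
  proper face misses the interior.\<close>

lemma interior_disjoint:
  assumes "K \<in> \<T>" "L \<in> \<T>" "K \<noteq> L"
  shows "interior K \<inter> interior L = {}"
proof -
  have f: "(K \<inter> L) face_of K" "(K \<inter> L) face_of L" using conf assms by (auto simp: conforming_mesh_def)
  show ?thesis
  proof (cases "K \<inter> L = K")
    case True
    then have "K \<inter> L \<noteq> L" using assms(3) by blast
    from face_of_disjoint_interior[OF f(2) this] show ?thesis using interior_subset[of K] interior_subset[of L] by blast
  next
    case False
    from face_of_disjoint_interior[OF f(1) this] show ?thesis using interior_subset[of K] interior_subset[of L] by blast
  qed
qed

text \<open>Extreme points of a face are extreme points of the element, so those of the intersection
  are the common vertices; Krein-Milman recovers the intersection from them.\<close>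

lemma intersection_hull:
  assumes "K \<in> \<T>" "L \<in> \<T>"
  shows "K \<inter> L = convex hull (vertices K \<inter> vertices L)"
proof -
  have f: "(K \<inter> L) face_of K" "(K \<inter> L) face_of L" using conf assms by (auto simp: conforming_mesh_def)
  have ext: "x extreme_point_of K \<inter> L" if "x \<in> vertices K \<inter> vertices L" for x
  proof -
    have "x extreme_point_of K" "x extreme_point_of L" using that by (auto simp: vertices_def)
    then show ?thesis using extreme_point_of_face[OF f(1)] by (auto simp: extreme_point_of_def)
  qed
  have ext2: "x \<in> vertices K \<inter> vertices L" if "x extreme_point_of K \<inter> L" for x
    using that extreme_point_of_face[OF f(1)] extreme_point_of_face[OF f(2)] by (auto simp: vertices_def)
  have cp: "compact (K \<inter> L)" "convex (K \<inter> L)"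
    using compactK convexK assms by (auto intro: compact_Int convex_Int)
  have "{x. x extreme_point_of K \<inter> L} = vertices K \<inter> vertices L" using ext ext2 by blast
  then show ?thesis using Krein_Milman_Minkowski[OF cp] by simp
qed

lemma lam_on_face:
  assumes "K \<in> \<T>" "W \<subseteq> vertices K" "sum u W = 1" "p \<in> vertices K"
  shows "lam (vertices K) p (\<Sum>q\<in>W. u q *\<^sub>R q) = (if p \<in> W then u p else 0)"
proof -
  interpret full_simplex "vertices K" by (rule simplex_vertices[OF assms(1)])
  have fW: "finite W" using fin assms(2) finite_subset by blast
  have "(\<Sum>q\<in>W. u q * lam (vertices K) p q) = (\<Sum>q\<in>W. if q = p then u q else 0)"
    by (rule sum.cong) (use assms(2,4) lam_vertex in auto)
  then show ?thesis using fW assms(3) by (simp add: lam_affine_sum)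
qed

lemma lam_agree:
  assumes "K \<in> \<T>" "L \<in> \<T>" "x \<in> K \<inter> L"
  shows "p \<in> vertices K - vertices L \<Longrightarrow> lam (vertices K) p x = 0"
    and "p \<in> vertices K \<inter> vertices L \<Longrightarrow> lam (vertices K) p x = lam (vertices L) p x"
proof -
  let ?W = "vertices K \<inter> vertices L"
  have fW: "finite ?W" using finV[OF assms(1)] by blast
  have "x \<in> convex hull ?W" using assms intersection_hull by blast
  then obtain u where u: "sum u ?W = 1" "(\<Sum>v\<in>?W. u v *\<^sub>R v) = x"
    by (auto simp: convex_hull_finite[OF fW])
  show "lam (vertices K) p x = 0" if "p \<in> vertices K - vertices L"
    using lam_on_face[OF assms(1) _ u(1), of p] that u(2) by auto
  show "lam (vertices K) p x = lam (vertices L) p x" if "p \<in> vertices K \<inter> vertices L"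
    using lam_on_face[OF assms(1) _ u(1), of p] lam_on_face[OF assms(2) _ u(1), of p] that u(2) by auto
qed

definition local_fe :: "('a \<Rightarrow> real) \<Rightarrow> 'a set \<Rightarrow> 'a \<Rightarrow> real" where
  "local_fe val K x = (\<Sum>\<alpha>\<in>lag_idx l (vertices K). val (lag_node l (vertices K) \<alpha>) * lag l (vertices K) \<alpha> x)"

text \<open>The choice among the elements containing \<open>x\<close> is immaterial by
  \<open>local_fe_agree\<close>.\<close>

definition fe_fun :: "('a \<Rightarrow> real) \<Rightarrow> 'a \<Rightarrow> real" where
  "fe_fun val x = local_fe val (SOME K. K \<in> \<T> \<and> x \<in> K) x"

lemma local_fe_agree:
  assumes "K \<in> \<T>" "L \<in> \<T>" "x \<in> K" "x \<in> L"
  shows "local_fe val K x = local_fe val L x"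
proof -
  let ?W = "vertices K \<inter> vertices L"
  have x: "x \<in> K \<inter> L" "x \<in> L \<inter> K" using assms by auto
  have "local_fe val K x = (\<Sum>\<alpha>\<in>lag_idx l ?W. val (\<Sum>p\<in>?W. (real (\<alpha> p) / real l) *\<^sub>R p) * (\<Prod>p\<in>?W. (real l * lam (vertices K) p x) gchoose (\<alpha> p)))"
    unfolding local_fe_def by (rule lag_sum_restrict[OF finV[OF assms(1)]]) (use lam_agree(1)[OF assms(1,2) x(1)] in auto)
  also have "\<dots> = (\<Sum>\<alpha>\<in>lag_idx l ?W. val (\<Sum>p\<in>?W. (real (\<alpha> p) / real l) *\<^sub>R p) * (\<Prod>p\<in>?W. (real l * lam (vertices L) p x) gchoose (\<alpha> p)))"
    using lam_agree(2)[OF assms(1,2) x(1)] by simp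
  also have "\<dots> = local_fe val L x"
    unfolding local_fe_def by (rule lag_sum_restrict[symmetric, OF finV[OF assms(2)]]) (use lam_agree(1)[OF assms(2,1) x(2)] in auto)
  finally show ?thesis .
qed

lemma fe_fun_eq: "K \<in> \<T> \<Longrightarrow> x \<in> K \<Longrightarrow> fe_fun val x = local_fe val K x"
  unfolding fe_fun_def using someI[of "\<lambda>K. K \<in> \<T> \<and> x \<in> K" K] by (intro local_fe_agree) auto

lemma local_fe_polys: "K \<in> \<T> \<Longrightarrow> local_fe val K \<in> polys l"
  unfolding local_fe_def[abs_def] by (intro polys_sum polys_cmult lag_polys finV)

lemma fe_fun_space: "fe_fun val \<in> fe_space l \<Omega> \<T>"
proof -
  have "continuous_on (\<Union>K\<in>\<T>. K) (fe_fun val)"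
  proof (rule continuous_on_closed_Union[OF finT])
    fix K assume K: "K \<in> \<T>"
    show "closed K" using compactK[OF K] by (rule compact_imp_closed)
    have "continuous_on K (local_fe val K)"
      using Ck_continuous[OF polys_Ck[OF local_fe_polys[OF K], of 0]] continuous_on_subset by blast
    then show "continuous_on K (fe_fun val)"
      by (rule continuous_on_eq) (simp add: fe_fun_eq[OF K])
  qed
  moreover have "\<forall>K\<in>\<T>. \<exists>P\<in>polys l. \<forall>x\<in>K. fe_fun val x = P x"
    using local_fe_polys fe_fun_eq by blast
  ultimately show ?thesis using UnT by (simp add: fe_space_def)
qed

lemma local_fe_node:
  assumes K: "K \<in> \<T>" and "z \<in> element_nodes l K"
  shows "local_fe val K z = val z"
proof -
  interpret full_simplex "vertices K" by (rule simplex_vertices[OF K])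
  obtain \<beta> where b: "\<beta> \<in> lag_idx l (vertices K)" "z = lag_node l (vertices K) \<beta>"
    using assms(2) element_nodes_eq[OF fin] by blast
  have "local_fe val K z = (\<Sum>\<alpha>\<in>lag_idx l (vertices K). if \<alpha> = \<beta> then val (lag_node l (vertices K) \<alpha>) else 0)"
    unfolding local_fe_def b(2) by (rule sum.cong) (auto simp: lag_at_node[OF _ b(1) l])
  then show ?thesis using b finite_lag_idx[OF fin] by simp
qed

lemma node_in_K: "K \<in> \<T> \<Longrightarrow> z \<in> element_nodes l K \<Longrightarrow> z \<in> K"
proof -
  assume K: "K \<in> \<T>" and "z \<in> element_nodes l K"
  then obtain \<beta> where "\<beta> \<in> lag_idx l (vertices K)" "z = lag_node l (vertices K) \<beta>"
    using element_nodes_eq[OF finV[OF K]] by blast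
  then have "z \<in> convex hull (vertices K)"
    using full_simplex.lag_node_hull[OF simplex_vertices[OF K] _ l] by simp
  then show "z \<in> K" by (subst K_hull[OF K])
qed

text \<open>A finite element function with the required nodal values exists, namely
  \<open>fe_fun\<close> of the indicator of \<open>z\<close>, so the choice operator really yields
  one.\<close>

lemma nodal_basis:
  shows nodal_basis_space: "nodal_basis l \<Omega> \<T> z \<in> fe_space l \<Omega> \<T>"
    and nodal_basis_node: "y \<in> nodes l \<T> \<Longrightarrow> nodal_basis l \<Omega> \<T> z y = (if y = z then 1 else 0)"
proof -
  let ?f = "fe_fun (\<lambda>y. if y = z then 1 else 0)"
  have "?f y = (if y = z then 1 else 0)" if y: "y \<in> nodes l \<T>" for y
  proof -
    obtain K where K: "K \<in> \<T>" "y \<in> element_nodes l K" using y by (auto simp: nodes_def)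
    then show ?thesis using fe_fun_eq[OF K(1) node_in_K[OF K]] local_fe_node[OF K] by simp
  qed
  then have "\<exists>\<phi>. \<phi> \<in> fe_space l \<Omega> \<T> \<and> (\<forall>y\<in>nodes l \<T>. \<phi> y = (if y = z then 1 else 0))"
    using fe_fun_space by blast
  from someI_ex[OF this] show "nodal_basis l \<Omega> \<T> z \<in> fe_space l \<Omega> \<T>"
    "y \<in> nodes l \<T> \<Longrightarrow> nodal_basis l \<Omega> \<T> z y = (if y = z then 1 else 0)"
    unfolding nodal_basis_def by auto
qed

text \<open>Translates patches defined by supports into incidence. On an element having
  \<open>z\<close> as a node the basis function is a polynomial with value 1 at \<open>z\<close>,
  hence nonzero on a dense subset; on any other element it vanishes at all nodes and so
  identically.\<close>

lemma patch_iff: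
  assumes K: "K \<in> \<T>"
  shows "K \<subseteq> node_patch l \<Omega> \<T> z \<longleftrightarrow> z \<in> element_nodes l K"
proof
  interpret full_simplex "vertices K" by (rule simplex_vertices[OF K])
  let ?\<phi> = "nodal_basis l \<Omega> \<T> z"
  obtain P where P: "P \<in> polys l" "\<And>x. x \<in> K \<Longrightarrow> ?\<phi> x = P x"
    using nodal_basis_space[of z] K by (auto simp: fe_space_def)
  {
    assume z: "z \<in> element_nodes l K"
    have zK: "z \<in> K" by (rule node_in_K[OF K z])
    have "z \<in> nodes l \<T>" using z K by (auto simp: nodes_def)
    then have Pz: "P z = 1" using nodal_basis_node[of z z] P(2)[OF zK] by simp
    show "K \<subseteq> node_patch l \<Omega> \<T> z"
    proof
      fix x assume x: "x \<in> K"
      obtain p where p: "degree p \<le> l" "\<And>t. P (x + t *\<^sub>R (z - x)) = poly p t"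
        using polys_line[OF P(1), of x "z - x"] by blast
      \<comment> \<open>A nonzero polynomial on the segment from \<open>x\<close> to
        \<open>z\<close> has finitely many roots, so there are points arbitrarily near
        \<open>x\<close> with nonzero value.\<close>
      have "poly p 1 = 1" using p(2)[of 1] Pz by simp
      then have fin0: "finite {t. poly p t = 0}" by (intro poly_roots_finite) auto
      show "x \<in> node_patch l \<Omega> \<T> z"
        unfolding node_patch_def
      proof (rule closure_approachable[THEN iffD2], intro allI impI)
        fix e :: real assume e: "e > 0"
        define s where "s = min 1 (e / (norm (z - x) + 1))"
        have d: "norm (z - x) + 1 > 0" using norm_ge_zero[of "z - x"] by linarith
        have s: "s > 0" "s \<le> 1" using e d by (auto simp: s_def)
        have "infinite {0<..<s}" using s by (simp add: infinite_Ioo)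
        then have "\<not> {0<..<s} \<subseteq> {t. poly p t = 0}" using fin0 finite_subset by blast
        then obtain t where "t \<in> {0<..<s}" "poly p t \<noteq> 0" by blast
        then have t: "0 < t" "t < s" "poly p t \<noteq> 0" by simp_all
        let ?y = "x + t *\<^sub>R (z - x)"
        have "?y = (1 - t) *\<^sub>R x + t *\<^sub>R z" by (simp add: algebra_simps)
        then have y: "?y \<in> K" using convexD[OF convexK[OF K] x zK, of "1 - t" t] t s by simp
        then have "?\<phi> ?y \<noteq> 0" using P(2)[OF y] p(2)[of t] t by simp
        moreover have "dist ?y x < e"
        proof -
          have "dist ?y x = t * norm (z - x)" using t by (simp add: dist_norm)
          also have "\<dots> \<le> t * (norm (z - x) + 1)" using t by (intro mult_left_mono) auto
          also have "\<dots> < s * (norm (z - x) + 1)" using t d by (intro mult_strict_right_mono) auto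
          also have "\<dots> \<le> (e / (norm (z - x) + 1)) * (norm (z - x) + 1)" using d by (intro mult_right_mono) (auto simp: s_def)
          also have "\<dots> = e" using d by simp
          finally show ?thesis .
        qed
        ultimately show "\<exists>y\<in>{x \<in> closure \<Omega>. ?\<phi> x \<noteq> 0}. dist y x < e"
          using y K_sub[OF K] by (intro bexI[of _ ?y]) auto
      qed
    qed
  }
  {
    assume sub: "K \<subseteq> node_patch l \<Omega> \<T> z"
    show "z \<in> element_nodes l K"
    proof (rule ccontr)
      assume z: "z \<notin> element_nodes l K"
      have "P (lag_node l (vertices K) \<alpha>) = 0" if a: "\<alpha> \<in> lag_idx l (vertices K)" for \<alpha>
      proof -
        let ?y = "lag_node l (vertices K) \<alpha>"
        have y: "?y \<in> element_nodes l K" using a element_nodes_eq[OF fin] by blast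
        then have "?y \<in> nodes l \<T>" "?y \<noteq> z" using K z by (auto simp: nodes_def)
        then show ?thesis using nodal_basis_node[of ?y z] P(2)[OF node_in_K[OF K y]] by simp
      qed
      then have "P x = 0" for x using lag_interpolation[OF P(1) l, of x] by simp
      then have zero: "K \<inter> {x \<in> closure \<Omega>. ?\<phi> x \<noteq> 0} = {}" using P(2) by auto
      \<comment> \<open>The function vanishes on the open interior, which therefore misses the
        closure of its nonzero set as well.\<close>
      then have "interior K \<inter> {x \<in> closure \<Omega>. ?\<phi> x \<noteq> 0} = {}" using interior_subset by blast
      then have "interior K \<inter> node_patch l \<Omega> \<T> z = {}"
        unfolding node_patch_def using open_Int_closure_eq_empty[OF open_interior] by blast
      then show False using sub interior_subset[of K] interior_ne[OF K] by blast
    qed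
  }
qed

section \<open>Neighbouring elements\<close>

text \<open>Counting dimensions: the intersection has affine dimension d - 1 and is the hull of the
  affinely independent common vertices, so each element has exactly one further vertex.\<close>

lemma facet_vertices:
  assumes K: "K \<in> \<T>" and L: "L \<in> \<T>" and F: "interior_facet \<Omega> \<T> (K \<inter> L)"
  obtains p q where "p \<in> vertices K" "p \<notin> vertices L" "q \<in> vertices L" "q \<notin> vertices K"
    "vertices K = insert p (vertices K \<inter> vertices L)" "vertices L = insert q (vertices K \<inter> vertices L)"
    "card (vertices K \<inter> vertices L) = DIM('a)"
proof -
  let ?W = "vertices K \<inter> vertices L"
  interpret K: full_simplex "vertices K" by (rule simplex_vertices[OF K])
  interpret L: full_simplex "vertices L" by (rule simplex_vertices[OF L])
  obtain M where M: "M \<in> \<T>" "(K \<inter> L) facet_of M" using F by (auto simp: interior_facet_def)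
  interpret M: full_simplex "vertices M" by (rule simplex_vertices[OF M(1)])
  have dM: "aff_dim M = int DIM('a)"
  proof -
    have "aff_dim M = aff_dim (vertices M)" using K_hull[OF M(1)] by (metis aff_dim_convex_hull)
    then show ?thesis using aff_dim_affine_independent[OF M.indep] M.cardV by simp
  qed
  have "aff_dim (K \<inter> L) = aff_dim ?W" using intersection_hull[OF K L] by (metis aff_dim_convex_hull)
  moreover have "\<not> affine_dependent ?W" using K.indep affine_dependent_subset by blast
  ultimately have "int (card ?W) = int DIM('a)"
    using M(2) dM aff_dim_affine_independent[of ?W] by (simp add: facet_of_def)
  then have cW: "card ?W = DIM('a)" by simp
  have "card (vertices K - ?W) = 1" "card (vertices L - ?W) = 1"
    using K.cardV L.cardV cW K.fin L.fin by (simp_all add: card_Diff_subset)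
  then obtain p q where "vertices K - ?W = {p}" "vertices L - ?W = {q}" by (auto simp: card_1_singleton_iff)
  then show ?thesis using cW by (intro that[of p q]) auto
qed

text \<open>The centre \<open>c\<close> is chosen deep inside the facet: near it the coordinates of
  the facet vertices stay positive in both elements, and membership is decided by the sign of the
  coordinate of the opposite vertex. The two entries of the radius ensure this in \<open>K\<close>
  and in \<open>L\<close>.\<close>

lemma facet_neighbourhood:
  assumes K: "K \<in> \<T>" and L: "L \<in> \<T>" and F: "interior_facet \<Omega> \<T> (K \<inter> L)"
    and bK: "cball xK rK \<subseteq> K" "rK > 0" and bL: "cball xL rL \<subseteq> L" "rL > 0"
  obtains c \<nu> where "norm \<nu> = 1" "c \<in> K" "c \<in> L" "\<And>z. z \<in> K \<inter> L \<Longrightarrow> (z - c) \<bullet> \<nu> = 0"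
    "\<And>z. z \<in> ball c (min rK (2 * rL * rK / diameter K)) \<Longrightarrow> (z - c) \<bullet> \<nu> > 0 \<Longrightarrow> z \<in> interior K"
    "\<And>z. z \<in> ball c (min rK (2 * rL * rK / diameter K)) \<Longrightarrow> (z - c) \<bullet> \<nu> < 0 \<Longrightarrow> z \<in> interior L"
    "ball c (min rK (2 * rL * rK / diameter K)) \<subseteq> \<Omega>"
proof -
  let ?W = "vertices K \<inter> vertices L" and ?\<delta> = "min rK (2 * rL * rK / diameter K)"
  interpret K: full_simplex "vertices K" by (rule simplex_vertices[OF K])
  interpret L: full_simplex "vertices L" by (rule simplex_vertices[OF L])
  obtain p q where pq: "p \<in> vertices K" "p \<notin> vertices L" "q \<in> vertices L" "q \<notin> vertices K"
    "vertices K = insert p ?W" "vertices L = insert q ?W" "card ?W = DIM('a)"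
    by (rule facet_vertices[OF K L F])
  have fW: "finite ?W" using K.fin by blast
  have Wne: "?W \<noteq> {}"
  proof
    assume "?W = {}"
    then have "card ?W = 0" by (simp only: card.empty)
    then show False using pq(7) by simp
  qed
  have dK: "norm (v - w) \<le> diameter K" if "v \<in> vertices K" "w \<in> vertices K" for v w
  proof -
    have "v \<in> K" "w \<in> K" using that K_hull[OF K] hull_subset[of "vertices K" convex] by auto
    then show ?thesis using diameter_bounded_bound[OF compact_imp_bounded[OF compactK[OF K]]] by (simp add: dist_norm)
  qed
  have grad_ge: "1 \<le> norm (lamgrad (vertices K) w) * diameter K" "lamgrad (vertices K) w \<noteq> 0" if w: "w \<in> vertices K" for w
  proof -
    obtain v where v: "v \<in> vertices K" "v \<noteq> w" using pq(1,2) Wne w by blast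
    have "1 \<le> norm (lamgrad (vertices K) w) * norm (w - v)" by (rule K.vertex_distance[OF w v(1)]) (use v in auto)
    also have "\<dots> \<le> norm (lamgrad (vertices K) w) * diameter K" using dK[OF w v(1)] by (intro mult_left_mono) auto
    finally show "1 \<le> norm (lamgrad (vertices K) w) * diameter K" .
    then show "lamgrad (vertices K) w \<noteq> 0" by auto
  qed
  have hK: "diameter K > 0"
  proof -
    have "norm (lamgrad (vertices K) p) * diameter K > 0" using grad_ge(1)[OF pq(1)] by linarith
    then show ?thesis by (simp add: zero_less_mult_iff)
  qed
  have bK': "cball xK rK \<subseteq> convex hull (vertices K)" "cball xL rL \<subseteq> convex hull (vertices L)"
    using bK bL K_hull K L by auto
  define s where "s = (\<Sum>w\<in>?W. lam (vertices K) w xK)"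
  have lamK: "0 < norm (lamgrad (vertices K) w) * rK" "norm (lamgrad (vertices K) w) * rK \<le> lam (vertices K) w xK" if "w \<in> vertices K" for w
    using K.inradius_bound(2)[OF bK'(1) bK(2) that] grad_ge(2)[OF that] bK(2) by auto
  have s0: "s > 0" unfolding s_def using lamK Wne fW by (intro sum_pos) force+
  have s1: "s \<le> 1"
  proof -
    have "(\<Sum>w\<in>insert p ?W. lam (vertices K) w xK) = 1" using K.lam_rep(1)[of xK] pq(5) by metis
    then have "lam (vertices K) p xK + s = 1" using fW pq(2) by (simp add: s_def)
    then show ?thesis using lamK[OF pq(1)] by linarith
  qed
  \<comment> \<open>The coordinates of the ball centre \<open>xK\<close> with that of
    \<open>p\<close> dropped and the rest renormalized. Since s is at most 1 they only grow, so they
    keep the lower bound from the inscribed ball.\<close>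
  define \<mu> where "\<mu> w = lam (vertices K) w xK / s" for w
  define c where "c = (\<Sum>w\<in>?W. \<mu> w *\<^sub>R w)"
  have \<mu>1: "sum \<mu> ?W = 1" using s0 by (simp add: \<mu>_def s_def flip: sum_divide_distrib)
  have \<mu>ge: "norm (lamgrad (vertices K) w) * rK \<le> \<mu> w" if w: "w \<in> ?W" for w
  proof -
    have lx: "lam (vertices K) w xK > 0" using lamK[of w] w by fastforce
    then have "lam (vertices K) w xK * s \<le> lam (vertices K) w xK * 1" using s1 by (intro mult_left_mono) auto
    then have "lam (vertices K) w xK \<le> \<mu> w" using s0 by (simp add: \<mu>_def pos_le_divide_eq)
    then show ?thesis using lamK(2)[of w] w by auto
  qed
  have lamKc: "lam (vertices K) w c = (if w \<in> ?W then \<mu> w else 0)" if "w \<in> vertices K" for w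
    unfolding c_def by (rule lam_on_face[OF K _ \<mu>1 that]) auto
  have lamLc: "lam (vertices L) w c = (if w \<in> ?W then \<mu> w else 0)" if "w \<in> vertices L" for w
    unfolding c_def by (rule lam_on_face[OF L _ \<mu>1 that]) auto
  have \<mu>pos: "\<mu> w > 0" if "w \<in> ?W" for w using \<mu>ge[OF that] lamK(1)[of w] that by auto
  have cKL: "c \<in> K \<inter> L"
    unfolding intersection_hull[OF K L] convex_hull_finite[OF fW] c_def using \<mu>1 \<mu>pos by (intro CollectI exI[of _ \<mu>]) (auto intro: less_imp_le)
  have lamK_near: "lam (vertices K) w z > 0" if "w \<in> ?W" "norm (z - c) < rK" for w z
  proof -
    have "lam (vertices K) w c - lam (vertices K) w z = lamgrad (vertices K) w \<bullet> (c - z)" by (rule lam_diff)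
    also have "\<dots> \<le> norm (lamgrad (vertices K) w) * norm (z - c)"
      using norm_cauchy_schwarz[of "lamgrad (vertices K) w" "c - z"] by (simp add: norm_minus_commute)
    also have "\<dots> < norm (lamgrad (vertices K) w) * rK"
      using that grad_ge(2)[of w] by (intro mult_strict_left_mono) auto
    finally show ?thesis using \<mu>ge[OF that(1)] lamKc[of w] that(1) by auto
  qed
  \<comment> \<open>In \<open>L\<close> the point \<open>c\<close> has the same coordinates, which
    are at least rK / diameter K, and the gradients are at most 1 / (2 rL); the quotient is the
    second radius.\<close>
  have lamL_near: "lam (vertices L) w z > 0" if w: "w \<in> ?W" and z: "norm (z - c) < 2 * rL * rK / diameter K" for w z
  proof -
    have "lam (vertices L) w c - lam (vertices L) w z = lamgrad (vertices L) w \<bullet> (c - z)" by (rule lam_diff)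
    also have "\<dots> \<le> norm (lamgrad (vertices L) w) * norm (z - c)"
      using norm_cauchy_schwarz[of "lamgrad (vertices L) w" "c - z"] by (simp add: norm_minus_commute)
    finally have 1: "lam (vertices L) w c - lam (vertices L) w z \<le> norm (lamgrad (vertices L) w) * norm (z - c)" .
    have 2: "norm (lamgrad (vertices L) w) * (2 * rL) \<le> 1"
      using L.inradius_bound(1)[OF bK'(2) bL(2), of w] w by auto
    have 3: "1 \<le> norm (lamgrad (vertices K) w) * diameter K" using grad_ge(1)[of w] w by auto
    have "rK / diameter K \<le> norm (lamgrad (vertices K) w) * rK"
    proof -
      have "1 * rK \<le> (norm (lamgrad (vertices K) w) * diameter K) * rK" using 3 bK(2) by (intro mult_right_mono) auto
      then show ?thesis using hK by (simp add: field_simps)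
    qed
    then have 4: "rK / diameter K \<le> \<mu> w" using \<mu>ge[OF w] by linarith
    have "norm (lamgrad (vertices L) w) * norm (z - c) < rK / diameter K"
    proof (cases "lamgrad (vertices L) w = 0")
      case True
      then show ?thesis using hK bK(2) by simp
    next
      case False
      then have "norm (lamgrad (vertices L) w) * norm (z - c) < norm (lamgrad (vertices L) w) * (2 * rL * rK / diameter K)"
        using z by (intro mult_strict_left_mono) auto
      also have "\<dots> = (norm (lamgrad (vertices L) w) * (2 * rL)) * (rK / diameter K)" by simp
      also have "\<dots> \<le> 1 * (rK / diameter K)" using 2 hK bK(2) by (intro mult_right_mono) auto
      finally show ?thesis by simp
    qed
    then show ?thesis using 1 4 lamLc[of w] w by auto
  qed
  have memK: "z \<in> K" if "lam (vertices K) p z \<ge> 0" "norm (z - c) < rK" for z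
  proof -
    have "\<forall>w\<in>vertices K. 0 \<le> lam (vertices K) w z"
    proof
      fix w assume "w \<in> vertices K"
      then have "w = p \<or> w \<in> ?W" using pq(5) by blast
      then show "0 \<le> lam (vertices K) w z" using that lamK_near[of w z] by force
    qed
    then have "z \<in> convex hull (vertices K)" using K.mem_hull by blast
    then show ?thesis using K_hull[OF K] by simp
  qed
  have memL: "z \<in> L" if "lam (vertices L) q z \<ge> 0" "norm (z - c) < 2 * rL * rK / diameter K" for z
  proof -
    have "\<forall>w\<in>vertices L. 0 \<le> lam (vertices L) w z"
    proof
      fix w assume "w \<in> vertices L"
      then have "w = q \<or> w \<in> ?W" using pq(6) by blast
      then show "0 \<le> lam (vertices L) w z" using that lamL_near[of w z] by force
    qed
    then have "z \<in> convex hull (vertices L)" using L.mem_hull by blast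
    then show ?thesis using K_hull[OF L] by simp
  qed
  have pF: "lam (vertices K) p z = 0" if "z \<in> K \<inter> L" for z
    using lam_agree(1)[OF K L that, of p] pq by auto
  have qF: "lam (vertices L) q z = 0" if "z \<in> K \<inter> L" for z
    using lam_agree(1)[OF L K, of z q] that pq by auto
  \<comment> \<open>Both functions are affine and vanish at the common vertices, so they are
    proportional; the factor is read off at \<open>q\<close>.\<close>
  have prp: "lam (vertices K) p z = lam (vertices L) q z * lam (vertices K) p q" for z
  proof -
    have "lam (vertices K) p z = lam (vertices K) p (\<Sum>v\<in>vertices L. lam (vertices L) v z *\<^sub>R v)"
      by (simp only: L.lam_rep(2))
    also have "\<dots> = (\<Sum>v\<in>vertices L. lam (vertices L) v z * lam (vertices K) p v)"
      by (rule lam_affine_sum[OF L.lam_rep(1)])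
    also have "\<dots> = (\<Sum>v\<in>vertices L. if v = q then lam (vertices L) q z * lam (vertices K) p q else 0)"
    proof (rule sum.cong[OF refl])
      fix v assume "v \<in> vertices L"
      then have "v = q \<or> v \<in> ?W" using pq(6) by blast
      then show "lam (vertices L) v z * lam (vertices K) p v = (if v = q then lam (vertices L) q z * lam (vertices K) p q else 0)"
      proof
        assume v: "v \<in> ?W"
        then have "v \<in> vertices K" "p \<noteq> v" "v \<noteq> q" using pq(2,4) by auto
        then show ?thesis using K.lam_vertex[OF pq(1), of v] by simp
      qed simp
    qed
    also have "\<dots> = lam (vertices L) q z * lam (vertices K) p q" using pq(3) L.fin by simp
    finally show ?thesis .
  qed
  \<comment> \<open>The elements lie on opposite sides: otherwise a point slightly off
    \<open>c\<close> towards \<open>q\<close> would belong to both elements although its coordinate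
    for \<open>q\<close> is positive.\<close>
  have neg: "lam (vertices K) p q < 0"
  proof (rule ccontr)
    assume "\<not> lam (vertices K) p q < 0"
    then have nn: "lam (vertices K) p q \<ge> 0" by simp
    define t where "t = min 1 (rK / (2 * (norm (q - c) + 1)))"
    have d: "norm (q - c) + 1 > 0" using norm_ge_zero[of "q - c"] by linarith
    have t: "0 < t" "t \<le> 1" using bK(2) d by (auto simp: t_def)
    let ?y = "c + t *\<^sub>R (q - c)"
    have "norm (?y - c) = t * norm (q - c)" using t by simp
    also have "\<dots> \<le> t * (norm (q - c) + 1)" using t by (intro mult_left_mono) auto
    also have "\<dots> \<le> (rK / (2 * (norm (q - c) + 1))) * (norm (q - c) + 1)" using d by (intro mult_right_mono) (auto simp: t_def)
    also have "\<dots> = rK / 2" using d by (simp add: field_simps)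
    also have "\<dots> < rK" using bK(2) by simp
    finally have ny: "norm (?y - c) < rK" .
    have qL: "q \<in> L" using pq(3) K_hull[OF L] hull_subset[of "vertices L" convex] by auto
    have "?y = (1 - t) *\<^sub>R c + t *\<^sub>R q" by (simp add: algebra_simps)
    then have yL: "?y \<in> L" using convexD[OF convexK[OF L] _ qL, of c "1 - t" t] cKL t by simp
    have "lam (vertices L) q ?y - lam (vertices L) q c = t * (lam (vertices L) q q - lam (vertices L) q c)"
      by (simp add: lam_diff)
    then have qy: "lam (vertices L) q ?y = t" using qF[OF cKL] L.lam_vertex[OF pq(3,3)] by simp
    then have "lam (vertices K) p ?y \<ge> 0" using prp[of ?y] nn t by simp
    from memK[OF this ny] yL have "lam (vertices L) q ?y = 0" using qF by blast
    then show False using qy t by simp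
  qed
  define n where "n = lamgrad (vertices K) p"
  have n0: "n \<noteq> 0" using grad_ge(2)[OF pq(1)] by (simp add: n_def)
  define \<nu> where "\<nu> = (1 / norm n) *\<^sub>R n"
  have \<nu>: "lam (vertices K) p z = norm n * ((z - c) \<bullet> \<nu>)" for z
    using lam_diff[of "vertices K" p z c] pF[OF cKL] n0 by (simp add: \<nu>_def n_def inner_commute)
  have inK: "z \<in> K" if "z \<in> ball c ?\<delta>" "(z - c) \<bullet> \<nu> \<ge> 0" for z
    using that by (intro memK) (auto simp: \<nu> dist_norm norm_minus_commute)
  have inL: "z \<in> L" if z: "z \<in> ball c ?\<delta>" "(z - c) \<bullet> \<nu> \<le> 0" for z
  proof (rule memL)
    show "norm (z - c) < 2 * rL * rK / diameter K" using z(1) by (auto simp: dist_norm norm_minus_commute)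
    have "lam (vertices K) p z \<le> 0" using z(2) by (simp add: \<nu> mult_nonneg_nonpos)
    then have "lam (vertices L) q z * lam (vertices K) p q \<le> 0" using prp[of z] by simp
    then show "lam (vertices L) q z \<ge> 0" using neg by (simp add: mult_le_0_iff)
  qed
  show ?thesis
  proof (rule that[of \<nu> c])
    show "norm \<nu> = 1" using n0 by (simp add: \<nu>_def)
    show "c \<in> K" "c \<in> L" using cKL by auto
    show "(z - c) \<bullet> \<nu> = 0" if "z \<in> K \<inter> L" for z using pF[OF that] \<nu>[of z] n0 by simp
    have op: "open (ball c ?\<delta> \<inter> {z. \<nu> \<bullet> z > \<nu> \<bullet> c})" "open (ball c ?\<delta> \<inter> {z. \<nu> \<bullet> z < \<nu> \<bullet> c})"
      by (intro open_Int open_ball open_halfspace_gt open_halfspace_lt)+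
    have "ball c ?\<delta> \<inter> {z. \<nu> \<bullet> z > \<nu> \<bullet> c} \<subseteq> interior K"
      using inK by (intro interior_maximal op) (auto simp: inner_diff_rearrange)
    then show "z \<in> interior K" if "z \<in> ball c ?\<delta>" "(z - c) \<bullet> \<nu> > 0" for z
      using that by (auto simp: inner_diff_rearrange)
    have "ball c ?\<delta> \<inter> {z. \<nu> \<bullet> z < \<nu> \<bullet> c} \<subseteq> interior L"
      using inL by (intro interior_maximal op) (auto simp: inner_diff_rearrange)
    then show "z \<in> interior L" if "z \<in> ball c ?\<delta>" "(z - c) \<bullet> \<nu> < 0" for z
      using that by (auto simp: inner_diff_rearrange)
    have "ball c ?\<delta> \<subseteq> K \<union> L"
    proof
      fix z assume z: "z \<in> ball c ?\<delta>"
      show "z \<in> K \<union> L" using inK[OF z] inL[OF z] by (cases "(z - c) \<bullet> \<nu> \<ge> 0") auto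
    qed
    \<comment> \<open>Here the absence of cracks enters: an open ball in the closure of the domain
      lies in the domain.\<close>
    then have "ball c ?\<delta> \<subseteq> closure \<Omega>" using K_sub K L by blast
    then have "ball c ?\<delta> \<subseteq> interior (closure \<Omega>)" by (intro interior_maximal) auto
    then show "ball c ?\<delta> \<subseteq> \<Omega>" using dom by (simp add: polyhedral_domain_def)
  qed
qed

text \<open>In dimension at least two the common facet has two vertices, and their edge is at least
  2 rK long because a coordinate of \<open>K\<close> has to fall from 1 to 0 along it with slope at
  most 1 / (2 rK).\<close>

lemma neighbour_diameter:
  assumes K: "K \<in> \<T>" and L: "L \<in> \<T>" and F: "interior_facet \<Omega> \<T> (K \<inter> L)" and d: "DIM('a) \<ge> 2"
    and bK: "cball xK rK \<subseteq> K" "rK > 0"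
  shows "2 * rK \<le> diameter L"
proof -
  let ?W = "vertices K \<inter> vertices L"
  interpret K: full_simplex "vertices K" by (rule simplex_vertices[OF K])
  obtain p q where "card ?W = DIM('a)" by (rule facet_vertices[OF K L F])
  then have "\<not> card ?W \<le> Suc 0" using d by simp
  then obtain v w where vw: "v \<in> ?W" "w \<in> ?W" "v \<noteq> w"
    using K.fin by (metis card_le_Suc0_iff_eq finite_Int)
  have "cball xK rK \<subseteq> convex hull (vertices K)" using bK K_hull[OF K] by simp
  then have 1: "norm (lamgrad (vertices K) v) * (2 * rK) \<le> 1" using K.inradius_bound(1) bK(2) vw(1) by auto
  have 2: "1 \<le> norm (lamgrad (vertices K) v) * norm (v - w)" using K.vertex_distance[of v w] vw by auto
  then have "norm (lamgrad (vertices K) v) \<noteq> 0" by auto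
  then have "norm (lamgrad (vertices K) v) > 0" by simp
  moreover have "norm (lamgrad (vertices K) v) * (2 * rK) \<le> norm (lamgrad (vertices K) v) * norm (v - w)"
    using 1 2 by (rule order.trans)
  ultimately have "2 * rK \<le> norm (v - w)" by (simp only: mult_le_cancel_left_pos)
  also have "\<dots> \<le> diameter L"
  proof -
    have "v \<in> L" "w \<in> L" using vw K_hull[OF L] hull_subset[of "vertices L" convex] by auto
    then show ?thesis using diameter_bounded_bound[OF compact_imp_bounded[OF compactK[OF L]]] by (simp add: dist_norm)
  qed
  finally show ?thesis .
qed

end

section \<open>Stability of the quasi-interpolation\<close>

lemma sum_abs_squared_le: "(\<Sum>i\<in>A. \<bar>e i\<bar>)\<^sup>2 \<le> real (card A) * (\<Sum>i\<in>A. (e i :: real)\<^sup>2)"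
  using sum_squared_le_sum_of_squares[of "\<lambda>i. \<bar>e i\<bar>" A] by (cases "finite A") (auto simp: mult.commute)

lemma norm_diff_sq_le: "(norm (a - b))\<^sup>2 \<le> 2 * (norm a)\<^sup>2 + 2 * (norm (b::'a::real_inner))\<^sup>2"
proof -
  have "norm (a - b) \<le> norm a + norm b" by (rule norm_triangle_ineq4)
  then have "(norm (a - b))\<^sup>2 \<le> (norm a + norm b)\<^sup>2" by (intro power_mono) auto
  moreover have "0 \<le> (norm a - norm b)\<^sup>2" by simp
  ultimately show ?thesis by (simp add: power2_eq_square algebra_simps)
qed

lemma gchoose_abs_le:
  assumes "0 \<le> a" "a \<le> real n" "k \<le> n"
  shows "\<bar>a gchoose k\<bar> \<le> real n ^ k"
  using assms(3)
proof (induction k)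
  case (Suc k)
  have "\<bar>a - real k\<bar> \<le> real n" using assms Suc.prems by auto
  then have "\<bar>a - real k\<bar> * \<bar>a gchoose k\<bar> \<le> real n * real n ^ k" using Suc by (intro mult_mono) auto
  moreover have "\<bar>a gchoose (Suc k)\<bar> \<le> \<bar>a - real k\<bar> * \<bar>a gchoose k\<bar>"
  proof -
    have "\<bar>a gchoose (Suc k)\<bar> = \<bar>a - real k\<bar> * \<bar>a gchoose k\<bar> / real (Suc k)"
      by (simp add: gchoose_Suc_mult abs_mult del: of_nat_Suc)
    also have "\<dots> \<le> \<bar>a - real k\<bar> * \<bar>a gchoose k\<bar> / 1" by (intro divide_left_mono) auto
    finally show ?thesis by simp
  qed
  ultimately show ?case by simp
qed simp

text \<open>The barycentric coordinates lie in [0, 1], so each generalized binomial is at most l to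
  the power of its index, and the indices add up to l.\<close>

lemma (in full_simplex) lag_abs_le:
  assumes "\<alpha> \<in> lag_idx l V" "x \<in> convex hull V"
  shows "\<bar>lag l V \<alpha> x\<bar> \<le> real l ^ l"
proof -
  have "\<bar>lag l V \<alpha> x\<bar> = (\<Prod>p\<in>V. \<bar>(real l * lam V p x) gchoose (\<alpha> p)\<bar>)"
    unfolding lag_def by (rule abs_prod)
  also have "\<dots> \<le> (\<Prod>p\<in>V. real l ^ \<alpha> p)"
  proof (rule prod_mono)
    fix p assume p: "p \<in> V"
    have "0 \<le> lam V p x" "lam V p x \<le> 1" using assms(2) p mem_hull lam_le_1 by auto
    moreover have "\<alpha> p \<le> l" using member_le_sum[of p V \<alpha>] p fin assms(1) by (auto simp: lag_idx_def)
    ultimately show "0 \<le> \<bar>(real l * lam V p x) gchoose (\<alpha> p)\<bar> \<and> \<bar>(real l * lam V p x) gchoose (\<alpha> p)\<bar> \<le> real l ^ \<alpha> p"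
      by (intro conjI gchoose_abs_le) (auto intro: mult_left_le)
  qed
  also have "\<dots> = real l ^ sum \<alpha> V" by (simp add: power_sum)
  finally show ?thesis using assms(1) by (simp add: lag_idx_def)
qed

text \<open>A Markov-type inequality: the growth bound for t tending to 0 controls the derivative at
  \<open>x\<close> towards every point of \<open>K\<close>, and two opposite points of the inscribed
  ball along the gradient turn this into a bound for its norm.\<close>

lemma polys_gradient_bound:
  fixes x :: "'a::euclidean_space"
  assumes Q: "Q \<in> polys n" and K: "convex K" "\<And>y. y \<in> K \<Longrightarrow> \<bar>Q y\<bar> \<le> M" and b: "cball c r \<subseteq> K" "r > 0" and x: "x \<in> K"
  shows "norm (grad Q x) * r \<le> poly_const n 1 * M"
proof -
  have dir: "\<bar>grad Q x \<bullet> (y - x)\<bar> \<le> poly_const n 1 * M" if y: "y \<in> K" for y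
  proof -
    let ?f = "\<lambda>t. Q (x + t *\<^sub>R (y - x))"
    have f: "((\<lambda>t. x + t *\<^sub>R (y - x)) has_derivative (\<lambda>t. t *\<^sub>R (y - x))) (at 0)"
      by (auto intro!: derivative_eq_intros)
    have gQ: "(Q has_derivative (\<lambda>h. grad Q x \<bullet> h)) (at (x + 0 *\<^sub>R (y - x)))"
      using Ck1_grad[OF polys_Ck[OF Q], of x] by simp
    have "(?f has_derivative (\<lambda>t. grad Q x \<bullet> (t *\<^sub>R (y - x)))) (at 0)"
      by (rule has_derivative_compose[OF f gQ])
    moreover have "(\<lambda>t. grad Q x \<bullet> (t *\<^sub>R (y - x))) = (*) (grad Q x \<bullet> (y - x))"
      by (auto simp: fun_eq_iff)
    ultimately have "(?f has_real_derivative (grad Q x \<bullet> (y - x))) (at 0)"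
      by (simp add: has_field_derivative_def)
    then have "((\<lambda>h. (?f h - ?f 0) / h) \<longlongrightarrow> grad Q x \<bullet> (y - x)) (at 0)"
      by (simp add: DERIV_def)
    then have "((\<lambda>h. \<bar>(?f h - ?f 0) / h\<bar>) \<longlongrightarrow> \<bar>grad Q x \<bullet> (y - x)\<bar>) (at 0)"
      by (rule tendsto_rabs)
    moreover have "\<forall>\<^sub>F h in at 0. \<bar>(?f h - ?f 0) / h\<bar> \<le> poly_const n 1 * M"
      unfolding eventually_at
    proof (intro exI[of _ 1] conjI ballI impI)
      fix h :: real assume h: "h \<noteq> 0 \<and> dist h 0 < 1"
      have "\<bar>Q (x + h *\<^sub>R (y - x)) - Q x\<bar> \<le> poly_const n 1 * \<bar>h\<bar> * M"
      proof (rule polys_ray_growth[OF Q])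
        show "\<bar>h\<bar> \<le> 1" using h by simp
        fix s :: real assume s: "s \<in> {0..1}"
        have "x + s *\<^sub>R (y - x) = (1 - s) *\<^sub>R x + s *\<^sub>R y" by (simp add: algebra_simps)
        then have "x + s *\<^sub>R (y - x) \<in> K" using convexD[OF K(1) x y, of "1 - s" s] s by simp
        then show "\<bar>Q (x + s *\<^sub>R (y - x))\<bar> \<le> M" by (rule K(2))
      qed
      then show "\<bar>(?f h - ?f 0) / h\<bar> \<le> poly_const n 1 * M"
        using h by (simp add: field_simps)
    qed simp
    ultimately show ?thesis by (intro tendsto_upperbound) auto
  qed
  have "\<exists>q. norm (grad Q x) * r = grad Q x \<bullet> q \<and> norm q \<le> r"
  proof (cases "grad Q x = 0")
    case True
    then show ?thesis using b(2) by (intro exI[of _ 0]) auto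
  next
    case False
    then show ?thesis using b(2)
      by (intro exI[of _ "(r / norm (grad Q x)) *\<^sub>R grad Q x"]) (auto simp: power2_norm_eq_inner[symmetric] power2_eq_square)
  qed
  then obtain q where q: "norm (grad Q x) * r = grad Q x \<bullet> q" "norm q \<le> r" by blast
  have "c + q \<in> K" "c - q \<in> K" using q(2) b(1) by (auto simp: dist_norm subset_iff)
  then have "\<bar>grad Q x \<bullet> (c + q - x)\<bar> \<le> poly_const n 1 * M" "\<bar>grad Q x \<bullet> (c - q - x)\<bar> \<le> poly_const n 1 * M"
    using dir by auto
  \<comment> \<open>Subtracting removes the unknown position of \<open>x\<close> relative to the
    ball.\<close>
  moreover have "2 * (grad Q x \<bullet> q) = grad Q x \<bullet> (c + q - x) - grad Q x \<bullet> (c - q - x)"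
    by (simp add: inner_diff_right inner_add_right)
  ultimately have "2 * (grad Q x \<bullet> q) \<le> 2 * (poly_const n 1 * M)" by linarith
  then show ?thesis using q(1) by simp
qed

text \<open>The fraction \<open>k\<close> for \<open>polys_disc_bound\<close>: the second entry
  keeps the oscillation below one half, and the entry 1/2 makes \<rho> at most \<delta>/8.\<close>

definition bump_ratio :: "nat \<Rightarrow> real" where
  "bump_ratio l = min (1 / 2) (1 / (2 * (poly_const l 1 * (1 + 2 * poly_const l 2) + 1)))"

text \<open>Lower bound for the radius in \<open>facet_neighbourhood\<close> relative to the
  diameter h of \<open>K\<close>, from rK >= h/(4\<sigma>) and rL >= h/(8\<sigma>^2).\<close>

definition facet_ratio :: "real \<Rightarrow> real" where
  "facet_ratio \<sigma> = min (1 / (4 * \<sigma>)) (1 / (16 * \<sigma> ^ 3))"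

text \<open>The constant of \<open>jump_bound\<close>, with 384 = 4 times 96, lengths bounded by (1
  + 2\<sigma>) diameter K, and an element within 4 / facet_ratio times the disc radius \<delta>/4 of
  the centre.\<close>

definition jump_const :: "'a::euclidean_space itself \<Rightarrow> nat \<Rightarrow> real \<Rightarrow> real" where
  "jump_const T l \<sigma> = (1 + poly_const l (4 / facet_ratio \<sigma>) * (4 / facet_ratio \<sigma>))\<^sup>2 * 384 * (1 + 2 * \<sigma>)\<^sup>2
     * (moll_bound T / (bump_ratio l * facet_ratio \<sigma> / 4) ^ DIM('a))"

text \<open>Recursion from (x + y)^2 <= 2x^2 + 2y^2: the term 4C is for the first jump, whose two
  energies are each at most the patch sum, and the power of 2\<sigma> is for passing from the
  diameter of one element to the next.\<close>

primrec chain_const :: "nat \<Rightarrow> real \<Rightarrow> real \<Rightarrow> nat \<Rightarrow> real" where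
  "chain_const d \<sigma> C 0 = 0"
| "chain_const d \<sigma> C (Suc m) = 4 * C + 2 * (2 * \<sigma>) ^ (d - 2) * chain_const d \<sigma> C m"

definition patch_const :: "'a::euclidean_space itself \<Rightarrow> real \<Rightarrow> nat" where
  "patch_const T \<sigma> = nat \<lceil>(4 * \<sigma>) ^ DIM('a)\<rceil>"

text \<open>A sum over all admissible path lengths in place of a maximum.\<close>

definition path_const :: "'a::euclidean_space itself \<Rightarrow> nat \<Rightarrow> real \<Rightarrow> real" where
  "path_const T l \<sigma> = (\<Sum>m\<le>(patch_const T \<sigma>)\<^sup>2. chain_const DIM('a) \<sigma> (jump_const T l \<sigma>) m)"

text \<open>Volume of a ball containing the element, gradient bound for the interpolant of the nodal
  errors, and the number of nodes from Cauchy-Schwarz.\<close>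

definition interp_const :: "'a::euclidean_space itself \<Rightarrow> nat \<Rightarrow> real \<Rightarrow> real" where
  "interp_const T l \<sigma> = unit_ball_vol (real DIM('a)) * (poly_const l 1 * (4 * \<sigma>) * real l ^ l)\<^sup>2 * real ((l + 1) ^ Suc DIM('a))"

definition stability_const :: "'a::euclidean_space itself \<Rightarrow> nat \<Rightarrow> real \<Rightarrow> real" where
  "stability_const T l \<sigma> = 2 + 2 * interp_const T l \<sigma> * path_const T l \<sigma> * real (patch_const T \<sigma>) * real ((l + 1) ^ Suc DIM('a))"

lemma bump_ratio: "bump_ratio l > 0" "bump_ratio l \<le> 1 / 2"
  "poly_const l 1 * bump_ratio l * (1 + 2 * poly_const l 2) \<le> 1 / 2"
proof -
  define A where "A = poly_const l 1 * (1 + 2 * poly_const l 2)"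
  have A: "A \<ge> 0" using poly_const(1)[of 1 l] poly_const(1)[of 2 l] by (simp add: A_def)
  then show "bump_ratio l > 0" "bump_ratio l \<le> 1 / 2" by (auto simp: bump_ratio_def A_def[symmetric])
  have "A * bump_ratio l \<le> A * (1 / (2 * (A + 1)))"
    using A by (intro mult_left_mono) (auto simp: bump_ratio_def A_def[symmetric])
  also have "\<dots> \<le> 1 / 2" using A by (simp add: field_simps)
  finally show "poly_const l 1 * bump_ratio l * (1 + 2 * poly_const l 2) \<le> 1 / 2"
    by (simp add: A_def mult_ac)
qed

text \<open>Fixes one square integrable weak gradient \<open>g\<close> of \<open>u\<close>, so that
  energies are ordinary integrals and the choice operator is met only at the end.\<close>

locale weighted_mesh = mesh \<Omega> \<T> l for \<Omega> :: "'a::euclidean_space set" and \<T> l +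
  fixes \<sigma> :: real and u :: "'a \<Rightarrow> real" and g :: "'a \<Rightarrow> 'a" and aK :: "'a set \<Rightarrow> real"
  assumes shape: "shape_bounded \<T> \<sigma>" and wg: "is_weak_gradient \<Omega> u g" and L2: "L2_on \<Omega> g"
    and apos: "\<And>K. K \<in> \<T> \<Longrightarrow> aK K > 0" and qm: "quasi_monotone l \<Omega> \<T> aK"
begin

definition E :: "'a set \<Rightarrow> ('a \<Rightarrow> real) \<Rightarrow> real" where
  "E K P = (LINT z:interior K|lebesgue. (norm (g z - grad P z))\<^sup>2)"

lemma E_nonneg: "E K P \<ge> 0"
  unfolding E_def set_lebesgue_integral_def by (auto intro!: Bochner_Integration.integral_nonneg)

lemma finite_measure_K: "K \<in> \<T> \<Longrightarrow> emeasure lebesgue (interior K) < \<infinity>"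
  using emeasure_bounded_finite[of "interior K"] bounded_subset[OF compact_imp_bounded[OF compactK] interior_subset]
  by (auto simp: less_top)

lemma E_integrable:
  assumes K: "K \<in> \<T>" and P: "P \<in> polys m"
  shows "set_integrable lebesgue (interior K) (\<lambda>z. (norm (g z - grad P z))\<^sup>2)"
  unfolding set_integrable_def
proof -
  obtain B where B: "\<And>z. z \<in> K \<Longrightarrow> norm (grad P z) \<le> B"
  proof -
    have "bounded (grad P ` K)"
      by (intro compact_imp_bounded compact_continuous_image compactK[OF K] continuous_on_subset[OF continuous_grad[OF polys_Ck[OF P]]]) auto
    then show ?thesis using that unfolding bounded_iff by blast
  qed
  have IK: "interior K \<in> sets lebesgue" by auto
  have gm: "(\<lambda>z. indicator \<Omega> z *\<^sub>R g z) \<in> borel_measurable lebesgue" and g2: "integrable lebesgue (\<lambda>z. indicator \<Omega> z *\<^sub>R (norm (g z))\<^sup>2)"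
    using L2 by (auto simp: L2_on_def set_borel_measurable_def set_integrable_def)
  have "(\<lambda>z. indicator (interior K) z *\<^sub>R (indicator \<Omega> z *\<^sub>R g z - grad P z)) \<in> borel_measurable lebesgue"
    by (intro borel_measurable_scaleR borel_measurable_indicator IK borel_measurable_diff gm
        lebesgue_measurable_continuous continuous_grad polys_Ck[OF P])
  then have "(\<lambda>z. (norm (indicator (interior K) z *\<^sub>R (indicator \<Omega> z *\<^sub>R g z - grad P z)))\<^sup>2) \<in> borel_measurable lebesgue"
    by measurable
  also have "(\<lambda>z. (norm (indicator (interior K) z *\<^sub>R (indicator \<Omega> z *\<^sub>R g z - grad P z)))\<^sup>2)
     = (\<lambda>z. indicator (interior K) z *\<^sub>R (norm (g z - grad P z))\<^sup>2)"
    using interior_sub[OF K] by (auto simp: indicator_def fun_eq_iff)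
  finally have m: "(\<lambda>z. indicator (interior K) z *\<^sub>R (norm (g z - grad P z))\<^sup>2) \<in> borel_measurable lebesgue" .
  have i: "integrable lebesgue (\<lambda>z. 2 * (indicator \<Omega> z *\<^sub>R (norm (g z))\<^sup>2) + 2 * B\<^sup>2 * indicator (interior K) z)"
    using finite_measure_K[OF K] IK g2 by (intro Bochner_Integration.integrable_add integrable_mult_right integrable_real_indicator) auto
  show "integrable lebesgue (\<lambda>z. indicator (interior K) z *\<^sub>R (norm (g z - grad P z))\<^sup>2)"
  proof (rule Bochner_Integration.integrable_bound[OF i m], rule AE_I2)
    fix z
    show "norm (indicator (interior K) z *\<^sub>R (norm (g z - grad P z))\<^sup>2) \<le> norm (2 * (indicator \<Omega> z *\<^sub>R (norm (g z))\<^sup>2) + 2 * B\<^sup>2 * indicator (interior K) z)"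
    proof (cases "z \<in> interior K")
      case True
      then have z: "z \<in> \<Omega>" "z \<in> K" using interior_sub[OF K] interior_subset by auto
      have "(norm (grad P z))\<^sup>2 \<le> B\<^sup>2" using B[OF z(2)] by (intro power_mono) auto
      then show ?thesis using norm_diff_sq_le[of "g z" "grad P z"] True z by simp
    qed simp
  qed
qed

text \<open>The supremum of the inball diameters is only approximated: a ball with more than half of
  it is taken, hence 4\<sigma>r where an optimal ball would give 2\<sigma>r.\<close>

lemma inball:
  assumes K: "K \<in> \<T>"
  shows "\<exists>x r. r > 0 \<and> cball x r \<subseteq> K \<and> diameter K \<le> 4 * \<sigma> * r"
proof -
  let ?S = "{diameter (cball x r) | x r. 0 \<le> r \<and> cball x r \<subseteq> K}"
  obtain y where "y \<in> interior K" using interior_ne[OF K] by blast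
  then obtain e where e: "e > 0" "cball y e \<subseteq> K" by (auto simp: mem_interior_cball)
  have mem: "2 * e \<in> ?S" using e diameter_cball[of y e] by (auto intro!: exI[of _ y] exI[of _ e])
  have bd: "bdd_above ?S"
  proof (rule bdd_aboveI[of _ "diameter K"])
    fix s assume "s \<in> ?S"
    then obtain x r where "s = diameter (cball x r)" "cball x r \<subseteq> K" by blast
    then show "s \<le> diameter K" using diameter_subset[of "cball x r" K] compact_imp_bounded[OF compactK[OF K]] by simp
  qed
  have inb: "inball_diameter K = Sup ?S" by (simp add: inball_diameter_def)
  have "2 * e \<le> inball_diameter K" unfolding inb by (rule cSup_upper[OF mem bd])
  then have pos: "inball_diameter K > 0" using e(1) by linarith
  then have "inball_diameter K / 2 < Sup ?S" unfolding inb by linarith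
  then obtain s where s: "s \<in> ?S" "inball_diameter K / 2 < s"
    using less_cSup_iff[of ?S] mem bd by blast
  then obtain x r where xr: "s = diameter (cball x r)" "0 \<le> r" "cball x r \<subseteq> K" by blast
  have s2: "s = 2 * r" using xr(1,2) by simp
  have "r > 0" using s(2) pos s2 by linarith
  have "diameter K / inball_diameter K \<le> \<sigma>" using shape K by (simp add: shape_bounded_def)
  then have dk: "diameter K \<le> \<sigma> * inball_diameter K" using pos by (simp add: field_simps)
  have "diameter K \<ge> 0" by (rule diameter_ge_0[OF compact_imp_bounded[OF compactK[OF K]]])
  then have "\<sigma> \<ge> 0" using dk pos by (smt (verit) mult_neg_pos)
  then have "\<sigma> * inball_diameter K \<le> \<sigma> * (4 * r)" using s(2) s2 by (intro mult_left_mono) auto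
  then show ?thesis using dk \<open>r > 0\<close> xr(3) by (intro exI[of _ x] exI[of _ r]) auto
qed

definition xc :: "'a set \<Rightarrow> 'a" where "xc K = (SOME x. \<exists>r>0. cball x r \<subseteq> K \<and> diameter K \<le> 4 * \<sigma> * r)"
definition rc :: "'a set \<Rightarrow> real" where "rc K = (SOME r. r > 0 \<and> cball (xc K) r \<subseteq> K \<and> diameter K \<le> 4 * \<sigma> * r)"

lemma rc:
  assumes K: "K \<in> \<T>"
  shows "rc K > 0" "cball (xc K) (rc K) \<subseteq> K" "diameter K \<le> 4 * \<sigma> * rc K"
proof -
  have "\<exists>r>0. cball (xc K) r \<subseteq> K \<and> diameter K \<le> 4 * \<sigma> * r"
    unfolding xc_def by (rule someI_ex) (use inball[OF K] in blast)
  then have "\<exists>r. r > 0 \<and> cball (xc K) r \<subseteq> K \<and> diameter K \<le> 4 * \<sigma> * r" by blast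
  from someI_ex[OF this] show "rc K > 0" "cball (xc K) (rc K) \<subseteq> K" "diameter K \<le> 4 * \<sigma> * rc K"
    unfolding rc_def by auto
qed

lemma dist_le_diameter: "K \<in> \<T> \<Longrightarrow> x \<in> K \<Longrightarrow> y \<in> K \<Longrightarrow> norm (x - y) \<le> diameter K"
  using diameter_bounded_bound[OF compact_imp_bounded[OF compactK]] by (simp add: dist_norm)

lemma rc_le_diameter: "K \<in> \<T> \<Longrightarrow> 2 * rc K \<le> diameter K"
  using diameter_subset[OF rc(2) compact_imp_bounded[OF compactK], of K] rc(1)[of K] by simp

lemma diameter_pos: "K \<in> \<T> \<Longrightarrow> diameter K > 0"
  using rc_le_diameter[of K] rc(1)[of K] by linarith

lemma sigma_ge: "K \<in> \<T> \<Longrightarrow> \<sigma> \<ge> 1 / 2"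
proof -
  assume K: "K \<in> \<T>"
  have "2 * rc K \<le> (4 * \<sigma>) * rc K" using rc_le_diameter[OF K] rc(3)[OF K] by linarith
  then have "2 \<le> 4 * \<sigma>" using rc(1)[OF K] by (simp only: mult_le_cancel_right_pos)
  then show ?thesis by simp
qed

lemma half_ball: "K \<in> \<T> \<Longrightarrow> cball (xc K) (rc K / 2) \<subseteq> interior K"
proof -
  assume K: "K \<in> \<T>"
  have "cball (xc K) (rc K / 2) \<subseteq> ball (xc K) (rc K)" using rc(1)[OF K] by auto
  also have "\<dots> \<subseteq> interior K" using rc(2)[OF K] by (intro interior_maximal) auto
  finally show ?thesis .
qed

lemma neighbours:
  assumes K: "K \<in> \<T>" and L: "L \<in> \<T>" and F: "interior_facet \<Omega> \<T> (K \<inter> L)" and d: "DIM('a) \<ge> 2"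
  shows "diameter K \<le> 2 * \<sigma> * diameter L" "diameter L \<le> 2 * \<sigma> * diameter K"
proof -
  have s: "\<sigma> \<ge> 1 / 2" by (rule sigma_ge[OF K])
  have F': "interior_facet \<Omega> \<T> (L \<inter> K)" using F by (simp add: Int_commute)
  have "2 * \<sigma> * (2 * rc K) \<le> 2 * \<sigma> * diameter L"
    using neighbour_diameter[OF K L F d rc(2)[OF K] rc(1)[OF K]] s by (intro mult_left_mono) auto
  then show "diameter K \<le> 2 * \<sigma> * diameter L" using rc(3)[OF K] by linarith
  have "2 * \<sigma> * (2 * rc L) \<le> 2 * \<sigma> * diameter K"
    using neighbour_diameter[OF L K F' d rc(2)[OF L] rc(1)[OF L]] s by (intro mult_left_mono) auto
  then show "diameter L \<le> 2 * \<sigma> * diameter K" using rc(3)[OF L] by linarith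
qed

text \<open>The energy does not see additive constants, but jumps do; this fixes them. The radius is
  halved to keep the bump inside the interior.\<close>

definition normalized :: "'a set \<Rightarrow> ('a \<Rightarrow> real) \<Rightarrow> bool" where
  "normalized K P \<longleftrightarrow> P \<in> polys l \<and> avg (\<lambda>z. u z - P z) (xc K) (rc K / 2) = 0"

lemma facet_ratio_pos: "K \<in> \<T> \<Longrightarrow> facet_ratio \<sigma> > 0"
  using sigma_ge[of K] by (auto simp: facet_ratio_def)

lemma facet_radius:
  assumes K: "K \<in> \<T>" and L: "L \<in> \<T>" and F: "interior_facet \<Omega> \<T> (K \<inter> L)" and d: "DIM('a) \<ge> 2"
  shows "facet_ratio \<sigma> * diameter K \<le> min (rc K) (2 * rc L * rc K / diameter K)"
    and "facet_ratio \<sigma> * diameter K \<le> rc L"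
proof -
  note s = sigma_ge[OF K] and h = diameter_pos[OF K]
  have a: "diameter K / (4 * \<sigma>) \<le> rc K" using rc(3)[OF K] s by (simp add: field_simps)
  have b: "2 * rc K \<le> diameter L" by (rule neighbour_diameter[OF K L F d rc(2)[OF K] rc(1)[OF K]])
  have c: "diameter L / (4 * \<sigma>) \<le> rc L" using rc(3)[OF L] s by (simp add: field_simps)
  have "2 * (diameter K / (4 * \<sigma>)) / (4 * \<sigma>) \<le> rc L"
  proof -
    have "2 * (diameter K / (4 * \<sigma>)) / (4 * \<sigma>) \<le> diameter L / (4 * \<sigma>)"
      using a b s by (intro divide_right_mono) auto
    with c show ?thesis by linarith
  qed
  then have c': "diameter K / (8 * \<sigma>\<^sup>2) \<le> rc L" by (simp add: power2_eq_square)
  have m: "2 * (diameter K / (8 * \<sigma>\<^sup>2)) * (diameter K / (4 * \<sigma>)) \<le> 2 * rc L * rc K"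
    using a c' s h rc(1)[OF L] by (intro mult_mono) auto
  have "diameter K / (16 * \<sigma> ^ 3) = 2 * (diameter K / (8 * \<sigma>\<^sup>2)) * (diameter K / (4 * \<sigma>)) / diameter K"
    using h s by (simp add: field_simps power2_eq_square power3_eq_cube)
  also have "\<dots> \<le> 2 * rc L * rc K / diameter K" using m h by (intro divide_right_mono) auto
  finally have e: "diameter K / (16 * \<sigma> ^ 3) \<le> 2 * rc L * rc K / diameter K" .
  have "facet_ratio \<sigma> \<le> 1 / (4 * \<sigma>)" "facet_ratio \<sigma> \<le> 1 / (16 * \<sigma> ^ 3)" by (simp_all add: facet_ratio_def)
  then have "facet_ratio \<sigma> * diameter K \<le> 1 / (4 * \<sigma>) * diameter K" "facet_ratio \<sigma> * diameter K \<le> 1 / (16 * \<sigma> ^ 3) * diameter K"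
    using h by (simp_all only: mult_right_mono less_imp_le)
  with a e show 1: "facet_ratio \<sigma> * diameter K \<le> min (rc K) (2 * rc L * rc K / diameter K)" by auto
  have "2 * rc L * rc K / diameter K = rc L * (2 * rc K / diameter K)" by simp
  also have "\<dots> \<le> rc L * 1" using rc_le_diameter[OF K] h rc(1)[OF L] by (intro mult_left_mono) auto
  finally show "facet_ratio \<sigma> * diameter K \<le> rc L" using 1 by simp
qed

text \<open>The power of the diameter is the scaling that frees the bound from the mesh size: the
  square of the path length, of order h^2, times the height of the bump, of order h^(-d), leaves
  h^(2-d).\<close>

lemma facet_jump:
  assumes K: "K \<in> \<T>" and L: "L \<in> \<T>" and F: "interior_facet \<Omega> \<T> (K \<inter> L)" and d: "DIM('a) \<ge> 2"
    and P: "normalized K P1" "normalized L P2" and x: "x \<in> K" "x \<in> L"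
  shows "(diameter K) ^ (DIM('a) - 2) * (P1 x - P2 x)\<^sup>2 \<le> jump_const TYPE('a) l \<sigma> * (E K P1 + E L P2)"
proof -
  note s = sigma_ge[OF K] and hpos = diameter_pos[OF K] and kap = facet_ratio_pos[OF K]
  let ?hK = "diameter K" and ?\<kappa> = "facet_ratio \<sigma>" and ?k = "bump_ratio l"
  define \<delta> where "\<delta> = ?\<kappa> * ?hK"
  define \<rho> where "\<rho> = ?k * (\<delta> / 4)"
  \<comment> \<open>Bounds both diameters, since that of the neighbour is at most 2\<sigma> times
    that of \<open>K\<close>.\<close>
  define h where "h = (1 + 2 * \<sigma>) * ?hK"
  note fr = facet_radius[OF K L F d, folded \<delta>_def]
  obtain c \<nu> where c: "norm \<nu> = 1" "c \<in> K" "c \<in> L" "\<And>z. z \<in> K \<inter> L \<Longrightarrow> (z - c) \<bullet> \<nu> = 0"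
    "\<And>z. z \<in> ball c (min (rc K) (2 * rc L * rc K / diameter K)) \<Longrightarrow> (z - c) \<bullet> \<nu> > 0 \<Longrightarrow> z \<in> interior K"
    "\<And>z. z \<in> ball c (min (rc K) (2 * rc L * rc K / diameter K)) \<Longrightarrow> (z - c) \<bullet> \<nu> < 0 \<Longrightarrow> z \<in> interior L"
    "ball c (min (rc K) (2 * rc L * rc K / diameter K)) \<subseteq> \<Omega>"
    by (rule facet_neighbourhood[OF K L F rc(2)[OF K] rc(1)[OF K] rc(2)[OF L] rc(1)[OF L]]) blast
  have bsub: "ball c \<delta> \<subseteq> ball c (min (rc K) (2 * rc L * rc K / diameter K))"
    using fr(1) by (intro subset_ball)
  have dpos: "\<delta> > 0" using kap hpos by (simp add: \<delta>_def)
  have rhopos: "\<rho> > 0" using dpos bump_ratio(1)[of l] by (simp add: \<rho>_def)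
  have rho8: "\<rho> \<le> \<delta> / 8"
    using mult_right_mono[OF bump_ratio(2)[of l], of "\<delta> / 4"] dpos by (simp add: \<rho>_def)
  have h1: "?hK \<le> h" using s hpos by (simp add: h_def)
  have h2: "diameter L \<le> h" using neighbours(2)[OF K L F d] hpos by (simp add: h_def distrib_right)
  have xcK: "xc K \<in> K" "xc L \<in> L" using rc(1,2)[OF K] rc(1,2)[OF L] by (auto simp: subset_iff)
  interpret crossing "interior K" "interior L" u g c \<nu> \<delta> P1 P2 l \<rho> h "xc K" "xc L" "rc K / 2" "rc L / 2"
  proof
    show "convex (interior K)" "convex (interior L)" using convexK K L by (auto intro: convex_interior)
    show "is_weak_gradient (ball c \<delta>) u g" using bsub c(7) by (intro is_weak_gradient_subset[OF wg]) auto
    show "is_weak_gradient (interior K) u g" "is_weak_gradient (interior L) u g"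
      using interior_sub K L by (auto intro: is_weak_gradient_subset[OF wg])
    show "z \<in> interior K" if "z \<in> ball c \<delta>" "(z - c) \<bullet> \<nu> > 0" for z using c(5) bsub that by blast
    show "z \<in> interior L" if "z \<in> ball c \<delta>" "(z - c) \<bullet> \<nu> < 0" for z using c(6) bsub that by blast
    show "P1 \<in> polys l" "P2 \<in> polys l" using P by (auto simp: normalized_def)
    then show "set_integrable lebesgue (interior K) (\<lambda>z. (norm (g z - grad P1 z))\<^sup>2)"
      "set_integrable lebesgue (interior L) (\<lambda>z. (norm (g z - grad P2 z))\<^sup>2)"
      using E_integrable K L by auto
    show "cball (xc K) (rc K / 2) \<subseteq> interior K" "cball (xc L) (rc L / 2) \<subseteq> interior L" using half_ball K L by auto
    show "\<rho> \<le> rc K / 2" "\<rho> \<le> rc L / 2" using rho8 fr rhopos dpos by auto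
    show "norm (xc K - c) \<le> h" using dist_le_diameter[OF K xcK(1) c(2)] h1 by linarith
    show "norm (xc L - c) \<le> h" using dist_le_diameter[OF L xcK(2) c(3)] h2 by linarith
    show "\<delta> \<le> h" using fr(1) rc_le_diameter[OF K] rc(1)[OF K] h1 by auto
    show "rc K / 2 \<le> h" using rc_le_diameter[OF K] rc(1)[OF K] h1 by auto
    show "rc L / 2 \<le> h" using rc_le_diameter[OF L] rc(1)[OF L] h2 by auto
    show "avg (\<lambda>z. u z - P1 z) (xc K) (rc K / 2) = 0" "avg (\<lambda>z. u z - P2 z) (xc L) (rc L / 2) = 0"
      using P by (auto simp: normalized_def)
  qed (use c dpos rhopos rho8 in auto)
  have "norm (x - c) \<le> ?hK" by (rule dist_le_diameter[OF K x(1) c(2)])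
  also have "?hK = (4 / ?\<kappa>) * (\<delta> / 4)" using kap by (simp add: \<delta>_def)
  finally have nx: "norm (x - c) \<le> (4 / ?\<kappa>) * (\<delta> / 4)" .
  have "(P1 x - P2 x)\<^sup>2 \<le> (1 + poly_const l (4 / ?\<kappa>) * (4 / ?\<kappa>))\<^sup>2 * 4 * (96 * h\<^sup>2 * Q * (E K P1 + E L P2))"
    using jump_bound[OF bump_ratio(1,3)[of l] _ \<rho>_def c(4) nx] x bump_ratio(2)[of l] by (simp add: E_def)
  then have "?hK ^ (DIM('a) - 2) * (P1 x - P2 x)\<^sup>2
     \<le> ?hK ^ (DIM('a) - 2) * ((1 + poly_const l (4 / ?\<kappa>) * (4 / ?\<kappa>))\<^sup>2 * 4 * (96 * h\<^sup>2 * Q * (E K P1 + E L P2)))"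
    using hpos by (intro mult_left_mono) auto
  also have "\<dots> = ((1 + poly_const l (4 / ?\<kappa>) * (4 / ?\<kappa>))\<^sup>2 * 384) * (?hK ^ (DIM('a) - 2) * (h\<^sup>2 * Q)) * (E K P1 + E L P2)"
    by (simp add: mult_ac)
  also have "?hK ^ (DIM('a) - 2) * (h\<^sup>2 * Q) = (1 + 2 * \<sigma>)\<^sup>2 * (moll_bound TYPE('a) / (?k * ?\<kappa> / 4) ^ DIM('a))"
  proof -
    have "\<rho> = (?k * ?\<kappa> / 4) * ?hK" by (simp add: \<rho>_def \<delta>_def)
    then have "\<rho> ^ DIM('a) = (?k * ?\<kappa> / 4) ^ DIM('a) * ?hK ^ DIM('a)" by (simp only: power_mult_distrib)
    moreover have "?hK ^ DIM('a) = ?hK ^ (DIM('a) - 2) * ?hK\<^sup>2"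
    proof -
      have "DIM('a) = (DIM('a) - 2) + 2" using d by simp
      then show ?thesis by (metis power_add)
    qed
    ultimately have "Q = moll_bound TYPE('a) / ((?k * ?\<kappa> / 4) ^ DIM('a) * (?hK ^ (DIM('a) - 2) * ?hK\<^sup>2))" by (simp add: Q_def)
    moreover have "?hK ^ (DIM('a) - 2) \<noteq> 0" "?hK\<^sup>2 \<noteq> 0" using hpos by auto
    ultimately show ?thesis by (simp add: h_def power_mult_distrib)
  qed
  finally show ?thesis by (simp only: jump_const_def mult.assoc)
qed

text \<open>By \<open>patch_iff\<close> these are the elements contained in the patch of
  \<open>z\<close>.\<close>

definition X :: "'a \<Rightarrow> 'a set set" where "X z = {K \<in> \<T>. z \<in> element_nodes l K}"

lemma X: "K \<in> X z \<Longrightarrow> K \<in> \<T>" "K \<in> X z \<Longrightarrow> z \<in> K" "finite (X z)"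
  using node_in_K finT by (auto simp: X_def)

text \<open>The elements at \<open>z\<close> may differ in size, so each is shrunk towards
  \<open>z\<close> to the smallest diameter \<rho>. The shrunken inscribed balls have radius at
  least \<rho>/(4\<sigma>), stay in their own elements and hence disjoint, and lie in the ball of
  radius \<rho> about \<open>z\<close>.\<close>

lemma card_X: "card (X z) \<le> patch_const TYPE('a) \<sigma>"
proof (cases "X z = {}")
  case False
  define \<rho> where "\<rho> = Min (diameter ` X z)"
  have rho_le: "\<rho> \<le> diameter K" if "K \<in> X z" for K using that X(3) by (auto simp: \<rho>_def)
  have rho_pos: "\<rho> > 0" using False X diameter_pos by (auto simp: \<rho>_def)
  obtain K0 where "K0 \<in> X z" using False by blast
  then have s: "\<sigma> \<ge> 1 / 2" using sigma_ge X(1) by blast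
  define q where "q = \<rho> / (4 * \<sigma>)"
  have q: "q > 0" using rho_pos s by (simp add: q_def)
  define y where "y K = z + (\<rho> / diameter K) *\<^sub>R (xc K - z)" for K
  have b: "ball (y K) q \<subseteq> K \<inter> cball z \<rho>" if K: "K \<in> X z" for K
  proof
    note KT = X(1)[OF K] and zK = X(2)[OF K]
    define t where "t = \<rho> / diameter K"
    have t: "0 < t" "t \<le> 1" using rho_pos rho_le[OF K] diameter_pos[OF KT] by (auto simp: t_def)
    fix w assume w: "w \<in> ball (y K) q"
    have "q \<le> t * rc K"
    proof -
      have "\<rho> * diameter K \<le> \<rho> * (4 * \<sigma> * rc K)" using rc(3)[OF KT] rho_pos by (intro mult_left_mono) auto
      then show ?thesis using diameter_pos[OF KT] s by (simp add: q_def t_def field_simps)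
    qed
    then have nw: "norm (w - y K) \<le> t * rc K" using w by (simp add: dist_norm norm_minus_commute)
    define v where "v = xc K + (1 / t) *\<^sub>R (w - y K)"
    have "norm (v - xc K) = norm (w - y K) / t" using t by (simp add: v_def)
    also have "\<dots> \<le> rc K" using nw t by (simp add: field_simps)
    finally have "norm (v - xc K) \<le> rc K" .
    then have vK: "v \<in> K" using rc(2)[OF KT] by (auto simp: dist_norm norm_minus_commute)
    have wv: "w = (1 - t) *\<^sub>R z + t *\<^sub>R v" using t by (simp add: v_def y_def t_def[symmetric] algebra_simps)
    then have "w \<in> K" using convexD[OF convexK[OF KT] zK vK, of "1 - t" t] t by simp
    moreover have "norm (w - z) \<le> \<rho>"
    proof -
      have "w - z = t *\<^sub>R (v - z)" using wv by (simp add: algebra_simps)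
      then have "norm (w - z) = t * norm (v - z)" using t by simp
      also have "\<dots> \<le> t * diameter K" using dist_le_diameter[OF KT vK zK] t by (intro mult_left_mono) auto
      also have "\<dots> = \<rho>" using diameter_pos[OF KT] by (simp add: t_def)
      finally show ?thesis .
    qed
    ultimately show "w \<in> K \<inter> cball z \<rho>" by (simp add: dist_norm norm_minus_commute)
  qed
  have disj: "disjoint_family_on (\<lambda>K. ball (y K) q) (X z)"
  proof (unfold disjoint_family_on_def, intro ballI impI)
    fix K L assume KL: "K \<in> X z" "L \<in> X z" "K \<noteq> L"
    have "ball (y K) q \<subseteq> interior K" "ball (y L) q \<subseteq> interior L"
      by (rule interior_maximal[OF _ open_ball], use b[OF KL(1)] b[OF KL(2)] in blast)+
    then show "ball (y K) q \<inter> ball (y L) q = {}" using interior_disjoint[OF X(1)[OF KL(1)] X(1)[OF KL(2)] KL(3)] by blast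
  qed
  have "real (card (X z)) * (unit_ball_vol (real DIM('a)) * q ^ DIM('a)) = (\<Sum>K\<in>X z. measure lebesgue (ball (y K) q))"
    using q by (simp add: content_ball)
  also have "\<dots> = measure lebesgue (\<Union>K\<in>X z. ball (y K) q)"
  proof (rule measure_finite_Union[symmetric, OF X(3) _ disj])
    show "emeasure lebesgue (ball (y K) q) \<noteq> \<infinity>" for K
      using emeasure_bounded_finite[OF bounded_ball, of "y K" q] by simp
  qed auto
  also have "\<dots> \<le> measure lebesgue (cball z \<rho>)"
  proof (rule measure_mono_fmeasurable)
    show "(\<Union>K\<in>X z. ball (y K) q) \<subseteq> cball z \<rho>" using b by blast
    show "(\<Union>K\<in>X z. ball (y K) q) \<in> sets lebesgue" by (intro sets.finite_UN X(3)) auto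
  qed simp
  also have "\<dots> = unit_ball_vol (real DIM('a)) * \<rho> ^ DIM('a)" using rho_pos by (simp add: content_cball)
  finally have "unit_ball_vol (real DIM('a)) * (real (card (X z)) * q ^ DIM('a)) \<le> unit_ball_vol (real DIM('a)) * \<rho> ^ DIM('a)"
    by (simp add: mult_ac)
  then have "real (card (X z)) * q ^ DIM('a) \<le> \<rho> ^ DIM('a)"
  proof -
    have p: "unit_ball_vol (real DIM('a)) > 0" by simp
    assume "unit_ball_vol (real DIM('a)) * (real (card (X z)) * q ^ DIM('a)) \<le> unit_ball_vol (real DIM('a)) * \<rho> ^ DIM('a)"
    then show ?thesis by (simp only: mult_le_cancel_left_pos[OF p])
  qed
  also have "\<rho> ^ DIM('a) = (4 * \<sigma>) ^ DIM('a) * q ^ DIM('a)"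
  proof -
    have "\<rho> = (4 * \<sigma>) * q" using s by (simp add: q_def)
    then show ?thesis by (simp only: power_mult_distrib)
  qed
  finally have "real (card (X z)) \<le> (4 * \<sigma>) ^ DIM('a)"
    by (simp only: mult_le_cancel_right_pos[OF zero_less_power[OF q]])
  then show ?thesis unfolding patch_const_def by linarith
qed simp

definition Nbr :: "'a \<Rightarrow> ('a set \<times> 'a set) set" where
  "Nbr z = {(K, L). K \<in> X z \<and> L \<in> X z \<and> interior_facet \<Omega> \<T> (K \<inter> L) \<and> aK K \<le> aK L}"

text \<open>The given path can be arbitrarily long and may repeat elements. Read as reachability in
  the finite relation \<open>Nbr z\<close>, it can be shortened to at most as many steps as the
  relation has pairs, hence the square of the bound for the number of elements.\<close>

lemma Nbr_path:
  assumes z: "z \<in> nodes l \<T>" and K: "K \<in> X z" and L: "L \<in> X z" and a: "aK K \<le> aK L"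
  shows "\<exists>m\<le>(patch_const TYPE('a) \<sigma>)\<^sup>2. (K, L) \<in> Nbr z ^^ m"
proof -
  have "K \<subseteq> node_patch l \<Omega> \<T> z" "L \<subseteq> node_patch l \<Omega> \<T> z" using patch_iff K L by (auto simp: X_def)
  then obtain m p where p: "monotone_path l \<Omega> \<T> aK z K L m p"
    using qm z X(1)[OF K] X(1)[OF L] a unfolding quasi_monotone_def by blast
  have step: "(p i, p (Suc i)) \<in> Nbr z" if "i < m" for i
  proof -
    have "\<forall>n\<le>m. p n \<in> \<T> \<and> p n \<subseteq> node_patch l \<Omega> \<T> z" using p by (simp add: monotone_path_def)
    then have "p i \<in> \<T> \<and> p i \<subseteq> node_patch l \<Omega> \<T> z" "p (Suc i) \<in> \<T> \<and> p (Suc i) \<subseteq> node_patch l \<Omega> \<T> z"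
      using that by simp_all
    then have "p i \<in> X z" "p (Suc i) \<in> X z" using patch_iff by (auto simp: X_def)
    then show ?thesis using p that by (auto simp: monotone_path_def Nbr_def)
  qed
  have "(p 0, p i) \<in> (Nbr z)\<^sup>*" if "i \<le> m" for i
    using that
  proof (induction i)
    case (Suc i)
    then have "(p 0, p i) \<in> (Nbr z)\<^sup>*" "(p i, p (Suc i)) \<in> Nbr z" using step[of i] by auto
    then show ?case by (rule rtrancl_into_rtrancl)
  qed simp
  then have KL: "(K, L) \<in> (Nbr z)\<^sup>*" using p by (auto simp: monotone_path_def)
  have sub: "Nbr z \<subseteq> X z \<times> X z" by (auto simp: Nbr_def)
  have fin: "finite (Nbr z)" by (rule finite_subset[OF sub]) (simp add: X(3))
  have "card (Nbr z) \<le> card (X z) * card (X z)"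
    using card_mono[OF _ sub] X(3) by (simp add: card_cartesian_product)
  also have "\<dots> \<le> (patch_const TYPE('a) \<sigma>)\<^sup>2" unfolding power2_eq_square by (intro mult_mono card_X) auto
  finally have c: "card (Nbr z) \<le> (patch_const TYPE('a) \<sigma>)\<^sup>2" .
  obtain i where "i \<le> card (Nbr z)" "(K, L) \<in> Nbr z ^^ i"
    using KL unfolding rtrancl_finite_eq_relpow[OF fin] by blast
  then show ?thesis using c by (intro exI[of _ i]) auto
qed

lemma jump_const_nonneg: "K \<in> \<T> \<Longrightarrow> jump_const TYPE('a) l \<sigma> \<ge> 0"
  unfolding jump_const_def using moll_bound(1)[where 'a = 'a] bump_ratio(1)[of l] facet_ratio_pos[of K]
  by (intro mult_nonneg_nonneg[OF mult_nonneg_nonneg[OF mult_nonneg_nonneg]] divide_nonneg_nonneg zero_le_power zero_le_power2) auto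

lemma chain_const_nonneg: "K \<in> \<T> \<Longrightarrow> chain_const d \<sigma> (jump_const TYPE('a) l \<sigma>) m \<ge> 0"
  using jump_const_nonneg[of K] sigma_ge[of K] by (induction m) auto

text \<open>Induction from the start of the path. The coefficient of the start is at most that of
  every later element, so each jump is paid for by energies with their own coefficients and no ratio
  of coefficients enters.\<close>

lemma chain_jump:
  assumes d: "DIM('a) \<ge> 2" and P: "\<And>K. K \<in> \<T> \<Longrightarrow> normalized K (P K)"
    and "K \<in> X z" "(K, M) \<in> Nbr z ^^ m"
  shows "aK K * diameter K ^ (DIM('a) - 2) * (P K z - P M z)\<^sup>2
     \<le> chain_const DIM('a) \<sigma> (jump_const TYPE('a) l \<sigma>) m * (\<Sum>L\<in>X z. aK L * E L (P L))"
  using assms(3,4)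
proof (induction m arbitrary: K)
  case 0
  then show ?case by simp
next
  case (Suc m)
  let ?S = "\<Sum>L\<in>X z. aK L * E L (P L)" and ?n = "DIM('a) - 2" and ?C = "jump_const TYPE('a) l \<sigma>"
  let ?B = "chain_const DIM('a) \<sigma> ?C m"
  obtain L where L: "(K, L) \<in> Nbr z" "(L, M) \<in> Nbr z ^^ m" using relpow_Suc_D2[OF Suc.prems(2)] by blast
  have L': "L \<in> X z" "interior_facet \<Omega> \<T> (K \<inter> L)" "aK K \<le> aK L" using L(1) by (auto simp: Nbr_def)
  note KT = X(1)[OF Suc.prems(1)] and LT = X(1)[OF L'(1)]
  note s = sigma_ge[OF KT]
  have le_S: "aK N * E N (P N) \<le> ?S" if "N \<in> X z" for N
    using that X(3) by (intro member_le_sum) (auto intro!: mult_nonneg_nonneg E_nonneg less_imp_le[OF apos] X(1))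
  have S0: "?S \<ge> 0" by (intro sum_nonneg mult_nonneg_nonneg E_nonneg less_imp_le[OF apos] X(1))
  have h0: "diameter K \<ge> 0" "diameter L \<ge> 0" using diameter_pos KT LT by (auto intro: less_imp_le)
  have "diameter K ^ ?n * (P K z - P L z)\<^sup>2 \<le> ?C * (E K (P K) + E L (P L))"
    by (rule facet_jump[OF KT LT L'(2) d P[OF KT] P[OF LT] X(2)[OF Suc.prems(1)] X(2)[OF L'(1)]])
  then have "aK K * (diameter K ^ ?n * (P K z - P L z)\<^sup>2) \<le> aK K * (?C * (E K (P K) + E L (P L)))"
    using apos[OF KT] by (intro mult_left_mono) auto
  also have "\<dots> = ?C * (aK K * E K (P K) + aK K * E L (P L))" by (simp add: algebra_simps)
  also have "\<dots> \<le> ?C * (?S + ?S)"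
  proof (intro mult_left_mono add_mono le_S[OF Suc.prems(1)] jump_const_nonneg[OF KT])
    have "aK K * E L (P L) \<le> aK L * E L (P L)" by (intro mult_right_mono L'(3) E_nonneg)
    also have "\<dots> \<le> ?S" by (rule le_S[OF L'(1)])
    finally show "aK K * E L (P L) \<le> ?S" .
  qed
  finally have 1: "aK K * (diameter K ^ ?n * (P K z - P L z)\<^sup>2) \<le> 2 * ?C * ?S" by simp
  \<comment> \<open>Changes the weight to that of the next element, as the induction hypothesis
    wants it: the coefficient does not decrease, and diameters of neighbours are comparable.\<close>
  have "aK K * diameter K ^ ?n \<le> aK L * ((2 * \<sigma>) ^ ?n * diameter L ^ ?n)"
  proof (rule mult_mono)
    have "diameter K ^ ?n \<le> (2 * \<sigma> * diameter L) ^ ?n"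
      by (rule power_mono[OF neighbours(1)[OF KT LT L'(2) d] h0(1)])
    then show "diameter K ^ ?n \<le> (2 * \<sigma>) ^ ?n * diameter L ^ ?n" by (simp only: power_mult_distrib)
  qed (use L'(3) apos[OF LT] h0 in auto)
  then have "aK K * diameter K ^ ?n * (P L z - P M z)\<^sup>2 \<le> aK L * ((2 * \<sigma>) ^ ?n * diameter L ^ ?n) * (P L z - P M z)\<^sup>2"
    by (intro mult_right_mono) auto
  also have "\<dots> = (2 * \<sigma>) ^ ?n * (aK L * diameter L ^ ?n * (P L z - P M z)\<^sup>2)" by (simp add: mult_ac)
  also have "\<dots> \<le> (2 * \<sigma>) ^ ?n * (?B * ?S)"
    using Suc.IH[OF L'(1) L(2)] s by (intro mult_left_mono) auto
  finally have 2: "aK K * diameter K ^ ?n * (P L z - P M z)\<^sup>2 \<le> (2 * \<sigma>) ^ ?n * (?B * ?S)" .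
  have "(P K z - P M z)\<^sup>2 = ((P K z - P L z) + (P L z - P M z))\<^sup>2" by simp
  also have "\<dots> \<le> 2 * (P K z - P L z)\<^sup>2 + 2 * (P L z - P M z)\<^sup>2"
  proof -
    have "(a + b)\<^sup>2 \<le> 2 * a\<^sup>2 + 2 * b\<^sup>2" for a b :: real
    proof -
      have "0 \<le> (a - b)\<^sup>2" by simp
      then show ?thesis by (simp add: power2_sum power2_diff)
    qed
    then show ?thesis .
  qed
  finally have "aK K * diameter K ^ ?n * (P K z - P M z)\<^sup>2
     \<le> aK K * diameter K ^ ?n * (2 * (P K z - P L z)\<^sup>2 + 2 * (P L z - P M z)\<^sup>2)"
    using apos[OF KT] h0 by (intro mult_left_mono) auto
  also have "\<dots> = 2 * (aK K * (diameter K ^ ?n * (P K z - P L z)\<^sup>2)) + 2 * (aK K * diameter K ^ ?n * (P L z - P M z)\<^sup>2)"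
    by (simp add: algebra_simps)
  also have "\<dots> \<le> 2 * (2 * ?C * ?S) + 2 * ((2 * \<sigma>) ^ ?n * (?B * ?S))" using 1 2 by linarith
  also have "\<dots> = chain_const DIM('a) \<sigma> ?C (Suc m) * ?S" by (simp add: algebra_simps)
  finally show ?case .
qed

end

section \<open>From nodal errors to the energy of the interpolant\<close>

context weighted_mesh
begin

lemma E_perturb:
  assumes K: "K \<in> \<T>" and P: "P \<in> polys m" "Q \<in> polys m" and A: "\<And>x. x \<in> K \<Longrightarrow> (norm (grad Q x))\<^sup>2 \<le> A"
  shows "E K (\<lambda>x. P x + Q x) \<le> 2 * E K P + 2 * A * measure lebesgue (interior K)"
proof -
  have gr: "grad (\<lambda>x. P x + Q x) z = grad P z + grad Q z" for z
    by (rule grad_eqI)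
       (use has_derivative_add[OF Ck1_grad[OF polys_Ck[OF P(1)]] Ck1_grad[OF polys_Ck[OF P(2)]]] in \<open>simp add: inner_add_left\<close>)
  have IK: "interior K \<in> sets lebesgue" by auto
  have i1: "integrable lebesgue (\<lambda>z. indicator (interior K) z *\<^sub>R (norm (g z - grad (\<lambda>x. P x + Q x) z))\<^sup>2)"
    using E_integrable[OF K polys_add[OF P]] by (simp add: set_integrable_def)
  have i2: "integrable lebesgue (\<lambda>z. indicator (interior K) z *\<^sub>R (norm (g z - grad P z))\<^sup>2)"
    using E_integrable[OF K P(1)] by (simp add: set_integrable_def)
  have i3: "integrable lebesgue (\<lambda>z. 2 * A * indicator (interior K) z)"
    using finite_measure_K[OF K] IK by (intro integrable_mult_right) (simp add: integrable_real_indicator)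
  have "E K (\<lambda>x. P x + Q x) \<le> (LINT z|lebesgue. 2 * (indicator (interior K) z *\<^sub>R (norm (g z - grad P z))\<^sup>2) + 2 * A * indicator (interior K) z)"
    unfolding E_def set_lebesgue_integral_def
  proof (rule integral_mono[OF i1])
    show "integrable lebesgue (\<lambda>z. 2 * (indicator (interior K) z *\<^sub>R (norm (g z - grad P z))\<^sup>2) + 2 * A * indicator (interior K) z)"
      by (rule Bochner_Integration.integrable_add[OF integrable_mult_right[OF i2] i3])
    fix z
    show "indicator (interior K) z *\<^sub>R (norm (g z - grad (\<lambda>x. P x + Q x) z))\<^sup>2
       \<le> 2 * (indicator (interior K) z *\<^sub>R (norm (g z - grad P z))\<^sup>2) + 2 * A * indicator (interior K) z"
    proof (cases "z \<in> interior K")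
      case True
      then have "(norm (grad Q z))\<^sup>2 \<le> A" using A interior_subset by blast
      moreover have "(norm (g z - grad P z - grad Q z))\<^sup>2 \<le> 2 * (norm (g z - grad P z))\<^sup>2 + 2 * (norm (grad Q z))\<^sup>2"
        by (rule norm_diff_sq_le)
      ultimately show ?thesis using True by (simp add: gr diff_diff_eq)
    qed simp
  qed
  also have "\<dots> = 2 * E K P + 2 * A * measure lebesgue (interior K)"
  proof -
    have "(LINT z|lebesgue. 2 * (indicator (interior K) z *\<^sub>R (norm (g z - grad P z))\<^sup>2) + 2 * A * indicator (interior K) z)
      = (LINT z|lebesgue. 2 * (indicator (interior K) z *\<^sub>R (norm (g z - grad P z))\<^sup>2)) + (LINT z|lebesgue. 2 * A * indicator (interior K) z)"
      by (rule Bochner_Integration.integral_add[OF integrable_mult_right[OF i2] i3])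
    then show ?thesis by (simp add: E_def set_lebesgue_integral_def)
  qed
  finally show ?thesis .
qed

text \<open>By Lagrange interpolation the difference to \<open>P\<close> is a combination of basis
  functions with the nodal errors as coefficients. Its gradient is of order error / h, and the
  volume of order h^d turns the square into the weight h^(d-2).\<close>

lemma interpolation_stability:
  assumes K: "K \<in> \<T>" and P: "P \<in> polys l" and d: "DIM('a) \<ge> 2"
  shows "E K (local_fe val K) \<le> 2 * E K P + 2 * interp_const TYPE('a) l \<sigma> *
    (\<Sum>z\<in>element_nodes l K. diameter K ^ (DIM('a) - 2) * (val z - P z)\<^sup>2)"
proof -
  let ?V = "vertices K" and ?I = "lag_idx l (vertices K)" and ?h = "diameter K"
  interpret full_simplex ?V by (rule simplex_vertices[OF K])
  define e where "e \<alpha> = val (lag_node l ?V \<alpha>) - P (lag_node l ?V \<alpha>)" for \<alpha>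
  define Q where "Q x = (\<Sum>\<alpha>\<in>?I. e \<alpha> * lag l ?V \<alpha> x)" for x
  define N where "N = (\<Sum>\<alpha>\<in>?I. (e \<alpha>)\<^sup>2)"
  have Qp: "Q \<in> polys l" unfolding Q_def[abs_def] by (intro polys_sum polys_cmult lag_polys fin)
  have PQ: "local_fe val K = (\<lambda>x. P x + Q x)"
  proof
    fix x
    have "local_fe val K x - (\<Sum>\<alpha>\<in>?I. P (lag_node l ?V \<alpha>) * lag l ?V \<alpha> x) = Q x"
      unfolding local_fe_def Q_def e_def by (simp add: sum_subtractf left_diff_distrib)
    then show "local_fe val K x = P x + Q x" using lag_interpolation[OF P l, of x] by simp
  qed
  have hpos: "?h > 0" by (rule diameter_pos[OF K])
  have s: "\<sigma> \<ge> 1 / 2" by (rule sigma_ge[OF K])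
  define M where "M = (\<Sum>\<alpha>\<in>?I. \<bar>e \<alpha>\<bar>)"
  have M0: "M \<ge> 0" by (simp add: M_def sum_nonneg)
  have QM: "\<bar>Q x\<bar> \<le> M * real l ^ l" if "x \<in> K" for x
  proof -
    have "\<bar>Q x\<bar> \<le> (\<Sum>\<alpha>\<in>?I. \<bar>e \<alpha> * lag l ?V \<alpha> x\<bar>)" unfolding Q_def by (rule sum_abs)
    also have "\<dots> \<le> (\<Sum>\<alpha>\<in>?I. \<bar>e \<alpha>\<bar> * real l ^ l)"
    proof (rule sum_mono)
      fix \<alpha> assume a: "\<alpha> \<in> ?I"
      have "x \<in> convex hull ?V" using that K_hull[OF K] by simp
      then show "\<bar>e \<alpha> * lag l ?V \<alpha> x\<bar> \<le> \<bar>e \<alpha>\<bar> * real l ^ l"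
        unfolding abs_mult by (intro mult_left_mono lag_abs_le[OF a]) auto
    qed
    finally show ?thesis by (simp add: M_def sum_distrib_right)
  qed
  \<comment> \<open>Bound for the squared gradient; the number of multi-indices enters when the
    square of the sum \<open>M\<close> is replaced by the sum of squares \<open>N\<close>.\<close>
  define A where "A = (poly_const l 1 * (4 * \<sigma>) * real l ^ l)\<^sup>2 * (real ((l + 1) ^ Suc DIM('a)) * N) / ?h\<^sup>2"
  have A: "(norm (grad Q x))\<^sup>2 \<le> A" if x: "x \<in> K" for x
  proof -
    let ?p = "poly_const l 1"
    have p0: "?p \<ge> 0" using poly_const(1)[of 1 l] by simp
    have 1: "norm (grad Q x) * rc K \<le> ?p * (M * real l ^ l)"
      by (rule polys_gradient_bound[OF Qp convexK[OF K] QM rc(2)[OF K] rc(1)[OF K] x])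
    have "norm (grad Q x) * ?h \<le> norm (grad Q x) * (4 * \<sigma> * rc K)"
      by (intro mult_left_mono rc(3)[OF K]) auto
    also have "\<dots> = 4 * \<sigma> * (norm (grad Q x) * rc K)" by simp
    also have "\<dots> \<le> 4 * \<sigma> * (?p * (M * real l ^ l))" using 1 s by (intro mult_left_mono) auto
    finally have "norm (grad Q x) * ?h \<le> (?p * (4 * \<sigma>) * real l ^ l) * M" by (simp add: mult_ac)
    then have "(norm (grad Q x) * ?h)\<^sup>2 \<le> ((?p * (4 * \<sigma>) * real l ^ l) * M)\<^sup>2" using hpos by (intro power_mono) auto
    then have "(norm (grad Q x))\<^sup>2 * ?h\<^sup>2 \<le> (?p * (4 * \<sigma>) * real l ^ l)\<^sup>2 * M\<^sup>2" by (simp only: power_mult_distrib)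
    also have "\<dots> \<le> (?p * (4 * \<sigma>) * real l ^ l)\<^sup>2 * (real ((l + 1) ^ Suc DIM('a)) * N)"
    proof (rule mult_left_mono)
      have "M\<^sup>2 \<le> real (card ?I) * N" unfolding M_def N_def by (rule sum_abs_squared_le)
      also have "\<dots> \<le> real ((l + 1) ^ Suc DIM('a)) * N"
      proof (rule mult_right_mono)
        show "real (card ?I) \<le> real ((l + 1) ^ Suc DIM('a))"
          using card_lag_idx[OF fin, of l] unfolding cardV by (simp only: of_nat_le_iff)
      qed (simp add: N_def sum_nonneg)
      finally show "M\<^sup>2 \<le> real ((l + 1) ^ Suc DIM('a)) * N" .
    qed simp
    finally show ?thesis using hpos unfolding A_def by (simp only: pos_le_divide_eq zero_less_power)
  qed
  have A0: "A \<ge> 0"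
  proof -
    have "xc K \<in> K" using rc(1,2)[OF K] by (auto simp: subset_iff)
    then show ?thesis using A[of "xc K"] zero_le_power2[of "norm (grad Q (xc K))"] by linarith
  qed
  have vol: "measure lebesgue (interior K) \<le> unit_ball_vol (real DIM('a)) * ?h ^ DIM('a)"
  proof -
    have "xc K \<in> K" using rc(1,2)[OF K] by (auto simp: subset_iff)
    then have "interior K \<subseteq> cball (xc K) ?h"
      using dist_le_diameter[OF K, of "xc K"] interior_subset[of K] by (auto simp: dist_norm)
    then have "measure lebesgue (interior K) \<le> measure lebesgue (cball (xc K) ?h)"
      by (intro measure_mono_fmeasurable) auto
    then show ?thesis using hpos by (simp add: content_cball)
  qed
  have "A * measure lebesgue (interior K) \<le> A * (unit_ball_vol (real DIM('a)) * ?h ^ DIM('a))"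
    using A0 vol by (intro mult_left_mono)
  also have "\<dots> = interp_const TYPE('a) l \<sigma> * (?h ^ (DIM('a) - 2) * N)"
  proof -
    have "?h ^ DIM('a) = ?h ^ (DIM('a) - 2) * ?h\<^sup>2"
    proof -
      have "DIM('a) = (DIM('a) - 2) + 2" using d by simp
      then show ?thesis by (metis power_add)
    qed
    then show ?thesis using hpos unfolding A_def interp_const_def by (simp add: mult_ac del: power_Suc)
  qed
  also have "?h ^ (DIM('a) - 2) * N = (\<Sum>z\<in>element_nodes l K. ?h ^ (DIM('a) - 2) * (val z - P z)\<^sup>2)"
  proof -
    have inj: "inj_on (lag_node l ?V) ?I"
    proof (rule inj_onI)
      fix \<alpha> \<beta> assume ab: "\<alpha> \<in> ?I" "\<beta> \<in> ?I" "lag_node l ?V \<alpha> = lag_node l ?V \<beta>"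
      then show "\<alpha> = \<beta>" using lag_at_node[OF ab(1,1) l] lag_at_node[OF ab(1,2) l] by (simp split: if_splits)
    qed
    show ?thesis unfolding element_nodes_eq[OF fin] sum.reindex[OF inj] N_def e_def by (simp add: sum_distrib_left)
  qed
  finally have "A * measure lebesgue (interior K)
     \<le> interp_const TYPE('a) l \<sigma> * (\<Sum>z\<in>element_nodes l K. ?h ^ (DIM('a) - 2) * (val z - P z)\<^sup>2)" .
  then show ?thesis using E_perturb[OF K P Qp A] unfolding PQ by linarith
qed

lemma path_const_ge:
  assumes "K \<in> \<T>" "m \<le> (patch_const TYPE('a) \<sigma>)\<^sup>2"
  shows "chain_const DIM('a) \<sigma> (jump_const TYPE('a) l \<sigma>) m \<le> path_const TYPE('a) l \<sigma>"
  unfolding path_const_def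
  by (rule member_le_sum[of m]) (use assms chain_const_nonneg[OF assms(1)] in auto)

lemma finite_nodes: "finite (nodes l \<T>)"
  unfolding nodes_def
proof (rule finite_UN_I[OF finT])
  fix K assume "K \<in> \<T>"
  then show "finite (element_nodes l K)"
    using finV[of K] finite_lag_idx[of "vertices K"] by (simp add: element_nodes_eq)
qed

lemma quasi_interpolation:
  assumes d: "DIM('a) \<ge> 2" and P: "\<And>K. K \<in> \<T> \<Longrightarrow> normalized K (P K)"
  shows "\<exists>val. (\<Sum>K\<in>\<T>. aK K * E K (local_fe val K)) \<le> stability_const TYPE('a) l \<sigma> * (\<Sum>K\<in>\<T>. aK K * E K (P K))"
proof (cases "\<T> = {}")
  case False
  then obtain K0 where K0: "K0 \<in> \<T>" by blast
  note s = sigma_ge[OF K0]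
  let ?n = "DIM('a) - 2" and ?I = "interp_const TYPE('a) l \<sigma>" and ?B = "path_const TYPE('a) l \<sigma>"
  let ?N = "real (patch_const TYPE('a) \<sigma>)" and ?c = "real ((l + 1) ^ Suc DIM('a))"
  define S where "S z = (\<Sum>L\<in>X z. aK L * E L (P L))" for z
  have ae: "0 \<le> aK K * E K (P K)" if "K \<in> \<T>" for K
    using apos[OF that] E_nonneg by (intro mult_nonneg_nonneg) auto
  have S0: "S z \<ge> 0" for z unfolding S_def using ae X(1) by (intro sum_nonneg) auto
  have I0: "?I \<ge> 0" unfolding interp_const_def by simp
  have B0: "?B \<ge> 0" unfolding path_const_def using chain_const_nonneg[OF K0] by (intro sum_nonneg) auto
  have "\<exists>K. K \<in> X z \<and> (\<forall>L\<in>X z. aK L \<le> aK K)" if "X z \<noteq> {}" for z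
  proof -
    have "Max (aK ` X z) \<in> aK ` X z" using that X(3) by (intro Max_in) auto
    then obtain K where "K \<in> X z" "aK K = Max (aK ` X z)" by force
    then show ?thesis using X(3) by (intro exI[of _ K]) auto
  qed
  then obtain top where top: "\<And>z. X z \<noteq> {} \<Longrightarrow> top z \<in> X z" "\<And>z L. L \<in> X z \<Longrightarrow> aK L \<le> aK (top z)"
    by (metis empty_iff)
  define val where "val z = P (top z) z" for z
  have node: "aK K * (diameter K ^ ?n * (val z - P K z)\<^sup>2) \<le> ?B * S z" if K: "K \<in> \<T>" and z: "z \<in> element_nodes l K" for K z
  proof -
    have KX: "K \<in> X z" using K z by (simp add: X_def)
    then have tX: "top z \<in> X z" using top(1) by blast
    have zn: "z \<in> nodes l \<T>" using K z by (auto simp: nodes_def)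
    obtain m where m: "m \<le> (patch_const TYPE('a) \<sigma>)\<^sup>2" "(K, top z) \<in> Nbr z ^^ m"
      using Nbr_path[OF zn KX tX top(2)[OF KX]] by blast
    have "aK K * diameter K ^ ?n * (P K z - P (top z) z)\<^sup>2 \<le> chain_const DIM('a) \<sigma> (jump_const TYPE('a) l \<sigma>) m * S z"
      unfolding S_def by (rule chain_jump[OF d P KX m(2)])
    also have "\<dots> \<le> ?B * S z" by (intro mult_right_mono path_const_ge[OF K m(1)] S0)
    finally show ?thesis by (simp add: val_def power2_commute mult.assoc)
  qed
  have elem: "aK K * E K (local_fe val K) \<le> 2 * (aK K * E K (P K)) + 2 * ?I * ?B * (\<Sum>z\<in>element_nodes l K. S z)" if K: "K \<in> \<T>" for K
  proof -
    have "aK K * E K (local_fe val K) \<le> aK K * (2 * E K (P K) + 2 * ?I * (\<Sum>z\<in>element_nodes l K. diameter K ^ ?n * (val z - P K z)\<^sup>2))"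
      using interpolation_stability[OF K _ d, of "P K" val] P[OF K] apos[OF K] by (intro mult_left_mono) (auto simp: normalized_def)
    also have "\<dots> = 2 * (aK K * E K (P K)) + 2 * ?I * (\<Sum>z\<in>element_nodes l K. aK K * (diameter K ^ ?n * (val z - P K z)\<^sup>2))"
      by (simp add: algebra_simps sum_distrib_left)
    also have "\<dots> \<le> 2 * (aK K * E K (P K)) + 2 * ?I * (\<Sum>z\<in>element_nodes l K. ?B * S z)"
      using I0 node[OF K] by (intro add_left_mono mult_left_mono sum_mono) auto
    finally show ?thesis by (simp add: sum_distrib_left mult.assoc)
  qed
  have nK: "{z \<in> nodes l \<T>. z \<in> element_nodes l K} = element_nodes l K" if "K \<in> \<T>" for K
    using that by (auto simp: nodes_def)
  have cardN: "real (card (element_nodes l K)) \<le> ?c" if K: "K \<in> \<T>" for K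
  proof -
    have "card (element_nodes l K) \<le> card (lag_idx l (vertices K))"
      unfolding element_nodes_eq[OF finV[OF K]] by (rule card_image_le[OF finite_lag_idx[OF finV[OF K]]])
    also have "\<dots> \<le> (l + 1) ^ Suc DIM('a)"
      using card_lag_idx[OF finV[OF K], of l] full_simplex.cardV[OF simplex_vertices[OF K]] by simp
    finally show ?thesis by (simp only: of_nat_le_iff)
  qed
  \<comment> \<open>Interchanging the summations twice bounds the overlap: each node lies in
    boundedly many elements and each element has boundedly many nodes, so every local energy is
    counted a bounded number of times.\<close>
  have "(\<Sum>K\<in>\<T>. \<Sum>z\<in>element_nodes l K. S z) = (\<Sum>K\<in>\<T>. \<Sum>z | z \<in> nodes l \<T> \<and> z \<in> element_nodes l K. S z)"
    by (rule sum.cong) (auto simp: nK)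
  also have "\<dots> = (\<Sum>z\<in>nodes l \<T>. \<Sum>K | K \<in> \<T> \<and> z \<in> element_nodes l K. S z)"
    by (rule sum.swap_restrict[OF finT finite_nodes])
  also have "\<dots> = (\<Sum>z\<in>nodes l \<T>. real (card (X z)) * S z)"
    by (simp add: X_def)
  also have "\<dots> \<le> (\<Sum>z\<in>nodes l \<T>. ?N * S z)"
    using card_X by (intro sum_mono mult_right_mono S0) auto
  also have "\<dots> = ?N * (\<Sum>z\<in>nodes l \<T>. \<Sum>L | L \<in> \<T> \<and> z \<in> element_nodes l L. aK L * E L (P L))"
    by (simp add: sum_distrib_left S_def X_def)
  also have "(\<Sum>z\<in>nodes l \<T>. \<Sum>L | L \<in> \<T> \<and> z \<in> element_nodes l L. aK L * E L (P L))
     = (\<Sum>L\<in>\<T>. \<Sum>z | z \<in> nodes l \<T> \<and> z \<in> element_nodes l L. aK L * E L (P L))"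
    by (rule sum.swap_restrict[OF finT finite_nodes, symmetric])
  also have "\<dots> = (\<Sum>L\<in>\<T>. real (card (element_nodes l L)) * (aK L * E L (P L)))"
    by (rule sum.cong) (auto simp: nK)
  also have "\<dots> \<le> (\<Sum>L\<in>\<T>. ?c * (aK L * E L (P L)))"
    using cardN ae by (intro sum_mono mult_right_mono) auto
  finally have sw: "(\<Sum>K\<in>\<T>. \<Sum>z\<in>element_nodes l K. S z) \<le> ?N * (?c * (\<Sum>K\<in>\<T>. aK K * E K (P K)))"
    by (simp add: sum_distrib_left mult_left_mono)
  have "(\<Sum>K\<in>\<T>. aK K * E K (local_fe val K)) \<le> (\<Sum>K\<in>\<T>. 2 * (aK K * E K (P K)) + 2 * ?I * ?B * (\<Sum>z\<in>element_nodes l K. S z))"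
    by (intro sum_mono elem)
  also have "\<dots> = 2 * (\<Sum>K\<in>\<T>. aK K * E K (P K)) + 2 * ?I * ?B * (\<Sum>K\<in>\<T>. \<Sum>z\<in>element_nodes l K. S z)"
    by (simp add: sum.distrib sum_distrib_left)
  also have "\<dots> \<le> 2 * (\<Sum>K\<in>\<T>. aK K * E K (P K)) + 2 * ?I * ?B * (?N * (?c * (\<Sum>K\<in>\<T>. aK K * E K (P K))))"
    using sw I0 B0 by (intro add_left_mono mult_left_mono mult_nonneg_nonneg) auto
  also have "\<dots> = stability_const TYPE('a) l \<sigma> * (\<Sum>K\<in>\<T>. aK K * E K (P K))"
    unfolding stability_const_def by (simp only: distrib_right mult.assoc)
  finally show ?thesis by blast
qed auto

text \<open>Adding the average of u - P to \<open>P\<close> achieves the normalization and changes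
  no gradient.\<close>

lemma normalize:
  assumes K: "K \<in> \<T>" and P: "P \<in> polys l"
  shows "\<exists>P'. normalized K P' \<and> E K P' = E K P"
proof -
  let ?r = "rc K / 2"
  have r: "?r > 0" using rc(1)[OF K] by simp
  define m where "m = avg (\<lambda>z. u z - P z) (xc K) ?r"
  define P' where "P' z = P z + m" for z
  have P'p: "P' \<in> polys l" unfolding P'_def[abs_def] by (rule polys_add[OF P polys_const])
  have li: "locally_integrable_on (interior K) (\<lambda>z. u z - P z)"
    using is_weak_gradient_diff[OF is_weak_gradient_subset[OF wg interior_sub[OF K]] is_weak_gradient_C1[OF open_interior polys_Ck[OF P]]]
    by (auto simp: is_weak_gradient_def)
  have lc: "locally_integrable_on (interior K) (\<lambda>z. m)"
    using is_weak_gradient_C1[OF open_interior Ck_const] by (auto simp: is_weak_gradient_def)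
  have "avg (\<lambda>z. u z - P' z) (xc K) ?r = avg (\<lambda>z. (u z - P z) - m) (xc K) ?r"
    by (simp add: P'_def algebra_simps)
  also have "\<dots> = 0"
    using avg_diff[OF li lc r half_ball[OF K]] by (simp add: avg_const[OF r] m_def)
  finally have "normalized K P'" using P'p by (simp add: normalized_def)
  moreover have "grad P' z = grad P z" for z
    unfolding P'_def[abs_def]
    by (rule grad_eqI) (use has_derivative_add[OF Ck1_grad[OF polys_Ck[OF P]] has_derivative_const] in simp)
  then have "E K P' = E K P" by (simp add: E_def)
  ultimately show ?thesis by blast
qed

end

section \<open>Explicit polynomial pieces, and gluing in dimension one\<close>

context mesh
begin

text \<open>Names the polynomials that \<open>fe_space\<close> hides behind an existential, because
  the energy is computed from them.\<close>

definition fe_pieces :: "('a \<Rightarrow> real) \<Rightarrow> ('a set \<Rightarrow> 'a \<Rightarrow> real) \<Rightarrow> bool" where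
  "fe_pieces v p \<longleftrightarrow> (\<forall>K\<in>\<T>. p K \<in> polys l \<and> (\<forall>x\<in>K. v x = p K x))"

lemma fe_pieces_space:
  assumes "fe_pieces v p"
  shows "v \<in> fe_space l \<Omega> \<T>"
proof -
  have "continuous_on (\<Union>K\<in>\<T>. K) v"
  proof (rule continuous_on_closed_Union[OF finT])
    fix K assume K: "K \<in> \<T>"
    show "closed K" using compactK[OF K] by (rule compact_imp_closed)
    have "p K \<in> polys l" using assms K by (simp add: fe_pieces_def)
    then have "continuous_on K (p K)"
      using Ck_continuous[OF polys_Ck[of "p K" l 0]] continuous_on_subset by blast
    then show "continuous_on K v"
      by (rule continuous_on_eq) (use assms K in \<open>simp add: fe_pieces_def\<close>)
  qed
  then show ?thesis using assms UnT by (auto simp: fe_space_def fe_pieces_def)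
qed

text \<open>In one dimension the pieces can be glued after adding constants: on an element other than
  \<open>K\<close> the projection onto \<open>K\<close> is constant.\<close>

lemma one_dimensional_gluing:
  assumes d: "DIM('a) = 1" and P: "\<And>K. K \<in> \<T> \<Longrightarrow> P K \<in> polys l"
  shows "\<exists>v c. fe_pieces v (\<lambda>K x. P K x + c K)"
proof -
  obtain b :: 'a where b: "Basis = {b}" using d card_1_singletonE by blast
  have bB: "b \<in> Basis" unfolding b by (rule singletonI)
  have bn: "norm b = 1" by (rule norm_Basis[OF bB])
  have rep: "w = (w \<bullet> b) *\<^sub>R b" for w :: 'a
    using euclidean_representation[of w, unfolded b] by simp
  \<comment> \<open>In one dimension the Cauchy-Schwarz inequality is an equality, so distances can
    be compared through any nonzero linear functional.\<close>
  have par: "norm a * norm w = \<bar>a \<bullet> w\<bar>" for a w :: 'a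
  proof -
    have "a \<bullet> w = (a \<bullet> b) * (w \<bullet> b)" using euclidean_inner[of a w, unfolded b] by simp
    moreover have "norm a = \<bar>a \<bullet> b\<bar>" "norm w = \<bar>w \<bullet> b\<bar>" using rep[of a] rep[of w] bn by (metis mult.right_neutral norm_scaleR)+
    ultimately show ?thesis by (simp add: abs_mult)
  qed
  \<comment> \<open>A hyperplane separates the two interiors and hence the elements; seen from
    \<open>M\<close>, the nearest point of \<open>K\<close> is always the maximizer \<open>k\<close>
    of the separating functional on \<open>K\<close>.\<close>
  have proj: "closest_point K x = closest_point K y" if KM: "K \<in> \<T>" "M \<in> \<T>" "K \<noteq> M" and xy: "x \<in> M" "y \<in> M" for K M x y
  proof -
    have cl: "closure (interior L) = L" if "L \<in> \<T>" for L
      using convex_closure_interior[OF convexK[OF that] interior_ne[OF that]] compact_imp_closed[OF compactK[OF that]] by simp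
    obtain a \<beta> where a: "a \<noteq> 0" "\<forall>k\<in>interior K. a \<bullet> k \<le> \<beta>" "\<forall>x\<in>interior M. \<beta> \<le> a \<bullet> x"
      using separating_hyperplane_sets[OF convex_interior[OF convexK[OF KM(1)]] convex_interior[OF convexK[OF KM(2)]]
        interior_ne[OF KM(1)] interior_ne[OF KM(2)] interior_disjoint[OF KM]] by blast
    have aK: "a \<bullet> k \<le> \<beta>" if "k \<in> K" for k
    proof -
      have "closure (interior K) \<subseteq> {x. a \<bullet> x \<le> \<beta>}" using a(2) by (intro closure_minimal closed_halfspace_le) auto
      then show ?thesis using that cl[OF KM(1)] by auto
    qed
    have aM: "\<beta> \<le> a \<bullet> x" if "x \<in> M" for x
    proof -
      have "closure (interior M) \<subseteq> {x. a \<bullet> x \<ge> \<beta>}" using a(3) by (intro closure_minimal closed_halfspace_ge) auto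
      then show ?thesis using that cl[OF KM(2)] by auto
    qed
    have "K \<noteq> {}" using interior_ne[OF KM(1)] interior_subset by blast
    then obtain k where k: "k \<in> K" "\<And>k'. k' \<in> K \<Longrightarrow> a \<bullet> k' \<le> a \<bullet> k"
    proof -
      have "continuous_on K (\<lambda>x. a \<bullet> x)" by (intro continuous_intros)
      from continuous_attains_sup[OF compactK[OF KM(1)] \<open>K \<noteq> {}\<close> this] show ?thesis using that by blast
    qed
    have "closest_point K z = k" if z: "z \<in> M" for z
    proof (rule closest_point_unique[OF convexK[OF KM(1)] compact_imp_closed[OF compactK[OF KM(1)]] k(1), symmetric])
      show "\<forall>k'\<in>K. dist z k \<le> dist z k'"
      proof
        fix k' assume k': "k' \<in> K"
        have "norm a * norm (z - k) \<le> norm a * norm (z - k')"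
          unfolding par using aK[OF k(1)] aK[OF k'] aM[OF z] k(2)[OF k'] by (simp add: inner_diff_right)
        then show "dist z k \<le> dist z k'" using a(1) by (simp add: dist_norm)
      qed
    qed
    then show ?thesis using xy by simp
  qed
  \<comment> \<open>On \<open>M\<close> the summand of \<open>M\<close> is \<open>P M\<close> itself
    and all others are constant, so the sum of all pieces composed with the projections is the glued
    function.\<close>
  define v where "v x = (\<Sum>K\<in>\<T>. P K (closest_point K x))" for x
  define y where "y M = (SOME y. y \<in> M)" for M :: "'a set"
  have y: "y M \<in> M" if "M \<in> \<T>" for M
  proof -
    have "\<exists>y. y \<in> M" using interior_ne[OF that] interior_subset[of M] by blast
    then show ?thesis unfolding y_def by (rule someI_ex)
  qed
  define c where "c M = (\<Sum>K\<in>\<T> - {M}. P K (closest_point K (y M)))" for M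
  have "v x = P M x + c M" if M: "M \<in> \<T>" and x: "x \<in> M" for M x
  proof -
    have "v x = P M (closest_point M x) + (\<Sum>K\<in>\<T> - {M}. P K (closest_point K x))"
      unfolding v_def by (rule sum.remove[OF finT M])
    also have "closest_point M x = x" by (rule closest_point_self[OF x])
    also have "(\<Sum>K\<in>\<T> - {M}. P K (closest_point K x)) = c M"
      unfolding c_def by (rule sum.cong) (use proj[OF _ M _ x y[OF M]] in auto)
    finally show ?thesis .
  qed
  then have "fe_pieces v (\<lambda>K x. P K x + c K)"
    unfolding fe_pieces_def using polys_add[OF P polys_const] by blast
  then show ?thesis by blast
qed

end

section \<open>Energies and weak gradients\<close>

text \<open>Completeness of Lebesgue measure. It gives measurability of integrands built from the
  chosen weak gradient and from a coefficient whose values are known only almost everywhere.\<close>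

lemma lebesgue_measurable_AE_eq:
  fixes f h :: "'a::euclidean_space \<Rightarrow> real"
  assumes h: "h \<in> borel_measurable lebesgue" and eq: "AE x in lebesgue. f x = h x"
  shows "f \<in> borel_measurable lebesgue"
proof (rule measurableI)
  fix A :: "real set" assume A: "A \<in> sets borel"
  obtain N where N0: "\<And>x. x \<in> space lebesgue - N \<Longrightarrow> f x = h x" and N2: "N \<in> null_sets lebesgue"
    using AE_E3[OF eq] by metis
  have sub: "S \<in> sets lebesgue" if "S \<subseteq> N" for S
  proof -
    have "negligible N" using N2 by (simp add: negligible_iff_null_sets)
    then have "negligible S" using that by (rule negligible_subset)
    then show ?thesis by (simp add: negligible_iff_null_sets null_setsD2)
  qed
  have eqA: "f -` A \<inter> space lebesgue = (h -` A \<inter> space lebesgue - N) \<union> (f -` A \<inter> N)"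
  proof (rule set_eqI)
    fix x
    show "x \<in> f -` A \<inter> space lebesgue \<longleftrightarrow> x \<in> (h -` A \<inter> space lebesgue - N) \<union> (f -` A \<inter> N)"
      using N0[of x] by (cases "x \<in> N") auto
  qed
  show "f -` A \<inter> space lebesgue \<in> sets lebesgue"
    unfolding eqA
    by (intro sets.Un sets.Diff measurable_sets[OF h A] null_setsD2[OF N2] sub Int_lower2)
qed auto

lemma integral_AE_eq:
  fixes f h :: "'a::euclidean_space \<Rightarrow> real"
  assumes "h \<in> borel_measurable lebesgue" "AE x in lebesgue. f x = h x"
  shows "(LINT x|lebesgue. f x) = (LINT x|lebesgue. h x)"
  using assms lebesgue_measurable_AE_eq[OF assms] by (intro integral_cong_AE)

lemma L2_norm_square: "(L2_norm U f)\<^sup>2 = (LINT x:U|lebesgue. (norm (f x))\<^sup>2)"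
proof -
  have "(LINT x:U|lebesgue. (norm (f x))\<^sup>2) \<ge> 0"
    unfolding set_lebesgue_integral_def by (auto intro!: Bochner_Integration.integral_nonneg)
  then show ?thesis by (simp add: L2_norm_def)
qed

context weighted_mesh
begin

text \<open>The norm is taken over the closed element but the weak gradient on its interior; the
  frontier of a convex set is a null set.\<close>

lemma element_energy:
  assumes K: "K \<in> \<T>" and P: "P \<in> polys l"
  shows "(L2_norm K (weak_gradient (interior K) (\<lambda>y. u y - P y)))\<^sup>2 = E K P"
proof -
  have wgK: "is_weak_gradient (interior K) (\<lambda>y. u y - P y) (\<lambda>z. g z - grad P z)"
    by (intro is_weak_gradient_diff is_weak_gradient_subset[OF wg interior_sub[OF K]]
        is_weak_gradient_C1[OF open_interior polys_Ck[OF P]])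
  have i: "integrable lebesgue (\<lambda>z. indicator (interior K) z *\<^sub>R (norm (g z - grad P z))\<^sup>2)"
    using E_integrable[OF K P] by (simp add: set_integrable_def)
  have "AE x in lebesgue. x \<notin> frontier K"
    using negl_frontier[OF K] by (intro AE_not_in) (simp add: negligible_iff_null_sets)
  with weak_gradient_AE[OF open_interior wgK]
  have "AE x in lebesgue. indicator K x *\<^sub>R (norm (weak_gradient (interior K) (\<lambda>y. u y - P y) x))\<^sup>2
     = indicator (interior K) x *\<^sub>R (norm (g x - grad P x))\<^sup>2"
  proof eventually_elim
    case (elim x)
    show ?case
    proof (cases "x \<in> interior K")
      case True
      then show ?thesis using elim interior_subset[of K] by auto
    next
      case False
      then have "x \<notin> K" using elim compact_imp_closed[OF compactK[OF K]] by (auto simp: frontier_def)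
      then show ?thesis using False by simp
    qed
  qed
  from integral_AE_eq[OF borel_measurable_integrable[OF i] this] show ?thesis
    unfolding L2_norm_square E_def set_lebesgue_integral_def .
qed

text \<open>Almost every point of the domain lies in the interior of exactly one element, where
  \<open>a\<close> has the value of that element and the broken gradient is the gradient of its
  polynomial.\<close>

lemma global_energy:
  assumes v: "fe_pieces v p" and a: "piecewise_constant \<T> a aK"
  shows "(L2_norm \<Omega> (\<lambda>x. sqrt (a x) *\<^sub>R weak_gradient \<Omega> (\<lambda>y. u y - v y) x))\<^sup>2 = (\<Sum>K\<in>\<T>. aK K * E K (p K))"
proof -
  have pK: "p K \<in> polys l" "\<And>x. x \<in> K \<Longrightarrow> v x = p K x" if "K \<in> \<T>" for K
    using v that by (auto simp: fe_pieces_def)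
  interpret pw: piecewise_C1 \<Omega> \<T> "\<lambda>K. K" p v
  proof
    fix K assume K: "K \<in> \<T>"
    show "closed K" by (rule compact_imp_closed[OF compactK[OF K]])
    show "Ck 1 (p K)" by (rule polys_Ck[OF pK(1)[OF K]])
    show "negligible (frontier K)" by (rule negl_frontier[OF K])
    show "v x = p K x" if "x \<in> K" for x using pK(2)[OF K that] .
  next
    show "\<Omega> \<subseteq> (\<Union>K\<in>\<T>. K)" using UnT closure_subset by auto
  qed (use open_dom finT in auto)
  have wgv: "is_weak_gradient \<Omega> (\<lambda>y. u y - v y) (\<lambda>x. g x - pw.G x)"
    by (intro is_weak_gradient_diff wg pw.is_weak_gradient)
  let ?h = "\<lambda>x. \<Sum>K\<in>\<T>. aK K * (indicator (interior K) x *\<^sub>R (norm (g x - grad (p K) x))\<^sup>2)"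
  have i: "integrable lebesgue (\<lambda>x. aK K * (indicator (interior K) x *\<^sub>R (norm (g x - grad (p K) x))\<^sup>2))" if "K \<in> \<T>" for K
    using E_integrable[OF that pK(1)[OF that]] by (intro integrable_mult_right) (simp add: set_integrable_def)
  have ih: "integrable lebesgue ?h" by (rule Bochner_Integration.integrable_sum[OF i])
  have "AE x in lebesgue. \<forall>K\<in>\<T>. x \<in> K \<longrightarrow> a x = aK K"
    using a finT by (subst AE_ball_countable) (auto simp: piecewise_constant_def intro: countable_finite)
  with weak_gradient_AE[OF open_dom wgv] pw.AE_interior
  have "AE x in lebesgue. indicator \<Omega> x *\<^sub>R (norm (sqrt (a x) *\<^sub>R weak_gradient \<Omega> (\<lambda>y. u y - v y) x))\<^sup>2 = ?h x"
  proof eventually_elim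
    case (elim x)
    show ?case
    proof (cases "x \<in> \<Omega>")
      case True
      then obtain K where K: "K \<in> \<T>" "x \<in> interior K" using elim by blast
      have xK: "x \<in> K" using K(2) interior_subset by blast
      have "?h x = (\<Sum>L\<in>\<T>. if L = K then aK K * (norm (g x - grad (p K) x))\<^sup>2 else 0)"
      proof (rule sum.cong[OF refl])
        fix L assume L: "L \<in> \<T>"
        show "aK L * (indicator (interior L) x *\<^sub>R (norm (g x - grad (p L) x))\<^sup>2)
            = (if L = K then aK K * (norm (g x - grad (p K) x))\<^sup>2 else 0)"
        proof (cases "L = K")
          case True
          then show ?thesis using K(2) by simp
        next
          case False
          then have "x \<notin> interior L" using interior_disjoint[OF L K(1) False] K(2) by blast
          then show ?thesis using False by simp
        qed
      qed
      also have "\<dots> = aK K * (norm (g x - grad (p K) x))\<^sup>2" using K(1) finT by simp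
      finally have hx: "?h x = aK K * (norm (g x - grad (p K) x))\<^sup>2" .
      have "a x = aK K" using elim K(1) xK by blast
      moreover have "weak_gradient \<Omega> (\<lambda>y. u y - v y) x = g x - grad (p K) x"
        using elim True pw.pw_grad_eq[OF K True] by simp
      ultimately show ?thesis
        unfolding hx using True apos[OF K(1)] by (simp add: power_mult_distrib)
    next
      case False
      then have "indicator (interior K) x = (0::real)" if "K \<in> \<T>" for K using interior_sub[OF that] by (auto simp: indicator_def)
      then show ?thesis using False by simp
    qed
  qed
  from integral_AE_eq[OF borel_measurable_integrable[OF ih] this]
  have "(L2_norm \<Omega> (\<lambda>x. sqrt (a x) *\<^sub>R weak_gradient \<Omega> (\<lambda>y. u y - v y) x))\<^sup>2 = (LINT x|lebesgue. ?h x)"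
    unfolding L2_norm_square set_lebesgue_integral_def .
  also have "\<dots> = (\<Sum>K\<in>\<T>. aK K * E K (p K))"
  proof -
    have "(LINT x|lebesgue. ?h x)
      = (\<Sum>K\<in>\<T>. LINT x|lebesgue. aK K * (indicator (interior K) x *\<^sub>R (norm (g x - grad (p K) x))\<^sup>2))"
      by (rule Bochner_Integration.integral_sum[OF i])
    then show ?thesis unfolding E_def set_lebesgue_integral_def by (simp only: integral_mult_right_zero)
  qed
  finally show ?thesis .
qed

text \<open>Merges the two cases of the dimension; the constant is 1 in dimension one because adding
  constants leaves every energy unchanged.\<close>

lemma approximation:
  assumes P: "\<And>K. K \<in> \<T> \<Longrightarrow> P K \<in> polys l"
  shows "\<exists>v p. fe_pieces v p \<and> (\<Sum>K\<in>\<T>. aK K * E K (p K))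
    \<le> (if DIM('a) = 1 then 1 else stability_const TYPE('a) l \<sigma>) * (\<Sum>K\<in>\<T>. aK K * E K (P K))"
proof (cases "DIM('a) = 1")
  case True
  obtain v c where v: "fe_pieces v (\<lambda>K x. P K x + c K)" using one_dimensional_gluing[OF True, of P, OF P] by blast
  have "E K (\<lambda>x. P K x + c K) = E K (P K)" if K: "K \<in> \<T>" for K
  proof -
    have "grad (\<lambda>x. P K x + c K) z = grad (P K) z" for z
      by (rule grad_eqI) (use has_derivative_add[OF Ck1_grad[OF polys_Ck[OF P[OF K]]] has_derivative_const] in simp)
    then show ?thesis by (simp add: E_def)
  qed
  then have "(\<Sum>K\<in>\<T>. aK K * E K (\<lambda>x. P K x + c K)) = (\<Sum>K\<in>\<T>. aK K * E K (P K))" by simp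
  then show ?thesis using v True by (intro exI[of _ v] exI[of _ "\<lambda>K x. P K x + c K"]) simp
next
  case False
  then have d: "DIM('a) \<ge> 2" using DIM_positive[where 'a = 'a] by linarith
  obtain P' where P': "\<And>K. K \<in> \<T> \<Longrightarrow> normalized K (P' K)" "\<And>K. K \<in> \<T> \<Longrightarrow> E K (P' K) = E K (P K)"
  proof -
    have "\<forall>K\<in>\<T>. \<exists>P'. normalized K P' \<and> E K P' = E K (P K)"
      by (intro ballI normalize P)
    from bchoice[OF this] show ?thesis using that by blast
  qed
  obtain val where "(\<Sum>K\<in>\<T>. aK K * E K (local_fe val K)) \<le> stability_const TYPE('a) l \<sigma> * (\<Sum>K\<in>\<T>. aK K * E K (P' K))"
    using quasi_interpolation[OF d P'(1)] by blast
  moreover have "fe_pieces (fe_fun val) (local_fe val)"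
    using local_fe_polys fe_fun_eq by (simp add: fe_pieces_def)
  ultimately show ?thesis
    using False P'(2) by (intro exI[of _ "fe_fun val"] exI[of _ "local_fe val"]) simp
qed

end

text \<open>A nonpositive value would contradict the lower bound of \<open>a\<close> on the interior
  of the element, which is not a null set.\<close>

lemma (in mesh) piecewise_constant_positive:
  assumes "uniformly_positive \<Omega> a" "piecewise_constant \<T> a aK" and K: "K \<in> \<T>"
  shows "aK K > 0"
proof (rule ccontr)
  assume neg: "\<not> aK K > 0"
  obtain c where "c > 0" and c: "AE x in lebesgue. x \<in> \<Omega> \<longrightarrow> c \<le> a x" using assms(1) by (auto simp: uniformly_positive_def)
  have "AE x in lebesgue. x \<in> K \<longrightarrow> a x = aK K" using assms(2) K by (simp add: piecewise_constant_def)
  with c have "AE x in lebesgue. x \<notin> interior K"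
  proof eventually_elim
    case (elim x)
    show ?case
    proof
      assume "x \<in> interior K"
      then have "x \<in> \<Omega>" "x \<in> K" using interior_sub[OF K] interior_subset[of K] by auto
      then show False using elim neg \<open>c > 0\<close> by auto
    qed
  qed
  then have "negligible (interior K)"
    using AE_iff_null_sets[of "interior K" lebesgue] by (simp add: negligible_iff_null_sets)
  then show False using open_not_negligible[OF open_interior interior_ne[OF K]] by blast
qed

text \<open>The infima need not be attained, so near-minimizers are taken; the 1 added in the
  denominator of \<open>d\<close> avoids division by zero when \<open>C\<close> is 0 or
  \<open>T\<close> is empty.\<close>

lemma INF_sum_bound:
  fixes F :: "'k \<Rightarrow> 'p \<Rightarrow> real"
  assumes fin: "finite T" and C: "C \<ge> 0" and ne: "A \<noteq> {}" and nn: "\<And>K P. K \<in> T \<Longrightarrow> P \<in> A \<Longrightarrow> 0 \<le> F K P"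
    and le: "\<And>P. (\<And>K. K \<in> T \<Longrightarrow> P K \<in> A) \<Longrightarrow> x \<le> C * (\<Sum>K\<in>T. F K (P K))"
  shows "x \<le> C * (\<Sum>K\<in>T. INF P\<in>A. F K P)"
proof (rule field_le_epsilon)
  fix e :: real assume e: "e > 0"
  define d where "d = e / (C * real (card T) + 1)"
  have den: "C * real (card T) + 1 > 0" using C by (simp add: add_nonneg_pos)
  have d: "d > 0" using e den by (simp add: d_def)
  have "\<exists>P\<in>A. F K P < (INF P\<in>A. F K P) + d" if K: "K \<in> T" for K
  proof -
    have "bdd_below (F K ` A)" using nn[OF K] by (intro bdd_belowI[of _ 0]) auto
    then show ?thesis using cINF_less_iff[OF ne, of "F K" "(INF P\<in>A. F K P) + d"] d by simp
  qed
  then obtain P where P: "\<And>K. K \<in> T \<Longrightarrow> P K \<in> A" "\<And>K. K \<in> T \<Longrightarrow> F K (P K) < (INF P\<in>A. F K P) + d"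
    using bchoice[of T "\<lambda>K P. P \<in> A \<and> F K P < (INF P\<in>A. F K P) + d"] by (metis (no_types, lifting))
  have "x \<le> C * (\<Sum>K\<in>T. F K (P K))" by (rule le[OF P(1)])
  also have "\<dots> \<le> C * (\<Sum>K\<in>T. (INF P\<in>A. F K P) + d)"
    by (rule mult_left_mono[OF sum_mono C]) (rule less_imp_le[OF P(2)])
  also have "\<dots> = C * (\<Sum>K\<in>T. INF P\<in>A. F K P) + (C * real (card T)) * d"
    by (simp add: sum.distrib distrib_left)
  also have "\<dots> \<le> C * (\<Sum>K\<in>T. INF P\<in>A. F K P) + (C * real (card T) + 1) * d"
    using d by (intro add_left_mono mult_right_mono) auto
  also have "(C * real (card T) + 1) * d = e" using den by (simp add: d_def)
  finally show "x \<le> C * (\<Sum>K\<in>T. INF P\<in>A. F K P) + e" .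
qed

theorem proposition3p2:
  fixes l :: nat and \<sigma> :: real
  assumes "l \<ge> 1" and "\<sigma> > 0"
  shows "\<exists>C::real. \<forall>(\<Omega> :: (real ^ 'd) set) \<T> a aK u.
    polyhedral_domain \<Omega> \<and> conforming_mesh \<Omega> \<T> \<and> shape_bounded \<T> \<sigma> \<and>
    uniformly_positive \<Omega> a \<and> piecewise_constant \<T> a aK \<and> quasi_monotone l \<Omega> \<T> aK \<and>
    u \<in> H1 \<Omega> \<longrightarrow>
    (INF v \<in> fe_space l \<Omega> \<T>.
       (L2_norm \<Omega> (\<lambda>x. sqrt (a x) *\<^sub>R weak_gradient \<Omega> (\<lambda>y. u y - v y) x))\<^sup>2)
    \<le> C * (\<Sum>K\<in>\<T>. INF P \<in> polys l.
       aK K * (L2_norm K (weak_gradient (interior K) (\<lambda>y. u y - P y)))\<^sup>2)"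
proof (rule exI[of _ "max 0 (if DIM(real ^ 'd) = 1 then 1 else stability_const TYPE(real ^ 'd) l \<sigma>)"],
    intro allI impI, elim conjE)
  fix \<Omega> :: "(real ^ 'd) set" and \<T> a aK u
  let ?C = "if DIM(real ^ 'd) = 1 then 1 else stability_const TYPE(real ^ 'd) l \<sigma>"
  assume dom: "polyhedral_domain \<Omega>" "conforming_mesh \<Omega> \<T>" and sh: "shape_bounded \<T> \<sigma>"
    and a: "uniformly_positive \<Omega> a" "piecewise_constant \<T> a aK" and qm: "quasi_monotone l \<Omega> \<T> aK" and u: "u \<in> H1 \<Omega>"
  interpret mesh \<Omega> \<T> l by standard (use dom assms in auto)
  obtain g where g: "is_weak_gradient \<Omega> u g" "L2_on \<Omega> g" using u by (auto simp: H1_def)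
  interpret weighted_mesh \<Omega> \<T> l \<sigma> u g aK
    by standard (use sh g qm piecewise_constant_positive[OF a] in auto)
  let ?N = "\<lambda>v. (L2_norm \<Omega> (\<lambda>x. sqrt (a x) *\<^sub>R weak_gradient \<Omega> (\<lambda>y. u y - v y) x))\<^sup>2"
  show "(INF v \<in> fe_space l \<Omega> \<T>. ?N v) \<le> max 0 ?C * (\<Sum>K\<in>\<T>. INF P \<in> polys l.
       aK K * (L2_norm K (weak_gradient (interior K) (\<lambda>y. u y - P y)))\<^sup>2)"
  proof (rule INF_sum_bound[OF finT])
    show "polys l \<noteq> {}" using polys_zero by blast
    show "0 \<le> aK K * (L2_norm K (weak_gradient (interior K) (\<lambda>y. u y - P y)))\<^sup>2" if "K \<in> \<T>" for K P
      using apos[OF that] by simp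
    fix P :: "(real ^ 'd) set \<Rightarrow> real ^ 'd \<Rightarrow> real" assume P: "\<And>K. K \<in> \<T> \<Longrightarrow> P K \<in> polys l"
    obtain v p where v: "fe_pieces v p" "(\<Sum>K\<in>\<T>. aK K * E K (p K)) \<le> ?C * (\<Sum>K\<in>\<T>. aK K * E K (P K))"
      using approximation[of P, OF P] by blast
    have "(INF v \<in> fe_space l \<Omega> \<T>. ?N v) \<le> ?N v"
      by (rule cINF_lower[OF bdd_belowI[of _ 0] fe_pieces_space[OF v(1)]]) auto
    also have "\<dots> = (\<Sum>K\<in>\<T>. aK K * E K (p K))" by (rule global_energy[OF v(1) a(2)])
    also have "\<dots> \<le> ?C * (\<Sum>K\<in>\<T>. aK K * E K (P K))" by (rule v(2))
    \<comment> \<open>The maximum with 0 supplies the nonnegative factor that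
      \<open>INF_sum_bound\<close> demands, whatever the sign of
      \<open>stability_const\<close>.\<close>
    also have "\<dots> \<le> max 0 ?C * (\<Sum>K\<in>\<T>. aK K * E K (P K))"
      by (intro mult_right_mono sum_nonneg mult_nonneg_nonneg E_nonneg less_imp_le[OF apos]) auto
    also have "(\<Sum>K\<in>\<T>. aK K * E K (P K)) = (\<Sum>K\<in>\<T>. aK K * (L2_norm K (weak_gradient (interior K) (\<lambda>y. u y - P K y)))\<^sup>2)"
      using P by (intro sum.cong) (auto simp: element_energy)
    finally show "(INF v \<in> fe_space l \<Omega> \<T>. ?N v) \<le> max 0 ?C * (\<Sum>K\<in>\<T>. aK K * (L2_norm K (weak_gradient (interior K) (\<lambda>y. u y - P K y)))\<^sup>2)" .
  qed simp
qed

end
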